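(* Let $t\ge 2$ be a fixed integer, and let $T$ be chosen uniformly at random among all canonical $t$-ary trees of size $n$. Then the height $h(T)$ is asymptotically (for $n\to\infty$) normally distributed, and a local limit theorem holds. Its mean is $\mu_h n+O(1)$ and its variance is $\sigma_h^2 n+O(1)$, where $\mu_h,\sigma_h^2$ depend only on $t$ and satisfy $$\mu_h=\frac{\frac{\partial}{\partial w}b(q_0,w)\big|_{w=1}}{q_0\,\frac{\partial}{\partial q}b(q,1)\big|_{q=q_0}}=\frac12+\frac{t-2}{2^{t+3}}+\frac{2t^2+3t-8}{2^{2t+5}}+\frac{9t^3+45t^2+2t-88}{2^{3t+8}}+\frac{0.55\,t^4}{2^{4t}}\,\varepsilon(t)$$ and $$\sigma_h^2=\frac14+\frac{-t^2+5t-2}{2^{t+4}}+\frac{-4t^3+4t^2+27t-14}{2^{2t+6}}+\frac{0.26\,t^4}{2^{3t}}\,\varepsilon'(t)$$ for all $t\ge2$, where $\varepsilon,\varepsilon'$ are real-valued functions with $|\varepsilon(t)|\le1$ and $|\varepsilon'(t)|\le 1$.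
   Context: Trees: a canonical $t$-ary tree is a rooted plane tree (the children of every vertex are ordered from left to right) in which every vertex has either $0$ or $t$ children and such that for every $k\ge0$, if $v_1,\dots,v_K$ are the vertices at depth $k$ (distance $k$ from the root) from left to right, then the number of children of $v_i$ is at most that of $v_{i+1}$ for all $i$. Leaves are vertices without children, all other vertices are internal. The size $n(T)$ is the number of internal vertices. The height $h(T)$ is the maximum distance of a leaf from the root. Functions: $[\![ j]\!]:=1+t+\cdots+t^{j-1}$ for $j\ge 1$, and for $|q|<1$, $$b(q,w)=\sum_{j\ge1}(-1)^{j-1}w^j\prod_{i=1}^j\frac{q^{[\![ i]\!]}}{1-q^{[\![ i]\!]}}.$$ The number $q_0$ is the unique zero of $q\mapsto 1-b(q,1)$ with $|q|<1-\frac{0.72}{t}$; it is positive and simple. Asymptotic normality means that $(h(T)-\mathbb E(h(T)))/\sqrt{\mathbb V(h(T))}$ converges in distribution to a standard normal random variable. A local limit theorem (of Gaussian type) means that, with $\mu_n$ and $\sigma_n$ the mean and standard deviation of $h(T)$ for trees of size $n$, $\sup_{x\in\mathbb R}\bigl|\sigma_n\,\mathbb P(h(T)=\lfloor \mu_n+x\sigma_n\rfloor)-\frac1{\sqrt{2\pi}}e^{-x^2/2}\bigr|\to0$ as $n\to\infty$. *)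

theory Defs
  imports "HOL-Probability.Probability" "HOL-Library.Landau_Symbols"
    "HOL-Complex_Analysis.Complex_Analysis"
begin

datatype plane_tree = Node (children: "plane_tree list")

(* A vertex is represented by the subtree rooted at it; vertices T k lists those at depth k
   from left to right. *)
fun vertices :: "plane_tree \<Rightarrow> nat \<Rightarrow> plane_tree list" where
  "vertices T 0 = [T]"
| "vertices (Node ts) (Suc k) = concat (map (\<lambda>T. vertices T k) ts)"

definition is_leaf :: "plane_tree \<Rightarrow> bool" where
  "is_leaf v \<longleftrightarrow> children v = []"

fun num_internal :: "plane_tree \<Rightarrow> nat" where
  "num_internal (Node ts) = (if ts = [] then 0 else 1) + sum_list (map num_internal ts)"

definition tree_height :: "plane_tree \<Rightarrow> nat" where
  "tree_height T = Max {k. \<exists>v \<in> set (vertices T k). is_leaf v}"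

definition canonical :: "nat \<Rightarrow> plane_tree \<Rightarrow> bool" where
  "canonical t T \<longleftrightarrow>
     (\<forall>k. \<forall>v \<in> set (vertices T k). length (children v) \<in> {0, t}) \<and>
     (\<forall>k. sorted (map (\<lambda>v. length (children v)) (vertices T k)))"

definition random_tree :: "nat \<Rightarrow> nat \<Rightarrow> plane_tree pmf" where
  "random_tree t n = pmf_of_set {T. canonical t T \<and> num_internal T = n}"

definition mean_height :: "nat \<Rightarrow> nat \<Rightarrow> real" where
  "mean_height t n = measure_pmf.expectation (random_tree t n) (\<lambda>T. real (tree_height T))"

definition var_height :: "nat \<Rightarrow> nat \<Rightarrow> real" where
  "var_height t n = measure_pmf.variance (random_tree t n) (\<lambda>T. real (tree_height T))"

definition sd_height :: "nat \<Rightarrow> nat \<Rightarrow> real" where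
  "sd_height t n = sqrt (var_height t n)"

definition height_asymp_normal :: "nat \<Rightarrow> bool" where
  "height_asymp_normal t \<longleftrightarrow>
     weak_conv_m
       (\<lambda>n. distr (measure_pmf (random_tree t n)) borel
              (\<lambda>T. (real (tree_height T) - mean_height t n) / sd_height t n))
       std_normal_distribution"

(* The real-valued supremum is over a bounded family: the first term is at most
   sd_height t n in absolute value. *)
definition height_local_limit :: "nat \<Rightarrow> bool" where
  "height_local_limit t \<longleftrightarrow>
     (\<lambda>n. SUP x::real.
        \<bar>sd_height t n *
           measure_pmf.prob (random_tree t n)
             {T. int (tree_height T) = \<lfloor>mean_height t n + x * sd_height t n\<rfloor>}
         - 1 / sqrt (2 * pi) * exp (- x\<^sup>2 / 2)\<bar>) \<longlonglongrightarrow> 0"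

definition br :: "nat \<Rightarrow> nat \<Rightarrow> nat" where
  "br t j = (\<Sum>i<j. t ^ i)"

(* The summation index is shifted: the summand for j is the (j+1)-st term of the series
   starting at 1. *)
definition b :: "nat \<Rightarrow> complex \<Rightarrow> complex \<Rightarrow> complex" where
  "b t q w = (\<Sum>j. (- 1) ^ j * w ^ Suc j * (\<Prod>i = 1..Suc j. q ^ br t i / (1 - q ^ br t i)))"

definition q0 :: "nat \<Rightarrow> complex" where
  "q0 t = (THE q. norm q < 1 - 0.72 / real t \<and> 1 - b t q 1 = 0)"

end

theory Submission
  imports Defs "HOL-Real_Asymp.Real_Asymp" "HOL-Computational_Algebra.Formal_Power_Series"
begin

text \<open>
  A canonical $t$-ary tree is determined by its profile, the list of the numbers of internal vertices on
  the successive levels: the first entry is 1 and each entry is at most $t$ times the preceding one. The size of the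
  tree is the sum of this list and the height is its length (\<open>random_height\<close>). Summing a geometric
  series over one entry at a time turns the generating function of the profiles into a quotient \<open>num t q w / den t q w\<close> of two alternating
  series, where \<open>den t q w = 1 - b t q w\<close> (\<open>profile_gf\<close>, \<open>den_eq\<close>).

  Multiplying \<open>den t q 1\<close> by \<open>1 - q\<close> leaves \<open>1 - 2 * q\<close> plus a small tail; by Rouche's theorem there is
  exactly one zero of modulus below \<open>1 - 0.72 / t\<close>, and it is real (\<open>dominant_pole\<close>). It is simple and
  moves holomorphically to \<open>\<rho> w\<close> when \<open>w\<close> moves near 1. Hence the coefficient of \<open>q ^ n\<close>, as a function of
  \<open>w = exp s\<close>, is bounded by a constant multiple of the \<open>n\<close>-th power of \<open>1 / \<rho> (exp s)\<close>, so that the moment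
  generating function of the height is a quasi-power. That is all the quasi-power machinery needs near the
  origin: after division by the power the moment generating function is uniformly bounded, and Cauchy's estimates
  give the mean and the variance up to bounded errors and the convergence of the characteristic functions.

  The local limit theorem also needs exponential smallness of the characteristic function away from the origin.
  This rests on a renewal structure: a profile is cut at its entries equal to 1, so that the generating function is
  \<open>1 / (1 - B)\<close> with \<open>B\<close> having nonnegative coefficients. The blocks \<open>[1]\<close> and \<open>[1, 2]\<close> have different
  phases unless \<open>w = 1\<close>, which excludes other zeros of the denominator for \<open>\<bar>w\<bar> = 1\<close> and \<open>\<bar>q\<bar> \<le> q\<^sub>0\<close>
  (\<open>renewal_lower_bound\<close>, \<open>den_on_circle\<close>).

  Differentiating \<open>(1 - q) * den t q w = 0\<close> along \<open>q = \<rho> (exp s)\<close> once and twice expresses both constants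
  by five alternating sums at \<open>q\<^sub>0\<close> (\<open>differentiate_zero_branch\<close>). Their terms decrease so fast that the first
  three of them determine the constants to the stated accuracy when \<open>t \<ge> 6\<close>: in terms of \<open>D = 2 * q\<^sub>0 - 1\<close>, which
  is about \<open>\<delta> = 1 / 2 ^ (t + 2)\<close>, these are rational functions, and expanding them and the relation between
  \<open>D\<close> and \<open>\<delta>\<close> in powers of \<open>(t + 1) * D\<close> gives the claim (\<open>good_constants_large\<close>). For \<open>t \<le> 5\<close> the
  parameter is not small enough for these estimates, and \<open>q\<^sub>0\<close> and the sums are enclosed in rational intervals instead.
\<close>

section \<open>Quasi-powers: moments, central and local limit theorem\<close>

definition pmf_mgf :: "nat pmf \<Rightarrow> complex \<Rightarrow> complex" where
  "pmf_mgf p s = (\<Sum>k\<in>set_pmf p. of_real (pmf p k) * exp (s * of_nat k))"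

definition pmf_mean :: "nat pmf \<Rightarrow> real" where
  "pmf_mean p = measure_pmf.expectation p real"

definition pmf_var :: "nat pmf \<Rightarrow> real" where
  "pmf_var p = measure_pmf.variance p real"

definition pmf_std_char :: "nat pmf \<Rightarrow> real \<Rightarrow> complex" where
  "pmf_std_char p x = iexp (- (x * pmf_mean p / sqrt (pmf_var p))) * pmf_mgf p (\<i> * of_real (x / sqrt (pmf_var p)))"

lemma pmf_mgf_0: "finite (set_pmf p) \<Longrightarrow> pmf_mgf p 0 = 1"
  unfolding pmf_mgf_def by (simp flip: of_real_sum add: sum_pmf_eq_1)

lemma pmf_mgf_has_derivative:
  "((deriv ^^ j) (pmf_mgf p)) = (\<lambda>s. \<Sum>k\<in>set_pmf p. of_real (pmf p k * real k ^ j) * exp (s * of_nat k))"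
proof (induction j)
  case 0
  show ?case by (auto simp: pmf_mgf_def)
next
  case (Suc j)
  show ?case
    unfolding funpow.simps o_def Suc
    by (intro ext DERIV_imp_deriv)
       (auto intro!: derivative_eq_intros sum.cong simp: algebra_simps)
qed

lemma pmf_mgf_holomorphic: "pmf_mgf p holomorphic_on S"
  unfolding pmf_mgf_def by (intro holomorphic_intros)

lemma pmf_moment_mgf:
  assumes "finite (set_pmf p)"
  shows "of_real (measure_pmf.expectation p (\<lambda>k. real k ^ j)) = (deriv ^^ j) (pmf_mgf p) 0"
  unfolding pmf_mgf_has_derivative
  by (subst integral_measure_pmf[OF assms]) (auto simp: scaleR_conv_of_real)

lemma pmf_var_moments:
  assumes "finite (set_pmf p)"
  shows "pmf_var p = measure_pmf.expectation p (\<lambda>k. real k ^ 2) - pmf_mean p ^ 2"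
  unfolding pmf_var_def pmf_mean_def
  by (rule measure_pmf.variance_eq) (auto intro: integrable_measure_pmf_finite assms)

text \<open>The second-order Taylor estimate that makes the exponent of a quasi-power Gaussian near the origin.\<close>

lemma holomorphic_quadratic_remainder:
  fixes G :: "complex \<Rightarrow> complex"
  assumes "0 < r" and hol: "G holomorphic_on ball 0 r"
  obtains B where "0 < B" "\<And>s. norm s \<le> r / 2 \<Longrightarrow>
    norm (G s - (G 0 + deriv G 0 * s + (deriv ^^ 2) G 0 * s ^ 2 / 2)) \<le> B * norm s ^ 3"
proof -
  have sub: "cball 0 (r/2) \<subseteq> ball (0::complex) r" using \<open>0 < r\<close> by auto
  have h3: "(deriv ^^ n) G holomorphic_on ball 0 r" for n
    by (rule holomorphic_higher_deriv[OF hol]) auto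
  have "bounded ((deriv ^^ 3) G ` cball 0 (r/2))"
    by (intro compact_imp_bounded compact_continuous_image holomorphic_on_imp_continuous_on
        holomorphic_on_subset[OF h3 sub]) auto
  then obtain B where B: "0 < B" "\<And>s. s \<in> cball 0 (r/2) \<Longrightarrow> norm ((deriv ^^ 3) G s) \<le> B"
    by (auto simp: bounded_pos)
  show ?thesis
  proof (rule that[of B])
    fix s :: complex assume s: "norm s \<le> r / 2"
    have "norm ((deriv ^^ 0) G s - (\<Sum>i\<le>2. (deriv ^^ i) G 0 * (s - 0)^i / (fact i)))
        \<le> B * cmod(s - 0)^(Suc 2) / fact 2"
    proof (rule complex_Taylor[of "cball 0 (r/2)"])
      fix i x assume x: "x \<in> cball (0::complex) (r/2)" "i \<le> (2::nat)"
      have "x \<in> ball 0 r" using x sub by auto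
      then show "((deriv ^^ i) G has_field_derivative (deriv ^^ (Suc i)) G x) (at x within cball 0 (r/2))"
        using h3[of i] holomorphic_derivI[of "(deriv ^^ i) G" "ball 0 r" x] by (simp)
    qed (use s B \<open>0 < r\<close> in \<open>auto simp: numeral_3_eq_3\<close>)
    moreover have "B * norm s ^ 3 / 2 \<le> B * norm s ^ 3" using B by (simp)
    ultimately show "norm (G s - (G 0 + deriv G 0 * s + (deriv ^^ 2) G 0 * s ^ 2 / 2)) \<le> B * norm s ^ 3"
      by (simp add: numeral_2_eq_2 numeral_3_eq_3)
  qed (use B in auto)
qed

lemma integral_iexp_period:
  assumes "0 < \<sigma>"
  shows "has_bochner_integral lborel
    (\<lambda>x. indicator {- pi * \<sigma>..pi * \<sigma>} x *\<^sub>R iexp (of_int l * (x / \<sigma>))) (if l = 0 then of_real (2 * pi * \<sigma>) else 0)"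
proof (cases "l = 0")
  case True
  have "has_bochner_integral lborel (\<lambda>x. indicator {- pi * \<sigma>..pi * \<sigma>} x *\<^sub>R (1 :: complex))
     (measure lborel {- pi * \<sigma>..pi * \<sigma>} *\<^sub>R 1)"
    by (intro has_bochner_integral_indicator) (use assms in auto)
  with True assms show ?thesis by (simp add: scaleR_conv_of_real mult.assoc)
next
  case False
  define F where "F x = iexp (of_int l * (x / \<sigma>)) * (of_real \<sigma> / (\<i> * of_int l))" for x
  have "has_bochner_integral lborel
    (\<lambda>x. indicator {- pi * \<sigma>..pi * \<sigma>} x *\<^sub>R iexp (of_int l * (x / \<sigma>))) (F (pi * \<sigma>) - F (- pi * \<sigma>))"
  proof (rule has_bochner_integral_FTC_Icc)
    fix x
    show "(F has_vector_derivative iexp (of_int l * (x / \<sigma>))) (at x within {- pi * \<sigma>..pi * \<sigma>})"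
    proof -
      have "((\<lambda>z. exp (\<i> * (of_int l * (z / of_real \<sigma>))) * (of_real \<sigma> / (\<i> * of_int l)))
        has_field_derivative iexp (of_int l * (x / \<sigma>))) (at (of_real x))"
        using False assms by (auto intro!: derivative_eq_intros simp flip: mult.assoc) (simp add: mult_ac)
      from has_vector_derivative_real_field[OF this] show ?thesis
        unfolding F_def by simp
    qed
  qed (use assms in \<open>auto intro!: continuous_intros\<close>)
  moreover have "F (pi * \<sigma>) = F (- pi * \<sigma>)"
  proof -
    have "iexp (of_int l * pi) = iexp (- (of_int l * pi))"
      using assms by (auto simp: exp_eq intro!: exI[of _ l])
    then show ?thesis using assms by (simp add: F_def)
  qed
  ultimately show ?thesis using False by simp
qed

text \<open>Fourier inversion for a lattice distribution, on the frequency scale of the standardized variable: only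
  one period of the characteristic function is integrated.\<close>

lemma pmf_inversion:
  assumes fin: "finite (set_pmf p)" and "0 < \<sigma>"
  shows "has_bochner_integral lborel
    (\<lambda>x. indicator {- pi * \<sigma>..pi * \<sigma>} x *\<^sub>R (pmf_mgf p (\<i> * of_real (x / \<sigma>)) * iexp (- (of_int j * (x / \<sigma>)))))
    (of_real (2 * pi * \<sigma> * measure_pmf.prob p {k. int k = j}))"
proof -
  have "has_bochner_integral lborel
    (\<lambda>x. \<Sum>k\<in>set_pmf p. of_real (pmf p k) *
        (indicator {- pi * \<sigma>..pi * \<sigma>} x *\<^sub>R iexp (of_int (int k - j) * (x / \<sigma>))))
    (\<Sum>k\<in>set_pmf p. of_real (pmf p k) * (if int k - j = 0 then of_real (2 * pi * \<sigma>) else 0))"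
    by (intro has_bochner_integral_sum has_bochner_integral_mult_right integral_iexp_period assms)
  moreover have "(\<Sum>k\<in>set_pmf p. of_real (pmf p k) *
        (indicator {- pi * \<sigma>..pi * \<sigma>} x *\<^sub>R iexp (of_int (int k - j) * (x / \<sigma>))))
     = indicator {- pi * \<sigma>..pi * \<sigma>} x *\<^sub>R (pmf_mgf p (\<i> * of_real (x / \<sigma>)) * iexp (- (of_int j * (x / \<sigma>))))" for x
    unfolding pmf_mgf_def sum_distrib_right scaleR_sum_right
    by (intro sum.cong refl) (simp add: algebra_simps diff_divide_distrib flip: exp_add)
  moreover have "(\<Sum>k\<in>set_pmf p. of_real (pmf p k) * (if int k - j = 0 then complex_of_real (2 * pi * \<sigma>) else 0))
     = of_real (2 * pi * \<sigma> * measure_pmf.prob p {k. int k = j})"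
  proof -
    have "(\<Sum>k\<in>set_pmf p. of_real (pmf p k) * (if int k - j = 0 then complex_of_real (2 * pi * \<sigma>) else 0))
      = of_real (2 * pi * \<sigma> * (\<Sum>k\<in>set_pmf p \<inter> {k. int k = j}. pmf p k))"
      using fin by (simp add: sum.inter_restrict sum_distrib_left if_distrib mult_ac cong: if_cong)
    also have "(\<Sum>k\<in>set_pmf p \<inter> {k. int k = j}. pmf p k) = measure_pmf.prob p (set_pmf p \<inter> {k. int k = j})"
      using fin by (simp add: measure_measure_pmf_finite)
    also have "\<dots> = measure_pmf.prob p {k. int k = j}"
      by (subst Int_commute) (rule measure_Int_set_pmf)
    finally show ?thesis .
  qed
  ultimately show ?thesis by simp
qed

lemma gaussian_inversion:
  "has_bochner_integral lborel (\<lambda>x. of_real (exp (- x\<^sup>2 / 2)) * iexp (- (z * x)))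
     (of_real (2 * pi * (1 / sqrt (2 * pi) * exp (- z\<^sup>2 / 2))))"
proof -
  have int: "integrable lborel (\<lambda>x. std_normal_density x *\<^sub>R iexp (- z * x))"
    by (rule Bochner_Integration.integrable_bound[of _ std_normal_density]) auto
  have "complex_of_real (exp (- z\<^sup>2 / 2)) = (CLINT x|std_normal_distribution. iexp (- z * x))"
    using fun_cong[OF char_std_normal_distribution, of "- z"] by (simp add: char_def)
  also have "\<dots> = (CLINT x|lborel. std_normal_density x *\<^sub>R iexp (- z * x))"
    by (subst integral_density) auto
  finally have "has_bochner_integral lborel (\<lambda>x. std_normal_density x *\<^sub>R iexp (- z * x)) (of_real (exp (- z\<^sup>2 / 2)))"
    using int by (simp add: has_bochner_integral_iff)
  from has_bochner_integral_mult_right[OF this, of "of_real (sqrt (2 * pi))"]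
  show ?thesis
  proof (rule has_bochner_integral_cong[THEN iffD1, rotated -1])
    have s: "sqrt (2 * pi) * sqrt (2 * pi) = 2 * pi" by simp
    show "complex_of_real (sqrt (2 * pi)) * complex_of_real (exp (- z\<^sup>2 / 2)) =
      complex_of_real (2 * pi * (1 / sqrt (2 * pi) * exp (- z\<^sup>2 / 2)))"
      by (subst s[symmetric]) (simp del: real_sqrt_mult_self)
  qed (simp_all add: std_normal_density_def scaleR_conv_of_real)
qed

lemma integrable_gaussian:
  assumes "0 < (c :: real)" shows "integrable lborel (\<lambda>x. exp (- c * x\<^sup>2))"
proof -
  define \<sigma> where "\<sigma> = 1 / sqrt (2 * c)"
  have "2 * \<sigma>\<^sup>2 = 1 / c" using assms by (simp add: \<sigma>_def power_divide)
  then have nd: "normal_density 0 \<sigma> = (\<lambda>x. 1 / sqrt (2 * pi * \<sigma>\<^sup>2) * exp (- c * x\<^sup>2))"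
    by (simp add: normal_density_def fun_eq_iff)
  have "integrable lborel (normal_density 0 \<sigma>)"
    by (rule integrable_normal_density) (use assms in \<open>auto simp: \<sigma>_def\<close>)
  then have "integrable lborel (\<lambda>x. sqrt (2 * pi * \<sigma>\<^sup>2) * (1 / sqrt (2 * pi * \<sigma>\<^sup>2) * exp (- c * x\<^sup>2)))"
    unfolding nd by (rule integrable_mult_right)
  then show ?thesis using assms by (simp add: \<sigma>_def)
qed

text \<open>The local limit theorem evaluates the density at the rounded argument; since rounding moves the
  standardized argument by at most the inverse standard deviation, a Lipschitz bound absorbs it.\<close>

lemma gaussian_lipschitz:
  "\<bar>1 / sqrt (2 * pi) * exp (- x\<^sup>2 / 2) - 1 / sqrt (2 * pi) * exp (- y\<^sup>2 / 2)\<bar> \<le> \<bar>x - y\<bar>" for x y :: real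
proof -
  have "norm (exp (- x\<^sup>2 / 2) - exp (- y\<^sup>2 / 2)) \<le> 1 * norm (x - y)"
  proof (rule field_differentiable_bound[of UNIV _ "\<lambda>z. - z * exp (- z\<^sup>2 / 2)"])
    fix z :: real
    show "((\<lambda>z. exp (- z\<^sup>2 / 2)) has_field_derivative - z * exp (- z\<^sup>2 / 2)) (at z within UNIV)"
      by (auto intro!: derivative_eq_intros)
    have "\<bar>z\<bar> \<le> 1 + z\<^sup>2 / 2" using zero_le_power2[of "\<bar>z\<bar> - 1"]
      by (simp add: power2_eq_square algebra_simps)
    also have "\<dots> \<le> exp (z\<^sup>2 / 2)" by (rule exp_ge_add_one_self)
    finally show "norm (- z * exp (- z\<^sup>2 / 2)) \<le> 1"
      by (simp add: abs_mult exp_minus field_simps)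
  qed auto
  moreover have "1 / sqrt (2 * pi) \<le> 1" using pi_gt3 by simp
  ultimately have "1 / sqrt (2 * pi) * \<bar>exp (- x\<^sup>2 / 2) - exp (- y\<^sup>2 / 2)\<bar> \<le> 1 * \<bar>x - y\<bar>"
    by (intro mult_mono) auto
  then have "\<bar>1 / sqrt (2 * pi) * (exp (- x\<^sup>2 / 2) - exp (- y\<^sup>2 / 2))\<bar> \<le> \<bar>x - y\<bar>"
    by (simp add: abs_mult)
  then show ?thesis by (simp only: right_diff_distrib)
qed

text \<open>A sequence of distributions whose moment generating functions are bounded by the $n$-th power of a fixed
  function near the origin and are exponentially small on the rest of the imaginary period.
  At the origin the moment generating functions equal 1, so the uniform bound that remains after division by
  the powers already controls their derivatives there.\<close>

locale quasi_power =
  fixes D :: "nat \<Rightarrow> nat pmf" and G :: "complex \<Rightarrow> complex" and r K \<mu> \<sigma>2 :: real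
  assumes fin: "\<And>n. finite (set_pmf (D n))"
    and r: "0 < r" and hol: "G holomorphic_on ball 0 r"
    and G0: "G 0 = 0" and G1: "deriv G 0 = of_real \<mu>" and G2: "(deriv ^^ 2) G 0 = of_real \<sigma>2"
    and \<sigma>2: "0 < \<sigma>2"
    and near: "\<And>n s. norm s < r \<Longrightarrow> norm (pmf_mgf (D n) s) \<le> K * exp (n * Re (G s))"
    and far: "\<And>\<delta>. 0 < \<delta> \<Longrightarrow> \<exists>K \<kappa>. 0 < \<kappa> \<and> \<kappa> < 1 \<and>
        (\<forall>n \<theta>. \<delta> \<le> \<bar>\<theta>\<bar> \<longrightarrow> \<bar>\<theta>\<bar> \<le> pi \<longrightarrow> norm (pmf_mgf (D n) (\<i> * of_real \<theta>)) \<le> K * \<kappa> ^ n)"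
begin

definition E :: "nat \<Rightarrow> complex \<Rightarrow> complex" where
  "E n s = pmf_mgf (D n) s * exp (- of_nat n * G s)"

lemma mgf_E: "pmf_mgf (D n) s = E n s * exp (of_nat n * G s)"
  unfolding E_def by (simp add: mult.assoc flip: exp_add)

lemma hol_E: "E n holomorphic_on ball 0 r"
  unfolding E_def by (intro holomorphic_intros pmf_mgf_holomorphic hol)

lemma E_bound: "norm s < r \<Longrightarrow> norm (E n s) \<le> K"
  using near[of s n] unfolding E_def norm_mult norm_exp_eq_Re
  by (simp add: exp_minus field_simps)

lemma E_0: "E n 0 = 1"
  by (simp add: E_def G0 pmf_mgf_0 fin)

lemma K_ge_1: "1 \<le> K"
  using E_bound[of 0 0] r by (simp add: E_0)

lemma E_deriv_bound:
  assumes "norm s < r / 2" "0 < j"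
  shows "norm ((deriv ^^ j) (E n) s) \<le> fact j * (K + 1) / (r / 2) ^ j"
proof -
  have sub: "cball s (r/2) \<subseteq> ball 0 r"
  proof
    fix w assume "w \<in> cball s (r/2)"
    then have "norm (w - s) \<le> r / 2" by (simp add: dist_norm norm_minus_commute)
    then show "w \<in> ball 0 r" using norm_triangle_ineq[of s "w - s"] assms(1) by simp
  qed
  show ?thesis
  proof (rule Cauchy_higher_deriv_bound[where y = 0])
    show "E n holomorphic_on ball s (r/2)"
      by (rule holomorphic_on_subset[OF hol_E]) (use sub in auto)
    show "continuous_on (cball s (r/2)) (E n)"
      by (rule holomorphic_on_imp_continuous_on, rule holomorphic_on_subset[OF hol_E sub])
    fix w assume "w \<in> ball s (r/2)"
    then have "w \<in> cball s (r/2)" by auto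
    with sub have "w \<in> ball 0 r" by blast
    then have "norm w < r" by simp
    then show "E n w \<in> ball 0 (K + 1)" using E_bound[of w n] by auto
  qed (use r assms in auto)
qed

lemma mean_eq: "of_real (pmf_mean (D n)) = deriv (E n) 0 + of_nat n * \<mu>"
proof -
  have "(E n has_field_derivative deriv (E n) 0) (at 0)"
    by (rule holomorphic_derivI[OF hol_E]) (use r in auto)
  moreover have "(G has_field_derivative deriv G 0) (at 0)"
    by (rule holomorphic_derivI[OF hol]) (use r in auto)
  ultimately have "((\<lambda>s. E n s * exp (of_nat n * G s)) has_field_derivative
     (deriv (E n) 0 + of_nat n * \<mu>)) (at 0)"
    by (auto intro!: derivative_eq_intros simp: G0 G1 E_0)
  then have "deriv (pmf_mgf (D n)) 0 = deriv (E n) 0 + of_nat n * \<mu>"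
    by (intro DERIV_imp_deriv) (simp add: mgf_E[abs_def])
  then show ?thesis using pmf_moment_mgf[OF fin, of n 1] by (simp add: pmf_mean_def)
qed

lemma second_moment_eq:
  "of_real (measure_pmf.expectation (D n) (\<lambda>k. real k ^ 2)) =
    (deriv ^^ 2) (E n) 0 + 2 * of_nat n * deriv (E n) 0 * \<mu> + (of_nat n * \<mu>)\<^sup>2 + of_nat n * \<sigma>2"
proof -
  have dE: "(E n has_field_derivative deriv (E n) s) (at s)" if "norm s < r" for s
    by (rule holomorphic_derivI[OF hol_E]) (use that in auto)
  have dG: "(G has_field_derivative deriv G s) (at s)" if "norm s < r" for s
    by (rule holomorphic_derivI[OF hol]) (use that in auto)
  have "deriv (E n) holomorphic_on ball 0 r" "deriv G holomorphic_on ball 0 r"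
    by (auto intro: holomorphic_deriv hol_E hol)
  then have ddE: "(deriv (E n) has_field_derivative (deriv ^^ 2) (E n) 0) (at 0)"
    and ddG: "(deriv G has_field_derivative (deriv ^^ 2) G 0) (at 0)"
    using r by (auto simp: numeral_2_eq_2 intro!: holomorphic_derivI[of _ "ball 0 r"])
  have d1: "deriv (pmf_mgf (D n)) s = (deriv (E n) s + E n s * (of_nat n * deriv G s)) * exp (of_nat n * G s)"
    if "norm s < r" for s
    unfolding mgf_E[abs_def]
    by (intro DERIV_imp_deriv) (auto intro!: derivative_eq_intros dE dG that simp: algebra_simps)
  have "((\<lambda>s. (deriv (E n) s + E n s * (of_nat n * deriv G s)) * exp (of_nat n * G s)) has_field_derivative
     ((deriv ^^ 2) (E n) 0 + 2 * of_nat n * deriv (E n) 0 * \<mu> + (of_nat n * \<mu>)\<^sup>2 + of_nat n * \<sigma>2)) (at 0)"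
    using r
    by (auto intro!: derivative_eq_intros dE dG ddE ddG simp: G0 G1 G2 E_0)
       (simp add: algebra_simps power2_eq_square)
  then have "(deriv (pmf_mgf (D n)) has_field_derivative
     ((deriv ^^ 2) (E n) 0 + 2 * of_nat n * deriv (E n) 0 * \<mu> + (of_nat n * \<mu>)\<^sup>2 + of_nat n * \<sigma>2)) (at 0)"
    by (rule has_field_derivative_transform_within_open[where S = "ball 0 r"]) (use r d1 in auto)
  from DERIV_imp_deriv[OF this] show ?thesis
    using pmf_moment_mgf[OF fin, of n 2] by (simp add: numeral_2_eq_2)
qed

lemma mean_bound: "\<bar>pmf_mean (D n) - \<mu> * n\<bar> \<le> 2 * (K + 1) / r"
proof -
  have "of_real (pmf_mean (D n) - \<mu> * n) = deriv (E n) 0" using mean_eq[of n] by (simp add: mult.commute)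
  then have "\<bar>pmf_mean (D n) - \<mu> * n\<bar> = norm (deriv (E n) 0)" by (metis norm_of_real)
  with E_deriv_bound[of 0 1 n] r show ?thesis by (simp add: field_simps)
qed

lemma var_eq: "of_real (pmf_var (D n) - \<sigma>2 * n) = (deriv ^^ 2) (E n) 0 - (deriv (E n) 0)\<^sup>2"
  unfolding pmf_var_moments[OF fin] of_real_diff of_real_power second_moment_eq mean_eq
  by (simp add: algebra_simps power2_eq_square)

lemma var_bound: "\<exists>B. \<forall>n. \<bar>pmf_var (D n) - \<sigma>2 * n\<bar> \<le> B"
proof (intro exI allI)
  fix n
  have "\<bar>pmf_var (D n) - \<sigma>2 * n\<bar> = norm ((deriv ^^ 2) (E n) 0 - (deriv (E n) 0)\<^sup>2)"
    by (metis norm_of_real var_eq)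
  also have "\<dots> \<le> norm ((deriv ^^ 2) (E n) 0) + (norm (deriv (E n) 0))\<^sup>2"
    by (metis norm_power norm_triangle_ineq4)
  also have "\<dots> \<le> fact 2 * (K + 1) / (r / 2) ^ 2 + (fact 1 * (K + 1) / (r / 2) ^ 1)\<^sup>2"
    using E_deriv_bound[of 0 1 n] E_deriv_bound[of 0 2 n] r
    by (intro add_mono power_mono) auto
  finally show "\<bar>pmf_var (D n) - \<sigma>2 * n\<bar> \<le> fact 2 * (K + 1) / (r / 2) ^ 2 + (fact 1 * (K + 1) / (r / 2) ^ 1)\<^sup>2" .
qed

lemma mean_bigo: "(\<lambda>n. pmf_mean (D n) - \<mu> * n) \<in> O(\<lambda>_. 1)"
  by (rule bigoI[where c = "2 * (K + 1) / r"]) (use mean_bound in auto)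

lemma var_bigo: "(\<lambda>n. pmf_var (D n) - \<sigma>2 * n) \<in> O(\<lambda>_. 1)"
proof -
  obtain B where "\<bar>pmf_var (D n) - \<sigma>2 * n\<bar> \<le> B" for n
    using var_bound by blast
  then show ?thesis by (intro bigoI[where c = B]) auto
qed

lemma E_near_1: "norm s < r / 2 \<Longrightarrow> norm (E n s - 1) \<le> 2 * (K + 1) / r * norm s"
proof -
  assume s: "norm s < r / 2"
  have "norm (E n s - E n 0) \<le> 2 * (K + 1) / r * norm (s - 0)"
  proof (rule field_differentiable_bound[of "ball 0 (r/2)" "E n" "deriv (E n)"])
    fix z assume "z \<in> ball (0::complex) (r/2)"
    then show "norm (deriv (E n) z) \<le> 2 * (K + 1) / r"
      using E_deriv_bound[of z 1 n] r by (simp add: field_simps)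
  next
    fix z assume "z \<in> ball (0::complex) (r/2)"
    then show "(E n has_field_derivative deriv (E n) z) (at z within ball 0 (r / 2))"
      using r by (intro has_field_derivative_at_within[OF holomorphic_derivI[OF hol_E]]) auto
  qed (use s r in auto)
  then show ?thesis by (simp add: E_0)
qed


lemma var_ratio: "(\<lambda>n. pmf_var (D n) / n) \<longlonglongrightarrow> \<sigma>2"
proof -
  obtain B where B: "\<bar>pmf_var (D n) - \<sigma>2 * n\<bar> \<le> B" for n
    using var_bound by blast
  have "(\<lambda>n. B / real n) \<longlonglongrightarrow> 0" by real_asymp
  then have "(\<lambda>n. pmf_var (D n) / n - \<sigma>2) \<longlonglongrightarrow> 0"
  proof (rule Lim_null_comparison[rotated])
    show "\<forall>\<^sub>F n in sequentially. norm (pmf_var (D n) / n - \<sigma>2) \<le> B / real n"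
      using eventually_gt_at_top[of 0]
    proof eventually_elim
      case (elim n)
      have "pmf_var (D n) / n - \<sigma>2 = (pmf_var (D n) - \<sigma>2 * n) / n"
        using elim by (simp add: field_simps)
      then show ?case using B[of n] elim by (simp add: divide_right_mono)
    qed
  qed
  then show ?thesis by (simp add: LIM_zero_iff)
qed

lemma eventually_var:
  "\<forall>\<^sub>F n in sequentially. 0 < n \<and> \<sigma>2 / 2 * n < pmf_var (D n) \<and> pmf_var (D n) < 2 * \<sigma>2 * n"
proof -
  have "\<forall>\<^sub>F n in sequentially. pmf_var (D n) / n > \<sigma>2 / 2" "\<forall>\<^sub>F n in sequentially. pmf_var (D n) / n < 2 * \<sigma>2"
    using order_tendstoD[OF var_ratio, of "\<sigma>2 / 2"] order_tendstoD[OF var_ratio, of "2 * \<sigma>2"] \<sigma>2 by simp_all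
  then show ?thesis
    using eventually_gt_at_top[of 0] by eventually_elim (auto simp: field_simps)
qed

lemma var_at_top: "filterlim (\<lambda>n. pmf_var (D n)) at_top sequentially"
proof (rule filterlim_at_top_mono)
  show "filterlim (\<lambda>n. \<sigma>2 / 2 * real n) at_top sequentially" using \<sigma>2 by real_asymp
  show "\<forall>\<^sub>F n in sequentially. \<sigma>2 / 2 * real n \<le> pmf_var (D n)"
    using eventually_var by eventually_elim auto
qed

lemma sd_at_top: "filterlim (\<lambda>n. sqrt (pmf_var (D n))) at_top sequentially"
  by (rule filterlim_compose[OF sqrt_at_top var_at_top])

lemma sd_inverse_0: "(\<lambda>n. x / sqrt (pmf_var (D n))) \<longlonglongrightarrow> 0"
  by (rule real_tendsto_divide_at_top[OF tendsto_const sd_at_top])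

text \<open>For small \<open>\<theta>\<close> the Gaussian bound comes from the real part of the exponent, for the
  others from the assumption \<open>far\<close>; both have the same form, which later serves as an
  integrable majorant.\<close>

lemma gaussian_domination:
  "\<exists>K' c. 0 < c \<and> 0 \<le> K' \<and> (\<forall>n \<theta>. \<bar>\<theta>\<bar> \<le> pi \<longrightarrow>
    norm (pmf_mgf (D n) (\<i> * of_real \<theta>)) \<le> K' * exp (- c * n * \<theta>\<^sup>2))"
proof -
  obtain B where B: "0 < B" "\<And>s. norm s \<le> r / 2 \<Longrightarrow>
    norm (G s - (G 0 + deriv G 0 * s + (deriv ^^ 2) G 0 * s ^ 2 / 2)) \<le> B * norm s ^ 3"
    using holomorphic_quadratic_remainder[OF r hol] by blast
  define \<delta> where "\<delta> = min (r / 2) (\<sigma>2 / (4 * B)) / 2"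
  have \<delta>: "0 < \<delta>" "\<delta> < r" "\<delta> \<le> r / 2" "B * \<delta> \<le> \<sigma>2 / 4"
    using r \<sigma>2 B(1) by (auto simp: \<delta>_def min_def field_simps)
  have Re_G: "Re (G (\<i> * of_real \<theta>)) \<le> - (\<sigma>2 / 4) * \<theta>\<^sup>2" if "\<bar>\<theta>\<bar> \<le> \<delta>" for \<theta>
  proof -
    define s where "s = \<i> * complex_of_real \<theta>"
    have ns: "norm s = \<bar>\<theta>\<bar>" by (simp add: s_def norm_mult)
    have "Re (G s - (of_real \<mu> * s + of_real \<sigma>2 * s ^ 2 / 2)) \<le> B * \<bar>\<theta>\<bar> ^ 3"
      using B(2)[of s] that \<delta> complex_Re_le_cmod[of "G s - (of_real \<mu> * s + of_real \<sigma>2 * s ^ 2 / 2)"]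
      by (simp add: ns G0 G1 G2)
    also have "B * \<bar>\<theta>\<bar> ^ 3 = (B * \<bar>\<theta>\<bar>) * \<theta>\<^sup>2"
      by (simp add: power3_eq_cube power2_eq_square)
    also have "\<dots> \<le> (B * \<delta>) * \<theta>\<^sup>2" using that B(1) by (intro mult_right_mono) auto
    also have "\<dots> \<le> \<sigma>2 / 4 * \<theta>\<^sup>2" by (intro mult_right_mono \<delta>) auto
    finally show ?thesis by (simp add: s_def power_mult_distrib)
  qed
  obtain K2 \<kappa> where far': "0 < \<kappa>" "\<kappa> < 1"
    "\<And>n \<theta>. \<delta> \<le> \<bar>\<theta>\<bar> \<Longrightarrow> \<bar>\<theta>\<bar> \<le> pi \<Longrightarrow> norm (pmf_mgf (D n) (\<i> * of_real \<theta>)) \<le> K2 * \<kappa> ^ n"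
    using far[OF \<delta>(1)] by blast
  define c where "c = min (\<sigma>2 / 4) (- ln \<kappa> / pi\<^sup>2)"
  have c: "0 < c" "c \<le> \<sigma>2 / 4" "c * pi\<^sup>2 \<le> - ln \<kappa>"
    using \<sigma>2 far' by (auto simp: c_def min_def field_simps)
  define K' where "K' = max K \<bar>K2\<bar>"
  show ?thesis
  proof (rule exI[of _ K'], rule exI[of _ c], intro conjI allI impI)
    fix n and \<theta> :: real assume \<theta>: "\<bar>\<theta>\<bar> \<le> pi"
    show "norm (pmf_mgf (D n) (\<i> * of_real \<theta>)) \<le> K' * exp (- c * n * \<theta>\<^sup>2)"
    proof (cases "\<bar>\<theta>\<bar> \<le> \<delta>")
      case True
      have "norm (pmf_mgf (D n) (\<i> * of_real \<theta>)) \<le> K * exp (n * Re (G (\<i> * of_real \<theta>)))"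
        by (rule near) (use True \<delta> in \<open>auto simp: norm_mult\<close>)
      also have "\<dots> \<le> K' * exp (- c * n * \<theta>\<^sup>2)"
      proof (rule mult_mono)
        have "Re (G (\<i> * of_real \<theta>)) \<le> - (\<sigma>2 / 4) * \<theta>\<^sup>2" by (rule Re_G[OF True])
        also have "\<dots> \<le> - c * \<theta>\<^sup>2" using c by (intro mult_right_mono) auto
        finally have "n * Re (G (\<i> * of_real \<theta>)) \<le> n * (- c * \<theta>\<^sup>2)" by (intro mult_left_mono) auto
        then show "exp (n * Re (G (\<i> * of_real \<theta>))) \<le> exp (- c * n * \<theta>\<^sup>2)"
          by (simp add: mult_ac)
      qed (use K_ge_1 in \<open>auto simp: K'_def\<close>)
      finally show ?thesis .
    next
      case False
      have "norm (pmf_mgf (D n) (\<i> * of_real \<theta>)) \<le> K2 * \<kappa> ^ n"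
        by (rule far') (use False \<theta> in auto)
      also have "\<dots> \<le> K' * exp (- c * n * \<theta>\<^sup>2)"
      proof (rule mult_mono)
        have "\<theta>\<^sup>2 \<le> pi\<^sup>2" using \<theta> by (metis abs_ge_zero power2_abs power_mono)
        then have "c * \<theta>\<^sup>2 \<le> c * pi\<^sup>2" using c by (intro mult_left_mono) auto
        with c(3) have "c * \<theta>\<^sup>2 \<le> - ln \<kappa>" by linarith
        then have "n * (c * \<theta>\<^sup>2) \<le> n * (- ln \<kappa>)" by (intro mult_left_mono) auto
        then have "exp (n * ln \<kappa>) \<le> exp (- c * n * \<theta>\<^sup>2)" by (simp add: mult_ac)
        then show "\<kappa> ^ n \<le> exp (- c * n * \<theta>\<^sup>2)"
          using far'(1) by (simp add: exp_of_nat_mult)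
      qed (use far' in \<open>auto simp: K'_def\<close>)
      finally show ?thesis .
    qed
  qed (use c K_ge_1 in \<open>auto simp: K'_def\<close>)
qed

text \<open>At frequency $x/\sigma_n$ the quotient of the moment generating function and the power tends to 1 because
  it is 1 at the origin and its derivative is bounded there, and the quadratic term of the exponent gives
  the Gaussian.\<close>

lemma std_char_tendsto: "(\<lambda>n. pmf_std_char (D n) x) \<longlonglongrightarrow> of_real (exp (- x\<^sup>2 / 2))"
proof -
  obtain B where B: "0 < B" "\<And>s. norm s \<le> r / 2 \<Longrightarrow>
    norm (G s - (G 0 + deriv G 0 * s + (deriv ^^ 2) G 0 * s ^ 2 / 2)) \<le> B * norm s ^ 3"
    using holomorphic_quadratic_remainder[OF r hol] by blast
  define \<theta> where "\<theta> n = x / sqrt (pmf_var (D n))" for n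
  define s where "s n = \<i> * complex_of_real (\<theta> n)" for n
  have ns: "norm (s n) = \<bar>\<theta> n\<bar>" for n by (simp add: s_def norm_mult)
  have \<theta>0: "\<theta> \<longlonglongrightarrow> 0" unfolding \<theta>_def[abs_def] by (rule sd_inverse_0)
  then have s0: "s \<longlonglongrightarrow> 0"
    unfolding s_def[abs_def] by (auto intro!: tendsto_eq_intros)
  have small: "\<forall>\<^sub>F n in sequentially. norm (s n) < r / 2"
    using order_tendstoD(2)[OF tendsto_norm_zero[OF s0], of "r/2"] r by simp
  have n\<theta>: "(\<lambda>n. real n * (\<theta> n)\<^sup>2) \<longlonglongrightarrow> x\<^sup>2 / \<sigma>2"
  proof -
    have "(\<lambda>n. x\<^sup>2 / (pmf_var (D n) / n)) \<longlonglongrightarrow> x\<^sup>2 / \<sigma>2"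
      using \<sigma>2 by (intro tendsto_intros var_ratio) auto
    moreover have "\<forall>\<^sub>F n in sequentially. x\<^sup>2 / (pmf_var (D n) / n) = real n * (\<theta> n)\<^sup>2"
      using eventually_var by eventually_elim
        (auto simp: \<theta>_def power_divide)
    ultimately show ?thesis by (rule Lim_transform_eventually)
  qed
  have E1: "(\<lambda>n. E n (s n)) \<longlonglongrightarrow> 1"
  proof -
    have "(\<lambda>n. 2 * (K + 1) / r * norm (s n)) \<longlonglongrightarrow> 0"
      by (rule tendsto_mult_right_zero[OF tendsto_norm_zero[OF s0]])
    then have "(\<lambda>n. E n (s n) - 1) \<longlonglongrightarrow> 0"
      by (rule Lim_null_comparison[rotated]) (use small in eventually_elim, rule E_near_1)
    then show ?thesis by (simp add: LIM_zero_iff)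
  qed
  have R: "(\<lambda>n. of_nat n * (G (s n) - (of_real \<mu> * s n + of_real \<sigma>2 * s n ^ 2 / 2))) \<longlonglongrightarrow> 0"
  proof (rule Lim_null_comparison)
    show "\<forall>\<^sub>F n in sequentially. norm (of_nat n * (G (s n) - (of_real \<mu> * s n + of_real \<sigma>2 * s n ^ 2 / 2)))
        \<le> B * (real n * (\<theta> n)\<^sup>2) * \<bar>\<theta> n\<bar>"
      using small
    proof eventually_elim
      case (elim n)
      have "norm (of_nat n * (G (s n) - (of_real \<mu> * s n + of_real \<sigma>2 * s n ^ 2 / 2))) \<le> n * (B * \<bar>\<theta> n\<bar> ^ 3)"
        unfolding norm_mult using B(2)[of "s n"] elim by (auto simp: G0 G1 G2 ns intro!: mult_left_mono)
      also have "\<dots> = B * (real n * (\<theta> n)\<^sup>2) * \<bar>\<theta> n\<bar>"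
        by (simp add: power3_eq_cube power2_eq_square)
      finally show ?case .
    qed
    have "(\<lambda>n. B * (real n * (\<theta> n)\<^sup>2) * \<bar>\<theta> n\<bar>) \<longlonglongrightarrow> B * (x\<^sup>2 / \<sigma>2) * \<bar>0\<bar>"
      by (intro tendsto_intros n\<theta> \<theta>0)
    then show "(\<lambda>n. B * (real n * (\<theta> n)\<^sup>2) * \<bar>\<theta> n\<bar>) \<longlonglongrightarrow> 0" by simp
  qed
  have M: "(\<lambda>n. of_real (\<mu> * n - pmf_mean (D n)) * s n) \<longlonglongrightarrow> 0"
  proof (rule Lim_null_comparison)
    show "\<forall>\<^sub>F n in sequentially. norm (of_real (\<mu> * n - pmf_mean (D n)) * s n) \<le> 2 * (K + 1) / r * norm (s n)"
      unfolding norm_mult norm_of_real using mean_bound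
      by (intro always_eventually allI mult_right_mono) (auto simp: abs_minus_commute)
    show "(\<lambda>n. 2 * (K + 1) / r * norm (s n)) \<longlonglongrightarrow> 0"
      by (rule tendsto_mult_right_zero[OF tendsto_norm_zero[OF s0]])
  qed
  have Q: "(\<lambda>n. - of_real (\<sigma>2 / 2 * (real n * (\<theta> n)\<^sup>2))) \<longlonglongrightarrow> - complex_of_real (\<sigma>2 / 2 * (x\<^sup>2 / \<sigma>2))"
    by (intro tendsto_intros n\<theta>)
  have "(\<lambda>n. E n (s n) * exp (of_nat n * (G (s n) - (of_real \<mu> * s n + of_real \<sigma>2 * s n ^ 2 / 2))
      + of_real (\<mu> * n - pmf_mean (D n)) * s n + - of_real (\<sigma>2 / 2 * (real n * (\<theta> n)\<^sup>2))))
    \<longlonglongrightarrow> 1 * exp (0 + 0 + - complex_of_real (\<sigma>2 / 2 * (x\<^sup>2 / \<sigma>2)))"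
    by (intro tendsto_intros E1 R M Q)
  moreover have "E n (s n) * exp (of_nat n * (G (s n) - (of_real \<mu> * s n + of_real \<sigma>2 * s n ^ 2 / 2))
      + of_real (\<mu> * n - pmf_mean (D n)) * s n + - of_real (\<sigma>2 / 2 * (real n * (\<theta> n)\<^sup>2)))
      = pmf_std_char (D n) x" for n
  proof -
    have "of_nat n * (G (s n) - (of_real \<mu> * s n + of_real \<sigma>2 * s n ^ 2 / 2))
      + of_real (\<mu> * n - pmf_mean (D n)) * s n + - of_real (\<sigma>2 / 2 * (real n * (\<theta> n)\<^sup>2))
      = of_nat n * G (s n) + \<i> * of_real (- (\<theta> n * pmf_mean (D n)))"
      by (simp add: s_def algebra_simps power2_eq_square)
    note exponent = this
    have "x * pmf_mean (D n) / sqrt (pmf_var (D n)) = \<theta> n * pmf_mean (D n)"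
      by (simp add: \<theta>_def)
    moreover have "x / sqrt (pmf_var (D n)) = \<theta> n" by (simp add: \<theta>_def)
    ultimately have "pmf_std_char (D n) x = iexp (- (\<theta> n * pmf_mean (D n))) * (E n (s n) * exp (of_nat n * G (s n)))"
      by (simp only: pmf_std_char_def mgf_E s_def)
    also have "\<dots> = E n (s n) * (exp (of_nat n * G (s n)) * iexp (- (\<theta> n * pmf_mean (D n))))"
      by (rule mult.left_commute[THEN trans]) (simp only: mult.commute)
    finally show ?thesis
      unfolding exponent exp_add by (rule sym)
  qed
  moreover have "0 + 0 + - complex_of_real (\<sigma>2 / 2 * (x\<^sup>2 / \<sigma>2)) = of_real (- x\<^sup>2 / 2)"
    using \<sigma>2 by simp
  ultimately have "(\<lambda>n. pmf_std_char (D n) x) \<longlonglongrightarrow> 1 * exp (of_real (- x\<^sup>2 / 2))"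
    by (simp only:)
  then show ?thesis unfolding exp_of_real mult_1 .
qed

theorem central_limit:
  "weak_conv_m
     (\<lambda>n. distr (measure_pmf (D n)) borel (\<lambda>k. (real k - pmf_mean (D n)) / sqrt (pmf_var (D n))))
     std_normal_distribution"
proof (rule levy_continuity)
  show "real_distribution (distr (measure_pmf (D n)) borel (\<lambda>k. (real k - pmf_mean (D n)) / sqrt (pmf_var (D n))))" for n
    by (rule prob_space.real_distribution_distr[OF measure_pmf.prob_space_axioms]) simp
  show "real_distribution std_normal_distribution" by (rule real_dist_normal_dist)
  fix x :: real
  have "char (distr (measure_pmf (D n)) borel (\<lambda>k. (real k - pmf_mean (D n)) / sqrt (pmf_var (D n)))) x
      = pmf_std_char (D n) x" for n
  proof -
    have "char (distr (measure_pmf (D n)) borel (\<lambda>k. (real k - pmf_mean (D n)) / sqrt (pmf_var (D n)))) x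
      = (CLINT k|measure_pmf (D n). iexp (x * ((real k - pmf_mean (D n)) / sqrt (pmf_var (D n)))))"
      unfolding char_def by (subst integral_distr) auto
    also have "\<dots> = (\<Sum>k\<in>set_pmf (D n). pmf (D n) k *\<^sub>R iexp (x * ((real k - pmf_mean (D n)) / sqrt (pmf_var (D n)))))"
      by (rule integral_measure_pmf[OF fin])
    also have "\<dots> = pmf_std_char (D n) x"
      unfolding pmf_std_char_def pmf_mgf_def sum_distrib_left
      by (intro sum.cong refl)
         (auto simp: scaleR_conv_of_real algebra_simps diff_divide_distrib simp flip: exp_add)
    finally show ?thesis .
  qed
  then show "(\<lambda>n. char (distr (measure_pmf (D n)) borel (\<lambda>k. (real k - pmf_mean (D n)) / sqrt (pmf_var (D n)))) x)
      \<longlonglongrightarrow> char std_normal_distribution x"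
    unfolding char_std_normal_distribution using std_char_tendsto[of x] by (simp only:)
qed

text \<open>The integrand that remains when the two inversion formulas, for the lattice distribution and for the
  Gaussian density, are subtracted.\<close>

definition char_gap :: "nat \<Rightarrow> real \<Rightarrow> complex" where
  "char_gap n x = indicator {- pi * sqrt (pmf_var (D n))..pi * sqrt (pmf_var (D n))} x *\<^sub>R pmf_std_char (D n) x
     - of_real (exp (- x\<^sup>2 / 2))"

lemma char_gap_measurable[measurable]: "char_gap n \<in> borel_measurable lborel"
  unfolding char_gap_def pmf_std_char_def pmf_mgf_def by measurable

lemma char_gap_tendsto: "(\<lambda>n. char_gap n x) \<longlonglongrightarrow> 0"
proof -
  have "filterlim (\<lambda>n. pi * sqrt (pmf_var (D n))) at_top sequentially"
    by (rule filterlim_tendsto_pos_mult_at_top[OF tendsto_const _ sd_at_top]) auto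
  then have "\<forall>\<^sub>F n in sequentially. \<bar>x\<bar> \<le> pi * sqrt (pmf_var (D n))"
    by (simp add: filterlim_at_top)
  then have ev: "\<forall>\<^sub>F n in sequentially. pmf_std_char (D n) x - of_real (exp (- x\<^sup>2 / 2)) = char_gap n x"
    by eventually_elim (simp add: char_gap_def indicator_def abs_le_iff)
  have "(\<lambda>n. pmf_std_char (D n) x - of_real (exp (- x\<^sup>2 / 2))) \<longlonglongrightarrow> 0"
    by (rule LIM_zero[OF std_char_tendsto])
  then show ?thesis using ev by (rule Lim_transform_eventually)
qed

text \<open>The variance grows linearly, so the Gaussian bound in \<open>\<theta>\<close> becomes one with a fixed
  exponent after standardization. This allows dominated convergence.\<close>

lemma char_gap_dominated:
  obtains w where "integrable lborel w" "\<forall>\<^sub>F n in sequentially. \<forall>x. norm (char_gap n x) \<le> w x"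
proof -
  obtain K' c where K': "0 < c" "0 \<le> K'" "\<And>n \<theta>. \<bar>\<theta>\<bar> \<le> pi \<Longrightarrow>
    norm (pmf_mgf (D n) (\<i> * of_real \<theta>)) \<le> K' * exp (- c * n * \<theta>\<^sup>2)"
    using gaussian_domination by blast
  define c1 where "c1 = c / (2 * \<sigma>2)"
  have c1: "0 < c1" using K' \<sigma>2 by (simp add: c1_def)
  show ?thesis
  proof (rule that[of "\<lambda>x. K' * exp (- c1 * x\<^sup>2) + exp (- (1/2) * x\<^sup>2)"])
    show "integrable lborel (\<lambda>x. K' * exp (- c1 * x\<^sup>2) + exp (- (1/2) * x\<^sup>2))"
      using integrable_gaussian[OF c1] integrable_gaussian[of "1/2"] by auto
    show "\<forall>\<^sub>F n in sequentially. \<forall>x. norm (char_gap n x) \<le> K' * exp (- c1 * x\<^sup>2) + exp (- (1/2) * x\<^sup>2)"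
      using eventually_var
    proof eventually_elim
      case (elim n)
      define \<sigma> where "\<sigma> = sqrt (pmf_var (D n))"
      have v: "0 < pmf_var (D n)" using elim \<sigma>2 by (smt (verit) mult_nonneg_nonneg of_nat_0_le_iff half_gt_zero)
      then have \<sigma>: "0 < \<sigma>" "\<sigma>\<^sup>2 = pmf_var (D n)" by (auto simp: \<sigma>_def)
      show ?case
      proof
        fix x
        have "norm (indicator {- pi * \<sigma>..pi * \<sigma>} x *\<^sub>R pmf_std_char (D n) x) \<le> K' * exp (- c1 * x\<^sup>2)"
        proof (cases "x \<in> {- pi * \<sigma>..pi * \<sigma>}")
          case True
          then have "\<bar>x / \<sigma>\<bar> \<le> pi" using \<sigma> by (auto simp: abs_le_iff field_simps)
          from K'(3)[OF this, of n]
          have "norm (pmf_std_char (D n) x) \<le> K' * exp (- c * n * (x / \<sigma>)\<^sup>2)"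
            by (simp add: pmf_std_char_def norm_mult \<sigma>_def)
          also have "\<dots> \<le> K' * exp (- c1 * x\<^sup>2)"
          proof (rule mult_left_mono)
            have "1 / (2 * \<sigma>2) \<le> n / \<sigma>\<^sup>2" using elim v \<sigma>2 unfolding \<sigma>(2) by (simp add: field_simps)
            then have "c * x\<^sup>2 * (1 / (2 * \<sigma>2)) \<le> c * x\<^sup>2 * (n / \<sigma>\<^sup>2)"
              using K' by (intro mult_left_mono) auto
            then show "exp (- c * n * (x / \<sigma>)\<^sup>2) \<le> exp (- c1 * x\<^sup>2)"
              by (simp add: c1_def power_divide mult_ac)
          qed (use K' in auto)
          finally show ?thesis using True by simp
        qed (use K' in auto)
        moreover have "norm (complex_of_real (exp (- x\<^sup>2 / 2))) = exp (- (1/2) * x\<^sup>2)" by simp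
        ultimately show "norm (char_gap n x) \<le> K' * exp (- c1 * x\<^sup>2) + exp (- (1/2) * x\<^sup>2)"
          unfolding char_gap_def \<sigma>_def[symmetric] by (smt (verit) norm_triangle_ineq4)
      qed
    qed
  qed
qed

lemma char_gap_integral_tendsto:
  "(\<lambda>n. LINT x|lborel. norm (char_gap n x)) \<longlonglongrightarrow> 0" "\<forall>\<^sub>F n in sequentially. integrable lborel (char_gap n)"
proof -
  obtain w where w: "integrable lborel w" "\<forall>\<^sub>F n in sequentially. \<forall>x. norm (char_gap n x) \<le> w x"
    by (rule char_gap_dominated)
  then obtain N where N: "\<And>n x. n \<ge> N \<Longrightarrow> norm (char_gap n x) \<le> w x"
    by (auto simp: eventually_sequentially)
  have "(\<lambda>n. LINT x|lborel. norm (char_gap (n + N) x)) \<longlonglongrightarrow> (LINT (x::real)|lborel. 0 :: real)"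
  proof (rule Bochner_Integration.integral_dominated_convergence[where f = "\<lambda>_. 0" and w = w
        and s = "\<lambda>n x. norm (char_gap (n + N) x)" and M = lborel])
    show "AE x in lborel. (\<lambda>n. norm (char_gap (n + N) x)) \<longlonglongrightarrow> 0"
      by (intro AE_I2 tendsto_norm_zero LIMSEQ_ignore_initial_segment char_gap_tendsto)
    show "AE x in lborel. norm (norm (char_gap (n + N) x)) \<le> w x" for n
      using N[of "n + N"] by simp
  qed (use w in auto)
  then show "(\<lambda>n. LINT x|lborel. norm (char_gap n x)) \<longlonglongrightarrow> 0"
    using LIMSEQ_offset[of "\<lambda>n. LINT x|lborel. norm (char_gap n x)" N] by simp
  show "\<forall>\<^sub>F n in sequentially. integrable lborel (char_gap n)"
    using w(2)
  proof eventually_elim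
    case (elim n)
    have "norm (char_gap n x) \<le> norm (w x)" for x
      using elim by (rule allE[of _ x]) simp
    then show ?case by (intro Bochner_Integration.integrable_bound[OF w(1)] AE_I2) simp_all
  qed
qed

text \<open>The supremum over all arguments is bounded by the integral of the modulus of \<open>char_gap\<close>,
  which does not depend on the argument, plus the error of rounding.\<close>

theorem local_limit:
  "(\<lambda>n. SUP x::real. \<bar>sqrt (pmf_var (D n)) *
       measure_pmf.prob (D n) {k. int k = \<lfloor>pmf_mean (D n) + x * sqrt (pmf_var (D n))\<rfloor>}
     - 1 / sqrt (2 * pi) * exp (- x\<^sup>2 / 2)\<bar>) \<longlonglongrightarrow> 0"
proof -
  define I where "I n = (LINT x|lborel. norm (char_gap n x))" for n
  have "\<forall>\<^sub>F n in sequentially. 0 < pmf_var (D n)"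
    using eventually_var by eventually_elim (smt (verit) \<sigma>2 mult_nonneg_nonneg of_nat_0_le_iff half_gt_zero)
  with char_gap_integral_tendsto(2)
  have bound: "\<forall>\<^sub>F n in sequentially. \<forall>x. \<bar>sqrt (pmf_var (D n)) *
       measure_pmf.prob (D n) {k. int k = \<lfloor>pmf_mean (D n) + x * sqrt (pmf_var (D n))\<rfloor>}
     - 1 / sqrt (2 * pi) * exp (- x\<^sup>2 / 2)\<bar> \<le> I n / (2 * pi) + 1 / sqrt (pmf_var (D n))"
  proof eventually_elim
    case (elim n)
    define \<sigma> m where "\<sigma> = sqrt (pmf_var (D n))" and "m = pmf_mean (D n)"
    have \<sigma>: "0 < \<sigma>" using elim by (simp add: \<sigma>_def)
    show ?case
    proof
      fix x :: real
      define j where "j = \<lfloor>m + x * \<sigma>\<rfloor>"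
      define z where "z = (of_int j - m) / \<sigma>"
      have xz: "\<bar>z - x\<bar> \<le> 1 / \<sigma>"
      proof -
        have "z - x = (of_int j - (m + x * \<sigma>)) / \<sigma>" using \<sigma> by (simp add: z_def field_simps)
        moreover have "\<bar>of_int j - (m + x * \<sigma>)\<bar> \<le> 1" unfolding j_def by linarith
        ultimately show ?thesis using \<sigma> by (simp add: divide_right_mono)
      qed
      have "has_bochner_integral lborel (\<lambda>x. char_gap n x * iexp (- (z * x)))
        (of_real (2 * pi * \<sigma> * measure_pmf.prob (D n) {k. int k = j})
         - of_real (2 * pi * (1 / sqrt (2 * pi) * exp (- z\<^sup>2 / 2))))"
      proof (rule has_bochner_integral_cong[THEN iffD1,
            OF refl _ refl has_bochner_integral_diff[OF pmf_inversion[OF fin \<sigma>, of n j] gaussian_inversion]])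
        fix x
        have e: "iexp (- (z * x)) * iexp (- (x * m / \<sigma>)) = iexp (- (of_int j * (x / \<sigma>)))"
          unfolding exp_add[symmetric]
          by (rule arg_cong[of _ _ exp]) (simp add: z_def diff_divide_distrib algebra_simps)
        show "indicator {- pi * \<sigma>..pi * \<sigma>} x *\<^sub>R (pmf_mgf (D n) (\<i> * of_real (x / \<sigma>)) * iexp (- (of_int j * (x / \<sigma>))))
            - complex_of_real (exp (- x\<^sup>2 / 2)) * iexp (- (z * x))
            = char_gap n x * iexp (- (z * x))"
          unfolding char_gap_def pmf_std_char_def \<sigma>_def[symmetric] m_def[symmetric] e[symmetric]
          by (simp add: algebra_simps)
      qed
      then have "norm (complex_of_real (2 * pi * \<sigma> * measure_pmf.prob (D n) {k. int k = j})
         - of_real (2 * pi * (1 / sqrt (2 * pi) * exp (- z\<^sup>2 / 2)))) \<le> I n"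
        using integral_norm_bound[of lborel "\<lambda>x. char_gap n x * iexp (- (z * x))"]
        unfolding I_def has_bochner_integral_iff by (simp add: norm_mult)
      then have "\<bar>2 * pi * (\<sigma> * measure_pmf.prob (D n) {k. int k = j} - 1 / sqrt (2 * pi) * exp (- z\<^sup>2 / 2))\<bar> \<le> I n"
        unfolding of_real_diff[symmetric] norm_of_real right_diff_distrib by (simp only: mult.assoc)
      then have "\<bar>\<sigma> * measure_pmf.prob (D n) {k. int k = j} - 1 / sqrt (2 * pi) * exp (- z\<^sup>2 / 2)\<bar> \<le> I n / (2 * pi)"
        by (simp add: abs_mult pos_le_divide_eq mult.commute)
      with gaussian_lipschitz[of z x] xz
      show "\<bar>sqrt (pmf_var (D n)) *
         measure_pmf.prob (D n) {k. int k = \<lfloor>pmf_mean (D n) + x * sqrt (pmf_var (D n))\<rfloor>}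
         - 1 / sqrt (2 * pi) * exp (- x\<^sup>2 / 2)\<bar> \<le> I n / (2 * pi) + 1 / sqrt (pmf_var (D n))"
        unfolding \<sigma>_def[symmetric] m_def[symmetric] j_def[symmetric] by linarith
    qed
  qed
  have "(\<lambda>n. I n / (2 * pi) + 1 / sqrt (pmf_var (D n))) \<longlonglongrightarrow> 0 / (2 * pi) + 0"
    unfolding I_def by (intro tendsto_intros char_gap_integral_tendsto sd_inverse_0) auto
  then have lim: "(\<lambda>n. I n / (2 * pi) + 1 / sqrt (pmf_var (D n))) \<longlonglongrightarrow> 0" by simp
  show ?thesis
  proof (rule tendsto_sandwich[OF _ _ tendsto_const lim])
    show "\<forall>\<^sub>F n in sequentially. (SUP x::real. \<bar>sqrt (pmf_var (D n)) *
       measure_pmf.prob (D n) {k. int k = \<lfloor>pmf_mean (D n) + x * sqrt (pmf_var (D n))\<rfloor>}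
     - 1 / sqrt (2 * pi) * exp (- x\<^sup>2 / 2)\<bar>) \<le> I n / (2 * pi) + 1 / sqrt (pmf_var (D n))"
      using bound
    proof eventually_elim
      case (elim n)
      show ?case by (rule cSUP_least) (use elim in blast)+
    qed
    show "\<forall>\<^sub>F n in sequentially. 0 \<le> (SUP x::real. \<bar>sqrt (pmf_var (D n)) *
       measure_pmf.prob (D n) {k. int k = \<lfloor>pmf_mean (D n) + x * sqrt (pmf_var (D n))\<rfloor>}
     - 1 / sqrt (2 * pi) * exp (- x\<^sup>2 / 2)\<bar>)"
      using bound
    proof eventually_elim
      case (elim n)
      show ?case
      proof (rule cSUP_upper2[where x = 0])
        show "bdd_above (range (\<lambda>x::real. \<bar>sqrt (pmf_var (D n)) *
           measure_pmf.prob (D n) {k. int k = \<lfloor>pmf_mean (D n) + x * sqrt (pmf_var (D n))\<rfloor>}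
           - 1 / sqrt (2 * pi) * exp (- x\<^sup>2 / 2)\<bar>))"
          using elim by (intro bdd_aboveI2) blast
      qed (simp_all only: abs_ge_zero UNIV_I)
    qed
  qed
qed

end

section \<open>Canonical trees and their profiles\<close>

fun chain :: "nat \<Rightarrow> nat \<Rightarrow> nat list \<Rightarrow> bool" where
  "chain t m [] \<longleftrightarrow> True"
| "chain t m (r # rs) \<longleftrightarrow> 1 \<le> r \<and> r \<le> m \<and> chain t (t * r) rs"

text \<open>The numbers of internal vertices on the successive levels of a canonical tree with \<open>n\<close>
  internal vertices. The predicate \<open>chain t m\<close> describes the profiles of forests whose roots
  number \<open>m\<close>: at most \<open>m\<close> of them are internal, and the next level then has
  \<open>t\<close> times as many vertices.\<close>

definition profiles :: "nat \<Rightarrow> nat \<Rightarrow> nat list set" where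
  "profiles t n = {rs. chain t 1 rs \<and> sum_list rs = n}"

abbreviation leaf :: plane_tree where "leaf \<equiv> Node []"

definition level :: "plane_tree list \<Rightarrow> nat \<Rightarrow> plane_tree list" where
  "level ts k = concat (map (\<lambda>T. vertices T k) ts)"

abbreviation offspring :: "plane_tree list \<Rightarrow> plane_tree list" where
  "offspring ts \<equiv> concat (map children ts)"

lemma level_0 [simp]: "level ts 0 = ts"
  unfolding level_def by (induction ts) auto

lemma level_Suc: "level ts (Suc k) = level (offspring ts) k"
proof (induction ts)
  case (Cons T ts)
  then show ?case by (cases T) (simp add: level_def)
qed (simp add: level_def)

lemma level_Nil [simp]: "level [] k = []"
  by (simp add: level_def)

lemma vertices_eq_level: "vertices T k = level [T] k"
  by (simp add: level_def)

text \<open>Induction over the levels leads from trees to forests, because removing the root of a tree leaves its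
  children.\<close>

definition canonical_forest :: "nat \<Rightarrow> plane_tree list \<Rightarrow> bool" where
  "canonical_forest t ts \<longleftrightarrow>
     (\<forall>k. \<forall>v \<in> set (level ts k). length (children v) \<in> {0, t}) \<and>
     (\<forall>k. sorted (map (\<lambda>v. length (children v)) (level ts k)))"

lemma canonical_iff_forest: "canonical t T \<longleftrightarrow> canonical_forest t [T]"
  by (simp add: canonical_def canonical_forest_def vertices_eq_level)

lemma canonical_forest_unfold:
  "canonical_forest t ts \<longleftrightarrow> (\<forall>v \<in> set ts. length (children v) \<in> {0, t}) \<and>
     sorted (map (\<lambda>v. length (children v)) ts) \<and> canonical_forest t (offspring ts)"
  (is "?l \<longleftrightarrow> ?r")
proof
  assume l: ?l
  show ?r
    unfolding canonical_forest_def[of t "offspring ts"] level_Suc[symmetric]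
    using l[unfolded canonical_forest_def] level_0[of ts] by metis
next
  assume r: ?r
  have "(\<forall>v \<in> set (level ts k). length (children v) \<in> {0, t}) \<and>
      sorted (map (\<lambda>v. length (children v)) (level ts k))" for k
    using r by (cases k) (simp_all add: level_Suc canonical_forest_def[of t "offspring ts"])
  then show ?l unfolding canonical_forest_def by blast
qed

lemma canonical_forest_Nil [simp]: "canonical_forest t []"
  by (simp add: canonical_forest_def)

fun chunks :: "nat \<Rightarrow> nat \<Rightarrow> 'a list \<Rightarrow> 'a list list" where
  "chunks t 0 xs = []"
| "chunks t (Suc r) xs = take t xs # chunks t r (drop t xs)"

lemma length_chunks [simp]: "length (chunks t r xs) = r"
  by (induction r arbitrary: xs) auto

lemma concat_chunks: "length xs = t * r \<Longrightarrow> concat (chunks t r xs) = xs"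
  by (induction r arbitrary: xs) auto

lemma length_in_chunks: "length xs = t * r \<Longrightarrow> ys \<in> set (chunks t r xs) \<Longrightarrow> length ys = t"
proof (induction r arbitrary: xs)
  case (Suc r)
  then show ?case using Suc.IH[of "drop t xs"] by auto
qed simp

lemma chunks_concat: "(\<And>ys. ys \<in> set yss \<Longrightarrow> length ys = t) \<Longrightarrow> chunks t (length yss) (concat yss) = yss"
  by (induction yss) auto

text \<open>The canonical forest with a given profile: on every level the leaves come first.\<close>

fun forest :: "nat \<Rightarrow> nat \<Rightarrow> nat list \<Rightarrow> plane_tree list" where
  "forest t m [] = replicate m leaf"
| "forest t m (r # rs) = replicate (m - r) leaf @ map Node (chunks t r (forest t (t * r) rs))"

lemma length_forest [simp]: "chain t m rs \<Longrightarrow> length (forest t m rs) = m"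
  by (cases rs) auto

lemma offspring_forest_Nil [simp]: "offspring (forest t m []) = []"
  by simp

lemma offspring_forest_Cons [simp]:
  "chain t m (r # rs) \<Longrightarrow> offspring (forest t m (r # rs)) = forest t (t * r) rs"
  by (simp add: o_def concat_chunks)

lemma canonical_forest_forest: "chain t m rs \<Longrightarrow> canonical_forest t (forest t m rs)"
proof (induction rs arbitrary: m)
  case Nil
  show ?case
    by (subst canonical_forest_unfold) (simp add: sorted_replicate)
next
  case (Cons r rs)
  then have c: "chain t (t * r) rs" by simp
  have len: "length ys = t" if "ys \<in> set (chunks t r (forest t (t * r) rs))" for ys
    using length_in_chunks[OF length_forest[OF c] that] .
  then have "map length (chunks t r (forest t (t * r) rs)) = replicate r t"
    by (intro replicate_eqI) auto
  then have "sorted (map (\<lambda>v. length (children v)) (forest t m (r # rs)))"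
    by (auto simp: sorted_append o_def)
  moreover have "\<forall>v \<in> set (forest t m (r # rs)). length (children v) \<in> {0, t}"
    using len by auto
  moreover have "canonical_forest t (offspring (forest t m (r # rs)))"
    unfolding offspring_forest_Cons[OF Cons.prems] by (rule Cons.IH[OF c])
  ultimately show ?case
    by (subst canonical_forest_unfold) blast
qed

lemma num_internal_alt: "num_internal T = (if children T = [] then 0 else 1) + sum_list (map num_internal (children T))"
  by (cases T) simp

lemma sum_num_internal_offspring:
  "sum_list (map num_internal ts) = length (filter (\<lambda>T. children T \<noteq> []) ts) + sum_list (map num_internal (offspring ts))"
proof (induction ts)
  case (Cons T ts)
  then show ?case by (simp add: num_internal_alt[of T])
qed simp

lemma internal_forest:
  assumes "0 < t" "chain t m (r # rs)"
  shows "length (filter (\<lambda>T. children T \<noteq> []) (forest t m (r # rs))) = r"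
proof -
  have c: "chain t (t * r) rs" using assms by simp
  have "ys \<noteq> []" if "ys \<in> set (chunks t r (forest t (t * r) rs))" for ys
    using length_in_chunks[OF length_forest[OF c] that] assms by auto
  then have "filter (\<lambda>ys. ys \<noteq> []) (chunks t r (forest t (t * r) rs)) = chunks t r (forest t (t * r) rs)"
    by (simp add: filter_id_conv)
  then show ?thesis by (simp add: filter_map o_def)
qed

lemma sum_num_internal_forest:
  assumes "0 < t" shows "chain t m rs \<Longrightarrow> sum_list (map num_internal (forest t m rs)) = sum_list rs"
proof (induction rs arbitrary: m)
  case (Cons r rs)
  then show ?case
    by (subst sum_num_internal_offspring)
       (simp add: internal_forest[OF assms] del: forest.simps)
qed (simp add: sum_list_replicate)

lemma forest_inj:
  assumes "0 < t"
  shows "chain t m rs \<Longrightarrow> chain t m rs' \<Longrightarrow> forest t m rs = forest t m rs' \<Longrightarrow> rs = rs'"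
proof (induction rs arbitrary: m rs')
  case Nil
  show ?case
  proof (cases rs')
    case (Cons r s)
    with Nil have "length (filter (\<lambda>T. children T \<noteq> []) (forest t m [])) = r" "1 \<le> r"
      using internal_forest[OF assms, of m r s] by auto
    then show ?thesis by simp
  qed simp
next
  case (Cons r rs)
  show ?case
  proof (cases rs')
    case Nil
    with Cons have "length (filter (\<lambda>T. children T \<noteq> []) (forest t m [])) = r" "1 \<le> r"
      using internal_forest[OF assms, of m r rs] by auto
    then show ?thesis by simp
  next
    case [simp]: (Cons r' s)
    have "r = r'"
      using Cons.prems(3) internal_forest[OF assms Cons.prems(1)]
        internal_forest[OF assms Cons.prems(2)[unfolded \<open>rs' = r' # s\<close>]] by simp
    moreover have "forest t (t * r) rs = forest t (t * r') s"
      using arg_cong[OF Cons.prems(3), of offspring] offspring_forest_Cons[OF Cons.prems(1)]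
        offspring_forest_Cons[OF Cons.prems(2)[unfolded \<open>rs' = r' # s\<close>]] by simp
    ultimately show ?thesis using Cons.IH[of "t * r" s] Cons.prems by auto
  qed
qed

lemma sorted_lengths_split:
  assumes "0 < t" "\<forall>v \<in> set ts. length (children v) \<in> {0, t}" "sorted (map (\<lambda>v. length (children v)) ts)"
  obtains us where "ts = replicate (length ts - length us) leaf @ us" "\<forall>v \<in> set us. length (children v) = t"
    "length us \<le> length ts"
proof -
  have "\<exists>us. ts = replicate (length ts - length us) leaf @ us \<and> (\<forall>v \<in> set us. length (children v) = t) \<and> length us \<le> length ts"
    using assms(2,3)
  proof (induction ts)
    case (Cons T ts)
    show ?case
    proof (cases "children T = []")
      case True
      then have T: "T = leaf" by (cases T) auto
      obtain us where us: "ts = replicate (length ts - length us) leaf @ us" "\<forall>v \<in> set us. length (children v) = t"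
        "length us \<le> length ts"
        using Cons by auto
      have "T # ts = replicate (length (T # ts) - length us) leaf @ us"
        using us T by (simp add: Suc_diff_le)
      with us show ?thesis by (intro exI[of _ us]) auto
    next
      case False
      then have "\<forall>v \<in> set (T # ts). length (children v) = t"
        using Cons.prems assms(1) by fastforce
      then show ?thesis by (intro exI[of _ "T # ts"]) auto
    qed
  qed auto
  with that show ?thesis by blast
qed

text \<open>Sortedness of a level forces its leaves to the left, so the number of internal vertices determines where
  they are, and the rest follows by induction on the profile of the next level.\<close>

lemma forest_surj:
  assumes "0 < t"
  shows "canonical_forest t ts \<Longrightarrow> \<exists>rs. chain t (length ts) rs \<and> ts = forest t (length ts) rs"
proof (induction "sum_list (map num_internal ts)" arbitrary: ts rule: less_induct)
  case less
  obtain us where us: "ts = replicate (length ts - length us) leaf @ us" "\<forall>v \<in> set us. length (children v) = t"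
    "length us \<le> length ts"
    using sorted_lengths_split[OF assms] less.prems[THEN canonical_forest_unfold[THEN iffD1]] by blast
  show ?case
  proof (cases "us = []")
    case True
    then show ?thesis using us(1) by (intro exI[of _ "[]"]) auto
  next
    case False
    define r where "r = length us"
    have off: "offspring ts = concat (map children us)"
      by (subst us(1)) simp
    have len: "length (offspring ts) = t * r"
      unfolding off r_def using us(2) by (induction us) auto
    have "filter (\<lambda>T. children T \<noteq> []) us = us"
      using us(2) assms by (auto simp: filter_id_conv)
    then have "length (filter (\<lambda>T. children T \<noteq> []) ts) = r"
      by (subst us(1)) (simp add: r_def)
    then have "sum_list (map num_internal (offspring ts)) < sum_list (map num_internal ts)"
      using sum_num_internal_offspring[of ts] False by (simp add: r_def)
    moreover have "canonical_forest t (offspring ts)"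
      using less.prems canonical_forest_unfold by blast
    ultimately obtain rs where rs: "chain t (t * r) rs" "offspring ts = forest t (t * r) rs"
      using less.hyps[of "offspring ts"] len by auto
    have "chunks t r (offspring ts) = map children us"
      unfolding off r_def using chunks_concat[of "map children us" t] us(2) by auto
    then have "us = map Node (chunks t r (forest t (t * r) rs))"
      by (simp add: rs(2)[symmetric] o_def)
    then have "ts = forest t (length ts) (r # rs)"
      using us(1) unfolding forest.simps r_def by metis
    moreover have "chain t (length ts) (r # rs)"
      using rs us(3) False by (simp add: r_def Suc_le_eq)
    ultimately show ?thesis by blast
  qed
qed

lemma leaf_levels_forest:
  assumes "0 < t"
  shows "chain t m rs \<Longrightarrow> 0 < m \<Longrightarrow>
    (\<exists>v \<in> set (level (forest t m rs) (length rs)). is_leaf v) \<and>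
    (\<forall>k. (\<exists>v \<in> set (level (forest t m rs) k). is_leaf v) \<longrightarrow> k \<le> length rs)"
proof (induction rs arbitrary: m)
  case Nil
  have "level (forest t m []) (Suc k) = []" for k
    unfolding level_Suc by simp
  then have "k = 0" if "\<exists>v \<in> set (level (forest t m []) k). is_leaf v" for k
    using that by (cases k) auto
  with Nil show ?case by (auto simp: is_leaf_def)
next
  case (Cons r rs)
  have IH: "(\<exists>v \<in> set (level (forest t (t * r) rs) (length rs)). is_leaf v) \<and>
    (\<forall>k. (\<exists>v \<in> set (level (forest t (t * r) rs) k). is_leaf v) \<longrightarrow> k \<le> length rs)"
    using Cons assms by (intro Cons.IH) auto
  have lev: "level (forest t m (r # rs)) (Suc k) = level (forest t (t * r) rs) k" for k
    unfolding level_Suc offspring_forest_Cons[OF Cons.prems(1)] ..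
  show ?case
  proof (intro conjI allI impI)
    fix k assume k: "\<exists>v \<in> set (level (forest t m (r # rs)) k). is_leaf v"
    show "k \<le> length (r # rs)"
    proof (cases k)
      case (Suc k')
      then show ?thesis using k IH lev by auto
    qed simp
  qed (use IH lev in auto)
qed

definition tree_of_profile :: "nat \<Rightarrow> nat list \<Rightarrow> plane_tree" where
  "tree_of_profile t rs = hd (forest t 1 rs)"

lemma forest_1: "chain t 1 rs \<Longrightarrow> forest t 1 rs = [tree_of_profile t rs]"
proof -
  assume "chain t 1 rs"
  then have "length (forest t 1 rs) = 1" by (rule length_forest)
  then show ?thesis unfolding tree_of_profile_def
    by (metis One_nat_def length_0_conv length_Suc_conv list.sel(1))
qed

lemma tree_height_of_profile:
  assumes "0 < t" "chain t 1 rs"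
  shows "tree_height (tree_of_profile t rs) = length rs"
proof -
  define K where "K = {k. \<exists>v \<in> set (level (forest t 1 rs) k). is_leaf v}"
  have K: "length rs \<in> K" "\<And>k. k \<in> K \<Longrightarrow> k \<le> length rs"
    using leaf_levels_forest[OF assms] by (auto simp: K_def)
  then have "finite K" by (intro finite_subset[of K "{..length rs}"]) auto
  with K have "Max K = length rs" by (intro Max_eqI) auto
  then show ?thesis
    unfolding tree_height_def vertices_eq_level K_def forest_1[OF assms(2)] .
qed

lemma bij_betw_tree_of_profile:
  assumes "0 < t"
  shows "bij_betw (tree_of_profile t) (profiles t n) {T. canonical t T \<and> num_internal T = n}"
  unfolding bij_betw_def
proof
  show "inj_on (tree_of_profile t) (profiles t n)"
  proof (rule inj_onI)
    fix rs rs' assume "rs \<in> profiles t n" "rs' \<in> profiles t n" and eq: "tree_of_profile t rs = tree_of_profile t rs'"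
    then have "chain t 1 rs" "chain t 1 rs'" by (auto simp: profiles_def)
    with eq show "rs = rs'" by (intro forest_inj[OF assms, of 1]) (simp_all only: forest_1)
  qed
  show "tree_of_profile t ` profiles t n = {T. canonical t T \<and> num_internal T = n}"
  proof (intro set_eqI iffI)
    fix T assume "T \<in> tree_of_profile t ` profiles t n"
    then obtain rs where rs: "chain t 1 rs" "sum_list rs = n" "T = tree_of_profile t rs"
      by (auto simp: profiles_def)
    then show "T \<in> {T. canonical t T \<and> num_internal T = n}"
      using canonical_forest_forest[OF rs(1)] sum_num_internal_forest[OF assms rs(1)]
      unfolding forest_1[OF rs(1)] by (simp add: canonical_iff_forest)
  next
    fix T assume "T \<in> {T. canonical t T \<and> num_internal T = n}"
    then have T: "canonical_forest t [T]" "num_internal T = n" by (auto simp: canonical_iff_forest)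
    obtain rs where rs: "chain t 1 rs" "[T] = forest t 1 rs"
      using forest_surj[OF assms T(1)] by auto
    then have "T = tree_of_profile t rs" "sum_list rs = n"
      using forest_1[OF rs(1)] sum_num_internal_forest[OF assms rs(1)] T(2) by auto
    with rs(1) show "T \<in> tree_of_profile t ` profiles t n" by (auto simp: profiles_def)
  qed
qed

lemma chain_pos: "chain t m rs \<Longrightarrow> r \<in> set rs \<Longrightarrow> 1 \<le> r"
  by (induction rs arbitrary: m) auto

lemma chain_length_le: "chain t m rs \<Longrightarrow> length rs \<le> sum_list rs"
  by (induction rs arbitrary: m) force+

lemma finite_profiles: "finite (profiles t n)"
proof (rule finite_subset)
  show "profiles t n \<subseteq> {rs. set rs \<subseteq> {..n} \<and> length rs \<le> n}"
    using chain_length_le member_le_sum_list by (fastforce simp: profiles_def)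
  show "finite {rs :: nat list. set rs \<subseteq> {..n} \<and> length rs \<le> n}"
    by (rule finite_lists_length_le) simp
qed

lemma profiles_nonempty: assumes "0 < t" shows "profiles t n \<noteq> {}"
proof -
  have "chain t m (replicate n 1)" if "0 < m" for m
    using that assms by (induction n arbitrary: m) auto
  then have "replicate n 1 \<in> profiles t n" by (simp add: profiles_def sum_list_replicate)
  then show ?thesis by blast
qed

definition height_pmf :: "nat \<Rightarrow> nat \<Rightarrow> nat pmf" where
  "height_pmf t n = map_pmf length (pmf_of_set (profiles t n))"

lemma random_height:
  assumes "0 < t" shows "map_pmf tree_height (random_tree t n) = height_pmf t n"
proof -
  have "random_tree t n = map_pmf (tree_of_profile t) (pmf_of_set (profiles t n))"
    unfolding random_tree_def
    by (rule map_pmf_of_set_bij_betw[symmetric, OF bij_betw_tree_of_profile[OF assms]])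
       (auto simp: finite_profiles profiles_nonempty assms)
  then have "map_pmf tree_height (random_tree t n) = map_pmf (tree_height \<circ> tree_of_profile t) (pmf_of_set (profiles t n))"
    by (simp add: map_pmf_comp o_def)
  also have "\<dots> = height_pmf t n"
    unfolding height_pmf_def
  proof (rule map_pmf_cong[OF refl])
    fix rs assume "rs \<in> set_pmf (pmf_of_set (profiles t n))"
    then have "chain t 1 rs"
      by (simp add: set_pmf_of_set finite_profiles profiles_nonempty assms) (simp add: profiles_def)
    then show "(tree_height \<circ> tree_of_profile t) rs = length rs"
      by (simp only: o_def tree_height_of_profile[OF assms])
  qed
  finally show ?thesis .
qed

section \<open>Alternating series with rapidly decreasing coefficients\<close>

lemma br_0 [simp]: "br t 0 = 0"
  by (simp add: br_def)

lemma br_Suc: "br t (Suc j) = br t j + t ^ j"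
  by (simp add: br_def)

lemma br_Suc_mult: "br t (Suc j) = 1 + t * br t j"
  by (simp add: br_def sum.lessThan_Suc_shift sum_distrib_left del: sum.lessThan_Suc)

lemma br_ge: "0 < t \<Longrightarrow> j \<le> br t j"
proof (induction j)
  case (Suc j)
  then have "1 \<le> t ^ j" by simp
  with Suc.IH[OF Suc.prems] show ?case unfolding br_Suc by linarith
qed simp

definition geo_ratio :: "nat \<Rightarrow> nat \<Rightarrow> 'a::real_normed_field \<Rightarrow> 'a" where
  "geo_ratio t i q = q ^ br t i / (1 - q ^ br t i)"

definition alt_coeff :: "nat \<Rightarrow> nat \<Rightarrow> 'a::real_normed_field \<Rightarrow> 'a" where
  "alt_coeff t j q = (\<Prod>i = 1..j. geo_ratio t i q)"

lemma alt_coeff_0 [simp]: "alt_coeff t 0 = (\<lambda>_. 1)"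
  by (simp add: alt_coeff_def fun_eq_iff)

lemma alt_coeff_Suc: "alt_coeff t (Suc j) q = alt_coeff t j q * geo_ratio t (Suc j) q"
  by (simp add: alt_coeff_def)

lemma of_real_alt_coeff: "of_real (alt_coeff t j x) = alt_coeff t j (of_real x :: 'a::real_normed_field)"
  by (simp add: alt_coeff_def geo_ratio_def)

lemma power_br_bound:
  fixes x :: real
  assumes "0 < t" "0 \<le> x" "x < 1"
  shows "x ^ br t (Suc j) \<le> x" "x ^ br t (Suc j) \<le> x ^ Suc j" "x ^ br t (Suc j) < 1"
proof -
  have "Suc j \<le> br t (Suc j)" using br_ge[OF assms(1)] .
  then show *: "x ^ br t (Suc j) \<le> x ^ Suc j" using assms by (intro power_decreasing) auto
  have "x ^ Suc j \<le> x ^ 1" using assms by (intro power_decreasing) auto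
  with * show "x ^ br t (Suc j) \<le> x" "x ^ br t (Suc j) < 1" using assms by auto
qed

lemma power_br_neq_1:
  fixes q :: "'a::real_normed_field"
  assumes "0 < t" "norm q < 1"
  shows "q ^ br t (Suc j) \<noteq> 1"
proof
  assume "q ^ br t (Suc j) = 1"
  then have "norm q ^ br t (Suc j) = 1" by (metis norm_one norm_power)
  then show False using power_br_bound(3)[OF assms(1) norm_ge_zero assms(2), of j] by simp
qed

lemma geo_ratio_nonneg:
  fixes x :: real assumes "0 < t" "0 \<le> x" "x < 1" shows "0 \<le> geo_ratio t (Suc j) x"
  using power_br_bound(3)[OF assms, of j] assms by (simp add: geo_ratio_def)

lemma geo_ratio_mono:
  fixes x y :: real assumes "0 < t" "0 \<le> x" "x \<le> y" "y < 1"
  shows "geo_ratio t (Suc j) x \<le> geo_ratio t (Suc j) y"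
  unfolding geo_ratio_def
proof (rule frac_le)
  have le: "x ^ br t (Suc j) \<le> y ^ br t (Suc j)" using assms by (intro power_mono) auto
  then show "x ^ br t (Suc j) \<le> y ^ br t (Suc j)" .
  show "0 < 1 - y ^ br t (Suc j)" using power_br_bound(3)[of t y j] assms by simp
  show "1 - y ^ br t (Suc j) \<le> 1 - x ^ br t (Suc j)" using le by simp
qed (use assms in auto)

lemma geo_ratio_le_power:
  fixes x :: real assumes "0 < t" "0 \<le> x" "x < 1"
  shows "geo_ratio t (Suc j) x \<le> x ^ Suc j / (1 - x)"
  unfolding geo_ratio_def
  by (rule frac_le) (use power_br_bound[OF assms, of j] assms in auto)

lemma norm_geo_ratio_le:
  fixes q :: "'a::real_normed_field"
  assumes "0 < t" "norm q < 1" shows "norm (geo_ratio t (Suc j) q) \<le> geo_ratio t (Suc j) (norm q)"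
  unfolding geo_ratio_def norm_divide norm_power
proof (rule divide_left_mono)
  have b: "norm q ^ br t (Suc j) < 1" using power_br_bound(3)[OF assms(1) norm_ge_zero assms(2)] .
  have "1 - norm (q ^ br t (Suc j)) \<le> norm (1 - q ^ br t (Suc j))"
    by (metis norm_one norm_triangle_ineq2)
  then show *: "1 - norm q ^ br t (Suc j) \<le> norm (1 - q ^ br t (Suc j))" by (simp add: norm_power)
  show "0 < norm (1 - q ^ br t (Suc j)) * (1 - norm q ^ br t (Suc j))" using * b by (intro mult_pos_pos) linarith+
qed auto

lemma alt_coeff_nonneg:
  fixes x :: real assumes "0 < t" "0 \<le> x" "x < 1" shows "0 \<le> alt_coeff t j x"
  by (induction j) (simp_all add: alt_coeff_Suc geo_ratio_nonneg assms)

lemma alt_coeff_mono: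
  fixes x y :: real assumes "0 < t" "0 \<le> x" "x \<le> y" "y < 1" shows "alt_coeff t j x \<le> alt_coeff t j y"
proof (induction j)
  case (Suc j)
  then show ?case unfolding alt_coeff_Suc
    using geo_ratio_nonneg[of t x j] alt_coeff_nonneg[of t y j] geo_ratio_mono[OF assms] assms by (intro mult_mono) auto
qed simp

lemma norm_alt_coeff_le:
  fixes q :: "'a::real_normed_field"
  assumes "0 < t" "norm q < 1" shows "norm (alt_coeff t j q) \<le> alt_coeff t j (norm q)"
proof (induction j)
  case (Suc j)
  then show ?case unfolding alt_coeff_Suc norm_mult
    using norm_geo_ratio_le[OF assms, of j] alt_coeff_nonneg[of t "norm q" j] assms by (intro mult_mono) auto
qed simp

lemma summable_alt_coeff:
  fixes x W :: real
  assumes "0 < t" "0 \<le> x" "x < 1" "0 \<le> W"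
  shows "summable (\<lambda>j. alt_coeff t j x * W ^ j)"
proof -
  have "(\<lambda>j. W * (x ^ Suc j / (1 - x))) \<longlonglongrightarrow> W * (0 / (1 - x))"
    using assms by (intro tendsto_intros LIMSEQ_Suc LIMSEQ_power_zero) auto
  then have "\<forall>\<^sub>F j in sequentially. W * (x ^ Suc j / (1 - x)) < 1 / 2"
    by (intro order_tendstoD(2)) auto
  then obtain J where J: "\<And>j. j \<ge> J \<Longrightarrow> W * (x ^ Suc j / (1 - x)) < 1 / 2"
    by (auto simp: eventually_sequentially)
  show ?thesis
  proof (rule summable_ratio_test[of "1/2" J])
    fix j assume "j \<ge> J"
    have nn: "0 \<le> alt_coeff t j x * W ^ j" using alt_coeff_nonneg[of t x j] assms by simp
    have "W * geo_ratio t (Suc j) x \<le> 1 / 2"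
      using J[OF \<open>j \<ge> J\<close>] mult_left_mono[OF geo_ratio_le_power[of t x j] \<open>0 \<le> W\<close>] assms by linarith
    then have "(alt_coeff t j x * W ^ j) * (W * geo_ratio t (Suc j) x) \<le> (alt_coeff t j x * W ^ j) * (1 / 2)"
      using nn by (rule mult_left_mono)
    moreover have "norm (alt_coeff t (Suc j) x * W ^ Suc j) = (alt_coeff t j x * W ^ j) * (W * geo_ratio t (Suc j) x)"
      using alt_coeff_nonneg[of t x j] geo_ratio_nonneg[of t x j] assms by (simp add: alt_coeff_Suc abs_mult mult_ac)
    ultimately show "norm (alt_coeff t (Suc j) x * W ^ Suc j) \<le> 1 / 2 * norm (alt_coeff t j x * W ^ j)"
      using nn by (simp only: real_norm_def abs_of_nonneg mult.commute)
  qed simp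
qed

lemma geo_ratio_holomorphic: "0 < t \<Longrightarrow> geo_ratio t (Suc i) holomorphic_on ball 0 1"
  unfolding geo_ratio_def using power_br_neq_1[of t] by (intro holomorphic_intros) fastforce

lemma alt_coeff_holomorphic: "0 < t \<Longrightarrow> alt_coeff t j holomorphic_on ball 0 1"
proof (induction j)
  case 0
  show ?case unfolding alt_coeff_0 by (rule holomorphic_on_const)
next
  case (Suc j)
  then show ?case unfolding alt_coeff_Suc by (intro holomorphic_intros geo_ratio_holomorphic) auto
qed

text \<open>The coefficients of both numerator and denominator, and of the denominator multiplied by \<open>1 -
  q\<close>, satisfy this bound; the factor 2 is needed for the last of them.\<close>

definition dominated :: "nat \<Rightarrow> (nat \<Rightarrow> complex \<Rightarrow> complex) \<Rightarrow> bool" where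
  "dominated t u \<longleftrightarrow> 0 < t \<and> (\<forall>j. u j holomorphic_on ball 0 1) \<and>
     (\<forall>j q. norm q < 1 \<longrightarrow> norm (u j q) \<le> 2 * alt_coeff t j (norm q))"

definition wser :: "(nat \<Rightarrow> complex \<Rightarrow> complex) \<Rightarrow> complex \<Rightarrow> complex \<Rightarrow> complex" where
  "wser u q w = (\<Sum>j. (- w) ^ j * u j q)"

lemma dominated_term_bound:
  assumes "dominated t u" "norm q \<le> x" "x < 1" "norm w \<le> W"
  shows "norm ((- w) ^ j * u j q) \<le> 2 * alt_coeff t j x * W ^ j"
proof -
  have "norm (u j q) \<le> 2 * alt_coeff t j (norm q)" using assms unfolding dominated_def by auto
  also have "\<dots> \<le> 2 * alt_coeff t j x"
    using assms unfolding dominated_def by (intro mult_left_mono alt_coeff_mono) auto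
  finally have "norm (u j q) \<le> 2 * alt_coeff t j x" .
  moreover have "norm ((- w) ^ j) \<le> W ^ j" using assms by (simp add: norm_power power_mono)
  ultimately show ?thesis unfolding norm_mult
    by (subst mult.commute) (intro mult_mono, auto intro: order_trans[OF norm_ge_zero])
qed

lemma summable_majorant:
  fixes x W :: real
  assumes "0 < t" "0 \<le> x" "x < 1" "0 \<le> W"
  shows "summable (\<lambda>j. 2 * alt_coeff t j x * W ^ j)"
  using summable_mult[OF summable_alt_coeff[OF assms], of 2] by (simp add: mult.assoc)

lemma wser_summable:
  assumes "dominated t u" "norm q < 1"
  shows "summable (\<lambda>j. norm ((- w) ^ j * u j q))" "summable (\<lambda>j. (- w) ^ j * u j q)"
proof -
  have "summable (\<lambda>j. 2 * alt_coeff t j (norm q) * norm w ^ j)"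
    using assms by (intro summable_majorant) (auto simp: dominated_def)
  then show *: "summable (\<lambda>j. norm ((- w) ^ j * u j q))"
    by (rule summable_comparison_test'[where N = 0]) (use dominated_term_bound[OF assms(1) order_refl assms(2) order_refl] in auto)
  then show "summable (\<lambda>j. (- w) ^ j * u j q)" by (rule summable_norm_cancel)
qed

lemma wser_bound:
  assumes "dominated t u" "norm q \<le> x" "x < 1" "norm w \<le> W"
  shows "norm (wser u q w) \<le> (\<Sum>j. 2 * alt_coeff t j x * W ^ j)"
  unfolding wser_def
  by (rule norm_suminf_le[OF dominated_term_bound[OF assms] summable_majorant])
     (use assms order_trans[OF norm_ge_zero] in \<open>auto simp: dominated_def\<close>)

lemma wser_uniform:
  assumes "dominated t u" "x < 1"
  shows "uniform_limit (cball 0 x \<times> cball 0 W) (\<lambda>n (q, w). \<Sum>j<n. (- w) ^ j * u j q) (\<lambda>(q, w). wser u q w) sequentially"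
proof (cases "0 \<le> x \<and> 0 \<le> W")
  case True
  have "uniform_limit (cball 0 x \<times> cball 0 W) (\<lambda>n p. \<Sum>j<n. (- snd p) ^ j * u j (fst p)) (\<lambda>p. \<Sum>j. (- snd p) ^ j * u j (fst p)) sequentially"
  proof (rule Weierstrass_m_test[where M = "\<lambda>j. 2 * alt_coeff t j x * W ^ j"])
    show "summable (\<lambda>j. 2 * alt_coeff t j x * W ^ j)"
      using True assms by (intro summable_majorant) (auto simp: dominated_def)
  qed (use assms in \<open>auto intro!: dominated_term_bound[OF assms(1)]\<close>)
  then show ?thesis by (simp add: case_prod_unfold wser_def)
next
  case False
  then have empty: "cball (0 :: complex) x \<times> cball (0 :: complex) W = {}" by auto
  show ?thesis unfolding uniform_limit_iff empty by simp
qed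

lemma wser_continuous:
  assumes "dominated t u"
  shows "continuous_on (ball 0 1 \<times> UNIV) (\<lambda>(q, w). wser u q w)"
proof -
  have ub: "continuous_on (ball 0 x \<times> ball 0 W) (\<lambda>(q, w). wser u q w)" if "x < 1" for x W
  proof (rule continuous_on_subset)
    have "continuous_on (cball 0 x) (u j)" for j
      by (rule continuous_on_subset[OF holomorphic_on_imp_continuous_on, of _ "ball 0 1"])
         (use assms that in \<open>auto simp: dominated_def\<close>)
    then have "continuous_on (cball 0 x \<times> cball 0 W) (\<lambda>p. \<Sum>j<n. (- snd p) ^ j * u j (fst p))" for n
      by (intro continuous_intros continuous_on_compose2[of "cball 0 x" "u _" _ fst]) auto
    then show "continuous_on (cball 0 x \<times> cball 0 W) (\<lambda>(q, w). wser u q w)"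
      by (intro uniform_limit_theorem[OF _ wser_uniform[OF assms that]] always_eventually allI)
         (simp_all add: case_prod_unfold)
  qed auto
  show ?thesis
  proof (rule continuous_at_imp_continuous_on, rule ballI)
    fix p :: "complex \<times> complex" assume p: "p \<in> ball 0 1 \<times> UNIV"
    define x where "x = (norm (fst p) + 1) / 2"
    have "x < 1" "p \<in> ball 0 x \<times> ball 0 (norm (snd p) + 1)" using p by (auto simp: x_def)
    with ub[OF this(1), of "norm (snd p) + 1"] show "isCont (\<lambda>(q, w). wser u q w) p"
      by (subst (asm) continuous_on_eq_continuous_at) (auto intro: open_Times)
  qed
qed

text \<open>Analyticity is stated along holomorphic curves, which covers both a fixed \<open>w\<close> and the moving zero.\<close>

lemma wser_compose_derivative:
  assumes dom: "dominated t u" and "open S" and holp: "p holomorphic_on S" and holv: "v holomorphic_on S"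
    and p: "\<And>s. s \<in> S \<Longrightarrow> norm (p s) < 1"
  shows "(\<lambda>s. wser u (p s) (v s)) holomorphic_on S"
    and "s \<in> S \<Longrightarrow> ((\<lambda>j. deriv (\<lambda>s. (- v s) ^ j * u j (p s)) s) sums deriv (\<lambda>s. wser u (p s) (v s)) s)"
proof -
  define h where "h j s = (- v s) ^ j * u j (p s)" for j s
  have "u j holomorphic_on p ` S" for j
    using dom p by (auto simp: dominated_def intro: holomorphic_on_subset[of _ "ball 0 1"])
  then have "(\<lambda>s. u j (p s)) holomorphic_on S" for j
    using holomorphic_on_compose[OF holp, of "u j"] by (simp add: o_def)
  then have holh: "h j holomorphic_on S" for j
    unfolding h_def by (intro holomorphic_intros holv)
  have "\<exists>g g'. \<forall>s \<in> S. ((\<lambda>j. h j s) sums g s) \<and> ((\<lambda>j. deriv (h j) s) sums g' s) \<and> (g has_field_derivative g' s) (at s)"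
  proof (rule series_and_derivative_comparison_local[OF \<open>open S\<close>])
    fix j s assume "s \<in> S"
    then show "(h j has_field_derivative deriv (h j) s) (at s)"
      by (rule holomorphic_derivI[OF holh \<open>open S\<close>])
  next
    fix s assume s: "s \<in> S"
    define x where "x = (norm (p s) + 1) / 2"
    define W where "W = norm (v s) + 1"
    have x: "norm (p s) < x" "x < 1" using p[OF s] by (auto simp: x_def)
    have "isCont p s" "isCont v s"
      using s holp holv \<open>open S\<close> by (meson continuous_on_eq_continuous_at holomorphic_on_imp_continuous_on)+
    then have "(\<lambda>y. norm (p y)) \<midarrow>s\<rightarrow> norm (p s)" "(\<lambda>y. norm (v y)) \<midarrow>s\<rightarrow> norm (v s)"
      by (auto intro: tendsto_norm isContD)
    then have "\<forall>\<^sub>F y in nhds s. norm (p y) < x" "\<forall>\<^sub>F y in nhds s. norm (v y) < W"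
      using x by (auto simp: W_def eventually_nhds_conv_at intro!: order_tendstoD(2))
    then have "\<forall>\<^sub>F y in nhds s. norm (p y) < x \<and> norm (v y) < W" by eventually_elim auto
    then obtain d where d: "d > 0" "\<And>y. dist y s < d \<Longrightarrow> norm (p y) < x \<and> norm (v y) < W"
      by (auto simp: eventually_nhds_metric)
    show "\<exists>d M. 0 < d \<and> summable M \<and> (\<forall>\<^sub>F n in sequentially. \<forall>y\<in>ball s d \<inter> S. norm (h n y) \<le> M n)"
    proof (intro exI conjI always_eventually allI ballI)
      show "summable (\<lambda>j. 2 * alt_coeff t j x * W ^ j)"
        by (rule summable_majorant) (use dom x order_trans[OF norm_ge_zero less_imp_le[OF x(1)]] in \<open>auto simp: dominated_def W_def\<close>)
      fix j y assume "y \<in> ball s d \<inter> S"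
      then have "norm (p y) < x \<and> norm (v y) < W" by (intro d) (auto simp: dist_commute)
      then show "norm (h j y) \<le> 2 * alt_coeff t j x * W ^ j"
        unfolding h_def using x by (intro dominated_term_bound[OF dom]) auto
    qed (use d in auto)
  qed
  then obtain g g' where g: "\<And>s. s \<in> S \<Longrightarrow> (\<lambda>j. h j s) sums g s" "\<And>s. s \<in> S \<Longrightarrow> (\<lambda>j. deriv (h j) s) sums g' s"
      "\<And>s. s \<in> S \<Longrightarrow> (g has_field_derivative g' s) (at s)"
    by blast
  have eq: "g s = wser u (p s) (v s)" if "s \<in> S" for s
    using sums_unique[OF g(1)[OF that]] by (simp add: wser_def h_def)
  have der: "((\<lambda>s. wser u (p s) (v s)) has_field_derivative g' s) (at s)" if "s \<in> S" for s
    by (rule has_field_derivative_transform_within_open[OF g(3)[OF that] \<open>open S\<close> that]) (rule eq)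
  then show "(\<lambda>s. wser u (p s) (v s)) holomorphic_on S"
    using \<open>open S\<close> holomorphic_on_open by blast
  show "s \<in> S \<Longrightarrow> ((\<lambda>j. deriv (\<lambda>s. (- v s) ^ j * u j (p s)) s) sums deriv (\<lambda>s. wser u (p s) (v s)) s)"
    using g(2)[of s] DERIV_imp_deriv[OF der, of s] by (simp add: h_def[abs_def])
qed

definition den :: "nat \<Rightarrow> complex \<Rightarrow> complex \<Rightarrow> complex" where
  "den t = wser (alt_coeff t)"

definition num :: "nat \<Rightarrow> complex \<Rightarrow> complex \<Rightarrow> complex" where
  "num t = wser (\<lambda>j q. alt_coeff t j q * q ^ br t j)"

lemma dominated_den: "0 < t \<Longrightarrow> dominated t (alt_coeff t)"
  unfolding dominated_def
  by (intro conjI allI impI alt_coeff_holomorphic order_trans[OF norm_alt_coeff_le])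
     (simp_all add: alt_coeff_nonneg)

lemma dominated_num: "0 < t \<Longrightarrow> dominated t (\<lambda>j q. alt_coeff t j q * q ^ br t j)"
  unfolding dominated_def
proof (intro conjI allI impI)
  fix j and q :: complex assume "0 < t" "norm q < 1"
  then have "norm (alt_coeff t j q * q ^ br t j) \<le> alt_coeff t j (norm q) * 1"
    unfolding norm_mult norm_power using alt_coeff_nonneg[of t "norm q" j]
    by (intro mult_mono norm_alt_coeff_le) (auto intro: power_le_one)
  then show "norm (alt_coeff t j q * q ^ br t j) \<le> 2 * alt_coeff t j (norm q)"
    using alt_coeff_nonneg[of t "norm q" j] \<open>0 < t\<close> \<open>norm q < 1\<close> by simp
qed (auto intro!: holomorphic_intros alt_coeff_holomorphic)

lemma den_eq: "norm q < 1 \<Longrightarrow> 0 < t \<Longrightarrow> den t q w = 1 - b t q w"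
proof -
  assume q: "norm q < 1" "0 < t"
  have s: "summable (\<lambda>j. (- w) ^ j * alt_coeff t j q)" by (rule wser_summable(2)[OF dominated_den]) (use q in auto)
  have "den t q w = 1 + (\<Sum>j. (- w) ^ Suc j * alt_coeff t (Suc j) q)"
    unfolding den_def wser_def using suminf_split_initial_segment[OF s, of 1] by simp
  also have "(\<Sum>j. (- w) ^ Suc j * alt_coeff t (Suc j) q) = (\<Sum>j. - ((- 1) ^ j * w ^ Suc j * alt_coeff t (Suc j) q))"
    by (intro suminf_cong) (simp add: power_minus[of w] mult_ac)
  also have "\<dots> = - b t q w"
  proof -
    have "summable (\<lambda>j. (- w) ^ Suc j * alt_coeff t (Suc j) q)" using s summable_Suc_iff[of "\<lambda>j. (- w) ^ j * alt_coeff t j q"] by simp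
    also have "(\<lambda>j. (- w) ^ Suc j * alt_coeff t (Suc j) q) = (\<lambda>j. - ((- 1) ^ j * w ^ Suc j * alt_coeff t (Suc j) q))"
      by (rule ext) (simp add: power_minus[of w] mult_ac)
    finally have "summable (\<lambda>j. (- 1) ^ j * w ^ Suc j * alt_coeff t (Suc j) q)" by (simp add: summable_minus_iff)
    from suminf_minus[OF this] show ?thesis unfolding b_def alt_coeff_def geo_ratio_def by simp
  qed
  finally show ?thesis by simp
qed

section \<open>The bivariate generating function of the profiles\<close>

definition chains :: "nat \<Rightarrow> nat \<Rightarrow> nat \<Rightarrow> nat list set" where
  "chains t m k = {rs. chain t m rs \<and> length rs = k}"

lemma chains_0 [simp]: "chains t m 0 = {[]}"
  by (auto simp: chains_def)

lemma chains_Suc: "chains t m (Suc k) = (\<lambda>(r, rs). r # rs) ` (SIGMA r:{1..m}. chains t (t * r) k)"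
  unfolding chains_def by (auto simp: length_Suc_conv image_iff)

lemma finite_chains: "finite (chains t m k)"
  by (induction k arbitrary: m) (auto simp: chains_Suc)

definition level_gf :: "nat \<Rightarrow> nat \<Rightarrow> nat \<Rightarrow> 'a::real_normed_field \<Rightarrow> 'a" where
  "level_gf t m k q = (\<Sum>rs\<in>chains t m k. q ^ sum_list rs)"

lemma level_gf_0 [simp]: "level_gf t m 0 q = 1"
  by (simp add: level_gf_def)

lemma level_gf_Suc: "level_gf t m (Suc k) q = (\<Sum>r=1..m. q ^ r * level_gf t (t * r) k q)"
proof -
  have "level_gf t m (Suc k) q = (\<Sum>p\<in>(SIGMA r:{1..m}. chains t (t * r) k). q ^ sum_list ((\<lambda>(r, rs). r # rs) p))"
    unfolding level_gf_def chains_Suc by (rule sum.reindex_cong[OF _ refl refl]) (auto simp: inj_on_def)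
  also have "\<dots> = (\<Sum>p\<in>(SIGMA r:{1..m}. chains t (t * r) k). q ^ fst p * q ^ sum_list (snd p))"
    by (intro sum.cong refl) (auto simp: power_add)
  also have "\<dots> = (\<Sum>r=1..m. \<Sum>rs\<in>chains t (t * r) k. q ^ r * q ^ sum_list rs)"
    by (subst sum.Sigma) (auto simp: finite_chains case_prod_unfold)
  finally show ?thesis by (simp add: level_gf_def sum_distrib_left)
qed

text \<open>The geometric sum over the size of one level produces a boundary term for each of its two ends; the upper
  one feeds the numerator of the next level.\<close>

lemma geometric_block:
  fixes q :: "'a::real_normed_field"
  assumes "q ^ br t (Suc j) \<noteq> 1"
  shows "(\<Sum>r=1..m. q ^ r * q ^ (br t j * (t * r))) = geo_ratio t (Suc j) q * (1 - q ^ (br t (Suc j) * m))"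
proof (induction m)
  case (Suc m)
  define y where "y = q ^ br t (Suc j)"
  have y: "q ^ (br t (Suc j) * n) = y ^ n" for n by (simp add: y_def power_mult)
  have e: "q ^ r * q ^ (br t j * (t * r)) = y ^ r" for r
    unfolding y[symmetric] power_add[symmetric] by (simp add: br_Suc_mult algebra_simps)
  define g where "g = geo_ratio t (Suc j) q"
  have g: "g * (1 - y) = y" using assms by (simp add: geo_ratio_def y_def g_def)
  have "g * (1 - y ^ Suc m) = g * (1 - y ^ m) + (g * (1 - y)) * y ^ m" by (simp add: algebra_simps)
  with Suc show ?case unfolding e y g_def[symmetric] g by simp
qed simp

definition den_fps :: "nat \<Rightarrow> 'a::real_normed_field \<Rightarrow> 'a fps" where
  "den_fps t q = Abs_fps (\<lambda>j. (- 1) ^ j * alt_coeff t j q)"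

definition num_fps :: "nat \<Rightarrow> nat \<Rightarrow> 'a::real_normed_field \<Rightarrow> 'a fps" where
  "num_fps t m q = Abs_fps (\<lambda>j. (- 1) ^ j * alt_coeff t j q * q ^ (br t j * m))"

text \<open>Fixing the number of levels makes both sides finite, so the identity is one of formal power series in
  \<open>w\<close>, and convergence is treated separately.\<close>

lemma level_gf_fps:
  fixes q :: "'a::real_normed_field"
  assumes "\<And>j. q ^ br t (Suc j) \<noteq> 1"
  shows "level_gf t m k q = fps_nth (num_fps t m q * inverse (den_fps t q)) k"
proof (induction k arbitrary: m)
  case 0
  show ?case by (simp add: num_fps_def den_fps_def)
next
  case (Suc k)
  define G where "G = inverse (den_fps t q)"
  define a where "a j = (- 1) ^ j * alt_coeff t j q" for j
  have nth: "fps_nth (num_fps t m q * G) k = (\<Sum>j=0..k. a j * q ^ (br t j * m) * fps_nth G (k - j))" for m k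
    by (simp add: fps_mult_nth num_fps_def a_def)
  have "den_fps t q * G = 1"
    unfolding G_def by (rule inverse_mult_eq_1') (simp add: den_fps_def)
  then have "fps_nth (den_fps t q * G) (Suc k) = 0" by simp
  then have inv: "(\<Sum>j=0..Suc k. a j * fps_nth G (Suc k - j)) = 0"
    by (simp add: fps_mult_nth den_fps_def a_def)
  have a_Suc: "a j * geo_ratio t (Suc j) q = - a (Suc j)" for j
    by (simp add: a_def alt_coeff_Suc)
  have "level_gf t m (Suc k) q = (\<Sum>r=1..m. \<Sum>j=0..k. q ^ r * (a j * q ^ (br t j * (t * r)) * fps_nth G (k - j)))"
    unfolding level_gf_Suc Suc.IH G_def[symmetric] nth by (simp add: sum_distrib_left)
  also have "\<dots> = (\<Sum>j=0..k. a j * fps_nth G (k - j) * (\<Sum>r=1..m. q ^ r * q ^ (br t j * (t * r))))"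
    by (subst sum.swap) (simp add: sum_distrib_left mult_ac)
  also have "\<dots> = (\<Sum>j=0..k. a (Suc j) * (q ^ (br t (Suc j) * m) - 1) * fps_nth G (k - j))"
    unfolding geometric_block[OF assms]
  proof (intro sum.cong refl)
    fix j
    have "a j * fps_nth G (k - j) * (geo_ratio t (Suc j) q * (1 - q ^ (br t (Suc j) * m)))
      = (a j * geo_ratio t (Suc j) q) * (1 - q ^ (br t (Suc j) * m)) * fps_nth G (k - j)"
      by (simp only: mult_ac)
    then show "a j * fps_nth G (k - j) * (geo_ratio t (Suc j) q * (1 - q ^ (br t (Suc j) * m)))
      = a (Suc j) * (q ^ (br t (Suc j) * m) - 1) * fps_nth G (k - j)"
      unfolding a_Suc by (simp add: algebra_simps)
  qed
  also have "\<dots> = (\<Sum>j=0..Suc k. a j * q ^ (br t j * m) * fps_nth G (Suc k - j)) - (\<Sum>j=0..Suc k. a j * fps_nth G (Suc k - j))"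
    by (simp add: sum.atLeast0_atMost_Suc_shift algebra_simps sum_subtractf del: sum.cl_ivl_Suc)
  finally show ?case unfolding inv G_def[symmetric] nth by simp
qed

lemma level_gf_le:
  fixes x :: real
  assumes "0 \<le> x" "x < 1"
  shows "level_gf t m k x \<le> (x / (1 - x)) ^ k"
proof (induction k arbitrary: m)
  case (Suc k)
  have "level_gf t m (Suc k) x \<le> (\<Sum>r=1..m. x ^ r * (x / (1 - x)) ^ k)"
    unfolding level_gf_Suc using assms by (intro sum_mono mult_left_mono Suc) auto
  also have "\<dots> = (\<Sum>r=1..m. x ^ r) * (x / (1 - x)) ^ k" by (simp add: sum_distrib_right)
  also have "(\<Sum>r=1..m. x ^ r) \<le> x / (1 - x)"
  proof -
    have "(\<Sum>r=1..m. x ^ r) * (1 - x) = x * (1 - x ^ m)"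
    proof (induction m)
      case (Suc m)
      have "(\<Sum>r=1..Suc m. x ^ r) * (1 - x) = (\<Sum>r=1..m. x ^ r) * (1 - x) + x ^ Suc m * (1 - x)"
        by (simp add: distrib_right)
      also have "\<dots> = x * (1 - x ^ m) + x ^ Suc m * (1 - x)" by (simp only: Suc.IH)
      also have "\<dots> = x * (1 - x ^ Suc m)" by (simp add: algebra_simps)
      finally show ?case .
    qed simp
    then have "(\<Sum>r=1..m. x ^ r) = x * (1 - x ^ m) / (1 - x)"
      by (rule eq_divide_imp[rotated]) (use assms in simp)
    also have "\<dots> \<le> x * 1 / (1 - x)" using assms by (intro divide_right_mono mult_left_mono) auto
    finally show ?thesis by simp
  qed
  then have "(\<Sum>r=1..m. x ^ r) * (x / (1 - x)) ^ k \<le> x / (1 - x) * (x / (1 - x)) ^ k"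
    using assms by (intro mult_right_mono) auto
  finally show ?case by simp
qed simp

lemma norm_level_gf_le: "norm (level_gf t m k q) \<le> level_gf t m k (norm q)"
  unfolding level_gf_def by (rule order_trans[OF norm_sum]) (simp add: norm_power)

definition profile_poly :: "nat \<Rightarrow> nat \<Rightarrow> complex \<Rightarrow> complex" where
  "profile_poly t n w = (\<Sum>rs\<in>profiles t n. w ^ length rs)"

lemma level_gf_num_den:
  fixes q w :: complex
  assumes "0 < t" "norm q \<le> 1/4" "norm w < 2"
  shows "summable (\<lambda>k. norm (w ^ k * level_gf t 1 k q))"
    and "(\<Sum>k. w ^ k * level_gf t 1 k q) * den t q w = num t q w"
proof -
  have q: "norm q < 1" using assms by simp
  have ratio: "norm q / (1 - norm q) \<le> 1/3" using assms by (simp add: field_simps)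
  have bound: "norm (w ^ k * level_gf t 1 k q) \<le> (2/3) ^ k" for k
  proof -
    have "norm (level_gf t 1 k q) \<le> (norm q / (1 - norm q)) ^ k"
      using norm_level_gf_le level_gf_le[OF norm_ge_zero q] by (rule order_trans)
    also have "\<dots> \<le> (1/3) ^ k" using ratio assms by (intro power_mono) auto
    finally have "norm (w ^ k) * norm (level_gf t 1 k q) \<le> 2 ^ k * (1/3) ^ k"
      using assms by (intro mult_mono) (auto simp: norm_power intro!: power_mono)
    then show ?thesis by (simp add: norm_mult power_divide)
  qed
  show s1: "summable (\<lambda>k. norm (w ^ k * level_gf t 1 k q))"
    by (rule summable_comparison_test'[where g = "\<lambda>k. (2/3) ^ k" and N = 0]) (use bound in \<open>auto intro: summable_geometric\<close>)
  have s2: "summable (\<lambda>j. norm ((- w) ^ j * alt_coeff t j q))"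
    by (rule wser_summable(1)[OF dominated_den[OF assms(1)] q])
  have "(\<Sum>k. w ^ k * level_gf t 1 k q) * den t q w
      = (\<Sum>k. \<Sum>i\<le>k. w ^ i * level_gf t 1 i q * ((- w) ^ (k - i) * alt_coeff t (k - i) q))"
    unfolding den_def wser_def by (rule Cauchy_product[OF s1 s2])
  also have "\<dots> = (\<Sum>k. (- w) ^ k * (alt_coeff t k q * q ^ br t k))"
  proof (rule suminf_cong)
    fix k
    have ne: "q ^ br t (Suc j) \<noteq> 1" for j by (rule power_br_neq_1[OF assms(1) q])
    have G1: "inverse (den_fps t q) * den_fps t q = 1"
      by (rule inverse_mult_eq_1) (simp add: den_fps_def)
    have "(\<Sum>i\<le>k. level_gf t 1 i q * ((- 1) ^ (k - i) * alt_coeff t (k - i) q))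
        = fps_nth (num_fps t 1 q * inverse (den_fps t q) * den_fps t q) k"
      unfolding level_gf_fps[OF ne] by (simp add: fps_mult_nth[of _ "den_fps t q"] den_fps_def[of t q, THEN arg_cong[where f = fps_nth]] atLeast0AtMost)
    also have "\<dots> = (- 1) ^ k * alt_coeff t k q * q ^ br t k"
      unfolding mult.assoc G1 by (simp add: num_fps_def mult.assoc)
    finally have *: "(\<Sum>i\<le>k. level_gf t 1 i q * ((- 1) ^ (k - i) * alt_coeff t (k - i) q)) = (- 1) ^ k * alt_coeff t k q * q ^ br t k" .
    have "(\<Sum>i\<le>k. w ^ i * level_gf t 1 i q * ((- w) ^ (k - i) * alt_coeff t (k - i) q))
      = (\<Sum>i\<le>k. w ^ k * (level_gf t 1 i q * ((- 1) ^ (k - i) * alt_coeff t (k - i) q)))"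
    proof (intro sum.cong refl)
      fix i assume "i \<in> {..k}"
      then have "w ^ k = w ^ i * w ^ (k - i)" by (simp flip: power_add)
      then show "w ^ i * level_gf t 1 i q * ((- w) ^ (k - i) * alt_coeff t (k - i) q)
        = w ^ k * (level_gf t 1 i q * ((- 1) ^ (k - i) * alt_coeff t (k - i) q))"
        by (simp add: power_minus[of w] mult_ac)
    qed
    also have "\<dots> = w ^ k * ((- 1) ^ k * alt_coeff t k q * q ^ br t k)"
      unfolding sum_distrib_left[symmetric] * ..
    finally show "(\<Sum>i\<le>k. w ^ i * level_gf t 1 i q * ((- w) ^ (k - i) * alt_coeff t (k - i) q)) = (- w) ^ k * (alt_coeff t k q * q ^ br t k)"
      by (simp add: power_minus[of w] mult_ac)
  qed
  finally show "(\<Sum>k. w ^ k * level_gf t 1 k q) * den t q w = num t q w"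
    by (simp add: num_def wser_def)
qed

text \<open>Near the origin the double series over profiles converges absolutely, so it can be summed by length or by
  size.\<close>

theorem profile_gf:
  fixes q w :: complex
  assumes "0 < t" "norm q \<le> 1/4" "norm w < 2"
  shows "\<exists>S. (\<lambda>n. profile_poly t n w * q ^ n) sums S \<and> S * den t q w = num t q w"
proof -
  define F where "F rs = w ^ length rs * q ^ sum_list rs" for rs :: "nat list"
  have fin: "(\<lambda>k. \<Sum>rs\<in>chains t 1 k. norm (F rs)) = (\<lambda>k. norm w ^ k * level_gf t 1 k (norm q))"
    unfolding level_gf_def F_def
    by (auto simp: fun_eq_iff sum_distrib_left norm_mult norm_power chains_def intro!: sum.cong)
  have "summable (\<lambda>k. norm (complex_of_real (norm w) ^ k * level_gf t 1 k (complex_of_real (norm q))))"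
    by (rule level_gf_num_den(1)) (use assms in auto)
  moreover have "level_gf t 1 k (complex_of_real x) = of_real (level_gf t 1 k x)" for k x
    by (simp add: level_gf_def)
  moreover have nn: "0 \<le> level_gf t 1 k (norm q)" for k
    unfolding level_gf_def by (intro sum_nonneg) auto
  ultimately have sm: "summable (\<lambda>k. norm w ^ k * level_gf t 1 k (norm q))"
    by (simp add: norm_mult norm_power)
  have inner: "(\<lambda>rs. norm (F rs)) summable_on chains t 1 k" for k
    by (rule summable_on_finite[OF finite_chains])
  have eq: "norm (infsum (\<lambda>rs. norm (F rs)) (chains t 1 k)) = norm w ^ k * level_gf t 1 k (norm q)" for k
    unfolding infsum_finite[OF finite_chains] fun_cong[OF fin, of k] real_norm_def
    by (intro abs_of_nonneg mult_nonneg_nonneg nn) auto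
  have "(\<lambda>k. norm (infsum (\<lambda>rs. norm (F rs)) (chains t 1 k))) summable_on UNIV"
    unfolding eq by (subst summable_on_UNIV_nonneg_real_iff[OF mult_nonneg_nonneg[OF _ nn]]) (use sm in auto)
  then have sumSig: "(\<lambda>p. norm (F (snd p))) summable_on (SIGMA k:UNIV. chains t 1 k)"
    using inner Infinite_Sum.abs_summable_on_Sigma_iff[of "\<lambda>p. F (snd p)" UNIV "\<lambda>k. chains t 1 k"] by simp
  have bij: "bij_betw snd (SIGMA k:UNIV. chains t 1 k) {rs. chain t 1 rs}"
    by (rule bij_betwI[where g = "\<lambda>rs. (length rs, rs)"]) (auto simp: chains_def)
  have bij': "bij_betw snd (SIGMA n:UNIV. profiles t n) {rs. chain t 1 rs}"
    by (rule bij_betwI[where g = "\<lambda>rs. (sum_list rs, rs)"]) (auto simp: profiles_def)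
  have absF: "(\<lambda>rs. norm (F rs)) summable_on {rs. chain t 1 rs}"
    using sumSig summable_on_reindex_bij_betw[OF bij, of "\<lambda>rs. norm (F rs)"] by (simp add: case_prod_unfold)
  then have sF: "F summable_on {rs. chain t 1 rs}" by (rule abs_summable_summable)
  have hs: "(F has_sum infsum F {rs. chain t 1 rs}) {rs. chain t 1 rs}"
    using sF by (rule has_sum_infsum)
  have h1: "((\<lambda>p. F (snd p)) has_sum infsum F {rs. chain t 1 rs}) (SIGMA k:UNIV. chains t 1 k)"
    using has_sum_reindex_bij_betw[OF bij, of F] hs by simp
  have "((\<lambda>k. \<Sum>rs\<in>chains t 1 k. F rs) has_sum infsum F {rs. chain t 1 rs}) UNIV"
    by (rule has_sum_SigmaD[OF h1]) (simp only: snd_conv has_sum_finite[OF finite_chains])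
  then have l1: "(\<lambda>k. \<Sum>rs\<in>chains t 1 k. F rs) sums infsum F {rs. chain t 1 rs}"
    by (rule has_sum_imp_sums)
  have h2: "((\<lambda>p. F (snd p)) has_sum infsum F {rs. chain t 1 rs}) (SIGMA n:UNIV. profiles t n)"
    using has_sum_reindex_bij_betw[OF bij', of F] hs by simp
  have "((\<lambda>n. \<Sum>rs\<in>profiles t n. F rs) has_sum infsum F {rs. chain t 1 rs}) UNIV"
    by (rule has_sum_SigmaD[OF h2]) (simp only: snd_conv has_sum_finite[OF finite_profiles])
  then have l2: "(\<lambda>n. \<Sum>rs\<in>profiles t n. F rs) sums infsum F {rs. chain t 1 rs}"
    by (rule has_sum_imp_sums)
  have "(\<Sum>rs\<in>chains t 1 k. F rs) = w ^ k * level_gf t 1 k q" for k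
    unfolding level_gf_def F_def sum_distrib_left by (intro sum.cong) (auto simp: chains_def)
  with l1 have "infsum F {rs. chain t 1 rs} = (\<Sum>k. w ^ k * level_gf t 1 k q)"
    by (simp add: sums_iff)
  then have "infsum F {rs. chain t 1 rs} * den t q w = num t q w"
    using level_gf_num_den(2)[OF assms] by simp
  moreover have "(\<Sum>rs\<in>profiles t n. F rs) = profile_poly t n w * q ^ n" for n
    unfolding profile_poly_def F_def sum_distrib_right by (intro sum.cong) (auto simp: profiles_def)
  ultimately show ?thesis using l2 by auto
qed

section \<open>Renewal structure at the levels with one internal vertex\<close>

lemma chain_append: "chain t m (ys @ zs) \<longleftrightarrow> chain t m ys \<and> chain t (if ys = [] then m else t * last ys) zs"
  by (induction ys arbitrary: m) auto

lemma chain_mono: "chain t m rs \<Longrightarrow> m \<le> m' \<Longrightarrow> chain t m' rs"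
  by (cases rs) auto

text \<open>The pieces into which a profile falls when it is cut before each entry 1.\<close>

definition blocks :: "nat \<Rightarrow> nat \<Rightarrow> nat list set" where
  "blocks t m = {ys \<in> profiles t m. ys \<noteq> [] \<and> 1 \<notin> set (tl ys)}"

definition block_poly :: "nat \<Rightarrow> nat \<Rightarrow> complex \<Rightarrow> complex" where
  "block_poly t m w = (\<Sum>ys\<in>blocks t m. w ^ length ys)"

lemma finite_blocks: "finite (blocks t m)"
  unfolding blocks_def using finite_profiles by auto

lemma profile_Cons: "rs \<in> profiles t n \<Longrightarrow> rs \<noteq> [] \<Longrightarrow> \<exists>xs. rs = 1 # xs"
  by (cases rs) (auto simp: profiles_def)

lemma block_sum_pos: "ys \<in> blocks t m \<Longrightarrow> 1 \<le> m"
  using profile_Cons[of ys t m] by (auto simp: blocks_def profiles_def)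

lemma append_profile:
  assumes "0 < t" "ys \<in> blocks t m" "zs \<in> profiles t k"
  shows "ys @ zs \<in> profiles t (m + k)"
proof -
  have ys: "chain t 1 ys" "sum_list ys = m" "ys \<noteq> []" using assms by (auto simp: blocks_def profiles_def)
  then have "1 \<le> last ys" using chain_pos[of t 1 ys "last ys"] by auto
  then have "1 \<le> t * last ys" using assms(1) by (simp add: Suc_le_eq)
  then show ?thesis
    using ys assms(3) chain_mono[of t 1 zs "t * last ys"] by (simp add: profiles_def chain_append)
qed

lemma split_profile:
  assumes "rs \<in> profiles t n" "rs \<noteq> []"
  defines "ys \<equiv> hd rs # takeWhile (\<lambda>x. x \<noteq> 1) (tl rs)" and "zs \<equiv> dropWhile (\<lambda>x. x \<noteq> 1) (tl rs)"
  shows "ys @ zs = rs" "ys \<in> blocks t (sum_list ys)" "zs \<in> profiles t (n - sum_list ys)" "sum_list ys \<le> n"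
proof -
  show app: "ys @ zs = rs" using assms(2) by (simp add: ys_def zs_def)
  have c: "chain t 1 (ys @ zs)" "sum_list (ys @ zs) = n" using assms(1) unfolding app by (auto simp: profiles_def)
  show "ys \<in> blocks t (sum_list ys)"
    using c(1) unfolding chain_append by (auto simp: blocks_def profiles_def ys_def dest: set_takeWhileD)
  have "chain t 1 zs"
  proof (cases zs)
    case (Cons z zs')
    then have "z = 1" unfolding zs_def by (metis (mono_tags) dropWhile_eq_Cons_conv)
    with c(1) Cons show ?thesis unfolding chain_append by auto
  qed simp
  then show "zs \<in> profiles t (n - sum_list ys)" "sum_list ys \<le> n" using c(2) by (auto simp: profiles_def)
qed

lemma split_append:
  assumes "ys \<in> blocks t m" "zs \<in> profiles t k"
  shows "hd (ys @ zs) # takeWhile (\<lambda>x. x \<noteq> 1) (tl (ys @ zs)) = ys" "dropWhile (\<lambda>x. x \<noteq> 1) (tl (ys @ zs)) = zs"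
proof -
  obtain xs where xs: "ys = 1 # xs" "1 \<notin> set xs"
    using assms(1) profile_Cons[of ys t m] by (auto simp: blocks_def)
  have tw: "takeWhile (\<lambda>x. x \<noteq> 1) (xs @ zs) = xs @ takeWhile (\<lambda>x. x \<noteq> 1) zs"
    "dropWhile (\<lambda>x. x \<noteq> 1) (xs @ zs) = dropWhile (\<lambda>x. x \<noteq> 1) zs"
    using xs(2) by (auto intro!: takeWhile_append2 dropWhile_append2)
  have "takeWhile (\<lambda>x. x \<noteq> 1) zs = [] \<and> dropWhile (\<lambda>x. x \<noteq> 1) zs = zs"
    using profile_Cons[OF assms(2)] by (cases "zs = []") auto
  then show "hd (ys @ zs) # takeWhile (\<lambda>x. x \<noteq> 1) (tl (ys @ zs)) = ys" "dropWhile (\<lambda>x. x \<noteq> 1) (tl (ys @ zs)) = zs"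
    using tw by (simp_all add: xs(1))
qed

text \<open>A level with one internal vertex is followed by the same possibilities as the root, so a profile is a
  sequence of independent blocks.\<close>

lemma renewal:
  assumes "0 < t" "0 < n"
  shows "profile_poly t n w = (\<Sum>m=1..n. block_poly t m w * profile_poly t (n - m) w)"
proof -
  have "profile_poly t n w = (\<Sum>p\<in>(SIGMA m:{1..n}. blocks t m \<times> profiles t (n - m)). w ^ length (fst (snd p)) * w ^ length (snd (snd p)))"
    unfolding profile_poly_def
  proof (rule sum.reindex_bij_witness[where i = "\<lambda>(m, ys, zs). ys @ zs" and
        j = "\<lambda>rs. let ys = hd rs # takeWhile (\<lambda>x. x \<noteq> 1) (tl rs) in (sum_list ys, ys, dropWhile (\<lambda>x. x \<noteq> 1) (tl rs))"])
    fix rs assume rs: "rs \<in> profiles t n"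
    then have "rs \<noteq> []" using assms(2) by (auto simp: profiles_def)
    note s = split_profile[OF rs this]
    show "(case let ys = hd rs # takeWhile (\<lambda>x. x \<noteq> 1) (tl rs) in (sum_list ys, ys, dropWhile (\<lambda>x. x \<noteq> 1) (tl rs)) of
        (m, ys, zs) \<Rightarrow> ys @ zs) = rs"
      using s(1) by (simp add: Let_def)
    show "(let ys = hd rs # takeWhile (\<lambda>x. x \<noteq> 1) (tl rs) in (sum_list ys, ys, dropWhile (\<lambda>x. x \<noteq> 1) (tl rs)))
        \<in> (SIGMA m:{1..n}. blocks t m \<times> profiles t (n - m))"
      unfolding Let_def using s(2-4) block_sum_pos[OF s(2)] by (simp del: sum_list.Cons)
    show "w ^ length (fst (snd (let ys = hd rs # takeWhile (\<lambda>x. x \<noteq> 1) (tl rs) in (sum_list ys, ys, dropWhile (\<lambda>x. x \<noteq> 1) (tl rs)))))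
       * w ^ length (snd (snd (let ys = hd rs # takeWhile (\<lambda>x. x \<noteq> 1) (tl rs) in (sum_list ys, ys, dropWhile (\<lambda>x. x \<noteq> 1) (tl rs))))) = w ^ length rs"
      unfolding Let_def fst_conv snd_conv power_add[symmetric] length_append[symmetric] s(1) ..
  next
    fix p assume p: "p \<in> (SIGMA m:{1..n}. blocks t m \<times> profiles t (n - m))"
    then obtain m ys zs where [simp]: "p = (m, ys, zs)" and *: "m \<in> {1..n}" "ys \<in> blocks t m" "zs \<in> profiles t (n - m)"
      by auto
    have "sum_list ys = m" using *(2) by (simp add: blocks_def profiles_def)
    then show "(let ys = hd (case p of (m, ys, zs) \<Rightarrow> ys @ zs) # takeWhile (\<lambda>x. x \<noteq> 1) (tl (case p of (m, ys, zs) \<Rightarrow> ys @ zs))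
        in (sum_list ys, ys, dropWhile (\<lambda>x. x \<noteq> 1) (tl (case p of (m, ys, zs) \<Rightarrow> ys @ zs)))) = p"
      unfolding Let_def by (simp only: \<open>p = _\<close> prod.case split_append[OF *(2,3)])
    show "(case p of (m, ys, zs) \<Rightarrow> ys @ zs) \<in> profiles t n"
      using append_profile[OF assms(1) *(2,3)] * by simp
  qed
  also have "\<dots> = (\<Sum>m=1..n. \<Sum>x\<in>blocks t m \<times> profiles t (n - m). w ^ length (fst x) * w ^ length (snd x))"
    by (subst sum.Sigma) (auto simp: finite_blocks finite_profiles case_prod_unfold)
  also have "\<dots> = (\<Sum>m=1..n. block_poly t m w * profile_poly t (n - m) w)"
    unfolding block_poly_def profile_poly_def sum_product sum.cartesian_product case_prod_unfold ..
  finally show ?thesis .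
qed

lemma profile_poly_0 [simp]: "profile_poly t 0 w = 1"
proof -
  have "profiles t 0 = {[]}"
  proof
    show "profiles t 0 \<subseteq> {[]}"
    proof
      fix rs assume "rs \<in> profiles t 0"
      then have "chain t 1 rs" "sum_list rs = 0" by (auto simp: profiles_def)
      then have "rs = []" by (metis chain_length_le le_zero_eq length_0_conv)
      then show "rs \<in> {[]}" by simp
    qed
  qed (simp add: profiles_def)
  then show ?thesis by (simp add: profile_poly_def)
qed

lemma block_poly_0 [simp]: "block_poly t 0 w = 0"
proof -
  have "blocks t 0 = {}" using block_sum_pos[of _ t 0] by fastforce
  then show ?thesis by (simp add: block_poly_def)
qed

lemma norm_profile_poly_le: "norm w \<le> 1 \<Longrightarrow> norm (profile_poly t n w) \<le> card (profiles t n)"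
proof -
  assume "norm w \<le> 1"
  then have "norm (profile_poly t n w) \<le> (\<Sum>rs\<in>profiles t n. 1)"
    unfolding profile_poly_def by (intro order_trans[OF norm_sum] sum_mono) (simp add: norm_power power_le_one)
  then show ?thesis by simp
qed

lemma norm_block_poly_le: "norm w \<le> 1 \<Longrightarrow> norm (block_poly t n w) \<le> card (blocks t n)"
proof -
  assume "norm w \<le> 1"
  then have "norm (block_poly t n w) \<le> (\<Sum>rs\<in>blocks t n. 1)"
    unfolding block_poly_def by (intro order_trans[OF norm_sum] sum_mono) (simp add: norm_power power_le_one)
  then show ?thesis by simp
qed

lemma profile_poly_1: "profile_poly t n 1 = of_nat (card (profiles t n))"
  by (simp add: profile_poly_def)

lemma block_poly_1: "block_poly t n 1 = of_nat (card (blocks t n))"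
  by (simp add: block_poly_def)

lemma card_blocks_le: "card (blocks t n) \<le> card (profiles t n)"
  by (rule card_mono[OF finite_profiles]) (auto simp: blocks_def)

lemma blocks_1: "blocks t 1 = {[1]}"
proof
  show "blocks t 1 \<subseteq> {[1]}"
  proof
    fix ys assume ys: "ys \<in> blocks t 1"
    then obtain xs where xs: "ys = 1 # xs" using profile_Cons[of ys t 1] by (auto simp: blocks_def)
    then have "sum_list xs = 0" "chain t t xs" using ys by (auto simp: blocks_def profiles_def)
    then have "xs = []" by (metis chain_length_le le_zero_eq length_0_conv)
    with xs show "ys \<in> {[1]}" by simp
  qed
qed (auto simp: blocks_def profiles_def)

lemma blocks_3: assumes "2 \<le> t" shows "blocks t 3 = {[1, 2]}"
proof
  show "blocks t 3 \<subseteq> {[1, 2]}"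
  proof
    fix ys assume ys: "ys \<in> blocks t 3"
    then obtain xs where xs: "ys = 1 # xs" using profile_Cons[of ys t 3] by (auto simp: blocks_def)
    then have *: "sum_list xs = 2" "chain t t xs" "1 \<notin> set xs" using ys by (auto simp: blocks_def profiles_def)
    then obtain x xs' where x: "xs = x # xs'" by (cases xs) auto
    have "x + sum_list xs' = 2" "x \<noteq> 1" "1 \<le> x" "chain t (t * x) xs'" using * chain_pos[OF *(2), of x] unfolding x by auto
    moreover from this have "x = 2" "sum_list xs' = 0" by linarith+
    ultimately have "x = 2" "xs' = []" by (simp_all, metis chain_length_le le_zero_eq length_0_conv)
    then show "ys \<in> {[1, 2]}" using xs x by simp
  qed
qed (use assms in \<open>auto simp: blocks_def profiles_def\<close>)

lemma block_series:
  fixes q w :: complex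
  assumes t: "0 < t" and s: "summable (\<lambda>n. real (card (profiles t n)) * norm q ^ n)" and w: "norm w \<le> 1"
  shows "summable (\<lambda>n. norm (profile_poly t n w * q ^ n))" "summable (\<lambda>n. norm (block_poly t n w * q ^ n))"
    and "(\<Sum>n. profile_poly t n w * q ^ n) * (1 - (\<Sum>n. block_poly t n w * q ^ n)) = 1"
proof -
  show s1: "summable (\<lambda>n. norm (profile_poly t n w * q ^ n))"
    by (rule summable_comparison_test'[OF s, of 0])
       (use norm_profile_poly_le[OF w] in \<open>auto simp: norm_mult norm_power intro!: mult_right_mono\<close>)
  show s2: "summable (\<lambda>n. norm (block_poly t n w * q ^ n))"
  proof (rule summable_comparison_test'[OF s, of 0])
    fix n
    have "norm (block_poly t n w) \<le> real (card (profiles t n))"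
      using norm_block_poly_le[OF w, of t n] card_blocks_le[of t n] by linarith
    then show "norm (norm (block_poly t n w * q ^ n)) \<le> real (card (profiles t n)) * norm q ^ n"
      by (simp add: norm_mult norm_power mult_right_mono)
  qed
  have "(\<Sum>n. block_poly t n w * q ^ n) * (\<Sum>n. profile_poly t n w * q ^ n)
     = (\<Sum>n. \<Sum>i\<le>n. (block_poly t i w * q ^ i) * (profile_poly t (n - i) w * q ^ (n - i)))"
    by (rule Cauchy_product[OF s2 s1])
  also have "\<dots> = (\<Sum>n. profile_poly t n w * q ^ n - (if n = 0 then 1 else 0))"
  proof (rule suminf_cong)
    fix n
    have "(\<Sum>i\<le>n. (block_poly t i w * q ^ i) * (profile_poly t (n - i) w * q ^ (n - i)))
      = (\<Sum>i\<le>n. block_poly t i w * profile_poly t (n - i) w * q ^ n)"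
    proof (intro sum.cong refl)
      fix i assume "i \<in> {..n}"
      then have "q ^ n = q ^ i * q ^ (n - i)" by (simp flip: power_add)
      then show "(block_poly t i w * q ^ i) * (profile_poly t (n - i) w * q ^ (n - i))
        = block_poly t i w * profile_poly t (n - i) w * q ^ n" by (simp add: mult_ac)
    qed
    also have "\<dots> = (\<Sum>i\<le>n. block_poly t i w * profile_poly t (n - i) w) * q ^ n"
      by (simp add: sum_distrib_right)
    also have "(\<Sum>i\<le>n. block_poly t i w * profile_poly t (n - i) w) = (if n = 0 then 0 else profile_poly t n w)"
    proof (cases "n = 0")
      case False
      have "(\<Sum>i\<le>n. block_poly t i w * profile_poly t (n - i) w) = (\<Sum>i=1..n. block_poly t i w * profile_poly t (n - i) w)"
        by (rule sum.mono_neutral_right) (auto simp: not_less_eq_eq Suc_le_eq)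
      with False renewal[OF t, of n w] show ?thesis by simp
    qed simp
    finally show "(\<Sum>i\<le>n. (block_poly t i w * q ^ i) * (profile_poly t (n - i) w * q ^ (n - i)))
      = profile_poly t n w * q ^ n - (if n = 0 then 1 else 0)" by auto
  qed
  also have "\<dots> = (\<Sum>n. profile_poly t n w * q ^ n) - (\<Sum>n. if n = 0 then 1 else 0)"
    by (rule suminf_diff[symmetric, OF summable_norm_cancel[OF s1]]) (rule summable_finite[of "{0}"], auto)
  also have "(\<Sum>n. if n = 0 then 1 else 0) = (1 :: complex)"
    by (subst suminf_finite[of "{0}"]) auto
  finally show "(\<Sum>n. profile_poly t n w * q ^ n) * (1 - (\<Sum>n. block_poly t n w * q ^ n)) = 1"
    by (simp add: algebra_simps)
qed

text \<open>At the positive radius \<open>\<bar>q\<bar>\<close> the block series is at most 1. Each block contributes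
  at \<open>(q, w)\<close> a real part that is no larger than its contribution at \<open>(\<bar>q\<bar>,
  1)\<close>, and for the blocks \<open>[1]\<close> and \<open>[1, 2]\<close> the loss is kept.\<close>

theorem renewal_lower_bound:
  fixes q w :: complex
  assumes t: "2 \<le> t" and s: "summable (\<lambda>n. real (card (profiles t n)) * norm q ^ n)" and w: "norm w = 1"
  shows "(norm q - Re (w * q)) + (norm q ^ 3 - Re (w ^ 2 * q ^ 3)) \<le> norm (1 - (\<Sum>n. block_poly t n w * q ^ n))"
proof -
  define x where "x = norm q"
  have t0: "0 < t" using t by simp
  have sx: "summable (\<lambda>n. real (card (profiles t n)) * norm (complex_of_real x) ^ n)" using s by (simp add: x_def)
  note real_case = block_series[OF t0 sx, of 1, unfolded profile_poly_1 block_poly_1]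
  define P where "P = (\<Sum>n. real (card (profiles t n)) * x ^ n)"
  define B where "B = (\<Sum>n. real (card (blocks t n)) * x ^ n)"
  have sP: "summable (\<lambda>n. real (card (profiles t n)) * x ^ n)" using s by (simp add: x_def)
  have sB: "summable (\<lambda>n. real (card (blocks t n)) * x ^ n)"
    by (rule summable_comparison_test'[OF sP, of 0]) (auto simp: x_def intro!: mult_right_mono card_blocks_le)
  have "complex_of_real (P * (1 - B)) = 1"
  proof -
    have "(\<lambda>n. of_nat (card (profiles t n)) * complex_of_real x ^ n) sums of_real P"
      "(\<lambda>n. of_nat (card (blocks t n)) * complex_of_real x ^ n) sums of_real B"
      using sums_of_real[OF summable_sums[OF sP], where 'a = complex] sums_of_real[OF summable_sums[OF sB], where 'a = complex]
      unfolding P_def B_def by simp_all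
    with real_case(3) show ?thesis by (simp add: sums_iff)
  qed
  then have "P * (1 - B) = 1" by (metis of_real_eq_1_iff)
  moreover have "0 \<le> P" unfolding P_def by (intro suminf_nonneg sP) (simp add: x_def)
  ultimately have B1: "B \<le> 1" by (smt (verit) mult_nonneg_nonpos)
  have sc: "summable (\<lambda>n. block_poly t n w * q ^ n)"
    by (rule summable_norm_cancel[OF block_series(2)[OF t0 s]]) (use w in auto)
  define d where "d n = real (card (blocks t n)) * x ^ n - Re (block_poly t n w * q ^ n)" for n
  have d: "0 \<le> d n" for n
  proof -
    have "Re (block_poly t n w * q ^ n) \<le> norm (block_poly t n w) * x ^ n"
      using complex_Re_le_cmod[of "block_poly t n w * q ^ n"] by (simp add: norm_mult norm_power x_def)
    also have "\<dots> \<le> real (card (blocks t n)) * x ^ n"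
      by (intro mult_right_mono norm_block_poly_le) (use w in \<open>auto simp: x_def\<close>)
    finally show ?thesis by (simp add: d_def)
  qed
  have sums_d: "d sums (B - Re (\<Sum>n. block_poly t n w * q ^ n))"
    unfolding d_def B_def by (intro sums_diff summable_sums[OF sB] sums_Re summable_sums[OF sc])
  have "d 1 = norm q - Re (w * q)"
    unfolding d_def by (simp add: blocks_1[unfolded One_nat_def] block_poly_def x_def)
  moreover have "d 3 = norm q ^ 3 - Re (w ^ 2 * q ^ 3)"
    unfolding d_def by (simp add: blocks_3[OF t] block_poly_def x_def numeral_2_eq_2)
  moreover have "(\<Sum>n\<in>{1, 3}. d n) \<le> suminf d"
    by (rule sum_le_suminf) (use d sums_d in \<open>auto simp: sums_iff\<close>)
  ultimately have "(norm q - Re (w * q)) + (norm q ^ 3 - Re (w ^ 2 * q ^ 3)) \<le> B - Re (\<Sum>n. block_poly t n w * q ^ n)"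
    using sums_d by (simp add: sums_iff)
  also have "\<dots> \<le> Re (1 - (\<Sum>n. block_poly t n w * q ^ n))" using B1 by simp
  also have "\<dots> \<le> norm (1 - (\<Sum>n. block_poly t n w * q ^ n))" by (rule complex_Re_le_cmod)
  finally show ?thesis .
qed

section \<open>Coefficients of a meromorphic function with one simple pole\<close>

text \<open>Analytic continuation identifies the power series with the quotient on the larger disc, and Cauchy's
  estimates bound the coefficients.\<close>

lemma coefficients_of_quotient:
  fixes p :: "nat \<Rightarrow> complex"
  assumes g: "g holomorphic_on ball 0 1" and N: "N holomorphic_on ball 0 1"
    and R: "0 < R" "R < 1" and m: "0 < m" "\<And>q. norm q \<le> R \<Longrightarrow> m \<le> norm (g q)"
    and M: "\<And>q. norm q \<le> R \<Longrightarrow> norm (N q) \<le> M"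
    and \<epsilon>: "0 < \<epsilon>" "\<And>q. norm q < \<epsilon> \<Longrightarrow> \<exists>S. (\<lambda>n. p n * q ^ n) sums S \<and> S * g q = N q"
  shows "norm (p n) \<le> M / m / R ^ n"
    and "norm q < R \<Longrightarrow> (\<lambda>n. p n * q ^ n) sums (N q / g q)"
proof -
  define h where "h q = N q / g q" for q
  have nz: "g q \<noteq> 0" if "norm q \<le> R" for q using m(2)[OF that] m(1) by auto
  have sub: "cball 0 R \<subseteq> ball (0::complex) 1" using R by auto
  have holh: "h holomorphic_on ball 0 R" unfolding h_def
    by (intro holomorphic_intros holomorphic_on_subset[OF g] holomorphic_on_subset[OF N])
       (use sub nz in \<open>auto simp: subset_eq\<close>)
  have conth: "continuous_on (cball 0 R) h" unfolding h_def
    by (intro continuous_intros holomorphic_on_imp_continuous_on holomorphic_on_subset[OF g sub] holomorphic_on_subset[OF N sub])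
       (use nz in auto)
  have "h has_fps_expansion Abs_fps p"
  proof (rule has_fps_expansionI)
    show "\<forall>\<^sub>F q in nhds 0. (\<lambda>n. fps_nth (Abs_fps p) n * q ^ n) sums h q"
      unfolding eventually_nhds_metric
    proof (intro exI[of _ "min \<epsilon> R"] conjI allI impI)
      fix q :: complex assume "dist q 0 < min \<epsilon> R"
      then have q: "norm q < \<epsilon>" "norm q \<le> R" by auto
      obtain S where S: "(\<lambda>n. p n * q ^ n) sums S" "S * g q = N q" using \<epsilon>(2)[OF q(1)] by blast
      then have "S = h q" using nz[OF q(2)] by (simp add: h_def field_simps)
      with S show "(\<lambda>n. fps_nth (Abs_fps p) n * q ^ n) sums h q" by simp
    qed (use \<epsilon> R in auto)
  qed
  from fps_nth_fps_expansion[OF this] have p: "p n = (deriv ^^ n) h 0 / fact n" for n by simp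
  have hM: "norm (h q) \<le> M / m" if "norm q \<le> R" for q
    unfolding h_def norm_divide using m M that order_trans[OF norm_ge_zero M[OF that]] by (intro frac_le) auto
  have "norm ((deriv ^^ n) h 0) \<le> fact n * (M / m) / R ^ n"
    by (rule Cauchy_inequality[OF holh conth]) (use R hM in auto)
  then show "norm (p n) \<le> M / m / R ^ n" unfolding p norm_divide by (simp add: field_simps)
  show "(\<lambda>n. p n * q ^ n) sums (N q / g q)" if "norm q < R"
    using holomorphic_power_series[OF holh, of q] that unfolding p h_def by simp
qed

text \<open>Multiplication by \<open>q - \<rho>\<close> removes the pole and replaces the coefficients by the
  differences \<open>p (n - 1) - \<rho> * p n\<close>, which decay geometrically relative to the claim;
  summing them gives the bound and the limit. The bound depends on the functions only through
  \<open>M\<close>, \<open>m\<close> and \<open>R\<close> and is therefore uniform in a parameter.\<close>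

lemma coefficients_at_simple_zero:
  fixes p :: "nat \<Rightarrow> complex"
  assumes f: "f holomorphic_on ball 0 1" and N: "N holomorphic_on ball 0 1"
    and R: "0 < R" "R < 1" and \<rho>: "norm \<rho> < R" "f \<rho> = 0"
    and m: "0 < m" "\<And>q. norm q \<le> R \<Longrightarrow> m * norm (q - \<rho>) \<le> norm (f q)"
    and M: "\<And>q. norm q \<le> R \<Longrightarrow> norm (N q) \<le> M"
    and \<epsilon>: "0 < \<epsilon>" "\<And>q. norm q < \<epsilon> \<Longrightarrow> \<exists>S. (\<lambda>n. p n * q ^ n) sums S \<and> S * f q = N q"
  shows "norm (p n * \<rho> ^ Suc n) \<le> M / m / (1 - norm \<rho> / R)"
    and "deriv f \<rho> \<noteq> 0" and "(\<lambda>n. p n * \<rho> ^ Suc n) \<longlonglongrightarrow> - (N \<rho> / deriv f \<rho>)"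
proof -
  define g where "g q = (if q = \<rho> then deriv f \<rho> else (f q - f \<rho>) / (q - \<rho>))" for q
  have \<rho>1: "\<rho> \<in> ball 0 1" using \<rho> R by auto
  have holg: "g holomorphic_on ball 0 1"
    unfolding g_def[abs_def] by (rule pole_lemma_open[OF f open_ball])
  have fg: "f q = g q * (q - \<rho>)" for q by (simp add: g_def \<rho>)
  have gm: "m \<le> norm (g q)" if "norm q \<le> R" for q
  proof (cases "q = \<rho>")
    case False
    then show ?thesis using m(2)[OF that] by (simp add: fg norm_mult)
  next
    case True
    have "continuous_on (ball 0 R) g"
      by (rule holomorphic_on_imp_continuous_on[OF holomorphic_on_subset[OF holg]]) (use R in auto)
    then have "isCont g \<rho>" using \<rho> by (simp add: continuous_on_eq_continuous_at)
    then have "(\<lambda>q. norm (g q)) \<midarrow>\<rho>\<rightarrow> norm (g \<rho>)" by (intro tendsto_norm isContD)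
    moreover have "\<forall>\<^sub>F q in at \<rho>. m \<le> norm (g q)"
      unfolding eventually_at
    proof (intro exI[of _ "R - norm \<rho>"] conjI ballI impI)
      fix q assume "q \<noteq> \<rho> \<and> dist q \<rho> < R - norm \<rho>"
      then have "q \<noteq> \<rho>" "norm q \<le> R" using norm_triangle_ineq[of "q - \<rho>" \<rho>] by (auto simp: dist_norm)
      then show "m \<le> norm (g q)" using m(2)[of q] by (simp add: fg norm_mult)
    qed (use \<rho> in auto)
    ultimately show ?thesis unfolding True by (rule tendsto_lowerbound) auto
  qed
  show nz: "deriv f \<rho> \<noteq> 0" using gm[of \<rho>] \<rho> m(1) by (auto simp: g_def)
  define h where "h n = (if n = 0 then 0 else p (n - 1)) - \<rho> * p n" for n
  have hS: "\<exists>S. (\<lambda>n. h n * q ^ n) sums S \<and> S * g q = N q" if q: "norm q < \<epsilon>" for q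
  proof -
    obtain S where S: "(\<lambda>n. p n * q ^ n) sums S" "S * f q = N q" using \<epsilon>(2)[OF q] by blast
    have "(\<lambda>n. (if Suc n = 0 then 0 else p (Suc n - 1)) * q ^ Suc n) sums (q * S)"
      using sums_mult[OF S(1), of q] by (simp add: mult_ac)
    then have "(\<lambda>n. (if n = 0 then 0 else p (n - 1)) * q ^ n) sums (q * S)"
      by (subst (asm) sums_Suc_iff) simp
    from sums_diff[OF this sums_mult[OF S(1), of \<rho>]]
    have "(\<lambda>n. h n * q ^ n) sums (q * S - \<rho> * S)" by (simp add: h_def algebra_simps)
    moreover have "(q * S - \<rho> * S) * g q = N q" using S(2) by (simp add: fg algebra_simps)
    ultimately show ?thesis by blast
  qed
  have quot1: "norm (h n) \<le> M / m / R ^ n" for n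
    by (rule coefficients_of_quotient(1)[OF holg N R m(1) gm M \<epsilon>(1) hS])
  have quot2: "(\<lambda>n. h n * \<rho> ^ n) sums (N \<rho> / g \<rho>)"
    by (rule coefficients_of_quotient(2)[OF holg N R m(1) gm M \<epsilon>(1) hS \<rho>(1)])
  have p: "p n * \<rho> ^ Suc n = - (\<Sum>k\<le>n. h k * \<rho> ^ k)" for n
    by (induction n) (simp_all add: h_def algebra_simps)
  have r: "norm \<rho> / R < 1" "0 \<le> norm \<rho> / R" using \<rho> R by auto
  have M0: "0 \<le> M" using M[of 0] R by (auto intro: order_trans[OF norm_ge_zero])
  have "norm (p n * \<rho> ^ Suc n) \<le> (\<Sum>k\<le>n. norm (h k * \<rho> ^ k))"
    unfolding p norm_minus_cancel by (rule norm_sum)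
  also have "\<dots> \<le> (\<Sum>k\<le>n. M / m * (norm \<rho> / R) ^ k)"
  proof (rule sum_mono)
    fix k
    have "norm (h k) * norm \<rho> ^ k \<le> M / m / R ^ k * norm \<rho> ^ k"
      by (intro mult_right_mono quot1) auto
    then show "norm (h k * \<rho> ^ k) \<le> M / m * (norm \<rho> / R) ^ k"
      by (simp add: norm_mult norm_power power_divide)
  qed
  also have "\<dots> = M / m * (\<Sum>k\<le>n. (norm \<rho> / R) ^ k)" by (simp add: sum_distrib_left)
  also have "\<dots> \<le> M / m * (1 / (1 - norm \<rho> / R))"
  proof (rule mult_left_mono)
    have "(\<Sum>k\<le>n. (norm \<rho> / R) ^ k) \<le> (\<Sum>k. (norm \<rho> / R) ^ k)"
      using r by (intro sum_le_suminf summable_geometric) auto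
    then show "(\<Sum>k\<le>n. (norm \<rho> / R) ^ k) \<le> 1 / (1 - norm \<rho> / R)"
      using r by (simp add: suminf_geometric)
  qed (use M0 m in auto)
  finally show "norm (p n * \<rho> ^ Suc n) \<le> M / m / (1 - norm \<rho> / R)" by simp
  have "(\<lambda>n. \<Sum>k\<le>n. h k * \<rho> ^ k) \<longlonglongrightarrow> N \<rho> / g \<rho>"
    using quot2 by (simp add: sums_def_le)
  then show "(\<lambda>n. p n * \<rho> ^ Suc n) \<longlonglongrightarrow> - (N \<rho> / deriv f \<rho>)"
    unfolding p by (intro tendsto_minus) (simp add: g_def)
qed

text \<open>Holomorphy along curves together with joint continuity replaces joint holomorphy in two variables.\<close>

locale analytic_family =
  fixes f :: "complex \<Rightarrow> complex \<Rightarrow> complex"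
  assumes compose: "\<And>u v S. open S \<Longrightarrow> u holomorphic_on S \<Longrightarrow> v holomorphic_on S \<Longrightarrow>
      (\<And>s. s \<in> S \<Longrightarrow> norm (u s) < 1) \<Longrightarrow> (\<lambda>s. f (u s) (v s)) holomorphic_on S"
    and cont: "continuous_on (ball 0 1 \<times> UNIV) (\<lambda>(q, w). f q w)"
begin

lemma hol_fst: "(\<lambda>q. f q w) holomorphic_on ball 0 1"
  by (rule compose) auto

lemma uniformly_close:
  assumes K: "compact K" "K \<subseteq> ball 0 1" and "0 < \<eta>"
  obtains \<delta> where "0 < \<delta>" "\<And>q w. q \<in> K \<Longrightarrow> norm (w - w0) < \<delta> \<Longrightarrow> norm (f q w - f q w0) < \<eta>"
proof -
  have "uniformly_continuous_on (K \<times> cball w0 1) (\<lambda>(q, w). f q w)"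
    by (intro compact_uniformly_continuous continuous_on_subset[OF cont] compact_Times K) (use K in auto)
  then obtain d where d: "d > 0"
    "\<And>x y. x \<in> K \<times> cball w0 1 \<Longrightarrow> y \<in> K \<times> cball w0 1 \<Longrightarrow> dist y x < d \<Longrightarrow> dist (case_prod f y) (case_prod f x) < \<eta>"
    using \<open>0 < \<eta>\<close> unfolding uniformly_continuous_on_def by metis
  show ?thesis
  proof (rule that[of "min d 1"])
    fix q w assume "q \<in> K" "norm (w - w0) < min d 1"
    then show "norm (f q w - f q w0) < \<eta>"
      using d(2)[of "(q, w0)" "(q, w)"] by (auto simp: dist_norm norm_minus_commute dist_Pair_Pair)
  qed (use d in auto)
qed

text \<open>For \<open>w\<close> near 1 the function \<open>q - f q w / a\<close> is a contraction on a small disc,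
  where \<open>a\<close> is the derivative at the simple zero. The contraction estimate also yields the
  lower bound for \<open>f q w\<close>.\<close>

lemma local_zero:
  assumes z0: "norm z0 < 1" "f z0 1 = 0" and a: "deriv (\<lambda>q. f q 1) z0 \<noteq> 0" and "0 < \<epsilon>0"
  obtains \<delta> \<epsilon> \<rho> m where "0 < \<delta>" "0 < \<epsilon>" "\<epsilon> \<le> \<epsilon>0" "0 < m" "\<rho> holomorphic_on ball 1 \<delta>" "\<rho> 1 = z0"
    "\<forall>w \<in> ball 1 \<delta>. norm (\<rho> w - z0) \<le> \<epsilon> \<and> f (\<rho> w) w = 0"
    "\<forall>w \<in> ball 1 \<delta>. \<forall>q. norm (q - z0) \<le> \<epsilon> \<longrightarrow> m * norm (q - \<rho> w) \<le> norm (f q w)"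
proof -
  define a where "a = deriv (\<lambda>q. f q 1) z0"
  have a0: "a \<noteq> 0" using assms by (simp add: a_def)
  define r where "r = (1 - norm z0) / 3"
  have r: "0 < r" using z0 by (simp add: r_def)
  have sub: "cball z0 (2 * r) \<subseteq> ball 0 1"
  proof
    fix q assume "q \<in> cball z0 (2 * r)"
    then have "norm (q - z0) \<le> 2 * r" by (simp add: dist_norm norm_minus_commute)
    then have "norm q \<le> norm z0 + 2 * r" using norm_triangle_ineq[of "q - z0" z0] by simp
    also have "\<dots> < 1" using z0 by (simp add: r_def field_simps)
    finally show "q \<in> ball 0 1" by simp
  qed
  have dhol: "deriv (\<lambda>q. f q 1) holomorphic_on ball 0 1"
    by (rule holomorphic_deriv[OF hol_fst]) simp
  have "isCont (deriv (\<lambda>q. f q 1)) z0"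
    using holomorphic_on_imp_continuous_on[OF dhol] z0 by (simp add: continuous_on_eq_continuous_at)
  then obtain \<epsilon>1 where \<epsilon>1: "\<epsilon>1 > 0" "\<And>q. dist q z0 < \<epsilon>1 \<Longrightarrow> dist (deriv (\<lambda>q. f q 1) q) a < norm a / 4"
    unfolding continuous_at_eps_delta a_def[symmetric] using a0 by (metis divide_pos_pos zero_less_norm_iff zero_less_numeral)
  define \<epsilon> where "\<epsilon> = min (min (\<epsilon>1 / 2) r) \<epsilon>0"
  have \<epsilon>: "0 < \<epsilon>" "\<epsilon> < \<epsilon>1" "\<epsilon> \<le> r" "\<epsilon> \<le> \<epsilon>0" using \<epsilon>1 r assms by (auto simp: \<epsilon>_def)
  define \<eta> where "\<eta> = min (r * norm a / 4) (\<epsilon> * norm a / 4)"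
  have \<eta>: "0 < \<eta>" using r \<epsilon> a0 by (simp add: \<eta>_def)
  obtain \<delta> where \<delta>: "0 < \<delta>" "\<And>q w. q \<in> cball z0 (2 * r) \<Longrightarrow> norm (w - 1) < \<delta> \<Longrightarrow> norm (f q w - f q 1) < \<eta>"
    using uniformly_close[OF compact_cball sub \<eta>] by metis
  define \<Phi> where "\<Phi> w q = q - f q w / a" for w q
  have in1: "norm q < 1" if "q \<in> cball z0 \<epsilon>" for q
  proof -
    have "q \<in> cball z0 (2 * r)" using that \<epsilon> r by auto
    with sub show ?thesis by auto
  qed
  have df: "((\<lambda>q. f q w) has_field_derivative deriv (\<lambda>q. f q w) q) (at q)" if "norm q < 1" for q w
    by (rule holomorphic_derivI[OF hol_fst]) (use that in auto)
  have dbound: "norm (deriv (\<lambda>q. f q w) q - a) \<le> norm a / 2" if w: "norm (w - 1) < \<delta>" and q: "q \<in> cball z0 \<epsilon>" for w q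
  proof -
    have subq: "cball q r \<subseteq> cball z0 (2 * r)"
    proof
      fix z assume "z \<in> cball q r"
      then show "z \<in> cball z0 (2 * r)" using q \<epsilon> dist_triangle[of z0 z q] by auto
    qed
    have "norm ((deriv ^^ 1) (\<lambda>q. f q w - f q 1) q) \<le> fact 1 * \<eta> / r ^ 1"
    proof (rule Cauchy_inequality)
      have h: "(\<lambda>q. f q w - f q 1) holomorphic_on cball q r"
        by (intro holomorphic_intros holomorphic_on_subset[OF hol_fst]) (use subq sub in blast)+
      then show "(\<lambda>q. f q w - f q 1) holomorphic_on ball q r" by (rule holomorphic_on_subset) auto
      show "continuous_on (cball q r) (\<lambda>q. f q w - f q 1)" using h by (rule holomorphic_on_imp_continuous_on)
      fix z assume "norm (q - z) = r"
      then have "z \<in> cball q r" by (simp add: dist_norm)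
      then show "norm (f z w - f z 1) \<le> \<eta>" using \<delta>(2)[of z w] w subq by (auto intro: less_imp_le)
    qed (use r in auto)
    then have "norm (deriv (\<lambda>q. f q w - f q 1) q) \<le> \<eta> / r" by simp
    moreover have "deriv (\<lambda>q. f q w - f q 1) q = deriv (\<lambda>q. f q w) q - deriv (\<lambda>q. f q 1) q"
      by (intro DERIV_imp_deriv derivative_intros df in1 q)
    moreover have "\<eta> / r \<le> norm a / 4" using r by (simp add: \<eta>_def field_simps min_le_iff_disj)
    moreover have "norm (deriv (\<lambda>q. f q 1) q - a) < norm a / 4"
      using \<epsilon>1(2)[of q] q \<epsilon> by (simp add: dist_norm norm_minus_commute)
    ultimately show ?thesis
      using norm_triangle_ineq[of "deriv (\<lambda>q. f q w) q - deriv (\<lambda>q. f q 1) q" "deriv (\<lambda>q. f q 1) q - a"]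
      by (simp only: diff_add_cancel add_diff_eq)
  qed
  have contr: "norm (\<Phi> w q - \<Phi> w q') \<le> 1 / 2 * norm (q - q')"
    if w: "norm (w - 1) < \<delta>" and q: "q \<in> cball z0 \<epsilon>" "q' \<in> cball z0 \<epsilon>" for w q q'
  proof (rule field_differentiable_bound[of "cball z0 \<epsilon>" _ "\<lambda>q. 1 - deriv (\<lambda>q. f q w) q / a"])
    fix z assume z: "z \<in> cball z0 \<epsilon>"
    show "(\<Phi> w has_field_derivative 1 - deriv (\<lambda>q. f q w) z / a) (at z within cball z0 \<epsilon>)"
      unfolding \<Phi>_def[abs_def]
      by (rule has_field_derivative_at_within, rule DERIV_diff[OF DERIV_ident DERIV_cdivide[OF df[OF in1[OF z]]]])
    have "1 - deriv (\<lambda>q. f q w) z / a = - (deriv (\<lambda>q. f q w) z - a) / a" using a0 by (simp add: field_simps)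
    then have "norm (1 - deriv (\<lambda>q. f q w) z / a) = norm (deriv (\<lambda>q. f q w) z - a) / norm a"
      by (simp add: norm_divide norm_minus_commute)
    also have "\<dots> \<le> 1 / 2" using dbound[OF w z] a0 by (simp add: field_simps)
    finally show "norm (1 - deriv (\<lambda>q. f q w) z / a) \<le> 1 / 2" .
  qed (use q in auto)
  have self: "\<Phi> w q \<in> cball z0 \<epsilon>" if w: "norm (w - 1) < \<delta>" and q: "q \<in> cball z0 \<epsilon>" for w q
  proof -
    have "norm (\<Phi> w q - \<Phi> w z0) \<le> 1 / 2 * norm (q - z0)" using \<epsilon> by (intro contr w q) auto
    also have "\<dots> \<le> \<epsilon> / 2" using q by (simp add: dist_norm norm_minus_commute)
    finally have 1: "norm (\<Phi> w q - \<Phi> w z0) \<le> \<epsilon> / 2" .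
    have "norm (f z0 w) < \<epsilon> * norm a / 4" using \<delta>(2)[of z0 w] w r by (simp add: z0 \<eta>_def)
    then have "norm (\<Phi> w z0 - z0) \<le> \<epsilon> / 4" using a0 by (simp add: \<Phi>_def norm_divide field_simps)
    with 1 show ?thesis using norm_triangle_ineq[of "\<Phi> w q - \<Phi> w z0" "\<Phi> w z0 - z0"] \<epsilon>
      by (simp add: dist_norm norm_minus_commute)
  qed
  have fix_eq: "\<Phi> w q = q \<longleftrightarrow> f q w = 0" for w q using a0 by (simp add: \<Phi>_def)
  have ex: "\<exists>q\<in>cball z0 \<epsilon>. f q w = 0" if w: "norm (w - 1) < \<delta>" for w
  proof -
    have "\<exists>!q\<in>cball z0 \<epsilon>. \<Phi> w q = q"
      by (rule Banach_fix[where c = "1/2"])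
         (use \<epsilon> self[OF w] contr[OF w] in \<open>auto simp: complete_eq_closed dist_norm\<close>)
    then show ?thesis unfolding fix_eq by blast
  qed
  define \<rho> where "\<rho> w = (SOME q. q \<in> cball z0 \<epsilon> \<and> f q w = 0)" for w
  have \<rho>: "\<rho> w \<in> cball z0 \<epsilon>" "f (\<rho> w) w = 0" if "norm (w - 1) < \<delta>" for w
    using someI_ex[of "\<lambda>q. q \<in> cball z0 \<epsilon> \<and> f q w = 0"] ex[OF that] unfolding \<rho>_def by blast+
  have sep: "norm a / 2 * norm (q - \<rho> w) \<le> norm (f q w)" if w: "norm (w - 1) < \<delta>" and q: "q \<in> cball z0 \<epsilon>" for w q
  proof -
    have "norm (\<Phi> w q - \<Phi> w (\<rho> w)) \<le> 1 / 2 * norm (q - \<rho> w)" by (intro contr w q \<rho>)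
    moreover have "\<Phi> w (\<rho> w) = \<rho> w" using \<rho>[OF w] by (simp add: fix_eq)
    ultimately have 1: "norm (\<Phi> w q - \<rho> w) \<le> 1 / 2 * norm (q - \<rho> w)" by simp
    have "q - \<rho> w = (\<Phi> w q - \<rho> w) + f q w / a" by (simp add: \<Phi>_def)
    then have "norm (q - \<rho> w) \<le> norm (\<Phi> w q - \<rho> w) + norm (f q w) / norm a"
      by (metis norm_divide norm_triangle_ineq)
    with 1 have "1 / 2 * norm (q - \<rho> w) \<le> norm (f q w) / norm a" by linarith
    then show ?thesis using a0 by (simp add: field_simps)
  qed
  define it where "it n w = (\<Phi> w ^^ n) z0" for n w
  have it_in: "it n w \<in> cball z0 \<epsilon>" if "norm (w - 1) < \<delta>" for n w
    unfolding it_def by (induction n) (use \<epsilon> self[OF that] in auto)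
  have it_hol: "it n holomorphic_on ball 1 \<delta>" for n
  proof (induction n)
    case 0
    show ?case by (simp add: it_def[abs_def])
  next
    case (Suc n)
    have "(\<lambda>w. f (it n w) w) holomorphic_on ball 1 \<delta>"
      by (rule compose[OF open_ball Suc]) (use in1 it_in in \<open>auto simp: dist_norm norm_minus_commute\<close>)
    then have "(\<lambda>w. it n w - f (it n w) w / a) holomorphic_on ball 1 \<delta>"
      by (intro holomorphic_intros Suc) (use a0 in auto)
    then show ?case by (simp add: it_def[abs_def] \<Phi>_def)
  qed
  have it_lim: "norm (it n w - \<rho> w) \<le> (1 / 2) ^ n * (2 * \<epsilon>)" if w: "norm (w - 1) < \<delta>" for n w
  proof (induction n)
    case 0
    show ?case using \<rho>(1)[OF w] \<epsilon> by (simp add: it_def dist_norm)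
  next
    case (Suc n)
    have "norm (\<Phi> w (it n w) - \<Phi> w (\<rho> w)) \<le> 1 / 2 * norm (it n w - \<rho> w)" by (intro contr w it_in \<rho>)
    moreover have "\<Phi> w (\<rho> w) = \<rho> w" using \<rho>[OF w] by (simp add: fix_eq)
    moreover have "it (Suc n) w = \<Phi> w (it n w)" by (simp add: it_def)
    ultimately show ?case using Suc by simp
  qed
  have "uniform_limit (ball 1 \<delta>) it \<rho> sequentially"
    unfolding uniform_limit_iff
  proof (intro allI impI)
    fix e :: real assume "e > 0"
    have "(\<lambda>n. (1 / 2) ^ n * (2 * \<epsilon>)) \<longlonglongrightarrow> 0 * (2 * \<epsilon>)"
      by (intro tendsto_intros LIMSEQ_power_zero) auto
    then have "\<forall>\<^sub>F n in sequentially. (1 / 2) ^ n * (2 * \<epsilon>) < e"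
      using \<open>e > 0\<close> by (intro order_tendstoD(2)) auto
    then show "\<forall>\<^sub>F n in sequentially. \<forall>w\<in>ball 1 \<delta>. dist (it n w) (\<rho> w) < e"
    proof eventually_elim
      case (elim n)
      show ?case
      proof
        fix w :: complex assume "w \<in> ball 1 \<delta>"
        then have "norm (w - 1) < \<delta>" by (simp add: dist_norm norm_minus_commute)
        from it_lim[OF this, of n] elim show "dist (it n w) (\<rho> w) < e" by (simp add: dist_norm)
      qed
    qed
  qed
  then have ul: "uniform_limit S it \<rho> sequentially" if "S \<subseteq> ball 1 \<delta>" for S
    using that uniform_limit_on_subset by blast
  have "\<rho> holomorphic_on ball 1 \<delta>"
  proof (rule holomorphic_uniform_sequence[OF open_ball it_hol])
    fix w assume "w \<in> ball (1::complex) \<delta>"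
    then obtain d where "d > 0" "cball w d \<subseteq> ball 1 \<delta>" by (meson open_ball open_contains_cball)
    then show "\<exists>d>0. cball w d \<subseteq> ball 1 \<delta> \<and> uniform_limit (cball w d) it \<rho> sequentially" using ul by blast
  qed
  moreover have "\<rho> 1 = z0"
    using sep[of 1 z0] \<delta> \<epsilon> a0 by (simp add: z0 mult_le_0_iff)
  ultimately show ?thesis
    using \<delta>(1) \<epsilon> a0 \<rho> sep by (intro that[of \<delta> \<epsilon> "norm a / 2" \<rho>]) (auto simp: dist_norm norm_minus_commute)
qed

text \<open>Outside a small disc around the zero the function is bounded away from 0 at \<open>w = 1\<close>, hence
  also for nearby \<open>w\<close>; inside, the local estimate applies.\<close>

lemma dominant_zero:
  assumes R: "R < 1" and z0: "norm z0 < R" "f z0 1 = 0" and a: "deriv (\<lambda>q. f q 1) z0 \<noteq> 0"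
    and uniq: "\<And>q. norm q \<le> R \<Longrightarrow> f q 1 = 0 \<Longrightarrow> q = z0" and R': "norm z0 < R'"
  obtains \<delta> \<rho> m where "0 < \<delta>" "0 < m" "\<rho> holomorphic_on ball 1 \<delta>" "\<rho> 1 = z0"
    "\<forall>w \<in> ball 1 \<delta>. norm (\<rho> w) < R' \<and> f (\<rho> w) w = 0"
    "\<forall>w \<in> ball 1 \<delta>. \<forall>q. norm q \<le> R \<longrightarrow> m * norm (q - \<rho> w) \<le> norm (f q w)"
proof -
  have z01: "norm z0 < 1" using z0 R by simp
  have "0 < min (R' - norm z0) (1 - norm z0) / 2" using R' z01 by simp
  then obtain \<delta>1 \<epsilon> \<rho> m1 where 1: "0 < \<delta>1" "0 < \<epsilon>" "\<epsilon> \<le> min (R' - norm z0) (1 - norm z0) / 2" "0 < m1"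
    "\<rho> holomorphic_on ball 1 \<delta>1" "\<rho> 1 = z0"
    "\<forall>w \<in> ball 1 \<delta>1. norm (\<rho> w - z0) \<le> \<epsilon> \<and> f (\<rho> w) w = 0"
    "\<forall>w \<in> ball 1 \<delta>1. \<forall>q. norm (q - z0) \<le> \<epsilon> \<longrightarrow> m1 * norm (q - \<rho> w) \<le> norm (f q w)"
    by (rule local_zero[OF z01 z0(2) a])
  have \<rho>b: "norm (\<rho> w) < R' \<and> norm (\<rho> w) < 1" if "w \<in> ball 1 \<delta>1" for w
    using bspec[OF 1(7) that] 1(3) R' z01 norm_triangle_ineq[of "\<rho> w - z0" z0] by simp
  define K where "K = cball 0 R - ball z0 \<epsilon>"
  have K: "compact K" "K \<subseteq> ball 0 1" using R by (auto simp: K_def intro: compact_diff)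
  obtain m2 where m2: "0 < m2" "\<And>q. q \<in> K \<Longrightarrow> m2 \<le> norm (f q 1)"
  proof (cases "K = {}")
    case False
    have "continuous_on K (\<lambda>q. norm (f q 1))"
      by (intro continuous_intros holomorphic_on_imp_continuous_on holomorphic_on_subset[OF hol_fst] K)
    then obtain k where k: "k \<in> K" "\<And>q. q \<in> K \<Longrightarrow> norm (f k 1) \<le> norm (f q 1)"
      using continuous_attains_inf[OF K(1) False] by blast
    have "f k 1 \<noteq> 0" using k(1) uniq[of k] 1(2) by (auto simp: K_def)
    then show ?thesis by (intro that[of "norm (f k 1)"] k) simp
  qed (use that[of 1] in auto)
  obtain \<delta>2 where \<delta>2: "0 < \<delta>2" "\<And>q w. q \<in> K \<Longrightarrow> norm (w - 1) < \<delta>2 \<Longrightarrow> norm (f q w - f q 1) < m2 / 2"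
    using uniformly_close[OF K, of "m2 / 2"] m2(1) by (metis half_gt_zero)
  define \<delta> where "\<delta> = min \<delta>1 \<delta>2"
  show ?thesis
  proof (rule that[of \<delta> "min m1 (m2 / 4)" \<rho>])
    show "\<rho> holomorphic_on ball 1 \<delta>" by (rule holomorphic_on_subset[OF 1(5)]) (auto simp: \<delta>_def)
    show "\<forall>w \<in> ball 1 \<delta>. \<forall>q. norm q \<le> R \<longrightarrow> min m1 (m2 / 4) * norm (q - \<rho> w) \<le> norm (f q w)"
    proof (intro ballI allI impI)
    fix w q :: complex assume w: "w \<in> ball 1 \<delta>" and q: "norm q \<le> R"
    have w1: "w \<in> ball 1 \<delta>1" using w by (auto simp: \<delta>_def)
    show "min m1 (m2 / 4) * norm (q - \<rho> w) \<le> norm (f q w)"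
    proof (cases "q \<in> K")
      case False
      then have "norm (q - z0) \<le> \<epsilon>" using q by (auto simp: K_def dist_norm norm_minus_commute)
      have "min m1 (m2 / 4) * norm (q - \<rho> w) \<le> m1 * norm (q - \<rho> w)"
        by (intro mult_right_mono) auto
      with 1(8)[rule_format, OF w1 \<open>norm (q - z0) \<le> \<epsilon>\<close>] show ?thesis by linarith
    next
      case True
      have "norm (f q w - f q 1) < m2 / 2" using w by (intro \<delta>2 True) (auto simp: \<delta>_def dist_norm norm_minus_commute)
      then have "m2 / 2 \<le> norm (f q w)"
        using m2(2)[OF True] norm_triangle_ineq2[of "f q 1" "f q 1 - f q w"] by (simp add: norm_minus_commute)
      moreover have "norm (q - \<rho> w) \<le> 2" using q R \<rho>b[OF w1] norm_triangle_ineq4[of q "\<rho> w"] by linarith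
      then have "min m1 (m2 / 4) * norm (q - \<rho> w) \<le> m2 / 4 * 2" using m2 by (intro mult_mono) auto
      ultimately show ?thesis by simp
    qed
    qed
    show "\<forall>w \<in> ball 1 \<delta>. norm (\<rho> w) < R' \<and> f (\<rho> w) w = 0"
      using 1(7) \<rho>b by (auto simp: \<delta>_def)
  qed (use 1 \<delta>2 m2 in \<open>auto simp: \<delta>_def\<close>)
qed

lemma nonvanishing_beyond:
  assumes A: "compact A" and r: "0 \<le> r" "r < 1" and nz: "\<And>q w. norm q \<le> r \<Longrightarrow> w \<in> A \<Longrightarrow> f q w \<noteq> 0"
  obtains R m where "r < R" "R < 1" "0 < m" "\<And>q w. norm q \<le> R \<Longrightarrow> w \<in> A \<Longrightarrow> m \<le> norm (f q w)"
proof (cases "A = {}")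
  case True
  then show ?thesis using that[of "(r + 1) / 2" 1] r by auto
next
  case False
  define R1 where "R1 = (r + 1) / 2"
  have R1: "r < R1" "R1 < 1" using r by (auto simp: R1_def)
  have cont': "continuous_on (cball 0 R1 \<times> A) (\<lambda>(q, w). f q w)"
    by (rule continuous_on_subset[OF cont]) (use R1 in auto)
  have c: "compact (cball (0::complex) r \<times> A)" "cball (0::complex) r \<times> A \<noteq> {}"
    using A False r by (simp_all add: compact_Times)
  have "continuous_on (cball 0 r \<times> A) (\<lambda>p. norm (case_prod f p))"
    by (intro continuous_on_norm continuous_on_subset[OF cont']) (use R1 in auto)
  from continuous_attains_inf[OF c this]
  obtain p where p: "p \<in> cball 0 r \<times> A" "\<forall>p'\<in>cball 0 r \<times> A. norm (case_prod f p) \<le> norm (case_prod f p')"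
    by (rule bexE)
  define m where "m = norm (case_prod f p)"
  have m: "0 < m" using p(1) nz by (auto simp: m_def)
  have "uniformly_continuous_on (cball 0 R1 \<times> A) (\<lambda>(q, w). f q w)"
    by (intro compact_uniformly_continuous cont' compact_Times A) auto
  then obtain d where d: "d > 0"
    "\<And>x y. x \<in> cball 0 R1 \<times> A \<Longrightarrow> y \<in> cball 0 R1 \<times> A \<Longrightarrow> dist y x < d \<Longrightarrow> dist (case_prod f y) (case_prod f x) < m / 2"
    using m unfolding uniformly_continuous_on_def by (metis half_gt_zero)
  define R where "R = min R1 (r + d / 2)"
  show ?thesis
  proof (rule that[of R "m / 2"])
    fix q w :: complex assume q: "norm q \<le> R" and w: "w \<in> A"
    obtain q' where q': "norm q' \<le> r" "dist q' q < d"
    proof (cases "norm q \<le> r")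
      case True then show ?thesis using that[of q] d by auto
    next
      case False
      then have z0: "norm q > r" "q \<noteq> 0" using r by auto
      define q' where "q' = of_real (r / norm q) * q"
      have n: "norm q' = r" unfolding q'_def norm_mult norm_of_real using z0 r by simp
      have "q - q' = of_real (1 - r / norm q) * q" by (simp add: q'_def algebra_simps)
      then have "norm (q - q') = \<bar>1 - r / norm q\<bar> * norm q" by (simp only: norm_mult norm_of_real)
      also have "\<dots> = norm q - r" using z0 r by (simp add: abs_of_nonneg algebra_simps)
      also have "\<dots> < d" using q d by (simp add: R_def)
      finally show ?thesis using that[of q'] n by (simp add: dist_norm norm_minus_commute)
    qed
    have "dist (case_prod f (q', w)) (case_prod f (q, w)) < m / 2"
      by (rule d) (use q q' w R1 in \<open>auto simp: R_def dist_Pair_Pair\<close>)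
    moreover have "m \<le> norm (f q' w)" using bspec[OF p(2), of "(q', w)"] q' w by (simp add: m_def)
    ultimately show "m / 2 \<le> norm (f q w)"
      using norm_triangle_ineq2[of "f q' w" "f q' w - f q w"] by (simp add: dist_norm)
  qed (use R1 d m in \<open>auto simp: R_def\<close>)
qed

end

section \<open>The dominant zero\<close>

text \<open>A function that is closer to \<open>1 - 2 * q\<close> than to 0 on the circle has a single zero inside,
  counted with multiplicity.\<close>

lemma unique_zero_by_Rouche:
  assumes hol: "h holomorphic_on ball 0 1" and r: "1 / 2 < r" "r < 1"
    and close: "\<And>q. norm q = r \<Longrightarrow> norm (h q - (1 - 2 * q)) < norm (1 - 2 * q)"
    and p: "norm p1 < r" "h p1 = 0" "norm p2 < r" "h p2 = 0"
  shows "p1 = p2"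
proof (rule ccontr)
  assume ne: "p1 \<noteq> p2"
  define R where "R = (1 + r) / 2"
  have R: "r < R" "R < 1" using r by (auto simp: R_def)
  define s where "s = ball (0::complex) R"
  define g where "g q = h q - (1 - 2 * q)" for q
  have sub: "s \<subseteq> ball 0 1" using R by (auto simp: s_def)
  have hr: "h q \<noteq> 0" if "norm q = r" for q using close[OF that] by (auto simp: norm_minus_commute)
  have r_in: "complex_of_real r \<in> ball 0 1" "norm (complex_of_real r) = r" using r by auto
  have nz: "\<forall>\<^sub>F w in at p. h w \<noteq> 0" if "p \<in> ball 0 1" for p
    using non_zero_neighbour_alt[OF hol open_ball connected_ball that r_in(1) hr[OF r_in(2)]]
    by eventually_elim auto
  have "\<not> h constant_on ball 0 1"
  proof
    assume "h constant_on ball 0 1"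
    then have "h (of_real r) = h p1" using r_in p r by (auto simp: constant_on_def)
    with hr[OF r_in(2)] p show False by simp
  qed
  then have "finite {z \<in> cball 0 R. h z = 0}"
    by (intro holomorphic_compact_finite_zeros[OF hol open_ball connected_ball]) (use R in auto)
  then have fin: "finite {z \<in> s. h z = 0}"
    by (rule rev_finite_subset) (auto simp: s_def)
  have half: "{z \<in> s. 1 - 2 * z = 0} = {1 / 2}"
    using r R by (auto simp: s_def field_simps)
  have eq: "(\<lambda>q. (1 - 2 * q) + g q) = h" by (simp add: g_def)
  have path: "path_image (circlepath 0 r) = sphere 0 r" using r by simp
  have wz: "winding_number (circlepath 0 r) z = 0" if "norm z > r" for z
    by (rule winding_number_zero_outside[of _ "cball 0 r"]) (use that r path in auto)
  have w1: "winding_number (circlepath 0 r) z = 1" if "norm z < r" for z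
    by (rule winding_number_circlepath) (use that in simp)
  have "(\<Sum>p\<in>{p \<in> s. (1 - 2 * p) + g p = 0}. winding_number (circlepath 0 r) p * zorder (\<lambda>p. (1 - 2 * p) + g p) p)
    = (\<Sum>p\<in>{p \<in> s. 1 - 2 * p = 0}. winding_number (circlepath 0 r) p * zorder (\<lambda>p. 1 - 2 * p) p)"
  proof (rule Rouche_theorem)
    show "finite {p \<in> s. (1 - 2 * p) + g p = 0}" using fin unfolding fun_cong[OF eq] .
    show "finite {p \<in> s. 1 - 2 * p = 0}" unfolding half by simp
    show "g holomorphic_on s" unfolding g_def by (intro holomorphic_intros holomorphic_on_subset[OF hol sub])
    show "path_image (circlepath 0 r) \<subseteq> s" unfolding path using R by (auto simp: s_def)
    show "\<forall>z\<in>path_image (circlepath 0 r). norm (g z) < norm (1 - 2 * z)"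
      unfolding path g_def using close by auto
    show "\<forall>z. z \<notin> s \<longrightarrow> winding_number (circlepath 0 r) z = 0" using R by (auto simp: s_def intro!: wz)
  qed (auto simp: s_def intro!: holomorphic_intros)
  also have "\<dots> = 1"
  proof -
    have "zorder (\<lambda>p. 1 - 2 * p) (1 / 2 :: complex) = 1"
      by (rule zorder_zero_eqI[of _ UNIV]) (auto intro!: holomorphic_intros)
    then show ?thesis unfolding half using w1[of "1/2"] r by simp
  qed
  finally have sum1: "(\<Sum>p\<in>{p \<in> s. h p = 0}. winding_number (circlepath 0 r) p * zorder h p) = 1"
    unfolding fun_cong[OF eq] eq .
  have wterm: "winding_number (circlepath 0 r) p * zorder h p = of_int (if norm p < r then zorder h p else 0)"
    if "p \<in> {p \<in> s. h p = 0}" for p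
    using that hr[of p] wz[of p] w1[of p] by (cases "norm p < r") (auto simp: not_less le_less)
  have pos: "1 \<le> zorder h p" if "norm p < r" "h p = 0" for p
  proof -
    have pb: "p \<in> ball 0 1" using that r by simp
    then have "h analytic_on {p}" using hol by (meson analytic_at open_ball)
    moreover have "frequently (\<lambda>z. h z \<noteq> 0) (at p)" using eventually_frequently[OF _ nz[OF pb]] by simp
    ultimately have "zorder h p > 0" using zorder_pos_iff'[of h p] that by simp
    then show ?thesis by simp
  qed
  have "(\<Sum>p\<in>{p \<in> s. h p = 0}. if norm p < r then zorder h p else 0) = 1"
  proof -
    have "of_int (\<Sum>p\<in>{p \<in> s. h p = 0}. if norm p < r then zorder h p else 0) = (1 :: complex)"
      unfolding of_int_sum by (rule trans[OF sum.cong[OF refl wterm[symmetric]] sum1])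
    then show ?thesis by (metis of_int_eq_1_iff)
  qed
  moreover have "(\<Sum>p\<in>{p1, p2}. if norm p < r then zorder h p else 0)
      \<le> (\<Sum>p\<in>{p \<in> s. h p = 0}. if norm p < r then zorder h p else 0)"
  proof (rule sum_mono2[OF fin])
    fix q assume "q \<in> {p \<in> s. h p = 0} - {p1, p2}"
    then show "0 \<le> (if norm q < r then zorder h q else 0)" using pos[of q] by auto
  qed (use p R in \<open>auto simp: s_def\<close>)
  ultimately show False using pos[OF p(1,2)] pos[OF p(3,4)] ne p by simp
qed

text \<open>The coefficients of \<open>(1 - q) * den t q w\<close>. Clearing the denominator of the first coefficient
  leaves a linear leading part \<open>1 - 2 * q\<close> at \<open>w = 1\<close>.\<close>

definition lin_coeff :: "nat \<Rightarrow> nat \<Rightarrow> 'a::real_normed_field \<Rightarrow> 'a" where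
  "lin_coeff t j q = (1 - q) * alt_coeff t j q"

lemma lin_coeff_0: "lin_coeff t 0 q = 1 - q"
  by (simp add: lin_coeff_def)

lemma br_1 [simp]: "br t (Suc 0) = 1"
  by (simp add: br_def)

lemma lin_coeff_1: "q \<noteq> 1 \<Longrightarrow> lin_coeff t (Suc 0) q = q"
  by (simp add: lin_coeff_def alt_coeff_Suc geo_ratio_def)

lemma lin_coeff_Suc: "lin_coeff t (Suc j) q = lin_coeff t j q * geo_ratio t (Suc j) q"
  by (simp add: lin_coeff_def alt_coeff_Suc)

lemma of_real_lin_coeff: "of_real (lin_coeff t j x) = (lin_coeff t j (of_real x) :: 'a::real_normed_field)"
  by (simp add: lin_coeff_def of_real_alt_coeff)

lemma lin_coeff_nonneg:
  fixes x :: real assumes "0 < t" "0 \<le> x" "x < 1" shows "0 \<le> lin_coeff t j x"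
  using alt_coeff_nonneg[OF assms] assms by (simp add: lin_coeff_def)

lemma lin_coeff_mono:
  fixes x y :: real assumes "0 < t" "0 \<le> x" "x \<le> y" "y < 1"
  shows "lin_coeff t (Suc j) x \<le> lin_coeff t (Suc j) y"
proof (induction j)
  case 0
  show ?case using assms by (simp add: lin_coeff_1)
next
  case (Suc j)
  show ?case unfolding lin_coeff_Suc[of t "Suc j"]
    by (intro mult_mono Suc geo_ratio_mono lin_coeff_nonneg geo_ratio_nonneg) (use assms in auto)
qed

lemma norm_lin_coeff_le:
  fixes q :: "'a::real_normed_field"
  assumes "0 < t" "norm q < 1" shows "norm (lin_coeff t (Suc j) q) \<le> lin_coeff t (Suc j) (norm q)"
proof (induction j)
  case 0
  have "q \<noteq> 1" "norm q \<noteq> 1" using assms by auto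
  then show ?case by (simp add: lin_coeff_1)
next
  case (Suc j)
  show ?case unfolding lin_coeff_Suc[of t "Suc j"] norm_mult
    by (intro mult_mono Suc norm_geo_ratio_le lin_coeff_nonneg) (use assms in auto)
qed

lemma dominated_lin: assumes "0 < t" shows "dominated t (lin_coeff t)"
  unfolding dominated_def
proof (intro conjI allI impI)
  show "lin_coeff t j holomorphic_on ball 0 1" for j :: nat
    unfolding lin_coeff_def by (intro holomorphic_intros alt_coeff_holomorphic assms)
  fix j and q :: complex assume q: "norm q < 1"
  have "norm (1 - q) \<le> 2" using q norm_triangle_ineq4[of 1 q] by simp
  then show "norm (lin_coeff t j q) \<le> 2 * alt_coeff t j (norm q)"
    unfolding lin_coeff_def norm_mult by (intro mult_mono norm_alt_coeff_le assms q) auto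
qed (rule assms)

lemma wser_lin: assumes "0 < t" "norm q < 1" shows "wser (lin_coeff t) q w = (1 - q) * den t q w"
  unfolding wser_def den_def lin_coeff_def
  using suminf_mult[OF wser_summable(2)[OF dominated_den assms(2)], OF assms(1), of "1 - q" w]
  by (simp add: mult_ac)

lemma geo_ratio_antimono:
  fixes x :: real assumes "0 < t" "0 \<le> x" "x < 1" "i \<le> j" shows "geo_ratio t (Suc j) x \<le> geo_ratio t (Suc i) x"
proof -
  have "br t (Suc i) \<le> br t (Suc j)" unfolding br_def by (rule sum_mono2) (use assms in auto)
  then have le: "x ^ br t (Suc j) \<le> x ^ br t (Suc i)" using assms by (intro power_decreasing) auto
  show ?thesis unfolding geo_ratio_def
    by (rule frac_le) (use le assms power_br_bound(3)[OF assms(1-3)] in auto)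
qed

text \<open>The terms from the third on are dominated by a geometric series.\<close>

lemma lin_coeff_geometric:
  fixes x :: real assumes "0 < t" "0 \<le> x" "x < 1"
  shows "lin_coeff t (j + k) x \<le> lin_coeff t k x * geo_ratio t (Suc k) x ^ j"
proof (induction j)
  case (Suc j)
  have "lin_coeff t (Suc j + k) x = lin_coeff t (j + k) x * geo_ratio t (Suc (j + k)) x"
    by (simp add: lin_coeff_Suc)
  also have "\<dots> \<le> (lin_coeff t k x * geo_ratio t (Suc k) x ^ j) * geo_ratio t (Suc k) x"
    by (intro mult_mono Suc geo_ratio_antimono geo_ratio_nonneg mult_nonneg_nonneg lin_coeff_nonneg zero_le_power)
       (use assms in auto)
  finally show ?case by (simp add: mult_ac)
qed simp

lemma wser_lin_split:
  fixes q :: complex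
  assumes "0 < t" "norm q < 1"
  shows "wser (lin_coeff t) q 1 = (1 - 2 * q) + (\<Sum>j. (- 1) ^ j * lin_coeff t (j + 2) q)"
proof -
  have "q \<noteq> 1" using assms by auto
  then show ?thesis
    unfolding wser_def using suminf_split_initial_segment[OF wser_summable(2)[OF dominated_lin[OF assms(1)] assms(2)], of 1 2]
    by (simp add: numeral_2_eq_2 lin_coeff_0 lin_coeff_1)
qed

lemma tail_bound:
  fixes q :: complex
  assumes t: "0 < t" and q: "norm q \<le> x" "x < 1" and g: "geo_ratio t 3 x < 1"
  shows "norm (\<Sum>j. (- 1) ^ j * lin_coeff t (j + 2) q) \<le> lin_coeff t 2 x / (1 - geo_ratio t 3 x)"
proof -
  have x: "0 \<le> x" using q order_trans[OF norm_ge_zero] by blast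
  have g0: "0 \<le> geo_ratio t 3 x" using geo_ratio_nonneg[OF t x q(2), of 2] by (simp add: numeral_3_eq_3)
  have sm: "summable (\<lambda>j. lin_coeff t 2 x * geo_ratio t 3 x ^ j)"
    using g g0 by (intro summable_mult summable_geometric) auto
  have b: "norm ((- 1) ^ j * lin_coeff t (j + 2) q) \<le> lin_coeff t 2 x * geo_ratio t 3 x ^ j" for j
  proof -
    have "norm ((- 1) ^ j * lin_coeff t (j + 2) q) = norm (lin_coeff t (Suc (Suc j)) q)" by (simp add: norm_mult norm_power)
    also have "\<dots> \<le> lin_coeff t (Suc (Suc j)) (norm q)" by (rule norm_lin_coeff_le) (use t q in auto)
    also have "\<dots> \<le> lin_coeff t (Suc (Suc j)) x" by (rule lin_coeff_mono) (use t q in auto)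
    also have "\<dots> \<le> lin_coeff t 2 x * geo_ratio t 3 x ^ j"
      using lin_coeff_geometric[OF t x q(2), of j 2] by (simp add: numeral_3_eq_3)
    finally show ?thesis .
  qed
  have "norm (\<Sum>j. (- 1) ^ j * lin_coeff t (j + 2) q) \<le> (\<Sum>j. lin_coeff t 2 x * geo_ratio t 3 x ^ j)"
    by (rule norm_suminf_le[OF b sm])
  also have "\<dots> = lin_coeff t 2 x / (1 - geo_ratio t 3 x)"
    using suminf_mult[of "\<lambda>j. geo_ratio t 3 x ^ j" "lin_coeff t 2 x"] suminf_geometric[of "geo_ratio t 3 x"]
      summable_geometric[of "geo_ratio t 3 x"] g g0 by simp
  finally show ?thesis .
qed

lemma br_2: "br t 2 = t + 1"
  by (simp add: br_def numeral_2_eq_2)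

lemma br_3: "br t 3 = t ^ 2 + t + 1"
  by (simp add: br_def numeral_3_eq_3 numeral_2_eq_2)

lemma lin_coeff_2: "q \<noteq> 1 \<Longrightarrow> lin_coeff t 2 q = q * (q ^ (t + 1) / (1 - q ^ (t + 1)))"
  using lin_coeff_Suc[of t 1 q] by (simp add: numeral_2_eq_2 lin_coeff_1 geo_ratio_def br_2[unfolded numeral_2_eq_2])

lemma exp_minus_072: "exp (- 0.72 :: real) \<le> 0.4868"
proof -
  have "(\<Sum>k<7. inverse (fact k) *\<^sub>R (0.72 :: real) ^ k) \<le> exp 0.72"
    unfolding exp_def by (intro sum_le_suminf summable_exp_generic) auto
  then have "2.0544 \<le> exp (0.72 :: real)"
    by (simp add: numeral_eq_Suc fact_numeral)
  then show ?thesis by (simp add: exp_minus field_simps)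
qed

text \<open>For large \<open>t\<close> the radius \<open>r\<close> satisfies \<open>r ^ t \<le> exp (- 0.72)\<close>,
  which is just small enough; the cases \<open>t = 2\<close> and \<open>t = 3\<close> are computed.\<close>

lemma disc_radius_tail:
  assumes "2 \<le> t"
  defines "r \<equiv> 1 - 0.72 / real t"
  shows "geo_ratio t 3 r < 1" "lin_coeff t 2 r / (1 - geo_ratio t 3 r) < 2 * r - 1"
proof -
  have r: "0 < r" "r < 1" using assms by (auto simp: r_def field_simps)
  consider "t = 2" | "t = 3" | "4 \<le> t" using assms by linarith
  then have "geo_ratio t 3 r < 1 \<and> lin_coeff t 2 r / (1 - geo_ratio t 3 r) < 2 * r - 1"
  proof cases
    case 1
    have r': "r = 16 / 25" using 1 by (simp add: r_def)
    show ?thesis unfolding r' 1 by (simp add: lin_coeff_2 geo_ratio_def br_3 power_divide)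
  next
    case 2
    have r': "r = 19 / 25" using 2 by (simp add: r_def)
    show ?thesis unfolding r' 2 by (simp add: lin_coeff_2 geo_ratio_def br_3 power_divide)
  next
    case 3
    have r82: "0.82 \<le> r" using 3 by (simp add: r_def field_simps)
    define e where "e = (0.4868 :: real)"
    have "ln r \<le> - 0.72 / t" using ln_le_minus_one[OF r(1)] by (simp add: r_def)
    then have "t * ln r \<le> - 0.72" using assms by (simp add: field_simps)
    then have "exp (t * ln r) \<le> exp (- 0.72)" by simp
    then have rt: "r ^ t \<le> e" using exp_minus_072 r by (simp add: e_def exp_of_nat_mult)
    have y: "r ^ (t + 1) \<le> r * e" using mult_left_mono[OF rt, of r] r by simp
    have z: "r ^ br t 3 \<le> 0.02734"
    proof -
      have "r ^ br t 3 = r * (r ^ t) ^ (t + 1)" by (simp add: br_3 power_mult[symmetric] power2_eq_square power_add algebra_simps)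
      also have "\<dots> \<le> 1 * (r ^ t) ^ (t + 1)" using r by (intro mult_right_mono) auto
      also have "(r ^ t) ^ (t + 1) \<le> e ^ (t + 1)" using rt r by (intro power_mono) auto
      also have "e ^ (t + 1) \<le> e ^ 5" using 3 by (intro power_decreasing) (auto simp: e_def)
      also have "\<dots> \<le> 0.02734" by (simp add: e_def power_divide)
      finally show ?thesis by simp
    qed
    have g: "geo_ratio t 3 r \<le> 0.02811"
    proof -
      have "geo_ratio t 3 r \<le> 0.02734 / (1 - 0.02734)"
        unfolding geo_ratio_def by (rule frac_le) (use z in auto)
      then show ?thesis by simp
    qed
    have "lin_coeff t 2 r \<le> r * (r * e / (1 - r * e))"
    proof -
      have "r * e < 1" using r by (simp add: e_def)
      then have "r ^ (t + 1) / (1 - r ^ (t + 1)) \<le> r * e / (1 - r * e)"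
        using y r by (intro frac_le) (auto simp: e_def)
      moreover have "lin_coeff t 2 r = r * (r ^ (t + 1) / (1 - r ^ (t + 1)))"
        by (rule lin_coeff_2) (use r in auto)
      ultimately show ?thesis using mult_left_mono[of _ _ r] r by (simp only: less_imp_le)
    qed
    moreover have "0 \<le> r * (r * e / (1 - r * e))" using r by (simp add: e_def)
    ultimately have "lin_coeff t 2 r / (1 - geo_ratio t 3 r) \<le> r * (r * e / (1 - r * e)) / (1 - 0.02811)"
      using g by (intro frac_le) auto
    also have "\<dots> < 2 * r - 1"
    proof -
      have "0 \<le> (1 - r) * (r - 0.82)" using r r82 by simp
      then have "r * r \<le> 1.82 * r - 0.82" by (simp add: field_simps)
      then have "0 < - 0.97189 + 2.416896052 * r - 1.433032104 * (r * r)" using r by simp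
      also have "\<dots> = (2 * r - 1) * ((1 - 0.02811) * (1 - r * e)) - r * (r * e)"
        by (simp add: e_def field_simps)
      finally have "r * (r * e) < (2 * r - 1) * ((1 - 0.02811) * (1 - r * e))" by simp
      moreover have "0 < (1 - 0.02811) * (1 - r * e)" using r by (simp add: e_def)
      ultimately show ?thesis by (simp add: field_simps)
    qed
    finally show ?thesis using g by simp
  qed
  then show "geo_ratio t 3 r < 1" "lin_coeff t 2 r / (1 - geo_ratio t 3 r) < 2 * r - 1" by auto
qed

lemma zero_unique:
  assumes t: "2 \<le> t" and p: "norm p1 < 1 - 0.72 / real t" "den t p1 1 = 0" "norm p2 < 1 - 0.72 / real t" "den t p2 1 = 0"
  shows "p1 = p2"
proof -
  define r where "r = 1 - 0.72 / real t"
  have t0: "0 < t" using t by simp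
  have r: "1 / 2 < r" "r < 1" using t by (auto simp: r_def field_simps)
  have p1: "norm p1 < 1" "norm p2 < 1" using p r unfolding r_def[symmetric] by linarith+
  show ?thesis
  proof (rule unique_zero_by_Rouche[where h = "\<lambda>q. wser (lin_coeff t) q 1" and r = r])
    show "(\<lambda>q. wser (lin_coeff t) q 1) holomorphic_on ball 0 1"
      by (rule wser_compose_derivative(1)[OF dominated_lin[OF t0] open_ball holomorphic_on_ident holomorphic_on_const]) auto
    fix q :: complex assume q: "norm q = r"
    have "norm (wser (lin_coeff t) q 1 - (1 - 2 * q)) = norm (\<Sum>j. (- 1) ^ j * lin_coeff t (j + 2) q)"
      using wser_lin_split[OF t0, of q] q r by simp
    also have "\<dots> \<le> lin_coeff t 2 r / (1 - geo_ratio t 3 r)"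
      by (rule tail_bound[OF t0]) (use q r disc_radius_tail[OF t] in \<open>auto simp: r_def\<close>)
    also have "\<dots> < 2 * r - 1" using disc_radius_tail[OF t] by (simp add: r_def)
    also have "\<dots> \<le> norm (1 - 2 * q)" using norm_triangle_ineq2[of "2 * q" 1] q by (simp add: norm_minus_commute norm_mult)
    finally show "norm (wser (lin_coeff t) q 1 - (1 - 2 * q)) < norm (1 - 2 * q)" .
  qed (use p p1 r t0 wser_lin[OF t0, of p1 1] wser_lin[OF t0, of p2 1] in \<open>auto simp: r_def\<close>)
qed

definition real_lin :: "nat \<Rightarrow> real \<Rightarrow> real" where
  "real_lin t x = (\<Sum>j. (- 1) ^ j * lin_coeff t j x)"

lemma real_lin_sums:
  assumes "0 < t" "0 \<le> x" "x < 1"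
  shows "(\<lambda>j. (- 1) ^ j * lin_coeff t j x) sums real_lin t x"
    and "of_real (real_lin t x) = wser (lin_coeff t) (of_real x) 1"
proof -
  have "summable (\<lambda>j. norm ((- 1 :: complex) ^ j * lin_coeff t j (of_real x)))"
    by (rule wser_summable(1)[OF dominated_lin[OF assms(1)]]) (use assms in auto)
  then have "summable (\<lambda>j. norm ((- 1) ^ j * lin_coeff t j x))"
    by (simp add: norm_mult norm_power abs_mult power_abs flip: of_real_lin_coeff)
  then have "summable (\<lambda>j. (- 1) ^ j * lin_coeff t j x)" by (rule summable_norm_cancel)
  then show s: "(\<lambda>j. (- 1) ^ j * lin_coeff t j x) sums real_lin t x"
    unfolding real_lin_def by (rule summable_sums)
  from sums_of_real[OF s, where 'a = complex] show "of_real (real_lin t x) = wser (lin_coeff t) (of_real x) 1"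
    by (simp add: wser_def sums_iff of_real_lin_coeff)
qed

lemma lin_coeff_decreasing:
  fixes x :: real
  assumes "0 < t" "0 \<le> x" "x < 1" "geo_ratio t 3 x \<le> 1" "2 \<le> j"
  shows "lin_coeff t (Suc j) x \<le> lin_coeff t j x"
proof -
  have "geo_ratio t (Suc j) x \<le> geo_ratio t (Suc 2) x" using assms by (intro geo_ratio_antimono) auto
  then have "geo_ratio t (Suc j) x \<le> 1" using assms(4) by (simp add: numeral_3_eq_3)
  then show ?thesis unfolding lin_coeff_Suc using lin_coeff_nonneg[OF assms(1-3), of j] by (intro mult_left_le) auto
qed

text \<open>The alternating series changes its sign between 1/2 and 0.56.\<close>

theorem real_zero:
  assumes t: "2 \<le> t"
  obtains z :: real where "1 / 2 \<le> z" "z \<le> 0.56" "real_lin t z = 0"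
proof -
  have t0: "0 < t" using t by simp
  have alt: "1 - 2 * x \<le> real_lin t x \<and> real_lin t x \<le> 1 - 2 * x + lin_coeff t 2 x" if x: "1 / 2 \<le> x" "x \<le> 0.56" for x :: real
  proof -
    have g: "geo_ratio t 3 x \<le> 1"
    proof -
      have "x ^ br t 3 \<le> x ^ 1" using x by (intro power_decreasing) (auto simp: br_3)
      then have "geo_ratio t 3 x \<le> x ^ 3 / (1 - x)" using geo_ratio_le_power[of t x 2] t0 x by (simp add: numeral_3_eq_3)
      also have "x ^ 3 / (1 - x) \<le> 0.56 ^ 3 / (1 - 0.56)" using x by (intro frac_le power_mono) auto
      also have "\<dots> \<le> 1" by (simp add: power_divide)
      finally show ?thesis .
    qed
    have s: "(\<lambda>j. (- 1) ^ j * lin_coeff t j x) sums real_lin t x" using t0 x by (intro real_lin_sums) auto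
    have "(\<lambda>j. (- 1) ^ (j + 2) * lin_coeff t (j + 2) x) sums (real_lin t x - (\<Sum>j<2. (- 1) ^ j * lin_coeff t j x))"
      using sums_split_initial_segment[OF s, of 2] by simp
    then have s2: "(\<lambda>j. (- 1) ^ j * lin_coeff t (j + 2) x) sums (real_lin t x - (1 - 2 * x))"
      using x by (simp add: numeral_2_eq_2 lin_coeff_0 lin_coeff_1 algebra_simps)
    have nn: "0 \<le> lin_coeff t (j + 2) x" for j using t0 x by (intro lin_coeff_nonneg) auto
    have "(\<lambda>j. \<bar>(- 1) ^ j * lin_coeff t (j + 2) x\<bar>) \<longlonglongrightarrow> 0"
      by (rule tendsto_rabs_zero[OF summable_LIMSEQ_zero[OF sums_summable[OF s2]]])
    then have lim: "(\<lambda>j. lin_coeff t (j + 2) x) \<longlonglongrightarrow> 0"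
      by (simp only: abs_mult power_abs abs_neg_one power_one mult_1 abs_of_nonneg[OF nn])
    have mono: "lin_coeff t (Suc j + 2) x \<le> lin_coeff t (j + 2) x" for j
      using lin_coeff_decreasing[of t x "j + 2"] t0 x g by simp
    have e: "real_lin t x - (1 - 2 * x) = (\<Sum>j. (- 1) ^ j * lin_coeff t (j + 2) x)" using s2 by (simp add: sums_iff)
    show ?thesis
      using summable_Leibniz'(2)[OF lim nn mono, of 0] summable_Leibniz'(4)[OF lim nn mono, of 0]
      unfolding e[symmetric] by (simp add: numeral_2_eq_2)
  qed
  have c: "continuous_on {1/2..0.56} (real_lin t)"
  proof -
    have "continuous_on (ball 0 1) (\<lambda>q. wser (lin_coeff t) q 1)"
      by (intro holomorphic_on_imp_continuous_on wser_compose_derivative(1)[OF dominated_lin[OF t0] open_ball holomorphic_on_ident holomorphic_on_const]) auto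
    then have "continuous_on {1/2..0.56} (\<lambda>x. Re (wser (lin_coeff t) (of_real x) 1))"
      by (intro continuous_intros continuous_on_compose2[of "ball 0 1" _ _ complex_of_real]) auto
    moreover have "Re (wser (lin_coeff t) (of_real x) 1) = real_lin t x" if "x \<in> {1/2..0.56}" for x
      using real_lin_sums(2)[of t x, symmetric] t0 that by simp
    ultimately show ?thesis by (rule continuous_on_eq)
  qed
  have lo: "0 \<le> real_lin t (1/2)" using alt[of "1/2"] by simp
  have hi: "real_lin t 0.56 \<le> 0"
  proof -
    have "(0.56 :: real) ^ (t + 1) \<le> 0.56 ^ 3" using t by (intro power_decreasing) auto
    then have "(0.56 :: real) ^ (t + 1) / (1 - 0.56 ^ (t + 1)) \<le> 0.56 ^ 3 / (1 - 0.56 ^ 3)"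
      by (intro frac_le) (auto simp: power_divide)
    then have "0.56 * ((0.56 :: real) ^ (t + 1) / (1 - 0.56 ^ (t + 1))) \<le> 0.56 * (0.56 ^ 3 / (1 - 0.56 ^ 3))"
      by (rule mult_left_mono) simp
    moreover have "lin_coeff t 2 (0.56 :: real) = 0.56 * (0.56 ^ (t + 1) / (1 - 0.56 ^ (t + 1)))"
      by (rule lin_coeff_2) simp
    ultimately have "lin_coeff t 2 (0.56 :: real) \<le> 0.56 * (0.56 ^ 3 / (1 - 0.56 ^ 3))" by (simp only:)
    also have "\<dots> \<le> 0.12" by (simp add: power_divide)
    finally show ?thesis using alt[of "0.56"] by simp
  qed
  obtain z where "1/2 \<le> z" "z \<le> 0.56" "real_lin t z = 0"
    using IVT2'[of "real_lin t" "0.56" 0 "1/2"] lo hi c by auto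
  then show ?thesis using that by blast
qed

theorem dominant_pole:
  assumes t: "2 \<le> t"
  obtains z :: real where "1 / 2 \<le> z" "z \<le> 0.56" "real_lin t z = 0" "q0 t = of_real z" "den t (of_real z) 1 = 0"
    "\<And>q. norm q < 1 - 0.72 / real t \<Longrightarrow> den t q 1 = 0 \<Longrightarrow> q = of_real z"
proof -
  have t0: "0 < t" using t by simp
  obtain z where z: "1 / 2 \<le> z" "z \<le> 0.56" "real_lin t z = 0" using real_zero[OF t] .
  have "wser (lin_coeff t) (of_real z) 1 = 0"
    using real_lin_sums(2)[of t z] t0 z by simp
  then have d: "den t (of_real z) 1 = 0" using wser_lin[of t "of_real z" 1] t0 z by simp
  have "0.72 / real t \<le> 0.72 / 2" using t by (intro divide_left_mono) auto
  then have zr: "norm (complex_of_real z) < 1 - 0.72 / real t" using z by simp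
  have uniq: "q = of_real z" if "norm q < 1 - 0.72 / real t" "den t q 1 = 0" for q
    using zero_unique[OF t that zr d] .
  have r1: "1 - 0.72 / real t < 1" using t by simp
  have "q0 t = of_real z"
    unfolding q0_def
  proof (rule the_equality)
    show "norm (complex_of_real z) < 1 - 0.72 / real t \<and> 1 - b t (of_real z) 1 = 0"
      using zr d den_eq[of "of_real z" t 1] t0 z by simp
    fix q assume q: "norm q < 1 - 0.72 / real t \<and> 1 - b t q 1 = 0"
    then have "norm q < 1" using r1 by linarith
    then show "q = of_real z" using q uniq[of q] den_eq[of q t 1] t0 by simp
  qed
  with z d uniq show ?thesis using that by blast
qed

section \<open>Asymptotics of the profile polynomials\<close>

lemma analytic_family_wser:
  assumes "dominated t u" shows "analytic_family (wser u)"
  by unfold_locales (auto intro: wser_compose_derivative(1)[OF assms] wser_continuous[OF assms])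

text \<open>Otherwise the pole might cancel. The terms of the numerator after the constant 1 add up to less than 1.\<close>

lemma num_nonzero:
  assumes t: "2 \<le> t" and q: "norm q \<le> 0.56" and w: "norm w = 1"
  shows "num t q w \<noteq> 0"
proof -
  define x :: real where "x = 0.56"
  have t0: "0 < t" using t by simp
  have x: "0 \<le> x" "x < 1" "norm q \<le> x" using q by (auto simp: x_def)
  define a where "a j = alt_coeff t (Suc j) x * x ^ br t (Suc j)" for j
  have a0: "a 0 \<le> 0.7128" by (simp add: a_def alt_coeff_Suc geo_ratio_def x_def power_divide)
  have ann: "0 \<le> a j" for j unfolding a_def using alt_coeff_nonneg[OF t0 x(1,2)] x by simp
  have step: "a (Suc j) \<le> a j * 0.1" for j
  proof -
    have b3: "3 \<le> br t (Suc (Suc j))" using t by (simp add: br_Suc_mult)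
    have "geo_ratio t (Suc (Suc j)) x \<le> geo_ratio t 2 x"
      using geo_ratio_antimono[OF t0 x(1,2), of 1 "Suc j"] by (simp add: numeral_2_eq_2)
    also have "\<dots> \<le> x ^ 3 / (1 - x ^ 3)"
    proof -
      have "x ^ br t 2 \<le> x ^ 3" using x t by (intro power_decreasing) (auto simp: br_2)
      then show ?thesis unfolding geo_ratio_def by (intro frac_le) (auto simp: x_def power_divide)
    qed
    finally have g: "geo_ratio t (Suc (Suc j)) x \<le> 0.3" by (simp add: x_def power_divide)
    have "x ^ t ^ Suc j \<le> x ^ 2"
    proof (rule power_decreasing)
      have "t ^ 1 \<le> t ^ Suc j" by (rule power_increasing) (use t in auto)
      with t show "2 \<le> t ^ Suc j" unfolding power_one_right by linarith
    qed (use x in auto)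
    also have "\<dots> \<le> 0.33" by (simp add: x_def power_divide)
    finally have "geo_ratio t (Suc (Suc j)) x * x ^ t ^ Suc j \<le> 0.3 * 0.33"
      using g geo_ratio_nonneg[OF t0 x(1,2), of "Suc j"] x by (intro mult_mono) auto
    then have "geo_ratio t (Suc (Suc j)) x * x ^ t ^ Suc j \<le> 0.1" by simp
    then have "a j * (geo_ratio t (Suc (Suc j)) x * x ^ t ^ Suc j) \<le> a j * 0.1"
      by (rule mult_left_mono[OF _ ann])
    moreover have "a (Suc j) = a j * (geo_ratio t (Suc (Suc j)) x * x ^ t ^ Suc j)"
      unfolding a_def alt_coeff_Suc[of t "Suc j"] br_Suc[of t "Suc j"] power_add by (simp only: mult_ac)
    ultimately show ?thesis by simp
  qed
  have le: "a j \<le> 0.7128 * 0.1 ^ j" for j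
  proof (induction j)
    case (Suc j)
    have "a (Suc j) \<le> a j * 0.1" by (rule step)
    also have "\<dots> \<le> (0.7128 * 0.1 ^ j) * 0.1" by (intro mult_right_mono Suc) auto
    finally show ?case by (simp only: power_Suc mult_ac)
  qed (use a0 in simp)
  have s: "summable (\<lambda>j. (- w) ^ j * (alt_coeff t j q * q ^ br t j))"
    by (rule wser_summable(2)[OF dominated_num[OF t0]]) (use x in auto)
  have "num t q w = 1 + (\<Sum>j. (- w) ^ Suc j * (alt_coeff t (Suc j) q * q ^ br t (Suc j)))"
    unfolding num_def wser_def using suminf_split_initial_segment[OF s, of 1] by simp
  moreover have "norm (\<Sum>j. (- w) ^ Suc j * (alt_coeff t (Suc j) q * q ^ br t (Suc j))) \<le> (\<Sum>j. 0.7128 * 0.1 ^ j :: real)"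
  proof (rule norm_suminf_le)
    fix j
    have "norm ((- w) ^ Suc j * (alt_coeff t (Suc j) q * q ^ br t (Suc j))) = norm (alt_coeff t (Suc j) q) * norm q ^ br t (Suc j)"
      using w by (simp add: norm_mult norm_power)
    also have "\<dots> \<le> alt_coeff t (Suc j) x * x ^ br t (Suc j)"
    proof (intro mult_mono power_mono)
      have "norm (alt_coeff t (Suc j) q) \<le> alt_coeff t (Suc j) (norm q)" by (rule norm_alt_coeff_le) (use t0 x in auto)
      also have "\<dots> \<le> alt_coeff t (Suc j) x" by (rule alt_coeff_mono) (use t0 x in auto)
      finally show "norm (alt_coeff t (Suc j) q) \<le> alt_coeff t (Suc j) x" .
    qed (use x alt_coeff_nonneg[OF t0 x(1,2)] in auto)
    also have "\<dots> \<le> 0.7128 * 0.1 ^ j" using le[of j] by (simp only: a_def)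
    finally show "norm ((- w) ^ Suc j * (alt_coeff t (Suc j) q * q ^ br t (Suc j))) \<le> 0.7128 * 0.1 ^ j" .
  qed (intro summable_mult summable_geometric, simp)
  moreover have "(\<Sum>j. 0.7128 * 0.1 ^ j :: real) = 0.7128 * (1 / (1 - 0.1))"
    by (subst suminf_mult) (auto simp: suminf_geometric intro!: summable_geometric)
  ultimately have "norm (num t q w - 1) < 1" by simp
  then show ?thesis by auto
qed

lemma dominated_profile_gf:
  assumes t0: "0 < t" and w: "norm w < 2"
  shows "norm q < 1/4 \<Longrightarrow> \<exists>S. (\<lambda>n. profile_poly t n w * q ^ n) sums S \<and> S * den t q w = num t q w"
  using profile_gf[OF t0 _ w, of q] by simp

lemma num_bounded:
  assumes "0 < t" "R < 1"
  obtains M where "0 < M" "\<And>q w. norm q \<le> R \<Longrightarrow> norm w \<le> 2 \<Longrightarrow> norm (num t q w) \<le> M"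
proof -
  define M where "M = (\<Sum>j. 2 * alt_coeff t j R * 2 ^ j)"
  show ?thesis
  proof (rule that[of "\<bar>M\<bar> + 1"])
    fix q w :: complex assume "norm q \<le> R" "norm w \<le> 2"
    then have "norm (num t q w) \<le> M"
      unfolding M_def num_def by (rule wser_bound[OF dominated_num[OF assms(1)] _ assms(2)])
    then show "norm (num t q w) \<le> \<bar>M\<bar> + 1" by simp
  qed simp
qed

locale dominant_zero_setup =
  fixes t :: nat and z :: real
  assumes t: "2 \<le> t" and z: "1 / 2 \<le> z" "z \<le> 0.56" and zero: "den t (of_real z) 1 = 0"
    and uniq: "\<And>q. norm q < 1 - 0.72 / real t \<Longrightarrow> den t q 1 = 0 \<Longrightarrow> q = of_real z"
    and simple: "deriv (\<lambda>q. den t q 1) (of_real z) \<noteq> 0"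
begin

lemma t0: "0 < t"
  using t by simp

sublocale den: analytic_family "den t"
  unfolding den_def by (rule analytic_family_wser[OF dominated_den[OF t0]])

definition R :: real where "R = 0.6"

lemma R: "z < R" "R < 1" "0 < R"
  using z by (auto simp: R_def)

lemma uniq_R: "norm q \<le> R \<Longrightarrow> den t q 1 = 0 \<Longrightarrow> q = of_real z"
proof (rule uniq)
  have "0.72 / real t \<le> 0.72 / 2" using t by (intro divide_left_mono) auto
  then show "norm q < 1 - 0.72 / real t" if "norm q \<le> R" using that by (simp add: R_def)
qed

lemma norm_z: "norm (complex_of_real z) = z"
  using z by simp

text \<open>The quasi-power bound: the constant \<open>K\<close> is the same for all \<open>w\<close> near 1.\<close>

lemma perturbation:
  obtains \<delta> \<rho> K where "0 < \<delta>" "\<delta> \<le> 1" "0 < K" "\<rho> holomorphic_on ball 1 \<delta>" "\<rho> 1 = of_real z"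
    "\<forall>w \<in> ball 1 \<delta>. norm (\<rho> w) < 0.6 \<and> den t (\<rho> w) w = 0"
    "\<forall>w \<in> ball 1 \<delta>. \<forall>n. norm (profile_poly t n w * \<rho> w ^ Suc n) \<le> K"
proof -
  define R' where "R' = (z + R) / 2"
  have R': "norm (complex_of_real z) < R'" "R' < R" using R z by (auto simp: R'_def)
  have zR: "norm (complex_of_real z) < R" using R norm_z by simp
  obtain \<delta> \<rho> m where d: "0 < \<delta>" "0 < m" "\<rho> holomorphic_on ball 1 \<delta>" "\<rho> 1 = of_real z"
    "\<forall>w \<in> ball 1 \<delta>. norm (\<rho> w) < R' \<and> den t (\<rho> w) w = 0"
    "\<forall>w \<in> ball 1 \<delta>. \<forall>q. norm q \<le> R \<longrightarrow> m * norm (q - \<rho> w) \<le> norm (den t q w)"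
    by (rule den.dominant_zero[OF R(2) zR zero simple uniq_R R'(1)])
  obtain M where M: "0 < M" "\<And>q w. norm q \<le> R \<Longrightarrow> norm w \<le> 2 \<Longrightarrow> norm (num t q w) \<le> M"
    using num_bounded[OF t0 R(2)] by blast
  show ?thesis
  proof (rule that[of "min \<delta> 1" "M / m / (1 - R' / R)" \<rho>])
    show "\<rho> holomorphic_on ball 1 (min \<delta> 1)" by (rule holomorphic_on_subset[OF d(3)]) auto
    show "0 < M / m / (1 - R' / R)" using M d R' R by simp
    show "\<forall>w \<in> ball 1 (min \<delta> 1). norm (\<rho> w) < 0.6 \<and> den t (\<rho> w) w = 0"
    proof
      fix w :: complex assume "w \<in> ball 1 (min \<delta> 1)"
      then have "w \<in> ball 1 \<delta>" by simp
      from bspec[OF d(5) this] R' show "norm (\<rho> w) < 0.6 \<and> den t (\<rho> w) w = 0" by (simp add: R_def)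
    qed
    show "\<forall>w \<in> ball 1 (min \<delta> 1). \<forall>n. norm (profile_poly t n w * \<rho> w ^ Suc n) \<le> M / m / (1 - R' / R)"
    proof (intro ballI allI)
      fix w :: complex and n assume w: "w \<in> ball 1 (min \<delta> 1)"
      then have w1: "w \<in> ball 1 \<delta>" "norm (w - 1) < 1" by (auto simp: dist_norm norm_minus_commute)
      then have w2: "norm w < 2" using norm_triangle_ineq[of "w - 1" 1] by simp
      have \<rho>R: "norm (\<rho> w) < R'" "den t (\<rho> w) w = 0" using d(5) w1 by auto
      have "norm (profile_poly t n w * \<rho> w ^ Suc n) \<le> M / m / (1 - norm (\<rho> w) / R)"
      proof (rule coefficients_at_simple_zero(1)[where f = "\<lambda>q. den t q w" and N = "\<lambda>q. num t q w" and \<epsilon> = "1/4"])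
        show "(\<lambda>q. num t q w) holomorphic_on ball 0 1"
          unfolding num_def using analytic_family_wser[OF dominated_num[OF t0]] by (rule analytic_family.hol_fst)
        show "(\<lambda>q. den t q w) holomorphic_on ball 0 1" by (rule den.hol_fst)
        show "norm (\<rho> w) < R" using \<rho>R R' by simp
        show "m * norm (q - \<rho> w) \<le> norm (den t q w)" if "norm q \<le> R" for q using d(6) w1 that by blast
        show "norm (num t q w) \<le> M" if "norm q \<le> R" for q using M(2)[OF that] w2 by simp
        show "\<exists>S. (\<lambda>n. profile_poly t n w * q ^ n) sums S \<and> S * den t q w = num t q w" if "norm q < 1/4" for q
          by (rule dominated_profile_gf[OF t0 w2 that])
      qed (use R d \<rho>R in auto)
      also have "\<dots> \<le> M / m / (1 - R' / R)"
      proof (rule divide_left_mono)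
        have "norm (\<rho> w) / R \<le> R' / R" using \<rho>R R by (intro divide_right_mono) auto
        then show "1 - R' / R \<le> 1 - norm (\<rho> w) / R" by simp
        have "R' / R < 1" "norm (\<rho> w) / R < 1" using R' R \<rho>R by auto
        then show "0 < (1 - norm (\<rho> w) / R) * (1 - R' / R)" by simp
      qed (use M d in auto)
      finally show "norm (profile_poly t n w * \<rho> w ^ Suc n) \<le> M / m / (1 - R' / R)" .
    qed
  qed (use d in auto)
qed

text \<open>The two-sided bound makes division by the number of trees harmless; a lower bound holds because the limit
  is not zero and every count is positive.\<close>

lemma profile_growth:
  obtains c C where "0 < c" "\<forall>n. c \<le> real (card (profiles t n)) * z ^ n" "\<forall>n. real (card (profiles t n)) * z ^ n \<le> C"
proof -
  obtain \<delta> \<rho> K where d0: "0 < \<delta>" "\<delta> \<le> 1" "0 < K" "\<rho> holomorphic_on ball 1 \<delta>" "\<rho> 1 = of_real z"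
    "\<forall>w \<in> ball 1 \<delta>. norm (\<rho> w) < 0.6 \<and> den t (\<rho> w) w = 0"
    "\<forall>w \<in> ball 1 \<delta>. \<forall>n. norm (profile_poly t n w * \<rho> w ^ Suc n) \<le> K"
    by (rule perturbation)
  note d = d0(1,5,7)
  define P where "P n = real (card (profiles t n)) * z ^ n" for n
  have "1 \<in> ball 1 \<delta>" using d(1) by simp
  from bspec[OF d(3) this] have "norm (profile_poly t n 1 * of_real z ^ Suc n) \<le> K" for n
    unfolding d(2) by (rule spec)
  moreover have pp: "profile_poly t n 1 * of_real z ^ Suc n = of_real (P n * z)" for n
    by (simp add: P_def profile_poly_1)
  ultimately have up: "P n * z \<le> K" for n by (metis abs_le_iff norm_of_real)
  obtain M where M: "0 < M" "\<And>q w. norm q \<le> R \<Longrightarrow> norm w \<le> 2 \<Longrightarrow> norm (num t q w) \<le> M"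
    using num_bounded[OF t0 R(2)] by blast
  have zR: "norm (complex_of_real z) < R" using R norm_z by simp
  obtain \<delta>' \<rho>' m where d0': "0 < \<delta>'" "0 < m" "\<rho>' holomorphic_on ball 1 \<delta>'" "\<rho>' 1 = of_real z"
    "\<forall>w \<in> ball 1 \<delta>'. norm (\<rho>' w) < R \<and> den t (\<rho>' w) w = 0"
    "\<forall>w \<in> ball 1 \<delta>'. \<forall>q. norm q \<le> R \<longrightarrow> m * norm (q - \<rho>' w) \<le> norm (den t q w)"
    by (rule den.dominant_zero[OF R(2) zR zero simple uniq_R zR])
  note d' = d0'(1,2,4,6)
  define L where "L = - (num t (of_real z) 1 / deriv (\<lambda>q. den t q 1) (of_real z))"
  have limL: "(\<lambda>n. profile_poly t n 1 * of_real z ^ Suc n) \<longlonglongrightarrow> L"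
    unfolding L_def
  proof (rule coefficients_at_simple_zero(3)[where f = "\<lambda>q. den t q 1" and N = "\<lambda>q. num t q 1" and \<epsilon> = "1/4" and R = R and m = m and M = M])
    show "(\<lambda>q. num t q 1) holomorphic_on ball 0 1"
      unfolding num_def using analytic_family_wser[OF dominated_num[OF t0]] by (rule analytic_family.hol_fst)
    show "(\<lambda>q. den t q 1) holomorphic_on ball 0 1" by (rule den.hol_fst)
    have "1 \<in> ball 1 \<delta>'" using d'(1) by simp
    from bspec[OF d'(4) this] show "m * norm (q - of_real z) \<le> norm (den t q 1)" if "norm q \<le> R" for q
      unfolding d'(3) using that by blast
    show "\<exists>S. (\<lambda>n. profile_poly t n 1 * q ^ n) sums S \<and> S * den t q 1 = num t q 1" if "norm q < 1/4" for q
      by (rule dominated_profile_gf[OF t0 _ that]) simp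
  qed (use R d' M zero norm_z in auto)
  have "L \<noteq> 0" unfolding L_def using simple num_nonzero[OF t, of "of_real z" 1] z by simp
  then have "norm L > 0" by simp
  have "(\<lambda>n. norm (complex_of_real (P n * z))) \<longlonglongrightarrow> norm L"
    using tendsto_norm[OF limL] unfolding pp .
  then have lim: "(\<lambda>n. \<bar>P n * z\<bar>) \<longlonglongrightarrow> norm L" by (simp only: norm_of_real)
  have P0: "0 < P n" for n
    unfolding P_def using z profiles_nonempty[OF t0, of n] finite_profiles[of t n] by (simp add: card_gt_0_iff)
  have abs: "\<bar>P n * z\<bar> = P n * z" for n using P0[of n] z by simp
  have "\<forall>\<^sub>F n in sequentially. norm L / 2 < P n * z"
    using order_tendstoD(1)[OF lim, of "norm L / 2"] \<open>norm L > 0\<close> unfolding abs by simp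
  then obtain N where N: "\<And>n. n \<ge> N \<Longrightarrow> norm L / 2 < P n * z" by (auto simp: eventually_sequentially)
  define c where "c = Min (insert (norm L / 2 / z) (P ` {..N}))"
  show ?thesis
  proof (rule that[of c "K / z"])
    show "0 < c" unfolding c_def using P0 \<open>norm L > 0\<close> z by (subst Min_gr_iff) auto
    show "\<forall>n. c \<le> real (card (profiles t n)) * z ^ n"
    proof
      fix n
      have "c \<le> P n"
      proof (cases "n \<le> N")
        case True
        then show ?thesis unfolding c_def by (intro Min_le) auto
      next
        case False
        have "c \<le> norm L / 2 / z" unfolding c_def by (intro Min_le) auto
        also have "\<dots> \<le> P n" using N[of n] False z by (simp add: field_simps)
        finally show ?thesis .
      qed
      then show "c \<le> real (card (profiles t n)) * z ^ n" by (simp add: P_def)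
    qed
    show "\<forall>n. real (card (profiles t n)) * z ^ n \<le> K / z"
      using up z by (auto simp: P_def field_simps)
  qed
qed

text \<open>Inside the disc a zero of the denominator would be a zero of the numerator. On its boundary the renewal
  bound forces \<open>w * q\<close> and \<open>w ^ 2 * q ^ 3\<close> to be positive real, and their
  combination gives \<open>q = z\<close> and \<open>w = 1\<close>.\<close>

lemma den_on_circle:
  assumes q: "norm q \<le> z" and w: "norm w = 1" and zero': "den t q w = 0"
  shows "w = 1"
proof -
  obtain c C where "0 < c" "\<forall>n. c \<le> real (card (profiles t n)) * z ^ n" and C: "\<forall>n. real (card (profiles t n)) * z ^ n \<le> C"
    by (rule profile_growth)
  have z0: "0 < z" using z by simp
  have summ: "summable (\<lambda>n. real (card (profiles t n)) * norm q ^ n)" if "norm q < z" for q :: complex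
  proof (rule summable_comparison_test')
    show "summable (\<lambda>n. C * (norm q / z) ^ n)" using that z0 by (intro summable_mult summable_geometric) simp
    fix n
    have "real (card (profiles t n)) * norm q ^ n = (real (card (profiles t n)) * z ^ n) * (norm q / z) ^ n"
      using z0 by (simp add: power_divide)
    also have "\<dots> \<le> C * (norm q / z) ^ n" using C z0 by (intro mult_right_mono) auto
    finally show "norm (real (card (profiles t n)) * norm q ^ n) \<le> C * (norm q / z) ^ n" by simp
  qed
  define S where "S q = (\<Sum>n. profile_poly t n w * q ^ n)" for q
  have s: "summable (\<lambda>n. profile_poly t n w * q ^ n)" if "norm q < z" for q
    by (rule summable_norm_cancel[OF block_series(1)[OF t0 summ[OF that]]]) (use w in simp)
  have holS: "S holomorphic_on ball 0 z"
  proof (rule power_series_holomorphic)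
    fix q :: complex assume "q \<in> ball 0 z"
    then show "(\<lambda>n. profile_poly t n w * (q - 0) ^ n) sums S q"
      using s[of q] by (simp add: S_def summable_sums)
  qed
  have sub: "ball 0 z \<subseteq> ball (0::complex) 1" using z by auto
  have holN: "(\<lambda>q. num t q w) holomorphic_on ball 0 1"
    unfolding num_def using analytic_family_wser[OF dominated_num[OF t0]] by (rule analytic_family.hol_fst)
  have id: "S q * den t q w = num t q w" if "norm q < z" for q
  proof -
    have "S q * den t q w - num t q w = 0"
    proof (rule analytic_continuation_open[where s = "ball 0 (1/4)" and s' = "ball 0 z"
          and f = "\<lambda>q. S q * den t q w - num t q w" and g = "\<lambda>_. 0"])
      show "(\<lambda>q. S q * den t q w - num t q w) holomorphic_on ball 0 z"
        by (intro holomorphic_intros holS holomorphic_on_subset[OF den.hol_fst sub] holomorphic_on_subset[OF holN sub])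
      fix q :: complex assume "q \<in> ball 0 (1/4)"
      then obtain S' where S': "(\<lambda>n. profile_poly t n w * q ^ n) sums S'" "S' * den t q w = num t q w"
        using dominated_profile_gf[OF t0, of w q] w by auto
      then have "S q = S'" by (simp add: S_def sums_iff)
      with S' show "S q * den t q w - num t q w = 0" by simp
    qed (use z that in auto)
    then show ?thesis by simp
  qed
  have q56: "norm q \<le> 0.56" using q z by simp
  show ?thesis
  proof (cases "norm q < z")
    case True
    then show ?thesis using id[OF True] num_nonzero[OF t q56 w] zero' by simp
  next
    case False
    then have qz: "norm q = z" using q by simp
    define l where "l q = (norm q - Re (w * q)) + (norm q ^ 3 - Re (w ^ 2 * q ^ 3))" for q
    have lower: "norm (num t q w) * l q \<le> norm (den t q w)" if "norm q < z" for q
    proof -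
      define B where "B = (\<Sum>n. block_poly t n w * q ^ n)"
      have "l q \<le> norm (1 - B)" unfolding l_def B_def by (rule renewal_lower_bound[OF t summ[OF that] w])
      moreover have "S q * (1 - B) = 1"
        unfolding S_def B_def by (rule block_series(3)[OF t0 summ[OF that]]) (use w in simp)
      then have "den t q w = num t q w * (1 - B)"
        using id[OF that] by (metis mult.commute mult.left_commute mult.right_neutral)
      ultimately show ?thesis by (simp add: norm_mult mult_left_mono)
    qed
    define x where "x n = of_real (1 - 1 / (real n + 2)) * q" for n
    have xn: "norm (x n) < z" for n
    proof -
      have "norm (x n) = \<bar>1 - 1 / (real n + 2)\<bar> * z" by (simp only: x_def norm_mult norm_of_real qz)
      also have "\<bar>1 - 1 / (real n + 2)\<bar> < 1" by (simp add: field_simps)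
      then have "\<bar>1 - 1 / (real n + 2)\<bar> * z < 1 * z" using z0 by (intro mult_strict_right_mono)
      finally show ?thesis by simp
    qed
    have "(\<lambda>n. 1 - 1 / (real n + 2)) \<longlonglongrightarrow> 1" by real_asymp
    then have "(\<lambda>n. complex_of_real (1 - 1 / (real n + 2)) * q) \<longlonglongrightarrow> of_real 1 * q" by (intro tendsto_intros)
    then have xq: "x \<longlonglongrightarrow> q" by (simp add: x_def[abs_def])
    have q1: "q \<in> ball 0 1" "\<And>n. x n \<in> ball 0 1" using qz z less_trans[OF xn] by auto
    have "(\<lambda>n. den t (x n) w) \<longlonglongrightarrow> den t q w"
      by (rule continuous_on_tendsto_compose[OF holomorphic_on_imp_continuous_on[OF den.hol_fst] xq q1(1)]) (use q1 in auto)
    moreover have "(\<lambda>n. num t (x n) w) \<longlonglongrightarrow> num t q w"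
      by (rule continuous_on_tendsto_compose[OF holomorphic_on_imp_continuous_on[OF holN] xq q1(1)]) (use q1 in auto)
    moreover have "(\<lambda>n. l (x n)) \<longlonglongrightarrow> l q" unfolding l_def by (intro tendsto_intros xq)
    ultimately have "norm (num t q w) * l q \<le> norm (den t q w)"
      by (intro LIMSEQ_le[OF tendsto_mult[OF tendsto_norm] tendsto_norm]) (use lower[OF xn] in auto)
    then have "l q \<le> 0" using zero' num_nonzero[OF t q56 w] by (simp add: mult_le_0_iff)
    moreover have "Re (w * q) \<le> z" using complex_Re_le_cmod[of "w * q"] w qz by (simp add: norm_mult)
    moreover have "Re (w ^ 2 * q ^ 3) \<le> z ^ 3" using complex_Re_le_cmod[of "w ^ 2 * q ^ 3"] w qz by (simp add: norm_mult norm_power)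
    ultimately have e: "Re (w * q) = z" "Re (w ^ 2 * q ^ 3) = z ^ 3" unfolding l_def qz by linarith+
    have real: "u = of_real r" if "norm u = r" "Re u = r" for u :: complex and r
    proof -
      have "(Im u)\<^sup>2 = 0" using cmod_power2[of u] that by simp
      then show ?thesis using that by (simp add: complex_eq_iff)
    qed
    have 1: "w * q = of_real z" by (rule real) (use w qz e in \<open>auto simp: norm_mult\<close>)
    have "w ^ 2 * q ^ 3 = of_real (z ^ 3)" by (rule real) (use w qz e in \<open>auto simp: norm_mult norm_power\<close>)
    moreover have "w ^ 2 * q ^ 3 = (w * q) ^ 2 * q" by (simp add: power2_eq_square power3_eq_cube)
    ultimately have "of_real z ^ 2 * q = of_real z ^ 2 * of_real z" by (auto simp: 1 power2_eq_square power3_eq_cube)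
    then have "q = of_real z" using z0 by auto
    with 1 show ?thesis using z0 by simp
  qed
qed

text \<open>On the compact arc the denominator has no zero of modulus at most \<open>z\<close>, hence none in a
  slightly larger disc, which gains an exponential factor.\<close>

lemma far_from_real_axis:
  assumes "0 < \<delta>"
  shows "\<exists>K \<kappa>. 0 < \<kappa> \<and> \<kappa> < 1 \<and> (\<forall>n \<theta>. \<delta> \<le> \<bar>\<theta>\<bar> \<longrightarrow> \<bar>\<theta>\<bar> \<le> pi \<longrightarrow>
     norm (profile_poly t n (exp (\<i> * of_real \<theta>))) * z ^ n \<le> K * \<kappa> ^ n)"
proof -
  define T where "T = {-pi..-\<delta>} \<union> {\<delta>..pi}"
  define A where "A = (\<lambda>\<theta>. exp (\<i> * complex_of_real \<theta>)) ` T"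
  have z0: "0 < z" using z by simp
  have "compact A" unfolding A_def T_def
    by (intro compact_continuous_image continuous_intros compact_Un compact_Icc)
  moreover have nz: "den t q w \<noteq> 0" if qA: "norm q \<le> z" "w \<in> A" for q w
  proof
    assume "den t q w = 0"
    obtain \<theta> where \<theta>: "\<theta> \<in> T" "w = exp (\<i> * complex_of_real \<theta>)"
      by (rule imageE[OF qA(2)[unfolded A_def]])
    then have "w = 1" using den_on_circle[OF qA(1) _ \<open>den t q w = 0\<close>] by simp
    then obtain n :: int where n: "\<theta> = of_int (2 * n) * pi" using \<theta>(2) by (auto simp: exp_eq_1)
    have "\<theta> \<noteq> 0" "\<bar>\<theta>\<bar> \<le> pi" using \<theta>(1) assms by (auto simp: T_def)
    then have "n \<noteq> 0" "real_of_int \<bar>2 * n\<bar> * pi \<le> 1 * pi" using n by (auto simp: abs_mult)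
    then have "real_of_int \<bar>2 * n\<bar> \<le> 1" by (subst (asm) mult_le_cancel_right_pos) auto
    with \<open>n \<noteq> 0\<close> show False by linarith
  qed
  moreover have "0 \<le> z" "z < 1" using z by auto
  ultimately obtain R2 m where R2: "z < R2" "R2 < 1" "0 < m" "\<And>q w. norm q \<le> R2 \<Longrightarrow> w \<in> A \<Longrightarrow> m \<le> norm (den t q w)"
    using den.nonvanishing_beyond[of A z] by blast
  obtain M where M: "0 < M" "\<And>q w. norm q \<le> R2 \<Longrightarrow> norm w \<le> 2 \<Longrightarrow> norm (num t q w) \<le> M"
    using num_bounded[OF t0 R2(2)] by blast
  show ?thesis
  proof (rule exI[of _ "M / m"], rule exI[of _ "z / R2"], intro conjI allI impI)
    show "0 < z / R2" "z / R2 < 1" using z0 R2 by auto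
    fix n and \<theta> :: real assume "\<delta> \<le> \<bar>\<theta>\<bar>" "\<bar>\<theta>\<bar> \<le> pi"
    then have "\<theta> \<in> T" by (auto simp: T_def abs_le_iff abs_if split: if_splits)
    define w where "w = exp (\<i> * complex_of_real \<theta>)"
    have w: "w \<in> A" "norm w = 1" using \<open>\<theta> \<in> T\<close> by (auto simp: A_def w_def)
    have "norm (profile_poly t n w) \<le> M / m / R2 ^ n"
    proof (rule coefficients_of_quotient(1)[where g = "\<lambda>q. den t q w" and N = "\<lambda>q. num t q w" and \<epsilon> = "1/4"])
      show "(\<lambda>q. num t q w) holomorphic_on ball 0 1"
        unfolding num_def using analytic_family_wser[OF dominated_num[OF t0]] by (rule analytic_family.hol_fst)
      show "(\<lambda>q. den t q w) holomorphic_on ball 0 1" by (rule den.hol_fst)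
      show "\<exists>S. (\<lambda>n. profile_poly t n w * q ^ n) sums S \<and> S * den t q w = num t q w" if "norm q < 1/4" for q
        by (rule dominated_profile_gf[OF t0 _ that]) (use w in simp)
      show "norm (num t q w) \<le> M" if "norm q \<le> R2" for q using M(2)[OF that, of w] w by simp
    qed (use R2 w z0 in auto)
    then have "norm (profile_poly t n w) * z ^ n \<le> M / m / R2 ^ n * z ^ n"
      using z0 by (intro mult_right_mono) auto
    then show "norm (profile_poly t n (exp (\<i> * of_real \<theta>))) * z ^ n \<le> M / m * (z / R2) ^ n"
      by (simp add: w_def power_divide)
  qed
qed

end

section \<open>Logarithmic derivatives of the coefficients\<close>

text \<open>The operator $q\,d/dq$ multiplies \<open>lin_coeff t j\<close> by this factor for \<open>j \<ge>
  1\<close>.\<close>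

definition log_weight :: "nat \<Rightarrow> nat \<Rightarrow> 'a::real_normed_field \<Rightarrow> 'a" where
  "log_weight t j q = 1 + (\<Sum>i=2..j. of_nat (br t i) / (1 - q ^ br t i))"

definition log_weight' :: "nat \<Rightarrow> nat \<Rightarrow> 'a::real_normed_field \<Rightarrow> 'a" where
  "log_weight' t j q = (\<Sum>i=2..j. of_nat (br t i) ^ 2 * q ^ br t i / (1 - q ^ br t i) ^ 2)"

text \<open>The image of \<open>lin_coeff t j\<close> under the Euler operator $q\,d/dq$; for \<open>j = 0\<close> it
  acts on \<open>1 - q\<close>.\<close>

definition euler_lin :: "nat \<Rightarrow> nat \<Rightarrow> 'a::real_normed_field \<Rightarrow> 'a" where
  "euler_lin t j q = (if j = 0 then - q else lin_coeff t j q * log_weight t j q)"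

definition euler2_lin :: "nat \<Rightarrow> nat \<Rightarrow> 'a::real_normed_field \<Rightarrow> 'a" where
  "euler2_lin t j q = (if j = 0 then - q else lin_coeff t j q * (log_weight t j q ^ 2 + log_weight' t j q))"

lemma log_weight_1: "log_weight t (Suc 0) q = 1"
  by (simp add: log_weight_def)

lemma log_weight_Suc: "log_weight t (Suc (Suc j)) q = log_weight t (Suc j) q + of_nat (br t (Suc (Suc j))) / (1 - q ^ br t (Suc (Suc j)))"
  by (simp add: log_weight_def)

lemma log_weight'_1: "log_weight' t (Suc 0) q = 0"
  by (simp add: log_weight'_def)

lemma log_weight'_Suc: "log_weight' t (Suc (Suc j)) q = log_weight' t (Suc j) q
    + of_nat (br t (Suc (Suc j))) ^ 2 * q ^ br t (Suc (Suc j)) / (1 - q ^ br t (Suc (Suc j))) ^ 2"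
  by (simp add: log_weight'_def)

lemma of_real_euler: "of_real (euler_lin t j x) = (euler_lin t j (of_real x) :: 'a::real_normed_field)"
  "of_real (euler2_lin t j x) = (euler2_lin t j (of_real x) :: 'a::real_normed_field)"
  by (simp_all add: euler_lin_def euler2_lin_def log_weight_def log_weight'_def of_real_lin_coeff)

lemma power_pred_br: "q \<noteq> 0 \<Longrightarrow> q ^ (br t (Suc i) - 1) = q ^ br t (Suc i) / (q :: complex)"
  by (simp add: br_Suc_mult)

lemma geo_ratio_derivative:
  fixes q :: complex
  assumes "0 < t" "norm q < 1" "q \<noteq> 0"
  shows "(geo_ratio t (Suc i) has_field_derivative
     geo_ratio t (Suc i) q * (of_nat (br t (Suc i)) / (1 - q ^ br t (Suc i))) / q) (at q)"
proof -
  define n where "n = br t (Suc i)"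
  have ne: "1 - q ^ n \<noteq> 0" using power_br_neq_1[OF assms(1,2), of i] by (simp add: n_def)
  have "((\<lambda>q. q ^ n / (1 - q ^ n)) has_field_derivative
     (of_nat n * q ^ (n - 1) * (1 - q ^ n) - q ^ n * (- (of_nat n * q ^ (n - 1)))) / ((1 - q ^ n) * (1 - q ^ n))) (at q)"
    using ne by (auto intro!: derivative_eq_intros)
  moreover have "(of_nat n * q ^ (n - 1) * (1 - q ^ n) - q ^ n * (- (of_nat n * q ^ (n - 1)))) / ((1 - q ^ n) * (1 - q ^ n))
     = q ^ n / (1 - q ^ n) * (of_nat n / (1 - q ^ n)) / q"
    unfolding power_pred_br[OF assms(3), of t i, folded n_def]
  proof -
    have "of_nat n * (q ^ n / q) * (1 - q ^ n) - q ^ n * (- (of_nat n * (q ^ n / q))) = of_nat n * (q ^ n / q)"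
      by (simp only: algebra_simps) simp
    then show "(of_nat n * (q ^ n / q) * (1 - q ^ n) - q ^ n * (- (of_nat n * (q ^ n / q)))) / ((1 - q ^ n) * (1 - q ^ n))
      = q ^ n / (1 - q ^ n) * (of_nat n / (1 - q ^ n)) / q"
      by (simp add: mult_ac)
  qed
  ultimately show ?thesis by (simp add: geo_ratio_def[abs_def] n_def)
qed

lemma log_weight_derivative:
  fixes q :: complex
  assumes "0 < t" "norm q < 1" "q \<noteq> 0"
  shows "(log_weight t (Suc j) has_field_derivative log_weight' t (Suc j) q / q) (at q)"
proof (induction j)
  case 0
  show ?case by (simp add: log_weight_1[abs_def] log_weight'_1)
next
  case (Suc j)
  define n where "n = br t (Suc (Suc j))"
  have ne: "1 - q ^ n \<noteq> 0" using power_br_neq_1[OF assms(1,2), of "Suc j"] by (simp add: n_def)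
  have "((\<lambda>q. of_nat n / (1 - q ^ n)) has_field_derivative
      (0 * (1 - q ^ n) - of_nat n * (- (of_nat n * q ^ (n - 1)))) / ((1 - q ^ n) * (1 - q ^ n))) (at q)"
    using ne by (auto intro!: derivative_eq_intros)
  moreover have "(0 * (1 - q ^ n) - of_nat n * (- (of_nat n * q ^ (n - 1)))) / ((1 - q ^ n) * (1 - q ^ n))
      = of_nat n ^ 2 * q ^ n / (1 - q ^ n) ^ 2 / q"
    unfolding power_pred_br[OF assms(3), of t "Suc j", folded n_def]
    using ne assms(3) by (simp add: divide_simps power2_eq_square)
  ultimately have "((\<lambda>q. of_nat n / (1 - q ^ n)) has_field_derivative of_nat n ^ 2 * q ^ n / (1 - q ^ n) ^ 2 / q) (at q)"
    by simp
  from DERIV_add[OF Suc this] show ?case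
    by (simp add: log_weight_Suc[abs_def] log_weight'_Suc n_def add_divide_distrib)
qed

lemma lin_coeff_derivative:
  fixes q :: complex
  assumes "0 < t" "norm q < 1" "q \<noteq> 0"
  shows "(lin_coeff t j has_field_derivative euler_lin t j q / q) (at q)"
proof (cases j)
  case 0
  have "((\<lambda>q. 1 - q) has_field_derivative - 1) (at q)" by (auto intro!: derivative_eq_intros)
  then show ?thesis using assms by (simp add: 0 euler_lin_def lin_coeff_0[abs_def])
next
  case (Suc i)
  have "(lin_coeff t (Suc i) has_field_derivative lin_coeff t (Suc i) q * log_weight t (Suc i) q / q) (at q)"
  proof (induction i)
    case 0
    have "((\<lambda>q. q) has_field_derivative 1) (at q)" by (rule DERIV_ident)
    then have "(lin_coeff t (Suc 0) has_field_derivative 1) (at q)"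
    proof (rule has_field_derivative_transform_within_open[where S = "ball 0 1"])
      fix x :: complex assume "x \<in> ball 0 1"
      then have "x \<noteq> 1" by auto
      then show "x = lin_coeff t (Suc 0) x" by (simp add: lin_coeff_1)
    qed (use assms in auto)
    moreover have "q \<noteq> 1" using assms by auto
    ultimately show ?case using assms by (simp add: lin_coeff_1 log_weight_1)
  next
    case (Suc i)
    have "lin_coeff t (Suc i) q * log_weight t (Suc i) q / q * geo_ratio t (Suc (Suc i)) q
        + geo_ratio t (Suc (Suc i)) q * (of_nat (br t (Suc (Suc i))) / (1 - q ^ br t (Suc (Suc i)))) / q * lin_coeff t (Suc i) q
      = lin_coeff t (Suc (Suc i)) q * log_weight t (Suc (Suc i)) q / q"
      unfolding log_weight_Suc lin_coeff_Suc[of t "Suc i"] by (simp add: algebra_simps add_divide_distrib)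
    with DERIV_mult[OF Suc geo_ratio_derivative[OF assms, of "Suc i"]]
    show ?case by (simp add: lin_coeff_Suc[of t "Suc i", abs_def])
  qed
  then show ?thesis by (simp add: Suc euler_lin_def)
qed

lemma euler_lin_derivative:
  fixes q :: complex
  assumes "0 < t" "norm q < 1" "q \<noteq> 0"
  shows "(euler_lin t j has_field_derivative euler2_lin t j q / q) (at q)"
proof (cases j)
  case 0
  have "((\<lambda>q. - q) has_field_derivative - 1) (at q)" by (auto intro!: derivative_eq_intros)
  then show ?thesis using assms by (simp add: 0 euler2_lin_def euler_lin_def[abs_def])
next
  case (Suc i)
  have "euler_lin t (Suc i) q / q * log_weight t (Suc i) q + log_weight' t (Suc i) q / q * lin_coeff t (Suc i) q
     = euler2_lin t (Suc i) q / q"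
    by (simp add: euler_lin_def euler2_lin_def power2_eq_square algebra_simps add_divide_distrib)
  with DERIV_mult[OF lin_coeff_derivative[OF assms, of "Suc i"] log_weight_derivative[OF assms, of i]]
  show ?thesis by (simp add: Suc euler_lin_def[abs_def])
qed

text \<open>Differentiating the identity $\sum_j (-e^s)^j\,l_j(p(s)) = 0$ once and twice at $s = 0$.\<close>

theorem differentiate_zero_branch:
  assumes t: "0 < t" and r: "0 < r" and hol: "p holomorphic_on ball 0 r" and x: "x < 1"
    and p: "\<And>s. s \<in> ball 0 r \<Longrightarrow> norm (p s) \<le> x \<and> p s \<noteq> 0"
    and zero: "\<And>s. s \<in> ball 0 r \<Longrightarrow> wser (lin_coeff t) (p s) (exp s) = 0"
  defines "\<gamma> \<equiv> \<lambda>s. deriv p s / p s"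
  shows "(\<lambda>j. (- 1) ^ j * (of_nat j * lin_coeff t j (p 0) + \<gamma> 0 * euler_lin t j (p 0))) sums 0"
    and "(\<lambda>j. (- 1) ^ j * (of_nat j ^ 2 * lin_coeff t j (p 0) + 2 * of_nat j * \<gamma> 0 * euler_lin t j (p 0)
         + \<gamma> 0 ^ 2 * euler2_lin t j (p 0) + deriv \<gamma> 0 * euler_lin t j (p 0))) sums 0"
proof -
  define B where "B = ball (0::complex) r"
  have B: "open B" "0 \<in> B" using r by (auto simp: B_def)
  define W where "W = exp r"
  have p1: "norm (p s) < 1" "p s \<noteq> 0" if "s \<in> B" for s using p[of s] that x by (auto simp: B_def)
  have dp: "(p has_field_derivative deriv p s) (at s)" if "s \<in> B" for s
    by (rule holomorphic_derivI[OF hol[folded B_def] B(1) that])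
  have \<gamma>p: "deriv p s = \<gamma> s * p s" if "s \<in> B" for s using p1(2)[OF that] by (simp add: \<gamma>_def)
  have hol\<gamma>: "\<gamma> holomorphic_on B"
    unfolding \<gamma>_def using hol B p1 by (intro holomorphic_intros holomorphic_deriv) (auto simp: B_def)
  have d\<gamma>: "(\<gamma> has_field_derivative deriv \<gamma> s) (at s)" if "s \<in> B" for s
    by (rule holomorphic_derivI[OF hol\<gamma> B(1) that])
  define h where "h j s = (- exp s) ^ j * lin_coeff t j (p s)" for j s
  define h1 where "h1 j s = (- exp s) ^ j * (of_nat j * lin_coeff t j (p s) + \<gamma> s * euler_lin t j (p s))" for j s
  define h2 where "h2 j s = (- exp s) ^ j * (of_nat j ^ 2 * lin_coeff t j (p s) + 2 * of_nat j * \<gamma> s * euler_lin t j (p s)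
         + \<gamma> s ^ 2 * euler2_lin t j (p s) + deriv \<gamma> s * euler_lin t j (p s))" for j s
  have de: "((\<lambda>s. (- exp s) ^ j) has_field_derivative of_nat j * (- exp s) ^ j) (at s)" for j and s :: complex
  proof -
    have e: "(- exp s) ^ j = (- 1) ^ j * exp (of_nat j * s)" for s :: complex
      by (simp add: power_minus[of "exp s"] exp_of_nat_mult)
    show ?thesis unfolding e by (auto intro!: derivative_eq_intros)
  qed
  have dl: "((\<lambda>s. lin_coeff t j (p s)) has_field_derivative \<gamma> s * euler_lin t j (p s)) (at s)" if "s \<in> B" for j s
    using DERIV_chain2[OF lin_coeff_derivative[OF t p1[OF that], of j] dp[OF that]] p1[OF that]
    by (simp add: \<gamma>p[OF that] mult.commute)
  have del: "((\<lambda>s. euler_lin t j (p s)) has_field_derivative \<gamma> s * euler2_lin t j (p s)) (at s)" if "s \<in> B" for j s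
    using DERIV_chain2[OF euler_lin_derivative[OF t p1[OF that], of j] dp[OF that]] p1[OF that]
    by (simp add: \<gamma>p[OF that] mult.commute)
  have dh: "(h j has_field_derivative h1 j s) (at s)" if "s \<in> B" for j s
    using DERIV_mult[OF de[of j s] dl[OF that, of j]] by (simp add: h_def[abs_def] h1_def algebra_simps)
  have dh1: "(h1 j has_field_derivative h2 j s) (at s)" if "s \<in> B" for j s
  proof -
    have "((\<lambda>s. of_nat j * lin_coeff t j (p s) + \<gamma> s * euler_lin t j (p s)) has_field_derivative
      of_nat j * (\<gamma> s * euler_lin t j (p s)) + (deriv \<gamma> s * euler_lin t j (p s) + \<gamma> s * euler2_lin t j (p s) * \<gamma> s)) (at s)"
      by (intro DERIV_add DERIV_cmult dl that DERIV_mult d\<gamma> del)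
    from DERIV_mult[OF de[of j s] this] show ?thesis
      by (simp add: h1_def[abs_def] h2_def algebra_simps power2_eq_square)
  qed
  define F where "F m s = (\<Sum>j<m. h j s)" for m s
  have dF: "(F m has_field_derivative (\<Sum>j<m. h1 j s)) (at s)" if "s \<in> B" for m s
    unfolding F_def[abs_def] by (intro DERIV_sum dh that)
  have dF': "deriv (F m) s = (\<Sum>j<m. h1 j s)" if "s \<in> B" for m s by (rule DERIV_imp_deriv[OF dF[OF that]])
  have ddF: "(deriv ^^ 2) (F m) 0 = (\<Sum>j<m. h2 j 0)" for m
  proof -
    have "((\<lambda>s. \<Sum>j<m. h1 j s) has_field_derivative (\<Sum>j<m. h2 j 0)) (at 0)"
      by (intro DERIV_sum dh1 B)
    then have "(deriv (F m) has_field_derivative (\<Sum>j<m. h2 j 0)) (at 0)"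
      by (rule has_field_derivative_transform_within_open[OF _ B]) (simp add: dF')
    then show ?thesis by (simp add: numeral_2_eq_2 DERIV_imp_deriv)
  qed
  have "uniform_limit B F (\<lambda>_. 0) sequentially"
    unfolding uniform_limit_iff
  proof (intro allI impI)
    fix e :: real assume "e > 0"
    from wser_uniform[OF dominated_lin[OF t] x, of W, unfolded uniform_limit_iff, rule_format, OF this]
    show "\<forall>\<^sub>F m in sequentially. \<forall>s\<in>B. dist (F m s) 0 < e"
    proof eventually_elim
      case (elim m)
      show ?case
      proof
        fix s assume s: "s \<in> B"
        have "norm (exp s) \<le> W" using s complex_Re_le_cmod[of s] by (simp add: W_def B_def)
        then have "(p s, exp s) \<in> cball 0 x \<times> cball 0 W" using p[of s] s by (simp add: B_def)
        from bspec[OF elim this] show "dist (F m s) 0 < e"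
          using zero[of s] s by (simp add: F_def h_def B_def)
      qed
    qed
  qed
  moreover have "\<forall>\<^sub>F m in sequentially. F m holomorphic_on B"
    unfolding holomorphic_on_open[OF B(1)] by (intro always_eventually allI ballI exI) (rule dF)
  ultimately have lim: "(\<lambda>m. (deriv ^^ k) (F m) 0) \<longlonglongrightarrow> (deriv ^^ k) (\<lambda>_. 0) 0" for k
    using B by (intro higher_deriv_complex_uniform_limit) auto
  have z: "(deriv ^^ k) (\<lambda>_. 0 :: complex) = (\<lambda>_. 0)" for k
    by (induction k) auto
  have "(\<lambda>m. \<Sum>j<m. h1 j 0) \<longlonglongrightarrow> 0" using lim[of 1] dF'[OF B(2)] by (simp add: z)
  then show "(\<lambda>j. (- 1) ^ j * (of_nat j * lin_coeff t j (p 0) + \<gamma> 0 * euler_lin t j (p 0))) sums 0"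
    by (simp add: sums_def h1_def)
  have "(\<lambda>m. \<Sum>j<m. h2 j 0) \<longlonglongrightarrow> 0" using lim[of 2] by (simp add: z ddF)
  then show "(\<lambda>j. (- 1) ^ j * (of_nat j ^ 2 * lin_coeff t j (p 0) + 2 * of_nat j * \<gamma> 0 * euler_lin t j (p 0)
         + \<gamma> 0 ^ 2 * euler2_lin t j (p 0) + deriv \<gamma> 0 * euler_lin t j (p 0))) sums 0"
    by (simp add: sums_def h2_def)
qed

section \<open>Tail bounds for the constants\<close>

definition alt_sum :: "(nat \<Rightarrow> real) \<Rightarrow> real" where
  "alt_sum a = (\<Sum>j. (- 1) ^ j * a j)"

text \<open>All the sums that occur in the constants have terms bounded by twice this quantity, because the index and
  the logarithmic weights are at most \<open>log_weight t j\<close>.\<close>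

definition majorant :: "nat \<Rightarrow> real \<Rightarrow> nat \<Rightarrow> real" where
  "majorant t x j = lin_coeff t j x * log_weight t j x ^ 2"

context
  fixes t :: nat and x :: real
  assumes t: "2 \<le> t" and x: "1 / 2 \<le> x" "x \<le> 0.56"
begin

lemma x01: "0 < t" "0 \<le> x" "x < 1" "0 < x"
  using t x by auto

lemma log_weight_term_nonneg: "0 \<le> real (br t (Suc i)) / (1 - x ^ br t (Suc i))"
  using power_br_bound(3)[OF x01(1-3), of i] by simp

lemma log_weight_ge: "1 + real (br t (Suc (Suc j))) \<le> log_weight t (Suc (Suc j)) x"
proof -
  have "1 \<le> log_weight t (Suc j) x" for j
  proof (induction j)
    case (Suc j)
    then show ?case unfolding log_weight_Suc using log_weight_term_nonneg[of "Suc j"] by linarith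
  qed (simp add: log_weight_1)
  moreover have "real (br t (Suc (Suc j))) \<le> real (br t (Suc (Suc j))) / (1 - x ^ br t (Suc (Suc j)))"
    using power_br_bound(3)[OF x01(1-3), of "Suc j"] x01 by (simp add: field_simps)
  ultimately show ?thesis unfolding log_weight_Suc by (smt (verit))
qed

lemma small_power: "2 \<le> j \<Longrightarrow> x ^ br t (Suc j) \<le> 0.56 ^ (t ^ 2 + t + 1)" "0.56 ^ (t ^ 2 + t + 1) \<le> (0.0173 :: real)"
proof -
  assume "2 \<le> j"
  then have "br t 3 \<le> br t (Suc j)" unfolding br_def by (intro sum_mono2) auto
  then have "x ^ br t (Suc j) \<le> x ^ br t 3" using x01 by (intro power_decreasing) auto
  also have "\<dots> \<le> 0.56 ^ br t 3" using x by (intro power_mono) auto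
  finally show "x ^ br t (Suc j) \<le> 0.56 ^ (t ^ 2 + t + 1)" by (simp add: br_3)
next
  have "2 ^ 2 \<le> t ^ 2" using t by (intro power_mono) auto
  then have "7 \<le> t ^ 2 + t + 1" using t by simp
  then have "(0.56 :: real) ^ (t ^ 2 + t + 1) \<le> 0.56 ^ 7" by (intro power_decreasing) auto
  also have "\<dots> \<le> 0.0173" by (simp add: power_divide)
  finally show "0.56 ^ (t ^ 2 + t + 1) \<le> (0.0173 :: real)" .
qed

lemma growth_constant: "2.3104 * real t ^ 2 * (0.56 ^ (t ^ 2 + t + 1) / (1 - 0.0173)) \<le> 0.2"
proof -
  have "t \<le> 2 ^ (t - 1)"
    using less_exp[of "t - 1"] t by linarith
  then have "real t \<le> 2 ^ (t - 1)" by (metis of_nat_le_iff of_nat_numeral of_nat_power)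
  also have "(2::real) ^ (t - 1) = 2 ^ t / 2" using t by (simp add: power_diff)
  finally have "real t ^ 2 \<le> (2 ^ t / 2) ^ 2" by (intro power_mono) auto
  also have "\<dots> = 4 ^ t / 4" by (simp add: power_divide power2_eq_square flip: power_mult_distrib)
  finally have t2: "real t ^ 2 \<le> 4 ^ t / 4" .
  have "t * 3 \<le> t * (t + 1)" using t by (intro mult_le_mono2) simp
  then have "3 * t + 1 \<le> t ^ 2 + t + 1" by (simp add: power2_eq_square)
  then have "(0.56 :: real) ^ (t ^ 2 + t + 1) \<le> 0.56 ^ (3 * t + 1)" by (intro power_decreasing) auto
  also have "\<dots> = 0.56 * (0.56 ^ 3) ^ t" by (simp add: power_mult)
  finally have p: "(0.56 :: real) ^ (t ^ 2 + t + 1) \<le> 0.56 * (0.56 ^ 3) ^ t" .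
  have "real t ^ 2 * 0.56 ^ (t ^ 2 + t + 1) \<le> (4 ^ t / 4) * (0.56 * (0.56 ^ 3) ^ t)"
    by (intro mult_mono t2 p) auto
  also have "\<dots> = 0.14 * (4 * 0.56 ^ 3) ^ t" by (subst power_mult_distrib) simp
  also have "\<dots> \<le> 0.14 * (4 * 0.56 ^ 3) ^ 2" using t by (intro mult_left_mono power_decreasing) (auto simp: power_divide)
  also have "\<dots> \<le> 0.0692" by (simp add: power_divide)
  finally have "real t ^ 2 * 0.56 ^ (t ^ 2 + t + 1) \<le> 0.0692" .
  then show ?thesis by simp
qed

text \<open>Passing to the next index multiplies the weight by at most \<open>1.52 * t\<close>, while the coefficient
  shrinks by a factor with exponent at least \<open>t ^ 2 + t + 1\<close>; the product is largest for
  \<open>t = 2\<close>.\<close>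

lemma majorant_step:
  assumes "2 \<le> j" shows "majorant t x (Suc j) \<le> 0.2 * majorant t x j"
proof -
  obtain i where j: "j = Suc (Suc i)" using assms by (metis add_2_eq_Suc le_Suc_ex)
  define k where "k = log_weight t j x"
  define N where "N = br t (Suc j)"
  define y where "y = x ^ N"
  have y: "y \<le> 0.0173" "0 \<le> y" using order_trans[OF small_power(1)[OF assms] small_power(2)] x01 by (auto simp: y_def N_def)
  have k: "1 + real (br t j) \<le> k" using log_weight_ge[of i] by (simp add: k_def j)
  have "1 / (1 - y) \<le> 1.02" using y by (simp add: field_simps)
  from mult_left_mono[OF this, of "real N"] have "real N / (1 - y) \<le> 1.02 * real N" by (simp add: mult.commute)
  also have "1.02 * real N \<le> 1.02 * (real t * k)"
  proof -
    have "real N = 1 + real t * real (br t j)" by (simp add: N_def br_Suc_mult)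
    also have "\<dots> \<le> 1 + real t * (k - 1)" using k by (intro add_left_mono mult_left_mono) auto
    also have "\<dots> \<le> real t * k" using t by (simp add: algebra_simps)
    finally show ?thesis by simp
  qed
  finally have "k + real N / (1 - y) \<le> k + 1.02 * (real t * k)" by (rule add_left_mono)
  also have "\<dots> \<le> 1.52 * real t * k"
  proof -
    have "2 * k \<le> real t * k" using t k by (intro mult_right_mono) auto
    then show ?thesis by (simp add: algebra_simps)
  qed
  finally have kS: "log_weight t (Suc j) x \<le> 1.52 * real t * k"
    by (simp add: k_def j log_weight_Suc N_def y_def)
  have k0: "0 \<le> k" using k by simp
  have "0 \<le> log_weight t (Suc j) x" using log_weight_ge[of "Suc i"] by (simp add: j)
  then have "log_weight t (Suc j) x ^ 2 \<le> (1.52 * real t * k) ^ 2" by (intro power_mono kS)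
  also have "\<dots> = 2.3104 * real t ^ 2 * k ^ 2" by (simp add: power_mult_distrib power_divide)
  finally have k2: "log_weight t (Suc j) x ^ 2 \<le> 2.3104 * real t ^ 2 * k ^ 2" .
  have "geo_ratio t (Suc j) x \<le> 0.56 ^ (t ^ 2 + t + 1) / (1 - 0.0173)"
    unfolding geo_ratio_def by (rule frac_le) (use small_power(1)[OF assms] y in \<open>auto simp: y_def N_def\<close>)
  then have "majorant t x (Suc j) \<le> lin_coeff t j x * (0.56 ^ (t ^ 2 + t + 1) / (1 - 0.0173)) * (2.3104 * real t ^ 2 * k ^ 2)"
    unfolding majorant_def lin_coeff_Suc using k2 lin_coeff_nonneg[OF x01(1-3), of j] geo_ratio_nonneg[OF x01(1-3), of j]
    by (intro mult_mono) (auto intro!: mult_nonneg_nonneg)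
  also have "\<dots> = (2.3104 * real t ^ 2 * (0.56 ^ (t ^ 2 + t + 1) / (1 - 0.0173))) * majorant t x j"
    by (simp add: majorant_def k_def)
  also have "\<dots> \<le> 0.2 * majorant t x j"
    using growth_constant lin_coeff_nonneg[OF x01(1-3), of j] by (intro mult_right_mono) (auto simp: majorant_def)
  finally show ?thesis .
qed

lemma majorant_nonneg: "0 \<le> majorant t x j"
  using lin_coeff_nonneg[OF x01(1-3), of j] by (simp add: majorant_def)

lemma majorant_geometric: "2 \<le> m \<Longrightarrow> majorant t x (j + m) \<le> majorant t x m * 0.2 ^ j"
proof (induction j)
  case (Suc j)
  have "majorant t x (Suc j + m) \<le> 0.2 * majorant t x (j + m)" using majorant_step[of "j + m"] Suc.prems by simp
  also have "\<dots> \<le> 0.2 * (majorant t x m * 0.2 ^ j)" by (intro mult_left_mono Suc.IH Suc.prems) auto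
  finally show ?case by simp
qed simp

lemma alternating_tail:
  assumes m: "2 \<le> m" and a: "\<And>j. 2 \<le> j \<Longrightarrow> \<bar>a j\<bar> \<le> 2 * majorant t x j"
  shows "(\<lambda>j. (- 1) ^ j * a j) sums alt_sum a"
    and "\<bar>alt_sum a - (\<Sum>j<m. (- 1) ^ j * a j)\<bar> \<le> 2.5 * majorant t x m"
proof -
  have b: "norm ((- 1) ^ (j + m) * a (j + m)) \<le> 2 * majorant t x m * 0.2 ^ j" for j
    using a[of "j + m"] m majorant_geometric[OF m, of j] by (simp add: abs_mult power_abs)
  have sg: "summable (\<lambda>j. 2 * majorant t x m * 0.2 ^ j)" by (intro summable_mult summable_geometric) simp
  then have "summable (\<lambda>j. (- 1) ^ (j + m) * a (j + m))"
    by (rule summable_comparison_test'[where N = 0]) (rule b)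
  then have s: "summable (\<lambda>j. (- 1) ^ j * a j)" by (rule summable_iff_shift[THEN iffD1])
  then show "(\<lambda>j. (- 1) ^ j * a j) sums alt_sum a" unfolding alt_sum_def by (rule summable_sums)
  have "\<bar>alt_sum a - (\<Sum>j<m. (- 1) ^ j * a j)\<bar> = norm (\<Sum>j. (- 1) ^ (j + m) * a (j + m))"
    unfolding alt_sum_def suminf_split_initial_segment[OF s, of m] by simp
  also have "\<dots> \<le> (\<Sum>j. 2 * majorant t x m * 0.2 ^ j)" by (rule norm_suminf_le[OF b sg])
  also have "\<dots> = 2 * majorant t x m * (1 / (1 - 0.2))"
    by (subst suminf_mult) (auto simp: suminf_geometric intro!: summable_geometric)
  finally show "\<bar>alt_sum a - (\<Sum>j<m. (- 1) ^ j * a j)\<bar> \<le> 2.5 * majorant t x m" by simp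
qed

lemma index_le_log_weight: "2 \<le> j \<Longrightarrow> real j \<le> log_weight t j x \<and> 1 \<le> log_weight t j x"
proof -
  assume "2 \<le> j"
  then obtain i where j: "j = Suc (Suc i)" by (metis add_2_eq_Suc le_Suc_ex)
  have "Suc (Suc i) \<le> br t (Suc (Suc i))" using br_ge[OF x01(1)] .
  then have "real (Suc (Suc i)) \<le> real (br t (Suc (Suc i)))" by (simp only: of_nat_le_iff)
  then show ?thesis using log_weight_ge[of i] unfolding j by linarith
qed

lemma log_weight'_le: "log_weight' t (Suc j) x \<le> log_weight t (Suc j) x ^ 2"  "0 \<le> log_weight' t (Suc j) x" "1 \<le> log_weight t (Suc j) x"
proof -
  have "0 \<le> log_weight' t (Suc j) x \<and> log_weight' t (Suc j) x \<le> log_weight t (Suc j) x ^ 2 \<and> 1 \<le> log_weight t (Suc j) x"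
  proof (induction j)
    case (Suc j)
    define N where "N = real (br t (Suc (Suc j)))"
    define y where "y = x ^ br t (Suc (Suc j))"
    define c where "c = N / (1 - y)"
    have y: "0 \<le> y" "y < 1" using power_br_bound(3)[OF x01(1-3), of "Suc j"] x01 by (auto simp: y_def)
    have c: "0 \<le> c" using y by (simp add: c_def N_def)
    have "N ^ 2 * y / (1 - y) ^ 2 = c ^ 2 * y" by (simp add: c_def power_divide)
    also have "\<dots> \<le> c ^ 2 * 1" using y by (intro mult_left_mono) auto
    finally have "N ^ 2 * y / (1 - y) ^ 2 \<le> c ^ 2" by simp
    moreover have "0 \<le> N ^ 2 * y / (1 - y) ^ 2" using y by simp
    moreover have "log_weight t (Suc j) x ^ 2 + c ^ 2 \<le> (log_weight t (Suc j) x + c) ^ 2"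
      using Suc c by (simp add: power2_sum)
    ultimately show ?case using Suc c by (simp add: log_weight_Suc log_weight'_Suc N_def y_def c_def)
  qed (simp add: log_weight_1 log_weight'_1)
  then show "log_weight' t (Suc j) x \<le> log_weight t (Suc j) x ^ 2"  "0 \<le> log_weight' t (Suc j) x" "1 \<le> log_weight t (Suc j) x"
    by auto
qed

lemma term_bounds:
  assumes "2 \<le> j"
  shows "\<bar>lin_coeff t j x\<bar> \<le> 2 * majorant t x j" "\<bar>real j * lin_coeff t j x\<bar> \<le> 2 * majorant t x j"
    "\<bar>euler_lin t j x\<bar> \<le> 2 * majorant t x j" "\<bar>real j ^ 2 * lin_coeff t j x\<bar> \<le> 2 * majorant t x j"
    "\<bar>real j * euler_lin t j x\<bar> \<le> 2 * majorant t x j" "\<bar>euler2_lin t j x\<bar> \<le> 2 * majorant t x j"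
proof -
  define l k where "l = lin_coeff t j x" and "k = log_weight t j x"
  have l: "0 \<le> l" using lin_coeff_nonneg[OF x01(1-3)] by (simp add: l_def)
  have k: "real j \<le> k" "1 \<le> k" using index_le_log_weight[OF assms] by (auto simp: k_def)
  have j0: "j \<noteq> 0" using assms by simp
  have k2: "1 \<le> k ^ 2" "k \<le> k ^ 2" "real j \<le> k ^ 2" "real j ^ 2 \<le> k ^ 2" "real j * k \<le> k ^ 2"
  proof -
    show 1: "k \<le> k ^ 2" using k mult_left_mono[of 1 k k] by (simp add: power2_eq_square)
    show "1 \<le> k ^ 2" "real j \<le> k ^ 2" using 1 k by linarith+
    show "real j ^ 2 \<le> k ^ 2" using k by (intro power_mono) auto
    show "real j * k \<le> k ^ 2" using k by (simp add: power2_eq_square)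
  qed
  have M: "majorant t x j = l * k ^ 2" by (simp add: majorant_def l_def k_def)
  have gen: "\<bar>l * c\<bar> \<le> 2 * majorant t x j" if "0 \<le> c" "c \<le> 2 * k ^ 2" for c
    using mult_left_mono[OF that(2) l] l that(1) unfolding M by (simp add: abs_mult)
  have "0 \<le> k" using k by simp
  show "\<bar>lin_coeff t j x\<bar> \<le> 2 * majorant t x j" using gen[of 1] k2 by (simp add: l_def)
  show "\<bar>real j * lin_coeff t j x\<bar> \<le> 2 * majorant t x j" using gen[of "real j"] k2 by (simp add: l_def mult.commute)
  show "\<bar>euler_lin t j x\<bar> \<le> 2 * majorant t x j" using gen[of k] k2 \<open>0 \<le> k\<close> j0 by (simp add: l_def k_def euler_lin_def)
  show "\<bar>real j ^ 2 * lin_coeff t j x\<bar> \<le> 2 * majorant t x j" using gen[of "real j ^ 2"] k2 by (simp add: l_def mult.commute)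
  show "\<bar>real j * euler_lin t j x\<bar> \<le> 2 * majorant t x j"
    using gen[of "real j * k"] k2 \<open>0 \<le> k\<close> j0 by (simp add: l_def k_def euler_lin_def mult_ac)
  obtain i where i: "j = Suc i" using j0 not0_implies_Suc by blast
  show "\<bar>euler2_lin t j x\<bar> \<le> 2 * majorant t x j"
    using gen[of "k ^ 2 + log_weight' t j x"] log_weight'_le[of i] j0 by (simp add: l_def k_def i euler2_lin_def)
qed

end

section \<open>Limit laws for the height\<close>

text \<open>Minus the logarithmic derivative of \<open>\<rho> (exp s)\<close> at 0, obtained by solving the first
  derived identity.\<close>

definition height_mu :: "nat \<Rightarrow> real \<Rightarrow> real" where
  "height_mu t z = alt_sum (\<lambda>j. real j * lin_coeff t j z) / alt_sum (\<lambda>j. euler_lin t j z)"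

text \<open>Minus the derivative of the logarithmic derivative of \<open>\<rho> (exp s)\<close> at 0, obtained from
  the second derived identity.\<close>

definition height_sigma2 :: "nat \<Rightarrow> real \<Rightarrow> real" where
  "height_sigma2 t z = (alt_sum (\<lambda>j. real j ^ 2 * lin_coeff t j z)
     - 2 * height_mu t z * alt_sum (\<lambda>j. real j * euler_lin t j z)
     + height_mu t z ^ 2 * alt_sum (\<lambda>j. euler2_lin t j z)) / alt_sum (\<lambda>j. euler_lin t j z)"

lemma pmf_mgf_height:
  assumes "0 < t"
  shows "pmf_mgf (height_pmf t n) s = profile_poly t n (exp s) / of_nat (card (profiles t n))"
    and "finite (set_pmf (height_pmf t n))"
proof -
  define A where "A = profiles t n"
  have A: "A \<noteq> {}" "finite A"
    using profiles_nonempty[OF assms, of n] finite_profiles[of t n] by (auto simp: A_def)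
  have sp: "set_pmf (height_pmf t n) = length ` A" using A by (simp add: height_pmf_def A_def)
  then show "finite (set_pmf (height_pmf t n))" using A by simp
  have pm: "pmf (height_pmf t n) k = real (card {rs \<in> A. length rs = k}) / real (card A)" for k
  proof -
    have "A \<inter> length -` {k} = {rs \<in> A. length rs = k}" by auto
    then show ?thesis using A by (simp add: height_pmf_def pmf_map measure_pmf_of_set flip: A_def)
  qed
  have "profile_poly t n (exp s) = (\<Sum>k\<in>length ` A. \<Sum>rs\<in>{rs \<in> A. length rs = k}. exp s ^ length rs)"
    unfolding profile_poly_def A_def[symmetric] by (rule sum.image_gen[OF A(2)])
  also have "\<dots> = (\<Sum>k\<in>length ` A. of_nat (card {rs \<in> A. length rs = k}) * exp (s * of_nat k))"
    by (intro sum.cong) (auto simp: exp_of_nat2_mult)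
  finally show "pmf_mgf (height_pmf t n) s = profile_poly t n (exp s) / of_nat (card (profiles t n))"
    unfolding pmf_mgf_def sp pm by (simp add: sum_divide_distrib A_def)
qed

locale height_constants =
  fixes t :: nat and z :: real
  assumes t: "2 \<le> t" and z: "1 / 2 \<le> z" "z \<le> 0.56" and real_zero: "real_lin t z = 0"
    and uniq': "\<And>q. norm q < 1 - 0.72 / real t \<Longrightarrow> den t q 1 = 0 \<Longrightarrow> q = of_real z"
    and euler_neq: "alt_sum (\<lambda>j. euler_lin t j z) \<noteq> 0"
    and variance_pos: "0 < height_sigma2 t z"
begin

definition "J1 = alt_sum (\<lambda>j. real j * lin_coeff t j z)"
definition "J2 = alt_sum (\<lambda>j. real j ^ 2 * lin_coeff t j z)"
definition "E1 = alt_sum (\<lambda>j. euler_lin t j z)"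
definition "JE = alt_sum (\<lambda>j. real j * euler_lin t j z)"
definition "E2 = alt_sum (\<lambda>j. euler2_lin t j z)"

lemma t_pos: "0 < t" using t by simp

lemma complex_sums:
  "(\<lambda>j. (- 1) ^ j * (of_nat j * lin_coeff t j (complex_of_real z))) sums of_real J1"
  "(\<lambda>j. (- 1) ^ j * (of_nat j ^ 2 * lin_coeff t j (complex_of_real z))) sums of_real J2"
  "(\<lambda>j. (- 1) ^ j * euler_lin t j (complex_of_real z)) sums of_real E1"
  "(\<lambda>j. (- 1) ^ j * (of_nat j * euler_lin t j (complex_of_real z))) sums of_real JE"
  "(\<lambda>j. (- 1) ^ j * euler2_lin t j (complex_of_real z)) sums of_real E2"
proof -
  note s = alternating_tail(1)[OF t z order_refl, THEN sums_of_real[where 'a = complex]]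
  note tb = term_bounds[OF t z]
  show "(\<lambda>j. (- 1) ^ j * (of_nat j * lin_coeff t j (complex_of_real z))) sums of_real J1"
    using s[OF tb(2)] by (simp add: J1_def of_real_lin_coeff)
  show "(\<lambda>j. (- 1) ^ j * (of_nat j ^ 2 * lin_coeff t j (complex_of_real z))) sums of_real J2"
    using s[OF tb(4)] by (simp add: J2_def of_real_lin_coeff)
  show "(\<lambda>j. (- 1) ^ j * euler_lin t j (complex_of_real z)) sums of_real E1"
    using s[OF tb(3)] by (simp add: E1_def of_real_euler)
  show "(\<lambda>j. (- 1) ^ j * (of_nat j * euler_lin t j (complex_of_real z))) sums of_real JE"
    using s[OF tb(5)] by (simp add: JE_def of_real_euler)
  show "(\<lambda>j. (- 1) ^ j * euler2_lin t j (complex_of_real z)) sums of_real E2"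
    using s[OF tb(6)] by (simp add: E2_def of_real_euler)
qed

lemma zero_lin: "wser (lin_coeff t) (complex_of_real z) 1 = 0"
  using real_lin_sums(2)[OF t_pos, of z] z real_zero by simp

lemma zero_den: "den t (of_real z) 1 = 0"
  using wser_lin[OF t_pos, of "of_real z" 1] z zero_lin by simp

lemma deriv_unique_series:
  assumes dom: "dominated t u" and S: "open S" "s \<in> S" and hol: "p holomorphic_on S" "v holomorphic_on S"
    and p: "\<And>s. s \<in> S \<Longrightarrow> norm (p s) < 1"
    and d: "\<And>j. ((\<lambda>s. (- v s) ^ j * u j (p s)) has_field_derivative d j) (at s)" and "d sums D"
  shows "((\<lambda>s. wser u (p s) (v s)) has_field_derivative D) (at s)"
proof -
  have "(\<lambda>j. deriv (\<lambda>s. (- v s) ^ j * u j (p s)) s) sums deriv (\<lambda>s. wser u (p s) (v s)) s"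
    by (rule wser_compose_derivative(2)[OF dom S(1) hol p S(2)])
  then have "d sums deriv (\<lambda>s. wser u (p s) (v s)) s" by (simp add: DERIV_imp_deriv[OF d])
  then have "deriv (\<lambda>s. wser u (p s) (v s)) s = D" using \<open>d sums D\<close> sums_unique2 by blast
  moreover have "((\<lambda>s. wser u (p s) (v s)) has_field_derivative deriv (\<lambda>s. wser u (p s) (v s)) s) (at s)"
    by (rule holomorphic_derivI[OF wser_compose_derivative(1)[OF dom S(1) hol p] S])
  ultimately show ?thesis by simp
qed

lemma z_props: "norm (complex_of_real z) < 1" "complex_of_real z \<noteq> 0" "0 < z" "1 - complex_of_real z \<noteq> 0"
proof -
  have "1 - z \<noteq> 0" using z by simp
  then have "complex_of_real (1 - z) \<noteq> 0" by (simp only: of_real_eq_0_iff not_False_eq_True)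
  then show "1 - complex_of_real z \<noteq> 0" by simp
qed (use z in auto)

lemma den_deriv_q: "((\<lambda>q. den t q 1) has_field_derivative of_real (E1 / (z * (1 - z)))) (at (of_real z))"
proof -
  have "((\<lambda>q. wser (lin_coeff t) q 1) has_field_derivative of_real (E1 / z)) (at (of_real z))"
  proof (rule deriv_unique_series[where S = "ball 0 1" and p = "\<lambda>q. q" and v = "\<lambda>_. 1", OF dominated_lin[OF t_pos]])
    fix j
    show "((\<lambda>q. (- 1) ^ j * lin_coeff t j q) has_field_derivative
        (- 1) ^ j * (euler_lin t j (of_real z) / of_real z)) (at (complex_of_real z))"
      by (intro DERIV_cmult lin_coeff_derivative t_pos z_props)
    show "(\<lambda>j. (- 1) ^ j * (euler_lin t j (complex_of_real z) / of_real z)) sums of_real (E1 / z)"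
      using sums_divide[OF complex_sums(3), of "of_real z"] by simp
  qed (use z in auto)
  from DERIV_divide[OF this DERIV_diff[OF DERIV_const[of 1] DERIV_ident] z_props(4)]
  have "((\<lambda>q. wser (lin_coeff t) q 1 / (1 - q)) has_field_derivative of_real (E1 / (z * (1 - z)))) (at (of_real z))"
    using z_props by (simp add: zero_lin divide_simps)
  then show ?thesis
  proof (rule has_field_derivative_transform_within_open[where S = "ball 0 1"])
    fix q :: complex assume "q \<in> ball 0 1"
    then have "norm q < 1" "1 - q \<noteq> 0" by auto
    then show "wser (lin_coeff t) q 1 / (1 - q) = den t q 1" using wser_lin[OF t_pos] by simp
  qed (use z in auto)
qed

lemma den_deriv_w: "((\<lambda>w. den t (of_real z) w) has_field_derivative of_real (J1 / (1 - z))) (at 1)"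
proof -
  have "((\<lambda>w. wser (lin_coeff t) (of_real z) w) has_field_derivative of_real J1) (at 1)"
  proof (rule deriv_unique_series[where S = UNIV and p = "\<lambda>_. of_real z" and v = "\<lambda>w. w", OF dominated_lin[OF t_pos]])
    fix j
    have "((\<lambda>w. (- w) ^ j * lin_coeff t j (complex_of_real z)) has_field_derivative
        of_nat j * ((- 1) * (- 1) ^ (j - Suc 0)) * lin_coeff t j (of_real z)) (at 1)"
      by (auto intro!: derivative_eq_intros)
    then show "((\<lambda>w. (- w) ^ j * lin_coeff t j (complex_of_real z)) has_field_derivative
        (- 1) ^ j * (of_nat j * lin_coeff t j (of_real z))) (at 1)"
      by (cases j) (auto simp: mult_ac)
    show "(\<lambda>j. (- 1) ^ j * (of_nat j * lin_coeff t j (complex_of_real z))) sums of_real J1"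
      by (rule complex_sums(1))
  qed (use z in auto)
  from DERIV_cdivide[OF this, of "1 - of_real z"] show ?thesis
    using z_props by (simp add: wser_lin[OF t_pos])
qed

lemma simple_zero: "deriv (\<lambda>q. den t q 1) (of_real z) \<noteq> 0"
proof -
  have "E1 / (z * (1 - z)) \<noteq> 0" using euler_neq z by (simp add: E1_def)
  then show ?thesis by (simp only: DERIV_imp_deriv[OF den_deriv_q] of_real_eq_0_iff not_False_eq_True)
qed

text \<open>The factors \<open>1 - q\<close> and the signs that distinguish \<open>den\<close> from \<open>b\<close>
  cancel in the quotient, since all derivatives are taken at a zero.\<close>

lemma mean_constant_formula:
  "complex_of_real (height_mu t z) = deriv (\<lambda>w. b t (of_real z) w) 1 / (of_real z * deriv (\<lambda>q. b t q 1) (of_real z))"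
proof -
  have bq: "((\<lambda>q. b t q 1) has_field_derivative - of_real (E1 / (z * (1 - z)))) (at (of_real z))"
  proof (rule has_field_derivative_transform_within_open[where S = "ball 0 1"])
    show "((\<lambda>q. 1 - den t q 1) has_field_derivative - of_real (E1 / (z * (1 - z)))) (at (of_real z))"
      using DERIV_diff[OF DERIV_const den_deriv_q, of 1] by simp
    fix q :: complex assume "q \<in> ball 0 1"
    then show "1 - den t q 1 = b t q 1" using den_eq[of q t 1] t_pos by simp
  qed (use z in auto)
  have bw: "((\<lambda>w. b t (of_real z) w) has_field_derivative - of_real (J1 / (1 - z))) (at 1)"
    using DERIV_diff[OF DERIV_const den_deriv_w, of 1] den_eq[OF z_props(1) t_pos] by simp
  have "height_mu t z = - (J1 / (1 - z)) / (z * - (E1 / (z * (1 - z))))"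
    using z euler_neq by (simp add: height_mu_def J1_def E1_def)
  then have "complex_of_real (height_mu t z) = of_real (- (J1 / (1 - z)) / (z * - (E1 / (z * (1 - z)))))" by (rule arg_cong)
  also have "\<dots> = deriv (\<lambda>w. b t (of_real z) w) 1 / (of_real z * deriv (\<lambda>q. b t q 1) (of_real z))"
    unfolding DERIV_imp_deriv[OF bq] DERIV_imp_deriv[OF bw] by (simp only: of_real_divide of_real_mult of_real_minus)
  finally show ?thesis .
qed

sublocale dominant_zero_setup t z
  by unfold_locales (use t z zero_den uniq' simple_zero in auto)

text \<open>The exponent is the logarithm of \<open>z / \<rho> (exp s)\<close>.\<close>

lemma quasi_power:
  obtains G r K where "quasi_power (height_pmf t) G r K (height_mu t z) (height_sigma2 t z)"
proof -
  obtain \<delta> \<rho> K0 where \<rho>: "0 < \<delta>" "\<delta> \<le> 1" "0 < K0" "\<rho> holomorphic_on ball 1 \<delta>" "\<rho> 1 = of_real z"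
    "\<forall>w \<in> ball 1 \<delta>. norm (\<rho> w) < 0.6 \<and> den t (\<rho> w) w = 0"
    "\<forall>w \<in> ball 1 \<delta>. \<forall>n. norm (profile_poly t n w * \<rho> w ^ Suc n) \<le> K0"
    by (rule perturbation)
  define p where "p s = \<rho> (exp s)" for s
  have "open (exp -` ball (1::complex) \<delta>)" by (intro open_vimage open_ball continuous_intros)
  moreover have "0 \<in> exp -` ball (1::complex) \<delta>" using \<rho> by simp
  ultimately obtain r1 where r1: "0 < r1" "ball 0 r1 \<subseteq> exp -` ball (1::complex) \<delta>"
    by (meson openE)
  have e1: "exp s \<in> ball 1 \<delta>" if "s \<in> ball 0 r1" for s :: complex using r1 that by auto
  have holp1: "p holomorphic_on ball 0 r1"
    unfolding p_def using holomorphic_on_compose_gen[OF holomorphic_on_exp \<rho>(4), of "ball 0 r1"] e1 by (simp add: o_def image_subset_iff)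
  have p0: "p 0 = of_real z" by (simp add: p_def \<rho>)
  have "isCont p 0"
    using holomorphic_on_imp_continuous_on[OF holp1] r1 by (simp add: continuous_on_eq_continuous_at)
  then have "\<forall>\<^sub>F s in at 0. dist (p s) (p 0) < z / 2" unfolding isCont_def using z by (intro tendstoD) auto
  then obtain r2 where r2: "0 < r2" "\<And>s. s \<noteq> 0 \<Longrightarrow> norm s < r2 \<Longrightarrow> dist (p s) (p 0) < z / 2"
    by (auto simp: eventually_at)
  define r where "r = min r1 r2"
  define B where "B = ball (0::complex) r"
  have r: "0 < r" using r1 r2 by (simp add: r_def)
  have B: "open B" "0 \<in> B" using r by (auto simp: B_def)
  have holp: "p holomorphic_on B" by (rule holomorphic_on_subset[OF holp1]) (auto simp: B_def r_def)
  have e: "exp s \<in> ball 1 \<delta>" if "s \<in> B" for s using e1[of s] that by (auto simp: B_def r_def)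
  have close: "norm (p s - of_real z) < z / 2" if "s \<in> B" for s
    using r2(2)[of s] that z p0 by (cases "s = 0") (auto simp: B_def r_def dist_norm)
  have pos: "0 < Re (p s / of_real z)" if "s \<in> B" for s
  proof -
    have "\<bar>Re (p s) - z\<bar> < z / 2" using abs_Re_le_cmod[of "p s - of_real z"] close[OF that] by simp
    then have "0 < Re (p s)" using z by linarith
    then show ?thesis using z by simp
  qed
  have pn: "z / 2 \<le> norm (p s)" if "s \<in> B" for s
    using close[OF that] norm_triangle_ineq2[of "of_real z" "of_real z - p s"] z by (simp add: norm_minus_commute)
  have pne: "p s \<noteq> 0" if "s \<in> B" for s using pn[OF that] z by auto
  have p6: "norm (p s) \<le> 0.6" if "s \<in> B" for s using \<rho>(6) e[OF that] by (force simp: p_def)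
  have pz: "wser (lin_coeff t) (p s) (exp s) = 0" if "s \<in> B" for s
  proof -
    have "norm (p s) < 1" using p6[OF that] by simp
    then show ?thesis using wser_lin[OF t_pos, of "p s" "exp s"] \<rho>(6) e[OF that] by (simp add: p_def)
  qed
  define \<gamma> where "\<gamma> = (\<lambda>s. deriv p s / p s)"
  have branch: "(\<lambda>j. (- 1) ^ j * (of_nat j * lin_coeff t j (p 0) + \<gamma> 0 * euler_lin t j (p 0))) sums 0"
    "(\<lambda>j. (- 1) ^ j * (of_nat j ^ 2 * lin_coeff t j (p 0) + 2 * of_nat j * \<gamma> 0 * euler_lin t j (p 0)
         + \<gamma> 0 ^ 2 * euler2_lin t j (p 0) + deriv \<gamma> 0 * euler_lin t j (p 0))) sums 0"
    unfolding \<gamma>_def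
    by (rule differentiate_zero_branch[OF t_pos r holp[unfolded B_def], where x = "0.6"]; use p6 pne pz in \<open>simp add: B_def\<close>)+
  have E1: "complex_of_real E1 \<noteq> 0" using euler_neq by (simp add: E1_def)
  have "(\<lambda>j. (- 1) ^ j * (of_nat j * lin_coeff t j (p 0) + \<gamma> 0 * euler_lin t j (p 0))) sums (of_real J1 + \<gamma> 0 * of_real E1)"
    using sums_add[OF complex_sums(1) sums_mult[OF complex_sums(3), of "\<gamma> 0"]] by (simp add: p0 algebra_simps)
  then have "of_real J1 + \<gamma> 0 * of_real E1 = 0" by (rule sums_unique2[OF _ branch(1)])
  then have "of_real J1 = - (\<gamma> 0 * of_real E1)" by (simp add: eq_neg_iff_add_eq_0)
  then have \<gamma>0: "\<gamma> 0 = - of_real (height_mu t z)"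
    using E1 by (simp add: height_mu_def flip: J1_def E1_def)
  have "(\<lambda>j. (- 1) ^ j * (of_nat j ^ 2 * lin_coeff t j (p 0) + 2 * of_nat j * \<gamma> 0 * euler_lin t j (p 0)
         + \<gamma> 0 ^ 2 * euler2_lin t j (p 0) + deriv \<gamma> 0 * euler_lin t j (p 0)))
     sums (of_real J2 + 2 * \<gamma> 0 * of_real JE + \<gamma> 0 ^ 2 * of_real E2 + deriv \<gamma> 0 * of_real E1)"
    using sums_add[OF sums_add[OF sums_add[OF complex_sums(2) sums_mult[OF complex_sums(4), of "2 * \<gamma> 0"]]
       sums_mult[OF complex_sums(5), of "\<gamma> 0 ^ 2"]] sums_mult[OF complex_sums(3), of "deriv \<gamma> 0"]]
    by (simp add: p0 algebra_simps)
  then have "of_real J2 + 2 * \<gamma> 0 * of_real JE + \<gamma> 0 ^ 2 * of_real E2 + deriv \<gamma> 0 * of_real E1 = 0"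
    by (rule sums_unique2[OF _ branch(2)])
  then have "of_real J2 + 2 * \<gamma> 0 * of_real JE + \<gamma> 0 ^ 2 * of_real E2 = - (deriv \<gamma> 0 * of_real E1)"
    by (simp add: eq_neg_iff_add_eq_0)
  then have "complex_of_real (J2 - 2 * height_mu t z * JE + height_mu t z ^ 2 * E2) = - (deriv \<gamma> 0 * of_real E1)"
    by (simp add: \<gamma>0)
  moreover have "height_sigma2 t z * E1 = J2 - 2 * height_mu t z * JE + height_mu t z ^ 2 * E2"
    using euler_neq by (simp add: height_sigma2_def J2_def JE_def E2_def E1_def)
  ultimately have "complex_of_real (height_sigma2 t z) * of_real E1 = (- deriv \<gamma> 0) * of_real E1"
    by (simp flip: of_real_mult)
  then have \<gamma>1: "- deriv \<gamma> 0 = of_real (height_sigma2 t z)" unfolding mult_right_cancel[OF E1] by (rule sym)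
  define G where "G s = - Ln (p s / of_real z)" for s
  have dp: "(p has_field_derivative deriv p s) (at s)" if "s \<in> B" for s
    by (rule holomorphic_derivI[OF holp B(1) that])
  have dG: "(G has_field_derivative - \<gamma> s) (at s)" if "s \<in> B" for s
  proof -
    have nn: "p s / of_real z \<notin> \<real>\<^sub>\<le>\<^sub>0" using pos[OF that] complex_nonpos_Reals_iff by force
    have "(G has_field_derivative - (inverse (p s / of_real z) * (deriv p s / of_real z))) (at s)"
      unfolding G_def
      by (intro DERIV_minus DERIV_chain2[where f = Ln] has_field_derivative_Ln nn DERIV_cdivide dp that)
    then show ?thesis using z_props pne[OF that] by (simp add: \<gamma>_def field_simps)
  qed
  obtain c C where c: "0 < c" "\<forall>n. c \<le> real (card (profiles t n)) * z ^ n" "\<forall>n. real (card (profiles t n)) * z ^ n \<le> C"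
    by (rule profile_growth)
  have quot: "X / real (card (profiles t n)) \<le> Y / c" if "0 \<le> X" "X * z ^ n \<le> Y" for X Y n
  proof -
    have zn: "0 < z ^ n" using z_props by simp
    have "X / real (card (profiles t n)) = X * z ^ n / (real (card (profiles t n)) * z ^ n)" using z_props(3) by simp
    also have "\<dots> \<le> Y / c"
    proof (rule frac_le)
      show "0 \<le> Y" by (rule order_trans[OF mult_nonneg_nonneg that(2)]) (use that zn in auto)
    qed (use that c in auto)
    finally show ?thesis .
  qed
  have norm_mgf: "norm (pmf_mgf (height_pmf t n) s) = norm (profile_poly t n (exp s)) / real (card (profiles t n))" for n s
    by (simp add: pmf_mgf_height(1)[OF t_pos] norm_divide)
  have "quasi_power (height_pmf t) G r (K0 / (z / 2) / c) (height_mu t z) (height_sigma2 t z)"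
  proof
    show "finite (set_pmf (height_pmf t n))" for n by (rule pmf_mgf_height(2)[OF t_pos])
    show "0 < r" by (rule r)
    show "G holomorphic_on ball 0 r"
      unfolding B_def[symmetric] using B(1) dG by (auto simp: holomorphic_on_open)
    show "G 0 = 0" using z_props by (simp add: G_def p0)
    have dG': "deriv G s = - \<gamma> s" if "s \<in> B" for s by (rule DERIV_imp_deriv[OF dG[OF that]])
    show "deriv G 0 = of_real (height_mu t z)" using dG'[OF B(2)] \<gamma>0 by simp
    have "(deriv G has_field_derivative - deriv \<gamma> 0) (at 0)"
    proof (rule has_field_derivative_transform_within_open[OF _ B])
      have "\<gamma> holomorphic_on B" unfolding \<gamma>_def using holp B pne by (intro holomorphic_intros holomorphic_deriv) auto
      then show "((\<lambda>s. - \<gamma> s) has_field_derivative - deriv \<gamma> 0) (at 0)"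
        by (intro DERIV_minus holomorphic_derivI[OF _ B])
    qed (simp add: dG')
    then show "(deriv ^^ 2) G 0 = of_real (height_sigma2 t z)" using \<gamma>1 by (simp add: numeral_2_eq_2 DERIV_imp_deriv)
    show "0 < height_sigma2 t z" by (rule variance_pos)
  next
    fix n and s :: complex assume "norm s < r"
    then have s: "s \<in> B" by (simp add: B_def)
    define P where "P = norm (profile_poly t n (exp s))"
    define y where "y = norm (p s)"
    have y: "z / 2 \<le> y" "0 < y" using pn[OF s] z_props by (auto simp: y_def)
    have "P * y ^ Suc n \<le> K0" using \<rho>(7) e[OF s] by (simp add: P_def y_def p_def norm_mult norm_power)
    then have "P * y ^ Suc n * ((z / y) ^ n / y) \<le> K0 * ((z / y) ^ n / y)"
      using y z_props by (intro mult_right_mono) auto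
    then have "P * z ^ n \<le> K0 / y * (z / y) ^ n" using y by (simp add: power_divide mult.commute[of y])
    also have "\<dots> \<le> K0 / (z / 2) * (z / y) ^ n" using y \<rho>(3) z_props by (intro mult_right_mono divide_left_mono) auto
    also have "(z / y) ^ n = exp (real n * Re (G s))"
    proof -
      have "Re (G s) = - ln (y / z)" using pne[OF s] z_props by (simp add: G_def y_def norm_divide)
      also have "\<dots> = ln (z / y)" using y z_props by (simp add: ln_div)
      finally show ?thesis using y z_props by (simp add: exp_of_nat_mult)
    qed
    finally have "P / real (card (profiles t n)) \<le> K0 / (z / 2) * exp (real n * Re (G s)) / c"
      by (intro quot) (simp_all add: P_def)
    then show "norm (pmf_mgf (height_pmf t n) s) \<le> K0 / (z / 2) / c * exp (real n * Re (G s))"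
      by (simp add: norm_mgf P_def)
  next
    fix \<delta> :: real assume "0 < \<delta>"
    then obtain K \<kappa> where K: "0 < \<kappa>" "\<kappa> < 1" "\<And>n \<theta>. \<delta> \<le> \<bar>\<theta>\<bar> \<Longrightarrow> \<bar>\<theta>\<bar> \<le> pi \<Longrightarrow>
       norm (profile_poly t n (exp (\<i> * of_real \<theta>))) * z ^ n \<le> K * \<kappa> ^ n"
      using far_from_real_axis by blast
    have "norm (pmf_mgf (height_pmf t n) (\<i> * of_real \<theta>)) \<le> K / c * \<kappa> ^ n" if "\<delta> \<le> \<bar>\<theta>\<bar>" "\<bar>\<theta>\<bar> \<le> pi" for n \<theta>
      unfolding norm_mgf using quot[OF norm_ge_zero K(3)[OF that]] by simp
    then show "\<exists>K \<kappa>. 0 < \<kappa> \<and> \<kappa> < 1 \<and>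
        (\<forall>n \<theta>. \<delta> \<le> \<bar>\<theta>\<bar> \<longrightarrow> \<bar>\<theta>\<bar> \<le> pi \<longrightarrow> norm (pmf_mgf (height_pmf t n) (\<i> * of_real \<theta>)) \<le> K * \<kappa> ^ n)"
      using K(1,2) by blast
  qed
  then show ?thesis by (rule that)
qed

lemma moments_random_tree:
  "mean_height t n = pmf_mean (height_pmf t n)" "var_height t n = pmf_var (height_pmf t n)"
proof -
  note m = random_height[OF t_pos, of n, symmetric]
  show "mean_height t n = pmf_mean (height_pmf t n)"
    by (simp add: mean_height_def pmf_mean_def m)
  then show "var_height t n = pmf_var (height_pmf t n)"
    by (simp add: var_height_def pmf_var_def pmf_mean_def m)
qed

theorem height_limit_laws:
  "height_asymp_normal t" "height_local_limit t"
  "(\<lambda>n. mean_height t n - height_mu t z * real n) \<in> O(\<lambda>_. 1)"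
  "(\<lambda>n. var_height t n - height_sigma2 t z * real n) \<in> O(\<lambda>_. 1)"
proof -
  obtain G r K where qp: "quasi_power (height_pmf t) G r K (height_mu t z) (height_sigma2 t z)"
    by (rule quasi_power)
  have M: "measure_pmf (height_pmf t n) = distr (measure_pmf (random_tree t n)) (count_space UNIV) tree_height" for n
    by (simp add: random_height[OF t_pos, symmetric] map_pmf_rep_eq)
  have "distr (measure_pmf (random_tree t n)) borel (\<lambda>T. (real (tree_height T) - mean_height t n) / sd_height t n)
     = distr (measure_pmf (height_pmf t n)) borel (\<lambda>k. (real k - pmf_mean (height_pmf t n)) / sqrt (pmf_var (height_pmf t n)))" for n
    unfolding M by (subst distr_distr) (auto simp: o_def sd_height_def moments_random_tree)
  then show "height_asymp_normal t"
    unfolding height_asymp_normal_def using quasi_power.central_limit[OF qp] by simp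
  have "measure_pmf.prob (random_tree t n) {T. int (tree_height T) = i}
     = measure_pmf.prob (height_pmf t n) {k. int k = i}" for n i
    by (simp add: random_height[OF t_pos, symmetric] vimage_def)
  then show "height_local_limit t"
    unfolding height_local_limit_def using quasi_power.local_limit[OF qp]
    by (simp add: sd_height_def moments_random_tree)
  show "(\<lambda>n. mean_height t n - height_mu t z * real n) \<in> O(\<lambda>_. 1)"
    using quasi_power.mean_bigo[OF qp] by (simp add: moments_random_tree)
  show "(\<lambda>n. var_height t n - height_sigma2 t z * real n) \<in> O(\<lambda>_. 1)"
    using quasi_power.var_bigo[OF qp] by (simp add: moments_random_tree)
qed

end

section \<open>Reducing the numerical claims to finitely many terms\<close>

definition mean_approx :: "nat \<Rightarrow> real" where
  "mean_approx t = 1 / 2 + (real t - 2) / 2 ^ (t + 3) + (2 * real t ^ 2 + 3 * real t - 8) / 2 ^ (2 * t + 5)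
     + (9 * real t ^ 3 + 45 * real t ^ 2 + 2 * real t - 88) / 2 ^ (3 * t + 8)"

definition variance_approx :: "nat \<Rightarrow> real" where
  "variance_approx t = 1 / 4 + (- (real t ^ 2) + 5 * real t - 2) / 2 ^ (t + 4)
     + (- 4 * real t ^ 3 + 4 * real t ^ 2 + 27 * real t - 14) / 2 ^ (2 * t + 6)"

text \<open>Everything that the analytic part needs to know about the numbers, together with the accuracy that is
  claimed for them.\<close>

definition good_constants :: "nat \<Rightarrow> real \<Rightarrow> bool" where
  "good_constants t z \<longleftrightarrow> alt_sum (\<lambda>j. euler_lin t j z) < 0 \<and> 0 < height_sigma2 t z \<and>
     \<bar>height_mu t z - mean_approx t\<bar> \<le> 0.55 * real t ^ 4 / 2 ^ (4 * t) \<and>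
     \<bar>height_sigma2 t z - variance_approx t\<bar> \<le> 0.26 * real t ^ 4 / 2 ^ (3 * t)"

lemma partial_sums:
  assumes t: "2 \<le> t" and z: "1 / 2 \<le> z" "z \<le> 0.56" and m: "2 \<le> m" and \<tau>: "2.5 * majorant t z m \<le> \<tau>"
  shows "\<bar>real_lin t z - (\<Sum>j<m. (- 1) ^ j * lin_coeff t j z)\<bar> \<le> \<tau>"
    "\<bar>alt_sum (\<lambda>j. real j * lin_coeff t j z) - (\<Sum>j<m. (- 1) ^ j * (real j * lin_coeff t j z))\<bar> \<le> \<tau>"
    "\<bar>alt_sum (\<lambda>j. euler_lin t j z) - (\<Sum>j<m. (- 1) ^ j * euler_lin t j z)\<bar> \<le> \<tau>"
    "\<bar>alt_sum (\<lambda>j. real j ^ 2 * lin_coeff t j z) - (\<Sum>j<m. (- 1) ^ j * (real j ^ 2 * lin_coeff t j z))\<bar> \<le> \<tau>"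
    "\<bar>alt_sum (\<lambda>j. real j * euler_lin t j z) - (\<Sum>j<m. (- 1) ^ j * (real j * euler_lin t j z))\<bar> \<le> \<tau>"
    "\<bar>alt_sum (\<lambda>j. euler2_lin t j z) - (\<Sum>j<m. (- 1) ^ j * euler2_lin t j z)\<bar> \<le> \<tau>"
proof -
  note tb = term_bounds[OF t z]
  note al = order_trans[OF alternating_tail(2)[OF t z m] \<tau>]
  have "real_lin t z = alt_sum (\<lambda>j. lin_coeff t j z)" by (simp add: real_lin_def alt_sum_def)
  then show "\<bar>real_lin t z - (\<Sum>j<m. (- 1) ^ j * lin_coeff t j z)\<bar> \<le> \<tau>" using al[OF tb(1)] by simp
qed (rule order_trans[OF alternating_tail(2)[OF t z m] \<tau>], rule term_bounds[OF t z], assumption)+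

lemma first_terms:
  fixes z :: real
  assumes "z < 1"
  shows "lin_coeff t 0 z = 1 - z" "lin_coeff t (Suc 0) z = z" "euler_lin t 0 z = - z" "euler_lin t (Suc 0) z = z"
    "euler2_lin t 0 z = - z" "euler2_lin t (Suc 0) z = z"
  using assms by (simp_all add: lin_coeff_0 lin_coeff_1 euler_lin_def euler2_lin_def log_weight_1 log_weight'_1)

lemma first_3_terms:
  assumes t: "2 \<le> t" and z: "1 / 2 \<le> z" "z \<le> 0.56" and zero: "real_lin t z = 0" and \<tau>: "2.5 * majorant t z 3 \<le> \<tau>"
  shows "\<bar>2 * z - (1 + lin_coeff t 2 z)\<bar> \<le> \<tau>"
    "\<bar>alt_sum (\<lambda>j. real j * lin_coeff t j z) - (- z + 2 * lin_coeff t 2 z)\<bar> \<le> \<tau>"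
    "\<bar>alt_sum (\<lambda>j. euler_lin t j z) - (- 2 * z + euler_lin t 2 z)\<bar> \<le> \<tau>"
    "\<bar>alt_sum (\<lambda>j. real j ^ 2 * lin_coeff t j z) - (- z + 4 * lin_coeff t 2 z)\<bar> \<le> \<tau>"
    "\<bar>alt_sum (\<lambda>j. real j * euler_lin t j z) - (- z + 2 * euler_lin t 2 z)\<bar> \<le> \<tau>"
    "\<bar>alt_sum (\<lambda>j. euler2_lin t j z) - (- 2 * z + euler2_lin t 2 z)\<bar> \<le> \<tau>"
proof -
  have s: "(\<Sum>j<3. f j) = f 0 + f (Suc 0) + f 2" for f :: "nat \<Rightarrow> real" by (simp add: eval_nat_numeral)
  have z1: "z < 1" using z by simp
  show "\<bar>2 * z - (1 + lin_coeff t 2 z)\<bar> \<le> \<tau>"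
    using partial_sums(1)[OF t z _ \<tau>] by (simp add: s first_terms[OF z1] zero abs_le_iff)
qed (use partial_sums(2-6)[OF t z _ \<tau>] z in \<open>simp_all add: first_terms eval_nat_numeral algebra_simps\<close>)

lemma first_4_terms:
  assumes t: "2 \<le> t" and z: "1 / 2 \<le> z" "z \<le> 0.56" and zero: "real_lin t z = 0" and \<tau>: "2.5 * majorant t z 4 \<le> \<tau>"
  shows "\<bar>2 * z - (1 + lin_coeff t 2 z - lin_coeff t 3 z)\<bar> \<le> \<tau>"
    "\<bar>alt_sum (\<lambda>j. real j * lin_coeff t j z) - (- z + 2 * lin_coeff t 2 z - 3 * lin_coeff t 3 z)\<bar> \<le> \<tau>"
    "\<bar>alt_sum (\<lambda>j. euler_lin t j z) - (- 2 * z + euler_lin t 2 z - euler_lin t 3 z)\<bar> \<le> \<tau>"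
    "\<bar>alt_sum (\<lambda>j. real j ^ 2 * lin_coeff t j z) - (- z + 4 * lin_coeff t 2 z - 9 * lin_coeff t 3 z)\<bar> \<le> \<tau>"
    "\<bar>alt_sum (\<lambda>j. real j * euler_lin t j z) - (- z + 2 * euler_lin t 2 z - 3 * euler_lin t 3 z)\<bar> \<le> \<tau>"
    "\<bar>alt_sum (\<lambda>j. euler2_lin t j z) - (- 2 * z + euler2_lin t 2 z - euler2_lin t 3 z)\<bar> \<le> \<tau>"
proof -
  have s: "(\<Sum>j<4. f j) = f 0 + f (Suc 0) + f 2 + f 3" for f :: "nat \<Rightarrow> real" by (simp add: eval_nat_numeral)
  have z1: "z < 1" using z by simp
  show "\<bar>2 * z - (1 + lin_coeff t 2 z - lin_coeff t 3 z)\<bar> \<le> \<tau>"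
    using partial_sums(1)[OF t z _ \<tau>] by (simp add: s first_terms[OF z1] zero abs_le_iff)
qed (use partial_sums(2-6)[OF t z _ \<tau>] z in \<open>simp_all add: first_terms eval_nat_numeral algebra_simps\<close>)

lemma first_5_terms:
  assumes t: "2 \<le> t" and z: "1 / 2 \<le> z" "z \<le> 0.56" and zero: "real_lin t z = 0" and \<tau>: "2.5 * majorant t z 5 \<le> \<tau>"
  shows "\<bar>2 * z - (1 + lin_coeff t 2 z - lin_coeff t 3 z + lin_coeff t 4 z)\<bar> \<le> \<tau>"
    "\<bar>alt_sum (\<lambda>j. real j * lin_coeff t j z) - (- z + 2 * lin_coeff t 2 z - 3 * lin_coeff t 3 z + 4 * lin_coeff t 4 z)\<bar> \<le> \<tau>"
    "\<bar>alt_sum (\<lambda>j. euler_lin t j z) - (- 2 * z + euler_lin t 2 z - euler_lin t 3 z + euler_lin t 4 z)\<bar> \<le> \<tau>"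
    "\<bar>alt_sum (\<lambda>j. real j ^ 2 * lin_coeff t j z) - (- z + 4 * lin_coeff t 2 z - 9 * lin_coeff t 3 z + 16 * lin_coeff t 4 z)\<bar> \<le> \<tau>"
    "\<bar>alt_sum (\<lambda>j. real j * euler_lin t j z) - (- z + 2 * euler_lin t 2 z - 3 * euler_lin t 3 z + 4 * euler_lin t 4 z)\<bar> \<le> \<tau>"
    "\<bar>alt_sum (\<lambda>j. euler2_lin t j z) - (- 2 * z + euler2_lin t 2 z - euler2_lin t 3 z + euler2_lin t 4 z)\<bar> \<le> \<tau>"
proof -
  have s: "(\<Sum>j<5. f j) = f 0 + f (Suc 0) + f 2 + f 3 + f 4" for f :: "nat \<Rightarrow> real" by (simp add: eval_nat_numeral)
  have z1: "z < 1" using z by simp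
  show "\<bar>2 * z - (1 + lin_coeff t 2 z - lin_coeff t 3 z + lin_coeff t 4 z)\<bar> \<le> \<tau>"
    using partial_sums(1)[OF t z _ \<tau>] by (simp add: s first_terms[OF z1] zero abs_le_iff)
qed (use partial_sums(2-6)[OF t z _ \<tau>] z in \<open>simp_all add: first_terms eval_nat_numeral algebra_simps\<close>)

lemma explicit_terms:
  fixes x :: real
  assumes "x < 1"
  shows "lin_coeff t 2 x = x * (x ^ br t 2 / (1 - x ^ br t 2))"
    "lin_coeff t 3 x = lin_coeff t 2 x * (x ^ br t 3 / (1 - x ^ br t 3))"
    "log_weight t 2 x = 1 + real (br t 2) / (1 - x ^ br t 2)"
    "log_weight t 3 x = log_weight t 2 x + real (br t 3) / (1 - x ^ br t 3)"
    "log_weight' t 2 x = real (br t 2) ^ 2 * x ^ br t 2 / (1 - x ^ br t 2) ^ 2"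
  using assms
  by (simp_all add: eval_nat_numeral lin_coeff_Suc[of t "Suc i" for i] lin_coeff_1 geo_ratio_def log_weight_1 log_weight'_1 log_weight_Suc log_weight'_Suc)

text \<open>Interval multiplication with a nonnegative first factor.\<close>

lemma mult_corners:
  fixes x y :: real
  assumes "a \<le> x" "x \<le> k" "0 \<le> a" "c \<le> y" "y \<le> d"
  shows "min (a * c) (k * c) \<le> x * y" "x * y \<le> max (a * d) (k * d)"
proof -
  have "x * c \<le> x * y" "x * y \<le> x * d" using assms by (auto intro: mult_left_mono)
  moreover have "min (a * c) (k * c) \<le> x * c"
    using assms mult_right_mono[of a x c] mult_right_mono_neg[of x k c] by (cases "0 \<le> c") auto
  moreover have "x * d \<le> max (a * d) (k * d)"
    using assms mult_right_mono[of x k d] mult_right_mono_neg[of a x d] by (cases "0 \<le> d") auto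
  ultimately show "min (a * c) (k * c) \<le> x * y" "x * y \<le> max (a * d) (k * d)" by linarith+
qed

lemma quotient_bounds:
  fixes a c :: real
  assumes "c < 0" "a \<le> l * c" "h * c \<le> a" shows "l \<le> a / c" "a / c \<le> h"
  using assms by (auto simp: neg_le_divide_eq neg_divide_le_eq)

text \<open>The variance constant is evaluated by interval arithmetic in the mean constant, which is bracketed first.
  Since \<open>E\<close> is negative, all quotient bounds are stated as products.\<close>

lemma constants_from_box:
  fixes t :: nat and z :: real
  defines "E \<equiv> alt_sum (\<lambda>j. euler_lin t j z)" and "J1 \<equiv> alt_sum (\<lambda>j. real j * lin_coeff t j z)"
    and "J2 \<equiv> alt_sum (\<lambda>j. real j ^ 2 * lin_coeff t j z)" and "JE \<equiv> alt_sum (\<lambda>j. real j * euler_lin t j z)"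
    and "E2 \<equiv> alt_sum (\<lambda>j. euler2_lin t j z)"
  assumes E: "El \<le> E" "E \<le> Eh" "Eh < 0"
    and J1: "J1 \<le> ml * E" "mh * E \<le> J1" and ml: "0 \<le> ml"
    and J2: "J2l \<le> J2" "J2 \<le> J2h" and JE: "JEl \<le> JE" "JE \<le> JEh" and E2: "E2l \<le> E2" "E2 \<le> E2h"
    and sl: "J2h - 2 * min (ml * JEl) (mh * JEl) + max (ml ^ 2 * E2h) (mh ^ 2 * E2h) \<le> sl * El"
    and sh: "sh * Eh \<le> J2l - 2 * max (ml * JEh) (mh * JEh) + min (ml ^ 2 * E2l) (mh ^ 2 * E2l)"
    and pos: "0 < sl" "sl \<le> sh"
    and m: "mean_approx t - 0.55 * real t ^ 4 / 2 ^ (4 * t) \<le> ml" "mh \<le> mean_approx t + 0.55 * real t ^ 4 / 2 ^ (4 * t)"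
    and v: "variance_approx t - 0.26 * real t ^ 4 / 2 ^ (3 * t) \<le> sl" "sh \<le> variance_approx t + 0.26 * real t ^ 4 / 2 ^ (3 * t)"
  shows "good_constants t z"
proof -
  define \<mu> where "\<mu> = height_mu t z"
  define N where "N = J2 - 2 * \<mu> * JE + \<mu> ^ 2 * E2"
  have En: "E < 0" using E by linarith
  have \<mu>: "ml \<le> \<mu>" "\<mu> \<le> mh"
    using quotient_bounds[OF En J1] by (simp_all add: \<mu>_def height_mu_def J1_def E_def)
  have \<mu>2: "ml ^ 2 \<le> \<mu> ^ 2" "\<mu> ^ 2 \<le> mh ^ 2" using \<mu> ml by (auto intro: power_mono)
  have N: "N \<le> J2h - 2 * min (ml * JEl) (mh * JEl) + max (ml ^ 2 * E2h) (mh ^ 2 * E2h)"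
    "J2l - 2 * max (ml * JEh) (mh * JEh) + min (ml ^ 2 * E2l) (mh ^ 2 * E2l) \<le> N"
    using mult_corners[OF \<mu> ml JE] mult_corners[OF \<mu>2 _ E2] J2 by (simp_all add: N_def)
  have "sl * El \<le> sl * E" "sh * E \<le> sh * Eh" using E pos by (auto intro!: mult_left_mono)
  then have "N \<le> sl * E" "sh * E \<le> N" using N sl sh by linarith+
  from quotient_bounds[OF En this] have \<sigma>: "sl \<le> height_sigma2 t z" "height_sigma2 t z \<le> sh"
    by (simp_all add: height_sigma2_def N_def \<mu>_def J2_def JE_def E2_def E_def)
  show ?thesis
    unfolding good_constants_def using En \<mu> \<sigma> m v pos unfolding E_def \<mu>_def by (auto simp: abs_le_iff)
qed

section \<open>Interval enclosures for two to five children\<close>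

text \<open>Simultaneous rational enclosures of the coefficient and of its two logarithmic weights at index
  \<open>j\<close>.\<close>

definition in_box :: "nat \<Rightarrow> nat \<Rightarrow> real \<Rightarrow> real \<Rightarrow> real \<Rightarrow> real \<Rightarrow> real \<Rightarrow> real \<Rightarrow> real \<Rightarrow> bool" where
  "in_box t j z l L k K g G \<longleftrightarrow> 0 \<le> l \<and> 0 \<le> k \<and> 0 \<le> g \<and>
     l \<le> lin_coeff t j z \<and> lin_coeff t j z \<le> L \<and> k \<le> log_weight t j z \<and> log_weight t j z \<le> K \<and>
     g \<le> log_weight' t j z \<and> log_weight' t j z \<le> G"

lemma in_box_1: "0 \<le> a \<Longrightarrow> a \<le> z \<Longrightarrow> z \<le> c \<Longrightarrow> z < 1 \<Longrightarrow> in_box t (Suc 0) z a c 1 1 0 0"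
  by (simp add: in_box_def lin_coeff_1 log_weight_1 log_weight'_1)

lemma power_ratio_bounds:
  fixes z :: real
  assumes "0 \<le> a" "a \<le> z" "z \<le> c" "0 \<le> p" "p \<le> a ^ N" "c ^ N \<le> P" "P < 1"
  shows "p \<le> z ^ N" "z ^ N \<le> P" "p / (1 - p) \<le> z ^ N / (1 - z ^ N)" "z ^ N / (1 - z ^ N) \<le> P / (1 - P)"
    "1 / (1 - p) \<le> 1 / (1 - z ^ N)" "1 / (1 - z ^ N) \<le> 1 / (1 - P)"
proof -
  show 1: "p \<le> z ^ N" "z ^ N \<le> P" using assms power_mono[of a z N] power_mono[of z c N] by linarith+
  then show "p / (1 - p) \<le> z ^ N / (1 - z ^ N)" "z ^ N / (1 - z ^ N) \<le> P / (1 - P)"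
    "1 / (1 - p) \<le> 1 / (1 - z ^ N)" "1 / (1 - z ^ N) \<le> 1 / (1 - P)"
    using assms by (auto intro!: frac_le)
qed

text \<open>The powers of \<open>z\<close> enter only through the rational bounds \<open>p\<close> and
  \<open>P\<close>, which keeps the numbers short.\<close>

lemma in_box_Suc:
  assumes bx: "in_box t (Suc j) z l L k K g G" and z: "0 \<le> a" "a \<le> z" "z \<le> c"
    and N: "br t (Suc (Suc j)) = N" and p: "0 \<le> p" "p \<le> a ^ N" "c ^ N \<le> P" "P < 1"
    and l: "0 \<le> l'" "l' \<le> l * (p / (1 - p))" "L * (P / (1 - P)) \<le> L'"
    and k: "0 \<le> k'" "k' \<le> k + real N * (1 / (1 - p))" "K + real N * (1 / (1 - P)) \<le> K'"
    and g: "0 \<le> g'" "g' \<le> g + real N ^ 2 * (p / (1 - p)) * (1 / (1 - p))" "G + real N ^ 2 * (P / (1 - P)) * (1 / (1 - P)) \<le> G'"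
  shows "in_box t (Suc (Suc j)) z l' L' k' K' g' G'"
proof -
  note r = power_ratio_bounds[OF z p]
  note bx' = bx[unfolded in_box_def]
  have p1: "p < 1" using r p by linarith
  have pos: "0 \<le> p / (1 - p)" "0 \<le> 1 / (1 - p)" "0 \<le> z ^ N / (1 - z ^ N)" "0 \<le> 1 / (1 - z ^ N)" using p1 p r by auto
  have "l * (p / (1 - p)) \<le> lin_coeff t (Suc j) z * (z ^ N / (1 - z ^ N))"
    "lin_coeff t (Suc j) z * (z ^ N / (1 - z ^ N)) \<le> L * (P / (1 - P))"
    using bx' r pos by (auto intro!: mult_mono simp del: times_divide_eq_right times_divide_eq_left)
  moreover have "lin_coeff t (Suc (Suc j)) z = lin_coeff t (Suc j) z * (z ^ N / (1 - z ^ N))"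
    unfolding lin_coeff_Suc[of t "Suc j"] geo_ratio_def N ..
  ultimately have L: "l' \<le> lin_coeff t (Suc (Suc j)) z" "lin_coeff t (Suc (Suc j)) z \<le> L'" using l by linarith+
  have "real N * (1 / (1 - p)) \<le> real N * (1 / (1 - z ^ N))" "real N * (1 / (1 - z ^ N)) \<le> real N * (1 / (1 - P))"
    using r by (auto intro!: mult_left_mono simp del: times_divide_eq_right)
  moreover have "log_weight t (Suc (Suc j)) z = log_weight t (Suc j) z + real N * (1 / (1 - z ^ N))"
    unfolding log_weight_Suc N by simp
  ultimately have K: "k' \<le> log_weight t (Suc (Suc j)) z" "log_weight t (Suc (Suc j)) z \<le> K'" using k bx' by linarith+
  have "real N ^ 2 * (p / (1 - p)) * (1 / (1 - p)) \<le> real N ^ 2 * (z ^ N / (1 - z ^ N)) * (1 / (1 - z ^ N))"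
    "real N ^ 2 * (z ^ N / (1 - z ^ N)) * (1 / (1 - z ^ N)) \<le> real N ^ 2 * (P / (1 - P)) * (1 / (1 - P))"
    by (rule mult_mono mult_left_mono mult_nonneg_nonneg r pos zero_le_power2 order_trans[OF pos(3)])+
  moreover have "log_weight' t (Suc (Suc j)) z = log_weight' t (Suc j) z + real N ^ 2 * (z ^ N / (1 - z ^ N)) * (1 / (1 - z ^ N))"
    unfolding log_weight'_Suc N by (simp add: power2_eq_square)
  ultimately have G: "g' \<le> log_weight' t (Suc (Suc j)) z" "log_weight' t (Suc (Suc j)) z \<le> G'" using g bx' by linarith+
  show ?thesis unfolding in_box_def using l k g L K G by blast
qed

lemma in_box_bounds:
  assumes "in_box t j z l L k K g G" "j \<noteq> 0"
  shows "l * k \<le> euler_lin t j z" "euler_lin t j z \<le> L * K"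
    "l * (k ^ 2 + g) \<le> euler2_lin t j z" "euler2_lin t j z \<le> L * (K ^ 2 + G)" "majorant t z j \<le> L * K ^ 2"
    "l \<le> lin_coeff t j z" "lin_coeff t j z \<le> L"
  using assms by (auto simp: in_box_def euler_lin_def euler2_lin_def majorant_def intro!: mult_mono add_mono power_mono)

text \<open>The zero satisfies \<open>2 * z = 1 + lin_coeff t 2 z - \<dots>\<close>, and the right-hand side is
  increasing in \<open>z\<close> with slope less than 2, so an enclosure of \<open>z\<close> yields a
  narrower one.\<close>

lemma refine_zero:
  fixes z :: real
  assumes rel: "\<bar>2 * z - (1 + lin_coeff t 2 z - s)\<bar> \<le> \<tau>" and z: "0 \<le> a" "a \<le> z" "z \<le> c" "z < 1"
    and N: "br t 2 = N" and p: "0 \<le> p" "p \<le> a ^ N" "c ^ N \<le> P" "P < 1" and s: "s\<^sub>l \<le> s" "s \<le> s\<^sub>h"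
    and lh: "2 * l \<le> 1 + a * (p / (1 - p)) - s\<^sub>h - \<tau>" "1 + c * (P / (1 - P)) - s\<^sub>l + \<tau> \<le> 2 * h"
  shows "l \<le> z \<and> z \<le> h"
proof -
  note r = power_ratio_bounds[OF z(1-3) p]
  have "0 \<le> p / (1 - p)" using r p by simp
  then have "a * (p / (1 - p)) \<le> z * (z ^ N / (1 - z ^ N))" "z * (z ^ N / (1 - z ^ N)) \<le> c * (P / (1 - P))"
    using z r by (auto intro!: mult_mono simp del: times_divide_eq_right times_divide_eq_left)
  moreover have "lin_coeff t 2 z = z * (z ^ N / (1 - z ^ N))" using explicit_terms(1)[OF z(4), of t] by (simp only: N)
  ultimately show ?thesis using rel[unfolded abs_le_iff] s lh by linarith
qed

text \<open>The bounds start from \<open>1 / 2 \<le> z \<le> 0.56\<close> and are improved until the constants are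
  known well enough; the numbers are rounded values of the quantities concerned. Here the tail is only
  negligible from the sixth term on.\<close>

lemma good_constants_2:
  assumes z: "1 / 2 \<le> z" "z \<le> 0.56" and zero: "real_lin 2 z = 0"
  shows "good_constants 2 z"
proof -
  have c1: "in_box 2 (Suc 0) z (1 / 2) (14 / 25) 1 1 0 0" by (rule in_box_1) (use z  in simp_all)
  have c2: "in_box 2 (Suc (Suc 0)) z (0) (11929509 / 100000000) (4) (116 / 25) (0) (233 / 100)"
    by (rule in_box_Suc[OF c1, where a = "1 / 2" and c = "14 / 25" and N = 3 and p = "0" and P = "2744 / 15625"]) (use z  in \<open>simp_all add: br_def power_divide\<close>)
  have c3: "in_box 2 (Suc (Suc (Suc 0))) z (0) (26207 / 12500000) (11) (1177 / 100) (0) (321 / 100)"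
    by (rule in_box_Suc[OF c2, where a = "1 / 2" and c = "14 / 25" and N = 7 and p = "0" and P = "17271 / 1000000"]) (use z  in \<open>simp_all add: br_def power_divide\<close>)
  have c4: "in_box 2 (Suc (Suc (Suc (Suc 0)))) z (0) (351 / 1000000000) (26) (1339 / 50) (0) (13 / 4)"
    by (rule in_box_Suc[OF c3, where a = "1 / 2" and c = "14 / 25" and N = 15 and p = "0" and P = "1671 / 10000000"]) (use z  in \<open>simp_all add: br_def power_divide\<close>)
  have c5: "in_box 2 (Suc (Suc (Suc (Suc (Suc 0))))) z (0) (1 / 10000000000000) (57) (5779 / 100) (0) (163 / 50)"
    by (rule in_box_Suc[OF c4, where a = "1 / 2" and c = "14 / 25" and N = 31 and p = "0" and P = "1563 / 100000000000"]) (use z  in \<open>simp_all add: br_def power_divide\<close>)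
  have \<tau>: "2.5 * majorant 2 z 5 \<le> 1 / 100000000" using in_box_bounds(5)[OF c5] by (simp add: eval_nat_numeral)
  have "2 \<le> (2::nat)" by simp
  note p = first_5_terms[OF this z zero \<tau>]
  have small: "0 \<le> lin_coeff 2 4 z" "lin_coeff 2 4 z \<le> 1 / 2500000" using in_box_bounds(6,7)[OF c4] by (simp_all add: eval_nat_numeral)
  have rel: "\<bar>2 * z - (1 + lin_coeff 2 2 z - lin_coeff 2 3 z)\<bar> \<le> 41 / 100000000" using p(1) small unfolding abs_le_iff by linarith
  have "1 / 2 \<le> z \<and> z \<le> 14 / 25" using z by simp
  then have z': "1 / 2 \<le> z" "z \<le> 14 / 25" by auto
  have s1: "in_box 2 (Suc 0) z (1 / 2) (14 / 25) 1 1 0 0" by (rule in_box_1) (use z' in simp_all)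
  have s2: "in_box 2 (Suc (Suc 0)) z (7142857 / 100000000) (11929509 / 100000000) 0 (116 / 25) 0 (233 / 100)"
    by (rule in_box_Suc[OF s1, where a = "1 / 2" and c = "14 / 25" and N = 3 and p = "1 / 8" and P = "2744 / 15625"]) (use z' in \<open>simp_all add: br_def power_divide\<close>)
  have "in_box 2 (Suc (Suc (Suc 0))) z (28121 / 50000000) (41931 / 20000000) 0 (1177 / 100) 0 (321 / 100)"
    by (rule in_box_Suc[OF s2, where a = "1 / 2" and c = "14 / 25" and N = 7 and p = "1 / 128" and P = "345419 / 20000000"]) (use z' in \<open>simp_all add: br_def power_divide\<close>)
  note s = in_box_bounds(6,7)[OF this, folded numeral_3_eq_3, simplified]
  have "26733 / 50000 \<le> z \<and> z \<le> 55937 / 100000"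
    by (rule refine_zero[OF rel, where a = "1 / 2" and c = "14 / 25" and N = 3 and p = "1 / 8" and P = "2744 / 15625" and s\<^sub>l = "28121 / 50000000" and s\<^sub>h = "41931 / 20000000"]) (use z' s in \<open>simp_all add: br_def eval_nat_numeral power_divide\<close>)
  then have z': "26733 / 50000 \<le> z" "z \<le> 55937 / 100000" by auto
  have s1: "in_box 2 (Suc 0) z (26733 / 50000) (55937 / 100000) 1 1 0 0" by (rule in_box_1) (use z' in simp_all)
  have s2: "in_box 2 (Suc (Suc 0)) z (9645941 / 100000000) (2373479 / 20000000) 0 (116 / 25) 0 (58 / 25)"
    by (rule in_box_Suc[OF s1, where a = "26733 / 50000" and c = "55937 / 100000" and N = 3 and p = "15283861 / 100000000" and P = "17502397 / 100000000"]) (use z' in \<open>simp_all add: br_def power_divide\<close>)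
  have "in_box 2 (Suc (Suc (Suc 0))) z (30499 / 25000000) (103449 / 50000000) 0 (1177 / 100) 0 (319 / 100)"
    by (rule in_box_Suc[OF s2, where a = "26733 / 50000" and c = "55937 / 100000" and N = 7 and p = "624473 / 50000000" and P = "85677 / 5000000"]) (use z' in \<open>simp_all add: br_def power_divide\<close>)
  note s = in_box_bounds(6,7)[OF this, folded numeral_3_eq_3, simplified]
  have "54719 / 100000 \<le> z \<and> z \<le> 55873 / 100000"
    by (rule refine_zero[OF rel, where a = "26733 / 50000" and c = "55937 / 100000" and N = 3 and p = "15283861 / 100000000" and P = "17502397 / 100000000" and s\<^sub>l = "30499 / 25000000" and s\<^sub>h = "103449 / 50000000"]) (use z' s in \<open>simp_all add: br_def eval_nat_numeral power_divide\<close>)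
  then have z': "54719 / 100000 \<le> z" "z \<le> 55873 / 100000" by auto
  have s1: "in_box 2 (Suc 0) z (54719 / 100000) (55873 / 100000) 1 1 0 0" by (rule in_box_1) (use z' in simp_all)
  have s2: "in_box 2 (Suc (Suc 0)) z (5360831 / 50000000) (1180459 / 10000000) 0 (116 / 25) 0 (231 / 100)"
    by (rule in_box_Suc[OF s1, where a = "54719 / 100000" and c = "55873 / 100000" and N = 3 and p = "16383793 / 100000000" and P = "1744239 / 10000000"]) (use z' in \<open>simp_all add: br_def power_divide\<close>)
  have "in_box 2 (Suc (Suc (Suc 0))) z (39957 / 25000000) (51033 / 25000000) 0 (1177 / 100) 0 (159 / 50)"
    by (rule in_box_Suc[OF s2, where a = "54719 / 100000" and c = "55873 / 100000" and N = 7 and p = "734407 / 50000000" and P = "212483 / 12500000"]) (use z' in \<open>simp_all add: br_def power_divide\<close>)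
  note s = in_box_bounds(6,7)[OF this, folded numeral_3_eq_3, simplified]
  have "27629 / 50000 \<le> z \<and> z \<le> 55823 / 100000"
    by (rule refine_zero[OF rel, where a = "54719 / 100000" and c = "55873 / 100000" and N = 3 and p = "16383793 / 100000000" and P = "1744239 / 10000000" and s\<^sub>l = "39957 / 25000000" and s\<^sub>h = "51033 / 25000000"]) (use z' s in \<open>simp_all add: br_def eval_nat_numeral power_divide\<close>)
  then have z': "27629 / 50000 \<le> z" "z \<le> 55823 / 100000" by auto
  have s1: "in_box 2 (Suc 0) z (27629 / 50000) (55823 / 100000) 1 1 0 0" by (rule in_box_1) (use z' in simp_all)
  have s2: "in_box 2 (Suc (Suc 0)) z (5607989 / 50000000) (11755729 / 100000000) 0 (116 / 25) 0 (23 / 10)"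
    by (rule in_box_Suc[OF s1, where a = "27629 / 50000" and c = "55823 / 100000" and N = 3 and p = "3374547 / 20000000" and P = "3479121 / 20000000"]) (use z' in \<open>simp_all add: br_def power_divide\<close>)
  have "in_box 2 (Suc (Suc (Suc 0))) z (89631 / 50000000) (50499 / 25000000) 0 (1177 / 100) 0 (79 / 25)"
    by (rule in_box_Suc[OF s2, where a = "27629 / 50000" and c = "55823 / 100000" and N = 7 and p = "314627 / 20000000" and P = "422311 / 25000000"]) (use z' in \<open>simp_all add: br_def power_divide\<close>)
  note s = in_box_bounds(6,7)[OF this, folded numeral_3_eq_3, simplified]
  have "27753 / 50000 \<le> z \<and> z \<le> 55789 / 100000"
    by (rule refine_zero[OF rel, where a = "27629 / 50000" and c = "55823 / 100000" and N = 3 and p = "3374547 / 20000000" and P = "3479121 / 20000000" and s\<^sub>l = "89631 / 50000000" and s\<^sub>h = "50499 / 25000000"]) (use z' s in \<open>simp_all add: br_def eval_nat_numeral power_divide\<close>)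
  then have z': "27753 / 50000 \<le> z" "z \<le> 55789 / 100000" by auto
  have s1: "in_box 2 (Suc 0) z (27753 / 50000) (55789 / 100000) 1 1 0 0" by (rule in_box_1) (use z' in simp_all)
  have s2: "in_box 2 (Suc (Suc 0)) z (286253 / 2500000) (11722607 / 100000000) 0 (116 / 25) 0 (229 / 100)"
    by (rule in_box_Suc[OF s1, where a = "27753 / 50000" and c = "55789 / 100000" and N = 3 and p = "4275233 / 25000000" and P = "17363839 / 100000000"]) (use z' in \<open>simp_all add: br_def power_divide\<close>)
  have "in_box 2 (Suc (Suc (Suc 0))) z (738 / 390625) (40111 / 20000000) 0 (294 / 25) 0 (63 / 20)"
    by (rule in_box_Suc[OF s2, where a = "27753 / 50000" and c = "55789 / 100000" and N = 7 and p = "1623227 / 100000000" and P = "336411 / 20000000"]) (use z' in \<open>simp_all add: br_def power_divide\<close>)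
  note s = in_box_bounds(6,7)[OF this, folded numeral_3_eq_3, simplified]
  have "6953 / 12500 \<le> z \<and> z \<le> 55767 / 100000"
    by (rule refine_zero[OF rel, where a = "27753 / 50000" and c = "55789 / 100000" and N = 3 and p = "4275233 / 25000000" and P = "17363839 / 100000000" and s\<^sub>l = "738 / 390625" and s\<^sub>h = "40111 / 20000000"]) (use z' s in \<open>simp_all add: br_def eval_nat_numeral power_divide\<close>)
  then have z': "6953 / 12500 \<le> z" "z \<le> 55767 / 100000" by auto
  have s1: "in_box 2 (Suc 0) z (6953 / 12500) (55767 / 100000) 1 1 0 0" by (rule in_box_1) (use z' in simp_all)
  have s2: "in_box 2 (Suc (Suc 0)) z (2890761 / 25000000) (11701219 / 100000000) 0 (463 / 100) 0 (229 / 100)"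
    by (rule in_box_Suc[OF s1, where a = "6953 / 12500" and c = "55767 / 100000" and N = 3 and p = "17210229 / 100000000" and P = "3468661 / 20000000"]) (use z' in \<open>simp_all add: br_def power_divide\<close>)
  have "in_box 2 (Suc (Suc (Suc 0))) z (6053 / 3125000) (199627 / 100000000) 0 (47 / 4) 0 (63 / 20)"
    by (rule in_box_Suc[OF s2, where a = "6953 / 12500" and c = "55767 / 100000" and N = 7 and p = "823769 / 50000000" and P = "1677417 / 100000000"]) (use z' in \<open>simp_all add: br_def power_divide\<close>)
  note s = in_box_bounds(6,7)[OF this, folded numeral_3_eq_3, simplified]
  have "55681 / 100000 \<le> z \<and> z \<le> 27877 / 50000"
    by (rule refine_zero[OF rel, where a = "6953 / 12500" and c = "55767 / 100000" and N = 3 and p = "17210229 / 100000000" and P = "3468661 / 20000000" and s\<^sub>l = "6053 / 3125000" and s\<^sub>h = "199627 / 100000000"]) (use z' s in \<open>simp_all add: br_def eval_nat_numeral power_divide\<close>)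
  then have z': "55681 / 100000 \<le> z" "z \<le> 27877 / 50000" by auto
  have s1: "in_box 2 (Suc 0) z (55681 / 100000) (27877 / 50000) 1 1 0 0" by (rule in_box_1) (use z' in simp_all)
  have s2: "in_box 2 (Suc (Suc 0)) z (2323589 / 20000000) (5844299 / 50000000) 0 (463 / 100) 0 (229 / 100)"
    by (rule in_box_Suc[OF s1, where a = "55681 / 100000" and c = "27877 / 50000" and N = 3 and p = "17263191 / 100000000" and P = "17331179 / 100000000"]) (use z' in \<open>simp_all add: br_def power_divide\<close>)
  have "in_box 2 (Suc (Suc (Suc 0))) z (4901 / 2500000) (199081 / 100000000) 0 (47 / 4) 0 (157 / 50)"
    by (rule in_box_Suc[OF s2, where a = "55681 / 100000" and c = "27877 / 50000" and N = 7 and p = "6482 / 390625" and P = "837341 / 50000000"]) (use z' in \<open>simp_all add: br_def power_divide\<close>)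
  note s = in_box_bounds(6,7)[OF this, folded numeral_3_eq_3, simplified]
  have "55709 / 100000 \<le> z \<and> z \<le> 55747 / 100000"
    by (rule refine_zero[OF rel, where a = "55681 / 100000" and c = "27877 / 50000" and N = 3 and p = "17263191 / 100000000" and P = "17331179 / 100000000" and s\<^sub>l = "4901 / 2500000" and s\<^sub>h = "199081 / 100000000"]) (use z' s in \<open>simp_all add: br_def eval_nat_numeral power_divide\<close>)
  then have z': "55709 / 100000 \<le> z" "z \<le> 55747 / 100000" by auto
  have s1: "in_box 2 (Suc 0) z (55709 / 100000) (55747 / 100000) 1 1 0 0" by (rule in_box_1) (use z' in simp_all)
  have s2: "in_box 2 (Suc (Suc 0)) z (11644999 / 100000000) (5840903 / 50000000) 0 (463 / 100) 0 (229 / 100)"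
    by (rule in_box_Suc[OF s1, where a = "55709 / 100000" and c = "55747 / 100000" and N = 3 and p = "17289247 / 100000000" and P = "4331163 / 25000000"]) (use z' in \<open>simp_all add: br_def power_divide\<close>)
  have "in_box 2 (Suc (Suc (Suc 0))) z (197201 / 100000000) (49697 / 25000000) 0 (47 / 4) 0 (157 / 50)"
    by (rule in_box_Suc[OF s2, where a = "55709 / 100000" and c = "55747 / 100000" and N = 7 and p = "832621 / 50000000" and P = "1673211 / 100000000"]) (use z' in \<open>simp_all add: br_def power_divide\<close>)
  note s = in_box_bounds(6,7)[OF this, folded numeral_3_eq_3, simplified]
  have "55723 / 100000 \<le> z \<and> z \<le> 55743 / 100000"
    by (rule refine_zero[OF rel, where a = "55709 / 100000" and c = "55747 / 100000" and N = 3 and p = "17289247 / 100000000" and P = "4331163 / 25000000" and s\<^sub>l = "197201 / 100000000" and s\<^sub>h = "49697 / 25000000"]) (use z' s in \<open>simp_all add: br_def eval_nat_numeral power_divide\<close>)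
  then have z': "55723 / 100000 \<le> z" "z \<le> 55743 / 100000" by auto
  have s1: "in_box 2 (Suc 0) z (55723 / 100000) (55743 / 100000) 1 1 0 0" by (rule in_box_1) (use z' in simp_all)
  have s2: "in_box 2 (Suc (Suc 0)) z (11658547 / 100000000) (11677927 / 100000000) 0 (463 / 100) 0 (229 / 100)"
    by (rule in_box_Suc[OF s1, where a = "55723 / 100000" and c = "55743 / 100000" and N = 3 and p = "3460457 / 20000000" and P = "17320923 / 100000000"]) (use z' in \<open>simp_all add: br_def power_divide\<close>)
  have "in_box 2 (Suc (Suc (Suc 0))) z (24723 / 12500000) (9931 / 5000000) 0 (47 / 4) 0 (157 / 50)"
    by (rule in_box_Suc[OF s2, where a = "55723 / 100000" and c = "55743 / 100000" and N = 7 and p = "834087 / 50000000" and P = "167237 / 10000000"]) (use z' in \<open>simp_all add: br_def power_divide\<close>)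
  note s = in_box_bounds(6,7)[OF this, folded numeral_3_eq_3, simplified]
  have "55729 / 100000 \<le> z \<and> z \<le> 55741 / 100000"
    by (rule refine_zero[OF rel, where a = "55723 / 100000" and c = "55743 / 100000" and N = 3 and p = "3460457 / 20000000" and P = "17320923 / 100000000" and s\<^sub>l = "24723 / 12500000" and s\<^sub>h = "9931 / 5000000"]) (use z' s in \<open>simp_all add: br_def eval_nat_numeral power_divide\<close>)
  then have z': "55729 / 100000 \<le> z" "z \<le> 55741 / 100000" by auto
  have s1: "in_box 2 (Suc 0) z (55729 / 100000) (55741 / 100000) 1 1 0 0" by (rule in_box_1) (use z' in simp_all)
  have s2: "in_box 2 (Suc (Suc 0)) z (5832179 / 50000000) (2918997 / 25000000) 0 (463 / 100) 0 (229 / 100)"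
    by (rule in_box_Suc[OF s1, where a = "55729 / 100000" and c = "55741 / 100000" and N = 3 and p = "138463 / 800000" and P = "17319059 / 100000000"]) (use z' in \<open>simp_all add: br_def power_divide\<close>)
  have "in_box 2 (Suc (Suc (Suc 0))) z (99017 / 50000000) (198537 / 100000000) 0 (47 / 4) 0 (157 / 50)"
    by (rule in_box_Suc[OF s2, where a = "55729 / 100000" and c = "55741 / 100000" and N = 7 and p = "208679 / 12500000" and P = "1671951 / 100000000"]) (use z' in \<open>simp_all add: br_def power_divide\<close>)
  note s = in_box_bounds(6,7)[OF this, folded numeral_3_eq_3, simplified]
  have "13933 / 25000 \<le> z \<and> z \<le> 55739 / 100000"
    by (rule refine_zero[OF rel, where a = "55729 / 100000" and c = "55741 / 100000" and N = 3 and p = "138463 / 800000" and P = "17319059 / 100000000" and s\<^sub>l = "99017 / 50000000" and s\<^sub>h = "198537 / 100000000"]) (use z' s in \<open>simp_all add: br_def eval_nat_numeral power_divide\<close>)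
  then have z': "13933 / 25000 \<le> z" "z \<le> 55739 / 100000" by auto
  have s1: "in_box 2 (Suc 0) z (13933 / 25000) (55739 / 100000) 1 1 0 0" by (rule in_box_1) (use z' in simp_all)
  have s2: "in_box 2 (Suc (Suc 0)) z (182301 / 1562500) (11674049 / 100000000) 0 (463 / 100) 0 (57 / 25)"
    by (rule in_box_Suc[OF s1, where a = "13933 / 25000" and c = "55739 / 100000" and N = 3 and p = "1731067 / 10000000" and P = "8658597 / 50000000"]) (use z' in \<open>simp_all add: br_def power_divide\<close>)
  have "in_box 2 (Suc (Suc (Suc 0))) z (198159 / 100000000) (198453 / 100000000) 0 (47 / 4) 0 (313 / 100)"
    by (rule in_box_Suc[OF s2, where a = "13933 / 25000" and c = "55739 / 100000" and N = 7 and p = "1670061 / 100000000" and P = "1671531 / 100000000"]) (use z' in \<open>simp_all add: br_def power_divide\<close>)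
  note s = in_box_bounds(6,7)[OF this, folded numeral_3_eq_3, simplified]
  have "27867 / 50000 \<le> z \<and> z \<le> 27869 / 50000"
    by (rule refine_zero[OF rel, where a = "13933 / 25000" and c = "55739 / 100000" and N = 3 and p = "1731067 / 10000000" and P = "8658597 / 50000000" and s\<^sub>l = "198159 / 100000000" and s\<^sub>h = "198453 / 100000000"]) (use z' s in \<open>simp_all add: br_def eval_nat_numeral power_divide\<close>)
  then have z': "27867 / 50000 \<le> z" "z \<le> 27869 / 50000" by auto
  have s1: "in_box 2 (Suc 0) z (27867 / 50000) (27869 / 50000) 1 1 0 0" by (rule in_box_1) (use z' in simp_all)
  have s2: "in_box 2 (Suc (Suc 0)) z (5834601 / 50000000) (291827 / 2500000) 0 (463 / 100) 0 (57 / 25)"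
    by (rule in_box_Suc[OF s1, where a = "27867 / 50000" and c = "27869 / 50000" and N = 3 and p = "8656267 / 50000000" and P = "8658131 / 50000000"]) (use z' in \<open>simp_all add: br_def power_divide\<close>)
  have "in_box 2 (Suc (Suc (Suc 0))) z (198243 / 100000000) (198411 / 100000000) 0 (47 / 4) 0 (313 / 100)"
    by (rule in_box_Suc[OF s2, where a = "27867 / 50000" and c = "27869 / 50000" and N = 7 and p = "20881 / 1250000" and P = "1671321 / 100000000"]) (use z' in \<open>simp_all add: br_def power_divide\<close>)
  note s = in_box_bounds(6,7)[OF this, folded numeral_3_eq_3, simplified]
  have "11147 / 20000 \<le> z \<and> z \<le> 27869 / 50000"
    by (rule refine_zero[OF rel, where a = "27867 / 50000" and c = "27869 / 50000" and N = 3 and p = "8656267 / 50000000" and P = "8658131 / 50000000" and s\<^sub>l = "198243 / 100000000" and s\<^sub>h = "198411 / 100000000"]) (use z' s in \<open>simp_all add: br_def eval_nat_numeral power_divide\<close>)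
  then have box: "11147 / 20000 \<le> z" "z \<le> 27869 / 50000" by auto
  have f1: "in_box 2 (Suc 0) z (11147 / 20000) (27869 / 50000) 1 1 0 0" by (rule in_box_1) (use z box in simp_all)
  have f2: "in_box 2 (Suc (Suc 0)) z (23340333 / 200000000) (14591357 / 125000000) (14463 / 3125) (23141417 / 5000000) (22790651 / 10000000) (227959 / 100000)"
    by (rule in_box_Suc[OF f1, where a = "11147 / 20000" and c = "27869 / 50000" and N = 3 and p = "865673 / 5000000" and P = "1731627 / 10000000"]) (use z box in \<open>simp_all add: br_def power_divide\<close>)
  have f3: "in_box 2 (Suc (Suc (Suc 0))) z (39657 / 20000000) (1984119 / 1000000000) (117470953 / 10000000) (117472651 / 10000000) (31257581 / 10000000) (3908273 / 1250000)"
    by (rule in_box_Suc[OF f2, where a = "11147 / 20000" and c = "27869 / 50000" and N = 7 and p = "167069 / 10000000" and P = "167133 / 10000000"]) (use z box in \<open>simp_all add: br_def power_divide\<close>)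
  have f4: "in_box 2 (Suc (Suc (Suc (Suc 0)))) z (77 / 250000000) (309 / 1000000000) (267494281 / 10000000) (26749601 / 1000000) (7901891 / 2500000) (31616619 / 10000000)"
    by (rule in_box_Suc[OF f3, where a = "11147 / 20000" and c = "27869 / 50000" and N = 15 and p = "311 / 2000000" and P = "1557 / 10000000"]) (use z box in \<open>simp_all add: br_def power_divide\<close>)
  have b2: "5401139 / 10000000 \<le> euler_lin 2 2 z" "euler_lin 2 2 z \<le> 1080527 / 2000000" "5531409 / 2000000 \<le> euler2_lin 2 2 z" "euler2_lin 2 2 z \<le> 27665911 / 10000000"
      "23340333 / 200000000 \<le> lin_coeff 2 2 z" "lin_coeff 2 2 z \<le> 14591357 / 125000000"
    using in_box_bounds(1-4,6,7)[OF f2] by (simp_all add: eval_nat_numeral power_divide)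
  have b3: "232927 / 10000000 \<le> euler_lin 2 3 z" "euler_lin 2 3 z \<le> 5827 / 250000" "1399099 / 5000000 \<le> euler2_lin 2 3 z" "euler2_lin 2 3 z \<le> 1400043 / 5000000"
      "39657 / 20000000 \<le> lin_coeff 2 3 z" "lin_coeff 2 3 z \<le> 1984119 / 1000000000"
    using in_box_bounds(1-4,6,7)[OF f3] by (simp_all add: eval_nat_numeral power_divide)
  have b4: "41 / 5000000 \<le> euler_lin 2 4 z" "euler_lin 2 4 z \<le> 83 / 10000000" "2213 / 10000000 \<le> euler2_lin 2 4 z" "euler2_lin 2 4 z \<le> 2221 / 10000000"
      "77 / 250000000 \<le> lin_coeff 2 4 z" "lin_coeff 2 4 z \<le> 309 / 1000000000"
    using in_box_bounds(1-4,6,7)[OF f4] by (simp_all add: eval_nat_numeral power_divide)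
  note bounds = box p(2-6)[unfolded abs_le_iff] b2 b3 b4
  show ?thesis
    by (rule constants_from_box[where El = "(- 11959 / 20000)" and Eh = "(- 14943 / 25000)" and ml = "(275807 / 500000)" and mh = "(551977 / 1000000)" and J2l = "(- 10843 / 100000)" and J2h = "(- 5413 / 50000)"
        and JEl = "(9059 / 20000)" and JEh = "(22667 / 50000)" and E2l = "(27423 / 20000)" and E2h = "(13723 / 10000)" and sl = "(127 / 400)" and sh = "(3207 / 10000)"])
       ((use bounds in linarith) | simp add: mean_approx_def variance_approx_def power_divide)+
qed

lemma good_constants_3:
  assumes z: "1 / 2 \<le> z" "z \<le> 0.56" and zero: "real_lin 3 z = 0"
  shows "good_constants 3 z"
proof -
  have c1: "in_box 3 (Suc 0) z (1 / 2) (14 / 25) 1 1 0 0" by (rule in_box_1) (use z  in simp_all)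
  have c2: "in_box 3 (Suc (Suc 0)) z (0) (6108013 / 100000000) (5) (136 / 25) (0) (97 / 50)"
    by (rule in_box_Suc[OF c1, where a = "1 / 2" and c = "14 / 25" and N = 4 and p = "0" and P = "19669 / 200000"]) (use z  in \<open>simp_all add: br_def power_divide\<close>)
  have c3: "in_box 3 (Suc (Suc (Suc 0))) z (0) (6511 / 200000000) (18) (369 / 20) (0) (51 / 25)"
    by (rule in_box_Suc[OF c2, where a = "1 / 2" and c = "14 / 25" and N = 13 and p = "0" and P = "5327 / 10000000"]) (use z  in \<open>simp_all add: br_def power_divide\<close>)
  have c4: "in_box 3 (Suc (Suc (Suc (Suc 0)))) z (0) (7 / 2500000000000000) (58) (2923 / 50) (0) (41 / 20)"
    by (rule in_box_Suc[OF c3, where a = "1 / 2" and c = "14 / 25" and N = 40 and p = "0" and P = "8463 / 100000000000000"]) (use z  in \<open>simp_all add: br_def power_divide\<close>)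
  have \<tau>: "2.5 * majorant 3 z 4 \<le> 1 / 100000000" using in_box_bounds(5)[OF c4] by (simp add: eval_nat_numeral)
  have "2 \<le> (3::nat)" by simp
  note p = first_4_terms[OF this z zero \<tau>]
  have rel: "\<bar>2 * z - (1 + lin_coeff 3 2 z - lin_coeff 3 3 z)\<bar> \<le> 1 / 100000000" using p(1) unfolding abs_le_iff by simp
  have "1 / 2 \<le> z \<and> z \<le> 14 / 25" using z by simp
  then have z': "1 / 2 \<le> z" "z \<le> 14 / 25" by auto
  have s1: "in_box 3 (Suc 0) z (1 / 2) (14 / 25) 1 1 0 0" by (rule in_box_1) (use z' in simp_all)
  have s2: "in_box 3 (Suc (Suc 0)) z (3333333 / 100000000) (610801 / 10000000) 0 (136 / 25) 0 (97 / 50)"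
    by (rule in_box_Suc[OF s1, where a = "1 / 2" and c = "14 / 25" and N = 4 and p = "1 / 16" and P = "38416 / 390625"]) (use z' in \<open>simp_all add: br_def power_divide\<close>)
  have "in_box 3 (Suc (Suc (Suc 0))) z (203 / 50000000) (407 / 12500000) 0 (369 / 20) 0 (51 / 25)"
    by (rule in_box_Suc[OF s2, where a = "1 / 2" and c = "14 / 25" and N = 13 and p = "12207 / 100000000" and P = "26633 / 50000000"]) (use z' in \<open>simp_all add: br_def power_divide\<close>)
  note s = in_box_bounds(6,7)[OF this, folded numeral_3_eq_3, simplified]
  have "10333 / 20000 \<le> z \<and> z \<le> 26527 / 50000"
    by (rule refine_zero[OF rel, where a = "1 / 2" and c = "14 / 25" and N = 4 and p = "1 / 16" and P = "38416 / 390625" and s\<^sub>l = "203 / 50000000" and s\<^sub>h = "407 / 12500000"]) (use z' s in \<open>simp_all add: br_def eval_nat_numeral power_divide\<close>)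
  then have z': "10333 / 20000 \<le> z" "z \<le> 26527 / 50000" by auto
  have s1: "in_box 3 (Suc 0) z (10333 / 20000) (26527 / 50000) 1 1 0 0" by (rule in_box_1) (use z' in simp_all)
  have s2: "in_box 3 (Suc (Suc 0)) z (3963541 / 100000000) (1141243 / 25000000) 0 (107 / 20) 0 (3 / 2)"
    by (rule in_box_Suc[OF s1, where a = "10333 / 20000" and c = "26527 / 50000" and N = 4 and p = "3562507 / 50000000" and P = "30948 / 390625"]) (use z' in \<open>simp_all add: br_def power_divide\<close>)
  have "in_box 3 (Suc (Suc (Suc 0))) z (37 / 5000000) (241 / 20000000) 0 (459 / 25) 0 (31 / 20)"
    by (rule in_box_Suc[OF s2, where a = "10333 / 20000" and c = "26527 / 50000" and N = 13 and p = "18687 / 100000000" and P = "1649 / 6250000"]) (use z' in \<open>simp_all add: br_def power_divide\<close>)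
  note s = in_box_bounds(6,7)[OF this, folded numeral_3_eq_3, simplified]
  have "51981 / 100000 \<le> z \<and> z \<le> 52283 / 100000"
    by (rule refine_zero[OF rel, where a = "10333 / 20000" and c = "26527 / 50000" and N = 4 and p = "3562507 / 50000000" and P = "30948 / 390625" and s\<^sub>l = "37 / 5000000" and s\<^sub>h = "241 / 20000000"]) (use z' s in \<open>simp_all add: br_def eval_nat_numeral power_divide\<close>)
  then have z': "51981 / 100000 \<le> z" "z \<le> 52283 / 100000" by auto
  have s1: "in_box 3 (Suc 0) z (51981 / 100000) (52283 / 100000) 1 1 0 0" by (rule in_box_1) (use z' in simp_all)
  have s2: "in_box 3 (Suc (Suc 0)) z (4093999 / 100000000) (4222113 / 100000000) 0 (533 / 100) 0 (7 / 5)"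
    by (rule in_box_Suc[OF s1, where a = "51981 / 100000" and c = "52283 / 100000" and N = 4 and p = "1460187 / 20000000" and P = "7472089 / 100000000"]) (use z' in \<open>simp_all add: br_def power_divide\<close>)
  have "in_box 3 (Suc (Suc (Suc 0))) z (207 / 25000000) (461 / 50000000) 0 (917 / 50) 0 (36 / 25)"
    by (rule in_box_Suc[OF s2, where a = "51981 / 100000" and c = "52283 / 100000" and N = 13 and p = "20229 / 100000000" and P = "5453 / 25000000"]) (use z' in \<open>simp_all add: br_def power_divide\<close>)
  note s = in_box_bounds(6,7)[OF this, folded numeral_3_eq_3, simplified]
  have "26023 / 50000 \<le> z \<and> z \<le> 52111 / 100000"
    by (rule refine_zero[OF rel, where a = "51981 / 100000" and c = "52283 / 100000" and N = 4 and p = "1460187 / 20000000" and P = "7472089 / 100000000" and s\<^sub>l = "207 / 25000000" and s\<^sub>h = "461 / 50000000"]) (use z' s in \<open>simp_all add: br_def eval_nat_numeral power_divide\<close>)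
  then have z': "26023 / 50000 \<le> z" "z \<le> 52111 / 100000" by auto
  have s1: "in_box 3 (Suc 0) z (26023 / 50000) (52111 / 100000) 1 1 0 0" by (rule in_box_1) (use z' in simp_all)
  have s2: "in_box 3 (Suc (Suc 0)) z (4121287 / 100000000) (1037183 / 25000000) 0 (133 / 25) 0 (69 / 50)"
    by (rule in_box_Suc[OF s1, where a = "26023 / 50000" and c = "52111 / 100000" and N = 4 and p = "3668761 / 50000000" and P = "7374247 / 100000000"]) (use z' in \<open>simp_all add: br_def power_divide\<close>)
  have "in_box 3 (Suc (Suc (Suc 0))) z (847 / 100000000) (217 / 25000000) 0 (1833 / 100) 0 (71 / 50)"
    by (rule in_box_Suc[OF s2, where a = "26023 / 50000" and c = "52111 / 100000" and N = 13 and p = "257 / 1250000" and P = "20897 / 100000000"]) (use z' in \<open>simp_all add: br_def power_divide\<close>)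
  note s = in_box_bounds(6,7)[OF this, folded numeral_3_eq_3, simplified]
  have "2603 / 5000 \<le> z \<and> z \<le> 26037 / 50000"
    by (rule refine_zero[OF rel, where a = "26023 / 50000" and c = "52111 / 100000" and N = 4 and p = "3668761 / 50000000" and P = "7374247 / 100000000" and s\<^sub>l = "847 / 100000000" and s\<^sub>h = "217 / 25000000"]) (use z' s in \<open>simp_all add: br_def eval_nat_numeral power_divide\<close>)
  then have z': "2603 / 5000 \<le> z" "z \<le> 26037 / 50000" by auto
  have s1: "in_box 3 (Suc 0) z (2603 / 5000) (26037 / 50000) 1 1 0 0" by (rule in_box_1) (use z' in simp_all)
  have s2: "in_box 3 (Suc (Suc 0)) z (257949 / 6250000) (4133091 / 100000000) 0 (133 / 25) 0 (69 / 50)"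
    by (rule in_box_Suc[OF s1, where a = "2603 / 5000" and c = "26037 / 50000" and N = 4 and p = "367271 / 5000000" and P = "294133 / 4000000"]) (use z' in \<open>simp_all add: br_def power_divide\<close>)
  have "in_box 3 (Suc (Suc (Suc 0))) z (851 / 100000000) (107 / 12500000) 0 (1833 / 100) 0 (71 / 50)"
    by (rule in_box_Suc[OF s2, where a = "2603 / 5000" and c = "26037 / 50000" and N = 13 and p = "2579 / 12500000" and P = "4141 / 20000000"]) (use z' in \<open>simp_all add: br_def power_divide\<close>)
  note s = in_box_bounds(6,7)[OF this, folded numeral_3_eq_3, simplified]
  have "52063 / 100000 \<le> z \<and> z \<le> 52067 / 100000"
    by (rule refine_zero[OF rel, where a = "2603 / 5000" and c = "26037 / 50000" and N = 4 and p = "367271 / 5000000" and P = "294133 / 4000000" and s\<^sub>l = "851 / 100000000" and s\<^sub>h = "107 / 12500000"]) (use z' s in \<open>simp_all add: br_def eval_nat_numeral power_divide\<close>)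
  then have z': "52063 / 100000 \<le> z" "z \<le> 52067 / 100000" by auto
  have s1: "in_box 3 (Suc 0) z (52063 / 100000) (52067 / 100000) 1 1 0 0" by (rule in_box_1) (use z' in simp_all)
  have s2: "in_box 3 (Suc (Suc 0)) z (4128449 / 100000000) (4130137 / 100000000) 0 (133 / 25) 0 (137 / 100)"
    by (rule in_box_Suc[OF s1, where a = "52063 / 100000" and c = "52067 / 100000" and N = 4 and p = "7347113 / 100000000" and P = "1837343 / 25000000"]) (use z' in \<open>simp_all add: br_def power_divide\<close>)
  have "in_box 3 (Suc (Suc (Suc 0))) z (213 / 25000000) (427 / 50000000) 0 (1833 / 100) 0 (141 / 100)"
    by (rule in_box_Suc[OF s2, where a = "52063 / 100000" and c = "52067 / 100000" and N = 13 and p = "2581 / 12500000" and P = "20669 / 100000000"]) (use z' in \<open>simp_all add: br_def power_divide\<close>)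
  note s = in_box_bounds(6,7)[OF this, folded numeral_3_eq_3, simplified]
  have "52063 / 100000 \<le> z \<and> z \<le> 10413 / 20000"
    by (rule refine_zero[OF rel, where a = "52063 / 100000" and c = "52067 / 100000" and N = 4 and p = "7347113 / 100000000" and P = "1837343 / 25000000" and s\<^sub>l = "213 / 25000000" and s\<^sub>h = "427 / 50000000"]) (use z' s in \<open>simp_all add: br_def eval_nat_numeral power_divide\<close>)
  then have box: "52063 / 100000 \<le> z" "z \<le> 10413 / 20000" by auto
  have f1: "in_box 3 (Suc 0) z (52063 / 100000) (10413 / 20000) 1 1 0 0" by (rule in_box_1) (use z box in simp_all)
  have f2: "in_box 3 (Suc (Suc 0)) z (20642237 / 500000000) (1651719 / 40000000) (10634377 / 2000000) (26586209 / 5000000) (13693629 / 10000000) (3424023 / 2500000)"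
    by (rule in_box_Suc[OF f1, where a = "52063 / 100000" and c = "10413 / 20000" and N = 4 and p = "734711 / 10000000" and P = "29393 / 400000"]) (use z box in \<open>simp_all add: br_def power_divide\<close>)
  have f3: "in_box 3 (Suc (Suc (Suc 0))) z (4261 / 500000000) (8533 / 1000000000) (91599361 / 5000000) (91599641 / 5000000) (14042589 / 10000000) (14045391 / 10000000)"
    by (rule in_box_Suc[OF f2, where a = "52063 / 100000" and c = "10413 / 20000" and N = 13 and p = "129 / 625000" and P = "1033 / 5000000"]) (use z box in \<open>simp_all add: br_def power_divide\<close>)
  have b2: "2195173 / 10000000 \<le> euler_lin 3 2 z" "euler_lin 3 2 z \<le> 34307 / 156250" "3059371 / 2500000 \<le> euler2_lin 3 2 z" "euler2_lin 3 2 z \<le> 12240341 / 10000000"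
      "20642237 / 500000000 \<le> lin_coeff 3 2 z" "lin_coeff 3 2 z \<le> 1651719 / 40000000"
    using in_box_bounds(1-4,6,7)[OF f2] by (simp_all add: eval_nat_numeral power_divide)
  have b3: "1561 / 10000000 \<le> euler_lin 3 3 z" "euler_lin 3 3 z \<le> 391 / 2500000" "28721 / 10000000 \<le> euler2_lin 3 3 z" "euler2_lin 3 3 z \<le> 28759 / 10000000"
      "4261 / 500000000 \<le> lin_coeff 3 3 z" "lin_coeff 3 3 z \<le> 8533 / 1000000000"
    using in_box_bounds(1-4,6,7)[OF f3] by (simp_all add: eval_nat_numeral power_divide)
  note bounds = box p(2-6)[unfolded abs_le_iff] b2 b3
  show ?thesis
    by (rule constants_from_box[where El = "(- 41097 / 50000)" and Eh = "(- 16437 / 20000)" and ml = "(53297 / 100000)" and mh = "(533073 / 1000000)" and J2l = "(- 35559 / 100000)" and J2h = "(- 35553 / 100000)"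
        and JEl = "(- 8209 / 100000)" and JEh = "(- 2049 / 25000)" and E2l = "(17957 / 100000)" and E2h = "(17991 / 100000)" and sl = "(1319 / 5000)" and sh = "(661 / 2500)"])
       ((use bounds in linarith) | simp add: mean_approx_def variance_approx_def power_divide)+
qed

lemma good_constants_4:
  assumes z: "1 / 2 \<le> z" "z \<le> 0.56" and zero: "real_lin 4 z = 0"
  shows "good_constants 4 z"
proof -
  have c1: "in_box 4 (Suc 0) z (1 / 2) (14 / 25) 1 1 0 0" by (rule in_box_1) (use z  in simp_all)
  have c2: "in_box 4 (Suc (Suc 0)) z (0) (3263901 / 100000000) (6) (63 / 10) (0) (31 / 20)"
    by (rule in_box_Suc[OF c1, where a = "1 / 2" and c = "14 / 25" and N = 5 and p = "0" and P = "27537 / 500000"]) (use z  in \<open>simp_all add: br_def power_divide\<close>)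
  have c3: "in_box 4 (Suc (Suc (Suc 0))) z (0) (1051 / 6250000000) (27) (2731 / 100) (0) (39 / 25)"
    by (rule in_box_Suc[OF c2, where a = "1 / 2" and c = "14 / 25" and N = 21 and p = "0" and P = "161 / 31250000"]) (use z  in \<open>simp_all add: br_def power_divide\<close>)
  have \<tau>: "2.5 * majorant 4 z 3 \<le> 157 / 500000" using in_box_bounds(5)[OF c3] by (simp add: eval_nat_numeral)
  have "2 \<le> (4::nat)" by simp
  note p = first_3_terms[OF this z zero \<tau>]
  have rel: "\<bar>2 * z - (1 + lin_coeff 4 2 z - 0)\<bar> \<le> 157 / 500000" using p(1) unfolding abs_le_iff by simp
  have "1 / 2 \<le> z \<and> z \<le> 14 / 25" using z by simp
  then have z': "1 / 2 \<le> z" "z \<le> 14 / 25" by auto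
  have "5079 / 10000 \<le> z \<and> z \<le> 1614 / 3125"
    by (rule refine_zero[OF rel, where a = "1 / 2" and c = "14 / 25" and N = 5 and p = "1 / 32" and P = "2753659 / 50000000" and s\<^sub>l = "0" and s\<^sub>h = "0"]) (use z' in \<open>simp_all add: br_def eval_nat_numeral power_divide\<close>)
  then have z': "5079 / 10000 \<le> z" "z \<le> 1614 / 3125" by auto
  have "6359 / 12500 \<le> z \<and> z \<le> 51001 / 100000"
    by (rule refine_zero[OF rel, where a = "5079 / 10000" and c = "1614 / 3125" and N = 5 and p = "16899 / 500000" and P = "3675087 / 100000000" and s\<^sub>l = "0" and s\<^sub>h = "0"]) (use z' in \<open>simp_all add: br_def eval_nat_numeral power_divide\<close>)
  then have z': "6359 / 12500 \<le> z" "z \<le> 51001 / 100000" by auto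
  have "50881 / 100000 \<le> z \<and> z \<le> 3183 / 6250"
    by (rule refine_zero[OF rel, where a = "6359 / 12500" and c = "51001 / 100000" and N = 5 and p = "851793 / 25000000" and P = "3450591 / 100000000" and s\<^sub>l = "0" and s\<^sub>h = "0"]) (use z' in \<open>simp_all add: br_def eval_nat_numeral power_divide\<close>)
  then have z': "50881 / 100000 \<le> z" "z \<le> 3183 / 6250" by auto
  have "25441 / 50000 \<le> z \<and> z \<le> 1273 / 2500"
    by (rule refine_zero[OF rel, where a = "50881 / 100000" and c = "3183 / 6250" and N = 5 and p = "1705093 / 50000000" and P = "3425967 / 100000000" and s\<^sub>l = "0" and s\<^sub>h = "0"]) (use z' in \<open>simp_all add: br_def eval_nat_numeral power_divide\<close>)
  then have z': "25441 / 50000 \<le> z" "z \<le> 1273 / 2500" by auto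
  have "25441 / 50000 \<le> z \<and> z \<le> 50919 / 100000"
    by (rule refine_zero[OF rel, where a = "25441 / 50000" and c = "1273 / 2500" and N = 5 and p = "1705261 / 50000000" and P = "3423277 / 100000000" and s\<^sub>l = "0" and s\<^sub>h = "0"]) (use z' in \<open>simp_all add: br_def eval_nat_numeral power_divide\<close>)
  then have box: "25441 / 50000 \<le> z" "z \<le> 50919 / 100000" by auto
  have f1: "in_box 4 (Suc 0) z (25441 / 50000) (50919 / 100000) 1 1 0 0" by (rule in_box_1) (use z box in simp_all)
  have f2: "in_box 4 (Suc (Suc 0)) z (8983073 / 500000000) (18047061 / 1000000000) (61765471 / 10000000) (12354427 / 2000000) (9139047 / 10000000) (4587359 / 5000000)"
    by (rule in_box_Suc[OF f1, where a = "25441 / 50000" and c = "50919 / 100000" and N = 5 and p = "85263 / 2500000" and P = "68459 / 2000000"]) (use z box in \<open>simp_all add: br_def power_divide\<close>)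
  have b2: "1109687 / 10000000 \<le> euler_lin 4 2 z" "euler_lin 4 2 z \<le> 557403 / 5000000" "701823 / 1000000 \<le> euler2_lin 4 2 z" "euler2_lin 4 2 z \<le> 7051969 / 10000000"
      "8983073 / 500000000 \<le> lin_coeff 4 2 z" "lin_coeff 4 2 z \<le> 18047061 / 1000000000"
    using in_box_bounds(1-4,6,7)[OF f2] by (simp_all add: eval_nat_numeral power_divide)
  note bounds = box p(2-6)[unfolded abs_le_iff] b2
  show ?thesis
    by (rule constants_from_box[where El = "(- 90773 / 100000)" and Eh = "(- 11323 / 12500)" and ml = "(260217 / 500000)" and mh = "(130699 / 250000)" and J2l = "(- 10941 / 25000)" and J2h = "(- 43631 / 100000)"
        and JEl = "(- 28757 / 100000)" and JEh = "(- 14277 / 50000)" and E2l = "(- 3961 / 12500)" and E2h = "(- 7803 / 25000)" and sl = "(97 / 400)" and sh = "(2507 / 10000)"])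
       ((use bounds in linarith) | simp add: mean_approx_def variance_approx_def power_divide)+
qed

lemma good_constants_5:
  assumes z: "1 / 2 \<le> z" "z \<le> 0.56" and zero: "real_lin 5 z = 0"
  shows "good_constants 5 z"
proof -
  have c1: "in_box 5 (Suc 0) z (1 / 2) (14 / 25) 1 1 0 0" by (rule in_box_1) (use z  in simp_all)
  have c2: "in_box 5 (Suc (Suc 0)) z (0) (1782057 / 100000000) (7) (36 / 5) (0) (119 / 100)"
    by (rule in_box_Suc[OF c1, where a = "1 / 2" and c = "14 / 25" and N = 6 and p = "0" and P = "30841 / 1000000"]) (use z  in \<open>simp_all add: br_def power_divide\<close>)
  have c3: "in_box 5 (Suc (Suc (Suc 0))) z (0) (1393 / 5000000000000) (38) (3821 / 100) (0) (6 / 5)"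
    by (rule in_box_Suc[OF c2, where a = "1 / 2" and c = "14 / 25" and N = 31 and p = "0" and P = "1563 / 100000000000"]) (use z  in \<open>simp_all add: br_def power_divide\<close>)
  have \<tau>: "2.5 * majorant 5 z 3 \<le> 51 / 50000000" using in_box_bounds(5)[OF c3] by (simp add: eval_nat_numeral)
  have "2 \<le> (5::nat)" by simp
  note p = first_3_terms[OF this z zero \<tau>]
  have rel: "\<bar>2 * z - (1 + lin_coeff 5 2 z - 0)\<bar> \<le> 51 / 50000000" using p(1) unfolding abs_le_iff by simp
  have "1 / 2 \<le> z \<and> z \<le> 14 / 25" using z by simp
  then have z': "1 / 2 \<le> z" "z \<le> 14 / 25" by auto
  have "503967 / 1000000 \<le> z \<and> z \<le> 508911 / 1000000"
    by (rule refine_zero[OF rel, where a = "1 / 2" and c = "14 / 25" and N = 6 and p = "1 / 64" and P = "1542049 / 50000000" and s\<^sub>l = "0" and s\<^sub>h = "0"]) (use z' in \<open>simp_all add: br_def eval_nat_numeral power_divide\<close>)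
  then have z': "503967 / 1000000 \<le> z" "z \<le> 508911 / 1000000" by auto
  have "126049 / 250000 \<le> z \<and> z \<le> 1009 / 2000"
    by (rule refine_zero[OF rel, where a = "503967 / 1000000" and c = "508911 / 1000000" and N = 6 and p = "409593 / 25000000" and P = "347441 / 20000000" and s\<^sub>l = "0" and s\<^sub>h = "0"]) (use z' in \<open>simp_all add: br_def eval_nat_numeral power_divide\<close>)
  then have z': "126049 / 250000 \<le> z" "z \<le> 1009 / 2000" by auto
  have "50421 / 100000 \<le> z \<and> z \<le> 50423 / 100000"
    by (rule refine_zero[OF rel, where a = "126049 / 250000" and c = "1009 / 2000" and N = 6 and p = "410711 / 25000000" and P = "1648797 / 100000000" and s\<^sub>l = "0" and s\<^sub>h = "0"]) (use z' in \<open>simp_all add: br_def eval_nat_numeral power_divide\<close>)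
  then have z': "50421 / 100000 \<le> z" "z \<le> 50423 / 100000" by auto
  have "504211 / 1000000 \<le> z \<and> z \<le> 252107 / 500000"
    by (rule refine_zero[OF rel, where a = "50421 / 100000" and c = "50423 / 100000" and N = 6 and p = "1643117 / 100000000" and P = "164351 / 10000000" and s\<^sub>l = "0" and s\<^sub>h = "0"]) (use z' in \<open>simp_all add: br_def eval_nat_numeral power_divide\<close>)
  then have z': "504211 / 1000000 \<le> z" "z \<le> 252107 / 500000" by auto
  have "504211 / 1000000 \<le> z \<and> z \<le> 504213 / 1000000"
    by (rule refine_zero[OF rel, where a = "504211 / 1000000" and c = "252107 / 500000" and N = 6 and p = "1643137 / 100000000" and P = "1643197 / 100000000" and s\<^sub>l = "0" and s\<^sub>h = "0"]) (use z' in \<open>simp_all add: br_def eval_nat_numeral power_divide\<close>)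
  then have box: "504211 / 1000000 \<le> z" "z \<le> 504213 / 1000000" by auto
  have f1: "in_box 5 (Suc 0) z (504211 / 1000000) (504213 / 1000000) 1 1 0 0" by (rule in_box_1) (use z box in simp_all)
  have f2: "in_box 5 (Suc (Suc 0)) z (16846567 / 2000000000) (16847051 / 2000000000) (355011761 / 50000000) (710023771 / 100000000) (61145843 / 100000000) (30573691 / 50000000)"
    by (rule in_box_Suc[OF f1, where a = "504211 / 1000000" and c = "504213 / 1000000" and N = 6 and p = "1643137 / 100000000" and P = "1643177 / 100000000"]) (use z box in \<open>simp_all add: br_def power_divide\<close>)
  have b2: "74759 / 1250000 \<le> euler_lin 5 2 z" "euler_lin 5 2 z \<le> 598091 / 10000000" "4297963 / 10000000 \<le> euler2_lin 5 2 z" "euler2_lin 5 2 z \<le> 1074523 / 2500000"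
      "16846567 / 2000000000 \<le> lin_coeff 5 2 z" "lin_coeff 5 2 z \<le> 16847051 / 2000000000"
    using in_box_bounds(1-4,6,7)[OF f2] by (simp_all add: eval_nat_numeral power_divide)
  note bounds = box p(2-6)[unfolded abs_le_iff] b2
  show ?thesis
    by (rule constants_from_box[where El = "(- 47431 / 50000)" and Eh = "(- 94861 / 100000)" and ml = "(3211 / 6250)" and mh = "(5137691 / 10000000)" and J2l = "(- 47053 / 100000)" and J2h = "(- 47051 / 100000)"
        and JEl = "(- 1923 / 5000)" and JEh = "(- 38459 / 100000)" and E2l = "(- 7233 / 12500)" and E2h = "(- 57861 / 100000)" and sl = "(2403 / 10000)" and sh = "(481 / 2000)"])
       ((use bounds in linarith) | simp add: mean_approx_def variance_approx_def power_divide)+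
qed

section \<open>Expansion of the constants in a small parameter\<close>

text \<open>One step of a bound for a polynomial in Horner form.\<close>

lemma horner_bound:
  fixes a c x :: real
  assumes "\<bar>a\<bar> \<le> A" "\<bar>c\<bar> \<le> C" "0 \<le> x" "x \<le> X" "A + X * C \<le> S"
  shows "\<bar>a + x * c\<bar> \<le> S"
proof -
  have "\<bar>x * c\<bar> \<le> X * C" unfolding abs_mult using assms by (intro mult_mono) auto
  then show ?thesis using assms by linarith
qed

lemma abs_mult_le: "\<bar>a\<bar> \<le> A \<Longrightarrow> \<bar>c\<bar> \<le> C \<Longrightarrow> \<bar>a * c\<bar> \<le> A * (C :: real)"
  unfolding abs_mult by (intro mult_mono) auto

text \<open>In the application \<open>\<nu> = 1 / (t + 1)\<close> and \<open>x = (t + 1) * D\<close>, so that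
  \<open>\<nu> * x = D\<close>. In these variables every quantity is a polynomial up to negligible errors,
  and the required accuracy is of order \<open>x ^ 4\<close> for the mean and \<open>x ^ 3 / \<nu>\<close>
  for the variance.\<close>

locale expansion =
  fixes x \<nu> :: real
  assumes x: "0 < x" "x \<le> (3 / 100)" and \<nu>: "0 < \<nu>" "\<nu> \<le> 1 / 7"
begin

definition "\<alpha> = 1 + 3 * \<nu>"
definition "\<beta> = 1 / 2 + 7 / 2 * \<nu> + 9 * \<nu> ^ 2"

lemma \<nu>_powers: "0 \<le> \<nu> ^ 2" "\<nu> ^ 2 \<le> 1 / 49" "0 \<le> \<nu> ^ 3" "\<nu> ^ 3 \<le> 1 / 343" "0 \<le> \<nu> ^ 4" "\<nu> ^ 4 \<le> 1 / 2401" "0 \<le> \<nu> ^ 5" "\<nu> ^ 5 \<le> 1 / 16807"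
  "\<nu> ^ 2 \<le> \<nu> / 7" "\<nu> ^ 3 \<le> \<nu> / 49"
  using \<nu> mult_left_mono[OF \<nu>(2), of \<nu>] mult_left_mono[OF power_mono[OF \<nu>(2), of 2], of \<nu>] power_mono[OF \<nu>(2), of 2] power_mono[OF \<nu>(2), of 3] power_mono[OF \<nu>(2), of 4] power_mono[OF \<nu>(2), of 5]
  by (auto simp: power_divide power2_eq_square power3_eq_cube)

lemma \<alpha>\<beta>_bounds: "1 \<le> \<alpha>" "\<alpha> \<le> 10 / 7" "0 \<le> \<beta>" "\<beta> \<le> (119 / 100)"
  using \<nu> \<nu>_powers by (auto simp: \<alpha>_def \<beta>_def)

lemma x2: "x ^ 2 \<le> (3 / 100) * x" "0 \<le> x ^ 2" "0 \<le> x ^ 3" "x ^ 3 \<le> (9 / 10000) * x" "x ^ 3 \<le> (3 / 100) * x ^ 2" "x ^ 4 \<le> (3 / 100) * x ^ 3" "0 \<le> x ^ 4"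
proof -
  have s: "x ^ Suc k \<le> (3 / 100) * x ^ k" for k using x by (simp add: mult_right_mono)
  show a: "x ^ 2 \<le> (3 / 100) * x" using s[of 1] by (simp add: numeral_2_eq_2)
  show c: "x ^ 3 \<le> (3 / 100) * x ^ 2" using s[of 2] by (simp add: eval_nat_numeral)
  show "x ^ 4 \<le> (3 / 100) * x ^ 3" using s[of 3] by (simp add: eval_nat_numeral)
  show "x ^ 3 \<le> (9 / 10000) * x" using a c by simp
qed (use x in auto)

text \<open>With \<open>B = (1 + D) ^ (t + 1)\<close> the assumption is the equation of the zero, solved for
  \<open>\<psi> = \<delta> / D\<close>. The coefficients \<open>\<alpha>\<close> and \<open>\<beta>\<close>
  are those of the inverse of \<open>B * (1 + 3 * D)\<close>; \<open>R1\<close> collects what is left of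
  the product.\<close>

lemma inverse_weight_expansion:
  assumes B: "1 + x + (1 - \<nu>) * x ^ 2 / 2 \<le> B" "B \<le> 1 + x + (1 - \<nu>) * x ^ 2 / 2 + x ^ 3 / 5"
    and e: "\<bar>e\<bar> \<le> x ^ 3 / 10000" and \<eta>: "\<bar>\<eta>\<bar> \<le> x ^ 3 / 10000"
    and eq: "\<psi> * (B * (1 + 3 * \<nu> * x + 2 * e)) = 1 + \<eta>"
  shows "\<bar>\<psi> - (1 - \<alpha> * x + \<beta> * x ^ 2)\<bar> \<le> x ^ 3"
proof -
  define b where "b = B - (1 + x + (1 - \<nu>) * x ^ 2 / 2)"
  define s where "s = 1 - \<alpha> * x + \<beta> * x ^ 2"
  define V where "V = B * (1 + 3 * \<nu> * x + 2 * e)"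
  define R1 where "R1 = (5 / 2 * \<nu> + 21 / 2 * \<nu> ^ 2 + 27 * \<nu> ^ 3)
     + x * ((1 / 4 + 3 / 2 * \<nu> + 41 / 4 * \<nu> ^ 2 + 27 * \<nu> ^ 3)
     + x * (3 / 4 * \<nu> + 9 / 2 * \<nu> ^ 2 + 33 / 4 * \<nu> ^ 3 - 27 / 2 * \<nu> ^ 4))"
  have b: "\<bar>b\<bar> \<le> x ^ 3 / 5" using B by (simp add: b_def)
  have R1: "\<bar>R1\<bar> \<le> (7 / 10)"
    unfolding R1_def
  proof (rule horner_bound[where X = "(3 / 100)" and A = "(33 / 50)" and C = 1], goal_cases)
    case 1
    show ?case by (rule abs_leI) (use \<nu> \<nu>_powers in linarith)+
  next
    case 2
    show ?case
    proof (rule horner_bound[where X = "(3 / 100)" and A = "(19 / 25)" and C = 1], goal_cases)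
      case 1
      show ?case by (rule abs_leI) (use \<nu> \<nu>_powers in linarith)+
    next
      case 2
      show ?case by (rule abs_leI) (use \<nu> \<nu>_powers in linarith)+
    qed (use x in auto)
  qed (use x in auto)
  have \<nu>x: "0 \<le> \<nu> * x" "\<nu> * x \<le> 3 / 700" "\<nu> * x ^ 2 \<le> (1 / 100) * x" "0 \<le> \<nu> * x ^ 2"
    using x \<nu> mult_mono[of \<nu> "1/7" x "(3 / 100)"] mult_mono[of \<nu> "1/7" "x ^ 2" "(3 / 100) * x"] x2 by auto
  have s: "\<bar>s\<bar> \<le> 1"
  proof -
    have "x \<le> \<alpha> * x" "\<alpha> * x \<le> 10 / 7 * x" "\<beta> * x ^ 2 \<le> (119 / 100) * x ^ 2" "0 \<le> \<beta> * x ^ 2"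
      using \<alpha>\<beta>_bounds x by (auto intro!: mult_right_mono)
    then show ?thesis using x2 x unfolding s_def by (intro abs_leI) linarith+
  qed
  have q: "\<bar>1 + 3 * \<nu> * x + 2 * e\<bar> \<le> (51 / 50)" using \<nu>x e x2 x by (auto simp: abs_le_iff)
  have h: "\<bar>1 + x + (1 - \<nu>) * x ^ 2 / 2\<bar> \<le> (26 / 25)" using \<nu>x x2 x unfolding left_diff_distrib mult_1 diff_divide_distrib by (intro abs_leI) linarith+
  have V: "1 \<le> V"
  proof -
    have "1 + x \<le> B" using B \<nu> x2 mult_nonneg_nonneg[of "1 - \<nu>" "x ^ 2"] by linarith
    moreover have "1 - (1 / 1000) * x \<le> 1 + 3 * \<nu> * x + 2 * e" using \<nu>x e x2 x by (auto simp: abs_le_iff)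
    ultimately have "(1 + x) * (1 - (1 / 1000) * x) \<le> V" unfolding V_def using x by (intro mult_mono) auto
    moreover have "1 \<le> (1 + x) * (1 - (1 / 1000) * x)" using x x2 by (simp add: algebra_simps power2_eq_square)
    ultimately show ?thesis by linarith
  qed
  have B': "B = 1 + x + (1 - \<nu>) * x ^ 2 / 2 + b" by (simp add: b_def)
  have "s * ((1 + x + (1 - \<nu>) * x ^ 2 / 2) * (1 + 3 * \<nu> * x)) = 1 + x ^ 3 * R1"
    unfolding s_def R1_def \<alpha>_def \<beta>_def
    by (simp add: algebra_simps power2_eq_square power3_eq_cube power4_eq_xxxx add_divide_distrib diff_divide_distrib)
  then have "s * V = 1 + x ^ 3 * R1 + s * (b * (1 + 3 * \<nu> * x + 2 * e) + (1 + x + (1 - \<nu>) * x ^ 2 / 2) * (2 * e))"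
    unfolding V_def B' by (simp only: distrib_left distrib_right)
  moreover define S where "S = s * (b * (1 + 3 * \<nu> * x + 2 * e) + (1 + x + (1 - \<nu>) * x ^ 2 / 2) * (2 * e))"
  ultimately have "\<bar>s * V - (1 + \<eta>)\<bar> \<le> \<bar>x ^ 3 * R1\<bar> + \<bar>S\<bar> + \<bar>\<eta>\<bar>" by linarith
  moreover have "\<bar>S\<bar> \<le> 21 / 100 * x ^ 3"
  proof -
  have "\<bar>S\<bar> \<le> 1 * (x ^ 3 / 5 * (51 / 50) + 26 / 25 * (2 * (x ^ 3 / 10000)))"
    unfolding S_def using e by (intro abs_mult_le s order_trans[OF abs_triangle_ineq] add_mono b q h) auto
  then show ?thesis using x2(3) by simp
  qed
  moreover have "\<bar>x ^ 3 * R1\<bar> \<le> 7 / 10 * x ^ 3"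
    using abs_mult_le[OF R1, of "x ^ 3" "x ^ 3"] x by (simp add: mult.commute)
  ultimately have "\<bar>s * V - (1 + \<eta>)\<bar> \<le> x ^ 3" using \<eta> x2(3) by linarith
  moreover have "(\<psi> - s) * V = - (s * V - (1 + \<eta>))" using eq by (simp add: V_def left_diff_distrib)
  ultimately have "\<bar>(\<psi> - s) * V\<bar> \<le> x ^ 3" by (simp only: abs_minus_cancel)
  then have "\<bar>\<psi> - s\<bar> * V \<le> x ^ 3" using V by (simp add: abs_mult)
  moreover have "\<bar>\<psi> - s\<bar> * 1 \<le> \<bar>\<psi> - s\<bar> * V" using V by (intro mult_left_mono) auto
  ultimately show ?thesis by (simp add: s_def)
qed

end

locale inverse_expansion = expansion +
  fixes \<psi> :: real
  assumes \<psi>: "\<bar>\<psi> - (1 - \<alpha> * x + \<beta> * x ^ 2)\<bar> \<le> x ^ 3"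
begin

definition "u = x * \<psi>"

lemma u_expansions:
  "1 - (147 / 100) * x \<le> \<psi>" "\<psi> \<le> 1" "\<bar>u - (x - \<alpha> * x ^ 2)\<bar> \<le> (5 / 4) * x ^ 3" "\<bar>u - (x - \<alpha> * x ^ 2 + \<beta> * x ^ 3)\<bar> \<le> x ^ 4"
  "\<bar>u ^ 2 - x ^ 2\<bar> \<le> (147 / 50) * x ^ 3" "\<bar>u ^ 2 - (x ^ 2 - 2 * \<alpha> * x ^ 3)\<bar> \<le> (23 / 5) * x ^ 4"
  "\<bar>u ^ 3 - x ^ 3\<bar> \<le> (9 / 2) * x ^ 4" "0 \<le> u" "u \<le> x"
proof -
  define k where "k = \<psi> - (1 - \<alpha> * x)"
  have \<alpha>x: "x \<le> \<alpha> * x" "\<alpha> * x \<le> 10 / 7 * x" "\<beta> * x ^ 2 \<le> (119 / 100) * x ^ 2" "0 \<le> \<beta> * x ^ 2"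
    using \<alpha>\<beta>_bounds x by (auto intro!: mult_right_mono)
  have k: "\<bar>k\<bar> \<le> (5 / 4) * x ^ 2" unfolding k_def by (rule abs_leI) (use \<psi>[unfolded abs_le_iff] \<alpha>x x2 in linarith)+
  have \<psi>k: "\<psi> = 1 - \<alpha> * x + k" by (simp add: k_def)
  show l: "1 - (147 / 100) * x \<le> \<psi>" using k \<alpha>x x2 x unfolding \<psi>k abs_le_iff by linarith
  show h: "\<psi> \<le> 1" using k \<alpha>x x2 x unfolding \<psi>k abs_le_iff by linarith
  have p0: "0 \<le> \<psi>" using l x by simp
  show "0 \<le> u" "u \<le> x" using p0 h x by (auto simp: u_def mult_left_le)
  have "u - (x - \<alpha> * x ^ 2) = x * k" by (simp add: u_def k_def algebra_simps power2_eq_square)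
  moreover have "\<bar>x * k\<bar> \<le> x * ((5 / 4) * x ^ 2)" using k x by (intro abs_mult_le) auto
  ultimately show "\<bar>u - (x - \<alpha> * x ^ 2)\<bar> \<le> (5 / 4) * x ^ 3" by (simp add: power3_eq_cube power2_eq_square)
  have "u - (x - \<alpha> * x ^ 2 + \<beta> * x ^ 3) = x * (\<psi> - (1 - \<alpha> * x + \<beta> * x ^ 2))"
    by (simp add: u_def algebra_simps power2_eq_square power3_eq_cube)
  moreover have "\<bar>x * (\<psi> - (1 - \<alpha> * x + \<beta> * x ^ 2))\<bar> \<le> x * x ^ 3" using \<psi> x by (intro abs_mult_le) auto
  ultimately show "\<bar>u - (x - \<alpha> * x ^ 2 + \<beta> * x ^ 3)\<bar> \<le> x ^ 4" by (simp add: eval_nat_numeral)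
  have "u ^ 2 - x ^ 2 = x ^ 2 * ((\<psi> - 1) * (\<psi> + 1))" by (simp add: u_def algebra_simps power2_eq_square)
  moreover have "\<bar>x ^ 2 * ((\<psi> - 1) * (\<psi> + 1))\<bar> \<le> x ^ 2 * ((147 / 100) * x * 2)" using l h p0 by (intro abs_mult_le) auto
  ultimately show "\<bar>u ^ 2 - x ^ 2\<bar> \<le> (147 / 50) * x ^ 3" by (simp add: power2_eq_square power3_eq_cube)
  have "u ^ 3 - x ^ 3 = x ^ 3 * ((\<psi> - 1) * (\<psi> * \<psi> + \<psi> + 1))" by (simp add: u_def algebra_simps power3_eq_cube)
  moreover have "\<bar>x ^ 3 * ((\<psi> - 1) * (\<psi> * \<psi> + \<psi> + 1))\<bar> \<le> x ^ 3 * ((147 / 100) * x * 3)"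
    using l h p0 mult_left_le[OF h p0] by (intro abs_mult_le) auto
  ultimately show "\<bar>u ^ 3 - x ^ 3\<bar> \<le> (9 / 2) * x ^ 4" using x2 by (simp add: eval_nat_numeral)
  have "u ^ 2 - (x ^ 2 - 2 * \<alpha> * x ^ 3) = x ^ 2 * ((\<alpha> * x) ^ 2 + (2 * k * (1 - \<alpha> * x) + k * k))"
    unfolding u_def unfolding \<psi>k by (simp add: algebra_simps power2_eq_square power3_eq_cube)
  moreover have "\<bar>x ^ 2 * ((\<alpha> * x) ^ 2 + (2 * k * (1 - \<alpha> * x) + k * k))\<bar> \<le> x ^ 2 * ((23 / 5) * x ^ 2)"
  proof (rule abs_mult_le)
    have "(\<alpha> * x) ^ 2 \<le> (10 / 7 * x) ^ 2" using \<alpha>x x by (intro power_mono) auto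
    then have 1: "(\<alpha> * x) ^ 2 \<le> 100 / 49 * x ^ 2" by (simp add: power_mult_distrib power_divide)
    have "\<bar>1 - \<alpha> * x\<bar> \<le> 1" using \<alpha>x x by (intro abs_leI) linarith+
    then have 2: "\<bar>2 * k * (1 - \<alpha> * x)\<bar> \<le> 2 * ((5 / 4) * x ^ 2) * 1" using k by (intro abs_mult_le) auto
    have "\<bar>k\<bar> \<le> (1 / 100)" using k x2 x by linarith
    then have "\<bar>k * k\<bar> \<le> (5 / 4) * x ^ 2 * (1 / 100)" using k by (intro abs_mult_le)
    then show "\<bar>(\<alpha> * x) ^ 2 + (2 * k * (1 - \<alpha> * x) + k * k)\<bar> \<le> (23 / 5) * x ^ 2"
      using 1 2 x2 zero_le_power2[of "\<alpha> * x"] unfolding abs_le_iff by linarith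
  qed simp
  ultimately show "\<bar>u ^ 2 - (x ^ 2 - 2 * \<alpha> * x ^ 3)\<bar> \<le> (23 / 5) * x ^ 4" by (simp add: eval_nat_numeral)
qed


text \<open>The claimed approximations in terms of \<open>u = (t + 1) / 2 ^ (t + 2)\<close>; the one for the variance
  is multiplied by \<open>\<nu>\<close>.\<close>

definition "mean_poly = 1 / 2 + (1 - 3 * \<nu>) / 2 * u + (2 - \<nu> - 9 * \<nu> ^ 2) / 2 * u ^ 2
  + (9 + 18 * \<nu> - 61 * \<nu> ^ 2 - 54 * \<nu> ^ 3) / 4 * u ^ 3"

definition "variance_poly = \<nu> / 4 + (- 1 + 7 * \<nu> - 8 * \<nu> ^ 2) / 4 * u
  + (- 4 + 16 * \<nu> + 7 * \<nu> ^ 2 - 33 * \<nu> ^ 3) / 4 * u ^ 2"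

definition "q = 1 + \<nu> * x"
definition "E\<^sub>0 = - (1 - (1 - \<nu>) * x - 3 * \<nu> * x ^ 2)"

lemma coeff_bounds:
  "\<bar>(1 - 3 * \<nu>) / 2\<bar> \<le> 1 / 2" "\<bar>(2 - \<nu> - 9 * \<nu> ^ 2) / 2\<bar> \<le> 1"
  "\<bar>(9 + 18 * \<nu> - 61 * \<nu> ^ 2 - 54 * \<nu> ^ 3) / 4\<bar> \<le> 29 / 10"
  "\<bar>(- 1 + 7 * \<nu> - 8 * \<nu> ^ 2) / 4\<bar> \<le> 1 / 4" "\<bar>(- 4 + 16 * \<nu> + 7 * \<nu> ^ 2 - 33 * \<nu> ^ 3) / 4\<bar> \<le> 1"
  using \<nu> \<nu>_powers unfolding add_divide_distrib diff_divide_distrib by - (intro abs_leI; linarith)+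

lemma q_bounds: "1 \<le> q" "q \<le> 101 / 100" "0 \<le> \<nu> * x" "\<nu> * x \<le> 3 / 700" "\<nu> * x \<le> x / 7" "\<nu> * x ^ 2 \<le> x / 100" "0 \<le> \<nu> * x ^ 2"
  using x \<nu> mult_mono[of \<nu> "1/7" x "3 / 100"] mult_right_mono[of \<nu> "1/7" x] mult_mono[of \<nu> "1/7" "x ^ 2" "3 / 100 * x"] x2
  by (auto simp: q_def)

lemma E\<^sub>0_bounds: "\<bar>E\<^sub>0\<bar> \<le> 1" "E\<^sub>0 \<le> - 969 / 1000"
proof -
  have "E\<^sub>0 = - 1 + x - \<nu> * x + 3 * (\<nu> * x ^ 2)" by (simp add: E\<^sub>0_def algebra_simps)
  moreover have "0 \<le> x - \<nu> * x" using q_bounds(5) x by linarith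
  ultimately show "E\<^sub>0 \<le> - 969 / 1000" "\<bar>E\<^sub>0\<bar> \<le> 1"
    using q_bounds(3,6,7) x by - (linarith, rule abs_leI, linarith, linarith)
qed

lemma u_powers: "u ^ 2 \<le> 3 / 100 * x" "u ^ 3 \<le> x ^ 3" "0 \<le> u ^ 2" "0 \<le> u ^ 3" "u ^ 3 \<le> x / 1000"
proof -
  have "u ^ 2 \<le> x ^ 2" "u ^ 3 \<le> x ^ 3" using u_expansions(8,9) by (auto intro: power_mono)
  then show "u ^ 2 \<le> 3 / 100 * x" "u ^ 3 \<le> x ^ 3" "u ^ 3 \<le> x / 1000" using x2 x by linarith+
  show "0 \<le> u ^ 2" "0 \<le> u ^ 3" using u_expansions(8) by auto
qed

lemma mean_poly_bound: "\<bar>mean_poly - 1 / 2\<bar> \<le> 54 / 100 * x"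
proof -
  have "mean_poly - 1 / 2 = (1 - 3 * \<nu>) / 2 * u + (2 - \<nu> - 9 * \<nu> ^ 2) / 2 * u ^ 2
    + (9 + 18 * \<nu> - 61 * \<nu> ^ 2 - 54 * \<nu> ^ 3) / 4 * u ^ 3" by (simp add: mean_poly_def)
  also have "\<bar>\<dots>\<bar> \<le> 1 / 2 * x + 1 * (3 / 100 * x) + 29 / 10 * (x / 1000)"
    using u_powers u_expansions(8,9)
    by (intro order_trans[OF abs_triangle_ineq] add_mono abs_mult_le coeff_bounds) auto
  finally show ?thesis using x by linarith
qed

text \<open>Multiplying by \<open>q * E\<close> turns the claim into one on polynomials; the terms up to \<open>x ^
  3\<close> cancel and \<open>R2\<close> is the remainder.\<close>

theorem mean_expansion:
  assumes J1: "\<bar>J1 + (1 - 3 * \<nu> * x) / 2\<bar> \<le> x ^ 4" and E: "\<bar>q * E - E\<^sub>0\<bar> \<le> x ^ 4"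
  shows "E < 0" "\<bar>J1 / E - mean_poly\<bar> \<le> 23 * x ^ 4"
proof -
  define P3 where "P3 = 1 / 2 + (1 - 3 * \<nu>) / 2 * (x - \<alpha> * x ^ 2 + \<beta> * x ^ 3)
    + (2 - \<nu> - 9 * \<nu> ^ 2) / 2 * (x ^ 2 - 2 * \<alpha> * x ^ 3) + (9 + 18 * \<nu> - 61 * \<nu> ^ 2 - 54 * \<nu> ^ 3) / 4 * x ^ 3"
  define R2 where "R2 = (- 1 / 2 - 3 / 2 * \<nu> + 6 * \<nu> ^ 2 - 4 * \<nu> ^ 3) + x * (- 3 / 2 * \<nu> - 3 / 2 * \<nu> ^ 2 + 12 * \<nu> ^ 3)"
  define e1 where "e1 = J1 + (1 - 3 * \<nu> * x) / 2"
  define e2 where "e2 = q * E - E\<^sub>0"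
  have R2: "\<bar>R2\<bar> \<le> 1"
    unfolding R2_def
  proof (rule horner_bound[where X = "3 / 100" and A = "9 / 10" and C = 1])
    show "\<bar>- 1 / 2 - 3 / 2 * \<nu> + 6 * \<nu> ^ 2 - 4 * \<nu> ^ 3\<bar> \<le> 9 / 10" using \<nu> \<nu>_powers by (intro abs_leI; linarith)
    show "\<bar>- 3 / 2 * \<nu> - 3 / 2 * \<nu> ^ 2 + 12 * \<nu> ^ 3\<bar> \<le> 1" using \<nu> \<nu>_powers by (intro abs_leI; linarith)
  qed (use x in auto)
  have "P3 * E\<^sub>0 = - ((1 - 3 * \<nu> * x) / 2 * q) - x ^ 4 * R2"
    unfolding P3_def R2_def E\<^sub>0_def q_def \<alpha>_def \<beta>_def
    by (simp add: algebra_simps power2_eq_square power3_eq_cube power4_eq_xxxx add_divide_distrib diff_divide_distrib)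
  then have id: "q * (J1 - mean_poly * E) = q * e1 + x ^ 4 * R2 + (P3 - mean_poly) * E\<^sub>0 - mean_poly * e2"
    unfolding e1_def e2_def by algebra
  have "P3 - mean_poly = - ((1 - 3 * \<nu>) / 2 * (u - (x - \<alpha> * x ^ 2 + \<beta> * x ^ 3)) + (2 - \<nu> - 9 * \<nu> ^ 2) / 2 * (u ^ 2 - (x ^ 2 - 2 * \<alpha> * x ^ 3))
      + (9 + 18 * \<nu> - 61 * \<nu> ^ 2 - 54 * \<nu> ^ 3) / 4 * (u ^ 3 - x ^ 3))"
    by (simp add: P3_def mean_poly_def field_simps)
  then have "\<bar>P3 - mean_poly\<bar> = \<bar>(1 - 3 * \<nu>) / 2 * (u - (x - \<alpha> * x ^ 2 + \<beta> * x ^ 3)) + (2 - \<nu> - 9 * \<nu> ^ 2) / 2 * (u ^ 2 - (x ^ 2 - 2 * \<alpha> * x ^ 3))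
      + (9 + 18 * \<nu> - 61 * \<nu> ^ 2 - 54 * \<nu> ^ 3) / 4 * (u ^ 3 - x ^ 3)\<bar>"
    by (simp only: abs_minus_cancel)
  also have "\<dots> \<le> 1 / 2 * x ^ 4 + 1 * (23 / 5 * x ^ 4) + 29 / 10 * (9 / 2 * x ^ 4)"
    using u_expansions by (intro order_trans[OF abs_triangle_ineq] add_mono abs_mult_le coeff_bounds) auto
  finally have P3: "\<bar>P3 - mean_poly\<bar> \<le> 19 * x ^ 4" using x2 by linarith
  have P: "\<bar>mean_poly\<bar> \<le> 1" using mean_poly_bound x by linarith
  have "\<bar>q * (J1 - mean_poly * E)\<bar> \<le> \<bar>q * e1\<bar> + \<bar>x ^ 4 * R2\<bar> + \<bar>(P3 - mean_poly) * E\<^sub>0\<bar> + \<bar>mean_poly * e2\<bar>"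
    unfolding id by linarith
  also have "\<dots> \<le> 101 / 100 * x ^ 4 + x ^ 4 * 1 + 19 * x ^ 4 * 1 + 1 * x ^ 4"
    using q_bounds x2 J1 E by (intro add_mono abs_mult_le R2 P3 P E\<^sub>0_bounds) (auto simp: e1_def e2_def)
  finally have N: "\<bar>q * (J1 - mean_poly * E)\<bar> \<le> 2201 / 100 * x ^ 4" using x2 by linarith
  have "x ^ 4 \<le> 1 / 1000" using x2 x by linarith
  then have qE: "q * E \<le> - 968 / 1000" using E E\<^sub>0_bounds by linarith
  then have "q * E < 0" by simp
  then show En: "E < 0" using q_bounds by (auto simp: mult_less_0_iff)
  have "\<bar>J1 / E - mean_poly\<bar> * (968 / 1000) \<le> \<bar>J1 / E - mean_poly\<bar> * \<bar>q * E\<bar>"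
    using qE by (intro mult_left_mono) auto
  also have "\<dots> = \<bar>q * (J1 - mean_poly * E)\<bar>"
  proof -
    have "(J1 / E - mean_poly) * (q * E) = q * (J1 - mean_poly * E)" using En by (simp add: field_simps)
    then show ?thesis by (simp only: abs_mult[symmetric])
  qed
  also note N
  finally have "484 * \<bar>J1 / E - mean_poly\<bar> \<le> 11005 * x ^ 4" by simp
  moreover have "a \<le> 23 * c" if "484 * a \<le> 11005 * c" "0 \<le> c" for a c :: real using that by linarith
  ultimately show "\<bar>J1 / E - mean_poly\<bar> \<le> 23 * x ^ 4" using x2(7) by blast
qed


definition "JE\<^sub>0 = - (q ^ 2) / 2 + 2 * \<nu> * x * q + 2 * x * (1 + 3 * \<nu> * x)"
definition "E2\<^sub>0 = - \<nu> * q ^ 3 + x * ((\<nu> * q + 1 + 3 * \<nu> * x) ^ 2 + 2 * \<nu> * x * (1 + 3 * \<nu> * x))"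

text \<open>The mean constant is only known up to \<open>x ^ 3\<close> here, but it enters through the factor
  \<open>Z\<close>, in which the terms of order 1 cancel. The polynomial identity is multiplied by 4 to
  have integer coefficients.\<close>

theorem variance_expansion:
  assumes E: "\<bar>q * E - E\<^sub>0\<bar> \<le> x ^ 4" and \<mu>: "\<bar>\<mu> - mean_poly\<bar> \<le> 23 * x ^ 4"
    and J2: "\<bar>J2 + (1 - 7 * \<nu> * x) / 2\<bar> \<le> x ^ 4" and JE: "\<bar>q * JE - JE\<^sub>0\<bar> \<le> x ^ 4"
    and E2: "\<bar>\<nu> * q ^ 2 * E2 - E2\<^sub>0\<bar> \<le> x ^ 4"
  shows "\<bar>\<nu> * ((J2 - 2 * \<mu> * JE + \<mu> ^ 2 * E2) / E) - variance_poly\<bar> \<le> 7 * x ^ 3"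
proof -
  define A where "A = 1 + (1 - 3 * \<nu>) * (x - \<alpha> * x ^ 2) + (2 - \<nu> - 9 * \<nu> ^ 2) * x ^ 2"
  define S4 where "S4 = \<nu> + (- 1 + 7 * \<nu> - 8 * \<nu> ^ 2) * (x - \<alpha> * x ^ 2) + (- 4 + 16 * \<nu> + 7 * \<nu> ^ 2 - 33 * \<nu> ^ 3) * x ^ 2"
  define c0 c1 c2 c3 c4 where c:
    "c0 = 6 - 10 * \<nu> - 47 * \<nu> ^ 2 + 81 * \<nu> ^ 3"
    "c1 = 2 + 31 * \<nu> - 102 * \<nu> ^ 2 - 33 * \<nu> ^ 3 + 162 * \<nu> ^ 4"
    "c2 = 1 + 16 * \<nu> + \<nu> ^ 2 - 174 * \<nu> ^ 3 + 177 * \<nu> ^ 4 + 81 * \<nu> ^ 5"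
    "c3 = 8 * \<nu> + 22 * \<nu> ^ 2 - 117 * \<nu> ^ 3 + 52 * \<nu> ^ 4 + 35 * \<nu> ^ 5"
    "c4 = 15 * \<nu> ^ 2 - 24 * \<nu> ^ 3 + 3 * \<nu> ^ 4 + 6 * \<nu> ^ 5"
  define R where "R = c0 + x * (c1 + x * (c2 + x * (c3 + x * c4)))"
  define h where "h = 1 + 3 * \<nu> * x"
  define M where "M = A / 2"
  define S where "S = S4 / 4"
  define em where "em = \<mu> - M"
  define es where "es = variance_poly - S"
  define e2 where "e2 = q * E - E\<^sub>0"
  define e3 where "e3 = J2 + (1 - 7 * \<nu> * x) / 2"
  define e4 where "e4 = q * JE - JE\<^sub>0"
  define e5 where "e5 = \<nu> * q ^ 2 * E2 - E2\<^sub>0"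
  define Z where "Z = - 2 * \<nu> * q * JE\<^sub>0 + (2 * M + em) * E2\<^sub>0"
  define W where "W = (J2 - 2 * \<mu> * JE + \<mu> ^ 2 * E2) / E"
  have cb: "\<bar>c0\<bar> \<le> 64 / 10" "\<bar>c1\<bar> \<le> 12" "\<bar>c2\<bar> \<le> 12" "\<bar>c3\<bar> \<le> 12" "\<bar>c4\<bar> \<le> 12"
    unfolding c using \<nu> \<nu>_powers by - (rule abs_leI; linarith)+
  have R: "\<bar>R\<bar> \<le> 72 / 10"
    unfolding R_def
    by (rule horner_bound[OF cb(1) horner_bound[OF cb(2) horner_bound[OF cb(3) horner_bound[OF cb(4,5), where X = "3 / 100" and S = 16],
      where X = "3 / 100" and S = 16], where X = "3 / 100" and S = 16], where X = "3 / 100"]) (use x in auto)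
  have JE\<^sub>0': "2 * JE\<^sub>0 = - (q ^ 2) + 4 * \<nu> * x * q + 4 * x * h" by (simp add: JE\<^sub>0_def h_def)
  have "- 2 * \<nu> * q ^ 2 * (1 - 7 * \<nu> * x) - 2 * A * \<nu> * q * (- (q ^ 2) + 4 * \<nu> * x * q + 4 * x * h) + A ^ 2 * E2\<^sub>0 - S4 * q * E\<^sub>0 = x ^ 3 * R"
    unfolding A_def S4_def R_def E\<^sub>0_def E2\<^sub>0_def q_def \<alpha>_def c h_def by algebra
  then have id: "\<nu> * q ^ 2 * (- (1 - 7 * \<nu> * x) / 2) - 2 * M * \<nu> * q * JE\<^sub>0 + M ^ 2 * E2\<^sub>0 - S * q * E\<^sub>0 = x ^ 3 * R / 4"
    unfolding JE\<^sub>0'[symmetric] M_def S_def by (simp add: power_divide field_simps)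
  have E_bound: "\<bar>u - (x - \<alpha> * x ^ 2)\<bar> \<le> 5 / 4 * x ^ 3" "\<bar>u ^ 2 - x ^ 2\<bar> \<le> 147 / 50 * x ^ 3" "\<bar>u ^ 3\<bar> \<le> x ^ 3"
    using u_expansions u_powers by auto
  have M: "\<bar>mean_poly - M\<bar> \<le> 13 / 2 * x ^ 3"
  proof -
    have eq: "mean_poly - M = (1 - 3 * \<nu>) / 2 * (u - (x - \<alpha> * x ^ 2)) + (2 - \<nu> - 9 * \<nu> ^ 2) / 2 * (u ^ 2 - x ^ 2)
        + (9 + 18 * \<nu> - 61 * \<nu> ^ 2 - 54 * \<nu> ^ 3) / 4 * u ^ 3"
      by (simp add: mean_poly_def M_def A_def field_simps)
    have "\<bar>mean_poly - M\<bar> \<le> 1 / 2 * (5 / 4 * x ^ 3) + 1 * (147 / 50 * x ^ 3) + 29 / 10 * x ^ 3"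
      unfolding eq by (intro order_trans[OF abs_triangle_ineq] add_mono abs_mult_le coeff_bounds E_bound)
    then show ?thesis using x2(3) by linarith
  qed
  then have em: "\<bar>em\<bar> \<le> 72 / 10 * x ^ 3" using \<mu> x2(6) unfolding em_def by linarith
  have es: "\<bar>es\<bar> \<le> 33 / 10 * x ^ 3"
  proof -
    have eq: "es = (- 1 + 7 * \<nu> - 8 * \<nu> ^ 2) / 4 * (u - (x - \<alpha> * x ^ 2)) + (- 4 + 16 * \<nu> + 7 * \<nu> ^ 2 - 33 * \<nu> ^ 3) / 4 * (u ^ 2 - x ^ 2)"
      by (simp add: variance_poly_def es_def S_def S4_def field_simps)
    have "\<bar>es\<bar> \<le> 1 / 4 * (5 / 4 * x ^ 3) + 1 * (147 / 50 * x ^ 3)"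
      unfolding eq by (intro order_trans[OF abs_triangle_ineq] add_mono abs_mult_le coeff_bounds E_bound)
    then show ?thesis using x2(3) by linarith
  qed
  have \<mu>b: "\<bar>\<mu> - 1 / 2\<bar> \<le> 56 / 100 * x" using \<mu> mean_poly_bound x2 x by linarith
  then have \<mu>1: "\<bar>\<mu>\<bar> \<le> 6 / 10" using x by linarith
  have MMb: "\<bar>2 * M + em - 1\<bar> \<le> 12 / 10 * x" using \<mu>b em x2 x unfolding em_def by linarith
  have hb: "\<bar>h\<bar> \<le> 102 / 100" using q_bounds unfolding h_def by (intro abs_leI) linarith+
  have \<nu>q: "\<bar>\<nu> * q\<bar> \<le> 15 / 100" using q_bounds \<nu> mult_mono[of \<nu> "1 / 7" q "101 / 100"] by auto
  have qa: "\<bar>q\<bar> \<le> 101 / 100" using q_bounds by auto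
  have \<nu>x: "\<bar>\<nu> * x\<bar> \<le> 3 / 700" "\<bar>x\<bar> \<le> 3 / 100" using q_bounds(3,4) x by (auto simp: abs_le_iff intro: order_trans[of _ 0])
  have E2b: "\<bar>E2\<^sub>0\<bar> \<le> 2 / 10"
  proof -
    have eq: "E2\<^sub>0 = - (\<nu> * q * (q * q)) + x * ((\<nu> * q + h) * (\<nu> * q + h) + 2 * (\<nu> * x * h))"
      by (simp add: E2\<^sub>0_def h_def power2_eq_square power3_eq_cube algebra_simps)
    have "\<bar>E2\<^sub>0\<bar> \<le> \<bar>\<nu> * q * (q * q)\<bar> + \<bar>x * ((\<nu> * q + h) * (\<nu> * q + h) + 2 * (\<nu> * x * h))\<bar>" unfolding eq by linarith
    also have "\<dots> \<le> 15 / 100 * (101 / 100 * (101 / 100))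
        + 3 / 100 * ((15 / 100 + 102 / 100) * (15 / 100 + 102 / 100) + 2 * (3 / 700 * (102 / 100)))"
      by (intro add_mono abs_mult_le order_trans[OF abs_triangle_ineq] \<nu>q qa hb \<nu>x) auto
    finally show ?thesis by simp
  qed
  have Z: "\<bar>Z\<bar> \<le> 54 / 1000"
  proof -
    define Y where "Y = h * h - 2 * (\<nu> * q * h) - 3 * (\<nu> * q * (\<nu> * q)) + 2 * (\<nu> * x * h)"
    have Zeq: "Z = x * Y + (2 * M + em - 1) * E2\<^sub>0"
      unfolding Z_def Y_def E2\<^sub>0_def JE\<^sub>0_def h_def by (simp add: power2_eq_square power3_eq_cube algebra_simps)
    have "\<bar>Y\<bar> \<le> \<bar>h * h\<bar> + \<bar>2 * (\<nu> * q * h)\<bar> + \<bar>3 * (\<nu> * q * (\<nu> * q))\<bar> + \<bar>2 * (\<nu> * x * h)\<bar>"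
      unfolding Y_def by linarith
    moreover have "\<dots> \<le> 102 / 100 * (102 / 100) + 2 * (15 / 100 * (102 / 100)) + 3 * (15 / 100 * (15 / 100)) + 2 * (3 / 700 * (102 / 100))"
      by (intro add_mono abs_mult_le \<nu>q qa hb \<nu>x) auto
    ultimately have "\<bar>Y\<bar> \<le> 3 / 2" by simp
    then have "\<bar>x * Y\<bar> \<le> 3 / 100 * (3 / 2)" by (intro abs_mult_le \<nu>x)
    moreover have "\<bar>(2 * M + em - 1) * E2\<^sub>0\<bar> \<le> 36 / 1000 * (2 / 10)" using MMb x by (intro abs_mult_le E2b) linarith
    ultimately show ?thesis unfolding Zeq by linarith
  qed
  have vp: "\<bar>variance_poly\<bar> \<le> 1 / 10"
  proof -
    have "\<bar>variance_poly\<bar> \<le> 1 / 28 + 1 / 4 * (3 / 100) + 1 * (3 / 100 * (3 / 100))"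
      unfolding variance_poly_def using u_expansions(8,9) u_powers x \<nu>
      by (intro order_trans[OF abs_triangle_ineq] add_mono abs_mult_le coeff_bounds) auto
    then show ?thesis by simp
  qed
  have x4: "0 \<le> x ^ 4" "0 \<le> x ^ 3" using x by auto
  have En: "E < 0" using mean_expansion(1)[OF _ E, of "- ((1 - 3 * \<nu> * x) / 2)"] x by simp
  have eb: "\<bar>e2\<bar> \<le> x ^ 4" "\<bar>e3\<bar> \<le> x ^ 4" "\<bar>e4\<bar> \<le> x ^ 4" "\<bar>e5\<bar> \<le> x ^ 4"
    using E J2 JE E2 by (auto simp: e2_def e3_def e4_def e5_def)
  define err where "err = \<nu> * q * q * e3 + - 2 * \<mu> * (\<nu> * q) * e4 + \<mu> * \<mu> * e5 + - variance_poly * q * e2"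
  have err: "\<bar>err\<bar> \<le> 1 * x ^ 4"
  proof -
    have "\<bar>err\<bar> \<le> 15 / 100 * (101 / 100) * x ^ 4 + 2 * (6 / 10) * (15 / 100) * x ^ 4 + 6 / 10 * (6 / 10) * x ^ 4 + 1 / 10 * (101 / 100) * x ^ 4"
      unfolding err_def
      by (intro order_trans[OF abs_triangle_ineq] add_mono abs_mult_le eb \<nu>q qa \<mu>1) (use vp \<mu>1 in auto)
    then show ?thesis using x4 by simp
  qed
  have WE: "W * E = J2 - 2 * \<mu> * JE + \<mu> ^ 2 * E2" using En by (simp add: W_def)
  have "q * (q * E) * (\<nu> * W - variance_poly) = \<nu> * q ^ 2 * (W * E) - variance_poly * q * (q * E)"
    by (simp add: algebra_simps power2_eq_square)
  also have "\<dots> = \<nu> * q ^ 2 * J2 - 2 * \<mu> * \<nu> * q * (q * JE) + \<mu> ^ 2 * (\<nu> * q ^ 2 * E2) - variance_poly * q * (q * E)"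
    unfolding WE by (simp add: algebra_simps power2_eq_square)
  also have "\<dots> = (\<nu> * q ^ 2 * (- (1 - 7 * \<nu> * x) / 2) - 2 * M * \<nu> * q * JE\<^sub>0 + M ^ 2 * E2\<^sub>0 - S * q * E\<^sub>0) + err + em * Z - es * (q * E\<^sub>0)"
  proof -
    define j0 where "j0 = - (1 - 7 * \<nu> * x) / 2"
    have eqs: "J2 = j0 + e3" "q * JE = JE\<^sub>0 + e4" "\<nu> * q ^ 2 * E2 = E2\<^sub>0 + e5" "q * E = E\<^sub>0 + e2"
      "\<mu> = M + em" "variance_poly = S + es"
      by (auto simp: j0_def e2_def e3_def e4_def e5_def em_def es_def add_divide_distrib diff_divide_distrib)
    show ?thesis unfolding err_def Z_def j0_def[symmetric] unfolding eqs by algebra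
  qed
  also have "\<dots> = x ^ 3 * R / 4 + err + em * Z - es * (q * E\<^sub>0)" unfolding id ..
  finally have main: "\<bar>q * (q * E) * (\<nu> * W - variance_poly)\<bar> \<le> \<bar>R * x ^ 3\<bar> / 4 + \<bar>err\<bar> + \<bar>em * Z\<bar> + \<bar>es * (q * E\<^sub>0)\<bar>"
    by (simp add: mult.commute)
  have RX: "\<bar>R * x ^ 3\<bar> \<le> 72 / 10 * x ^ 3" using x4 by (intro abs_mult_le R) auto
  have "\<bar>em * Z\<bar> \<le> 72 / 10 * x ^ 3 * (54 / 1000)" by (intro abs_mult_le em Z)
  then have mX: "\<bar>em * Z\<bar> \<le> 4 / 10 * x ^ 3" using x4 by simp
  have "\<bar>es * (q * E\<^sub>0)\<bar> \<le> 33 / 10 * x ^ 3 * (101 / 100 * 1)" by (intro abs_mult_le es qa E\<^sub>0_bounds)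
  then have eX: "\<bar>es * (q * E\<^sub>0)\<bar> \<le> 34 / 10 * x ^ 3" using x4 by simp
  have "w \<le> 6 * c" if "w \<le> r / 4 + a + m + k" "r \<le> 72 / 10 * c" "a \<le> 1 * c'" "m \<le> 4 / 10 * c" "k \<le> 34 / 10 * c"
      "c' \<le> 3 / 100 * c" "0 \<le> c" for w r a m k c c' :: real
    using that by linarith
  from this[OF main RX err mX eX x2(6) x4(2)]
  have main2: "\<bar>q * (q * E) * (\<nu> * W - variance_poly)\<bar> \<le> 6 * x ^ 3" .
  have "x ^ 4 \<le> 1 / 1000" using x2 x by linarith
  then have "q * E \<le> - 968 / 1000" using E E\<^sub>0_bounds by linarith
  then have "968 / 1000 \<le> \<bar>q * E\<bar>" by simp
  then have "1 * (968 / 1000) \<le> \<bar>q\<bar> * \<bar>q * E\<bar>" using q_bounds by (intro mult_mono) auto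
  then have "968 / 1000 * \<bar>\<nu> * W - variance_poly\<bar> \<le> \<bar>q * (q * E)\<bar> * \<bar>\<nu> * W - variance_poly\<bar>"
    unfolding abs_mult by (intro mult_right_mono) auto
  also have "\<dots> \<le> 6 * x ^ 3" using main2 by (simp add: abs_mult)
  finally have "968 / 1000 * \<bar>\<nu> * W - variance_poly\<bar> \<le> 6 * x ^ 3" .
  moreover have "a \<le> 7 * c" if "968 / 1000 * a \<le> 6 * c" "0 \<le> c" for a c :: real using that by linarith
  ultimately show ?thesis unfolding W_def[symmetric] using x4(2) by blast
qed

end

section \<open>Estimates for six or more children\<close>

lemma power_two_terms:
  fixes D :: real assumes "0 \<le> D"
  shows "1 + real n * D + real n * (real n - 1) / 2 * D ^ 2 \<le> (1 + D) ^ n"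
proof (induction n)
  case (Suc n)
  have "0 \<le> real n * (real n - 1) / 2 * D ^ 3" using assms by (cases n) auto
  then have "1 + real (Suc n) * D + real (Suc n) * (real (Suc n) - 1) / 2 * D ^ 2
      \<le> (1 + D) * (1 + real n * D + real n * (real n - 1) / 2 * D ^ 2)"
    by (simp add: field_simps power2_eq_square power3_eq_cube)
  also have "\<dots> \<le> (1 + D) * (1 + D) ^ n" using assms by (intro mult_left_mono Suc) auto
  finally show ?case by simp
qed simp

lemma power_three_terms:
  fixes D :: real assumes "0 \<le> D" "real n * D \<le> 1 / 2"
  shows "(1 + D) ^ n \<le> 1 + real n * D + real n * (real n - 1) / 2 * D ^ 2 + (real n * D) ^ 3 / 5"
  using assms(2)
proof (induction n)
  case (Suc n)
  define m where "m = real n"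
  have m: "0 \<le> m" "m * D \<le> 1 / 2" using Suc.prems assms(1) by (auto simp: m_def algebra_simps)
  have "(1 + D) ^ Suc n \<le> (1 + D) * (1 + m * D + m * (m - 1) / 2 * D ^ 2 + (m * D) ^ 3 / 5)"
    unfolding power_Suc m_def using assms m by (intro mult_left_mono Suc.IH) (auto simp: m_def)
  also have "\<dots> = 1 + (m + 1) * D + (m + 1) * m / 2 * D ^ 2 + D ^ 3 * (m * (m - 1) / 2 + m ^ 3 / 5 + m ^ 2 * (m * D) / 5)"
    by (simp add: field_simps power2_eq_square power3_eq_cube)
  finally have "(1 + D) ^ Suc n \<le> 1 + (m + 1) * D + (m + 1) * m / 2 * D ^ 2
      + D ^ 3 * (m * (m - 1) / 2 + m ^ 3 / 5 + m ^ 2 * (m * D) / 5)" .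
  then have F: "(1 + D) ^ Suc n \<le> 1 + (m + 1) * D + (m + 1) * m / 2 * D ^ 2
      + D ^ 3 * (m * (m - 1) / 2 + m ^ 3 / 5 + m ^ 2 * (m * D) / 5)" .
  have le: "D ^ 3 * (m * (m - 1) / 2 + m ^ 3 / 5 + m ^ 2 * (m * D) / 5) \<le> D ^ 3 * ((m + 1) ^ 3 / 5)"
  proof (rule mult_left_mono)
    have "m ^ 2 * (m * D) \<le> m ^ 2 * (1 / 2)" using m by (intro mult_left_mono) auto
    then show "m * (m - 1) / 2 + m ^ 3 / 5 + m ^ 2 * (m * D) / 5 \<le> (m + 1) ^ 3 / 5"
      using m by (simp add: field_simps power2_eq_square power3_eq_cube)
  qed (use assms in auto)
  have S: "real (Suc n) = m + 1" by (simp add: m_def)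
  have t1: "(m + 1) * (m + 1 - 1) = (m + 1) * m" by simp
  have t2: "((m + 1) * D) ^ 3 / 5 = D ^ 3 * ((m + 1) ^ 3 / 5)" by (simp add: power_mult_distrib)
  show ?case unfolding S t1 t2 using F le by linarith
qed simp

lemma linear_over_power: "7 \<le> n \<Longrightarrow> real n * (14 / 25) ^ n \<le> (121 / 1000)"
proof (induction n rule: dec_induct)
  case (step n)
  have "real (Suc n) * (14 / 25) ^ Suc n = ((14 / 25) * (real n + 1)) * (14 / 25) ^ n" by simp
  also have "\<dots> \<le> real n * (14 / 25) ^ n" using step by (intro mult_right_mono) auto
  finally show ?case using step by linarith
qed (simp add: power_divide)

lemma square_over_power: "7 \<le> n \<Longrightarrow> real n ^ 2 / 2 ^ n \<le> 49 / 128" "7 \<le> n \<Longrightarrow> real n / 2 ^ n \<le> 7 / 128"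
proof -
  show sq: "real n ^ 2 / 2 ^ n \<le> 49 / 128" if "7 \<le> n" for n
    using that
  proof (induction n rule: dec_induct)
    case (step n)
    have "7 * 7 \<le> real n * real n" using step by (intro mult_mono) auto
    moreover have "7 * real n \<le> real n * real n" using step by (intro mult_right_mono) auto
    ultimately have "real (Suc n) ^ 2 \<le> 2 * real n ^ 2" by (simp add: power2_eq_square algebra_simps)
    then have "real (Suc n) ^ 2 / 2 ^ Suc n \<le> 2 * real n ^ 2 / 2 ^ Suc n" by (intro divide_right_mono) auto
    moreover have "2 * real n ^ 2 / 2 ^ Suc n = real n ^ 2 / 2 ^ n" by simp
    ultimately show ?case using step.IH by linarith
  qed simp
  assume n: "7 \<le> n"
  have "7 * (real n / 2 ^ n) \<le> real n * (real n / 2 ^ n)" using n by (intro mult_right_mono) auto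
  moreover have "real n * (real n / 2 ^ n) = real n ^ 2 / 2 ^ n" by (simp add: power2_eq_square)
  ultimately show "real n / 2 ^ n \<le> 7 / 128" using sq[OF n] by linarith
qed

locale large_arity =
  fixes t :: nat and z :: real
  assumes t: "6 \<le> t" and z: "1 / 2 \<le> z" "z \<le> 0.56"
begin

definition "N = real (t + 1)"
definition "y = z ^ (t + 1)"
definition "d = lin_coeff t 2 z"
definition "T = 2.5 * majorant t z 3"

lemma t2: "2 \<le> t" "0 < t" using t by auto

lemma N: "7 \<le> N" "1 / N \<le> 1 / 7" "0 < N"
  using t by (auto simp: N_def)

lemma y: "0 < y" "y \<le> (173 / 10000)" "N * y \<le> (121 / 1000)"
proof -
  show "0 < y" using z by (simp add: y_def)
  have "y \<le> (14 / 25) ^ (t + 1)" unfolding y_def using z by (intro power_mono) auto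
  moreover have "((14 / 25) :: real) ^ (t + 1) \<le> (14 / 25) ^ 7" using t by (intro power_decreasing) auto
  moreover have "((14 / 25) :: real) ^ 7 \<le> (173 / 10000)" by (simp add: power_divide)
  ultimately show "y \<le> (173 / 10000)" by linarith
  have "N * y \<le> N * (14 / 25) ^ (t + 1)" using \<open>y \<le> (14 / 25) ^ (t + 1)\<close> N by (intro mult_left_mono) auto
  also have "\<dots> \<le> (121 / 1000)" unfolding N_def by (rule linear_over_power) (use t in auto)
  finally show "N * y \<le> (121 / 1000)" .
qed

lemma d_eq: "d = z * (y / (1 - y))" "0 < d" "y * (z + d) = d" "(z + d) / z = 1 / (1 - y)"
proof -
  show d: "d = z * (y / (1 - y))" using lin_coeff_2[of z t] z by (simp add: d_def y_def)
  show "0 < d" unfolding d using z y by simp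
  show "y * (z + d) = d" "(z + d) / z = 1 / (1 - y)" unfolding d using z y by (simp_all add: field_simps)
qed

lemma y_le: "y \<le> 2 * d"
proof -
  have "y * 1 \<le> y * (2 * (z + d))" using y z d_eq(2) by (intro mult_left_mono) auto
  also have "y * (2 * (z + d)) = 2 * (y * (z + d))" by (rule mult.left_commute)
  finally show ?thesis unfolding d_eq(3) by simp
qed

lemma log_weight_2: "log_weight t 2 z = 1 + N / (1 - y)"
  using explicit_terms(3)[of z t] z by (simp add: br_2 N_def y_def)

text \<open>The fourth term contains the power with exponent \<open>t ^ 2 + t + 1 = (t + 1) * t + 1\<close> of
  \<open>z\<close>, that is \<open>z * y ^ t\<close>, against which the weights of order \<open>N ^
  4\<close> are harmless.\<close>

lemma T_bound: "0 \<le> T" "T \<le> 2 * d * N ^ 4 * y ^ 6"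
proof -
  define u where "u = z ^ (t ^ 2 + t + 1)"
  have "t ^ 2 + t + 1 = Suc ((t + 1) * t)" by (simp add: power2_eq_square)
  then have "u = z * y ^ t" by (simp only: u_def y_def power_Suc power_mult)
  also have "\<dots> \<le> (14 / 25) * y ^ 6" using z y t by (intro mult_mono power_decreasing) auto
  finally have u: "u \<le> (14 / 25) * y ^ 6" .
  have u0: "0 \<le> u" using z by (simp add: u_def)
  have "y ^ 6 \<le> (173 / 10000) ^ 6" using y by (intro power_mono) auto
  also have "\<dots> \<le> 1 / 100" by (simp add: power_divide)
  finally have u1: "u \<le> 1 / 100" using u by simp
  have "u / (1 - u) \<le> (51 / 50) * u" using u0 u1 mult_left_mono[OF u1 u0] by (simp add: field_simps)
  then have uu: "u / (1 - u) \<le> (29 / 50) * y ^ 6" "0 \<le> u / (1 - u)" using u u0 u1 by auto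
  have M: "real (br t 3) = N ^ 2 - N + 1" by (simp add: br_3 N_def power2_eq_square algebra_simps)
  have k: "log_weight t 3 z = 1 + N / (1 - y) + (N ^ 2 - N + 1) / (1 - u)"
    using explicit_terms(4)[of z t] z by (simp add: log_weight_2 M) (simp add: br_3 u_def)
  have N2: "7 * N \<le> N ^ 2" "49 \<le> N ^ 2" using N mult_mono[of 7 N 7 N] by (auto simp: power2_eq_square)
  have "N / (1 - y) \<le> (51 / 50) * N" "(N ^ 2 - N + 1) / (1 - u) \<le> (51 / 50) * (N ^ 2 - N + 1)"
  proof -
    have "1 / (1 - y) \<le> (51 / 50)" "1 / (1 - u) \<le> (51 / 50)" using y u1 by (simp_all add: field_simps)
    from mult_left_mono[OF this(1), of N] mult_left_mono[OF this(2), of "N ^ 2 - N + 1"]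
    show "N / (1 - y) \<le> (51 / 50) * N" "(N ^ 2 - N + 1) / (1 - u) \<le> (51 / 50) * (N ^ 2 - N + 1)"
      using N N2 by (simp_all add: mult.commute)
  qed
  moreover have "1 + a + c \<le> 107 / 100 * M" if "a \<le> 51 / 50 * n" "c \<le> 51 / 50 * (M - n + 1)" "49 \<le> M" for a c n M :: real
    using that by simp
  ultimately have "log_weight t 3 z \<le> (107 / 100) * N ^ 2" unfolding k using N2(2) by blast
  moreover have "0 \<le> log_weight t 3 z" unfolding k using N N2 y u1 by simp
  ultimately have "log_weight t 3 z ^ 2 \<le> ((107 / 100) * N ^ 2) ^ 2" by (intro power_mono)
  also have "\<dots> \<le> (23 / 20) * N ^ 4" by (simp add: power_mult_distrib power_divide)
  finally have kk: "log_weight t 3 z ^ 2 \<le> (23 / 20) * N ^ 4" .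
  have l3: "lin_coeff t 3 z = d * (u / (1 - u))"
    using explicit_terms(2)[of z t] z by (simp add: d_def) (simp add: br_3 u_def)
  have "T = 2.5 * (d * (u / (1 - u)) * log_weight t 3 z ^ 2)" by (simp add: T_def majorant_def l3)
  also have "\<dots> \<le> 2.5 * (d * ((29 / 50) * y ^ 6) * ((23 / 20) * N ^ 4))"
    using uu kk d_eq(2) y N by (intro mult_left_mono mult_mono) auto
  also have "\<dots> \<le> 2 * (d * N ^ 4 * y ^ 6)" using d_eq(2) y N by (simp add: mult_ac)
  finally show "T \<le> 2 * d * N ^ 4 * y ^ 6" by simp
  show "0 \<le> T" unfolding T_def using majorant_nonneg[OF t2(1) z] by simp
qed

text \<open>The crude bound \<open>z \<le> 0.56\<close> first gives a bound for \<open>D\<close>, and inserting this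
  in the equation \<open>y = ((1 + D) / 2) ^ (t + 1)\<close> gives the smaller bounds that the expansion
  needs.\<close>

lemma perturbation_bounds:
  assumes zero: "real_lin t z = 0"
  defines "D \<equiv> 2 * z - 1"
  shows "\<bar>d - D\<bar> \<le> T" "0 < D" "N * D \<le> 3 / 100" "N * (N * D) \<le> 21 / 100" "N * T \<le> (N * D) ^ 4 / 10000"
proof -
  have n7: "7 \<le> t + 1" using t by simp
  have "\<bar>real_lin t z - (\<Sum>j<3. (- 1) ^ j * lin_coeff t j z)\<bar> \<le> T"
    by (rule partial_sums(1)[OF t2(1) z]) (auto simp: T_def)
  moreover have "(\<Sum>j<3. (- 1) ^ j * lin_coeff t j z) = 1 - 2 * z + d"
    using first_terms[of z t] z by (simp add: eval_nat_numeral d_def)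
  ultimately show e: "\<bar>d - D\<bar> \<le> T" unfolding zero D_def by (simp add: abs_minus_commute)
  have "T \<le> d / 1000"
  proof -
    have "N ^ 4 * y ^ 6 = (N * y) ^ 4 * y ^ 2" by (simp add: power_mult_distrib mult_ac flip: power_add)
    also have "\<dots> \<le> (121 / 1000) ^ 4 * (173 / 10000) ^ 2" using y N by (intro mult_mono power_mono) auto
    also have "\<dots> \<le> 1 / 2000" by (simp add: power_divide)
    finally have "2 * d * (N ^ 4 * y ^ 6) \<le> 2 * d * (1 / 2000)" using d_eq(2) by (intro mult_left_mono) auto
    then show ?thesis using T_bound by (simp add: mult.assoc)
  qed
  then have Dd: "999 / 1000 * d \<le> D" "D \<le> 1001 / 1000 * d" using e unfolding abs_le_iff by linarith+
  then show D0: "0 < D" using d_eq(2) by linarith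
  have y1: "1 / (1 - y) \<le> 1018 / 1000" using y by (simp add: field_simps)
  have Nd: "N * d \<le> 69 / 1000"
  proof -
    have "N * d = z * (N * y) * (1 / (1 - y))" by (simp add: d_eq(1))
    also have "\<dots> \<le> (14 / 25) * (121 / 1000) * (1018 / 1000)" using z y N y1 by (intro mult_mono) auto
    finally show ?thesis by simp
  qed
  have ND1: "N * D \<le> 1001 / 1000 * (N * d)" using mult_left_mono[OF Dd(2), of N] N by (simp add: mult.left_commute)
  then have ND: "N * D \<le> 6907 / 100000" using Nd by linarith
  have p: "(1 + D) ^ (t + 1) \<le> 10716 / 10000"
  proof -
    have "(1 + D) ^ (t + 1) \<le> 1 + N * D + N * (N - 1) / 2 * D ^ 2 + (N * D) ^ 3 / 5"
      unfolding N_def by (rule power_three_terms) (use D0 ND in \<open>auto simp: N_def\<close>)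
    also have "N * (N - 1) / 2 * D ^ 2 \<le> (N * D) ^ 2 / 2"
      using N D0 by (simp add: power_mult_distrib) (simp add: power2_eq_square algebra_simps)
    also have "(N * D) ^ 2 \<le> (6907 / 100000) ^ 2" using ND N D0 by (intro power_mono) auto
    also have "(N * D) ^ 3 \<le> (6907 / 100000) ^ 3" using ND N D0 by (intro power_mono) auto
    finally show ?thesis using ND by (simp add: power_divide)
  qed
  have "(1 + D) / 2 = z" by (simp add: D_def)
  then have "y = ((1 + D) / 2) ^ (t + 1)" by (simp only: y_def)
  then have "y = (1 + D) ^ (t + 1) / 2 ^ (t + 1)" by (simp only: power_divide)
  then have y2: "y \<le> 10716 / 10000 * (1 / 2 ^ (t + 1))" using divide_right_mono[OF p, of "2 ^ (t + 1)"] by simp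
  have "7 * D \<le> N * D" using N D0 by (intro mult_right_mono) auto
  then have "7 * D \<le> 6907 / 100000" using ND by linarith
  then have z2: "z \<le> 50494 / 100000" unfolding D_def by simp
  have small: "N * d \<le> 2985 / 100000 \<and> N * (N * d) \<le> 20895 / 100000"
  proof -
    have "N * y \<le> N * (10716 / 10000 * (1 / 2 ^ (t + 1)))" using y2 N by (intro mult_left_mono) auto
    also have "\<dots> = 10716 / 10000 * (real (t + 1) / 2 ^ (t + 1))" by (simp add: N_def field_simps)
    also have "\<dots> \<le> 10716 / 10000 * (7 / 128)" by (intro mult_left_mono square_over_power(2) n7) simp
    finally have 1: "N * y \<le> 586032 / 10000000" by simp
    have "N * (N * y) \<le> N * (N * (10716 / 10000 * (1 / 2 ^ (t + 1))))" using y2 N by (intro mult_left_mono) auto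
    also have "\<dots> = 10716 / 10000 * (real (t + 1) ^ 2 / 2 ^ (t + 1))" by (simp add: N_def field_simps power2_eq_square)
    also have "\<dots> \<le> 10716 / 10000 * (49 / 128)" by (intro mult_left_mono square_over_power(1) n7) simp
    finally have 2: "N * (N * y) \<le> 410222 / 1000000" by simp
    have "7 * y \<le> N * y" using N y by (intro mult_right_mono) auto
    then have "y \<le> 83719 / 10000000" using 1 by linarith
    then have 3: "1 / (1 - y) \<le> 100845 / 100000" by (simp add: field_simps)
    have "N * d = z * (N * y) * (1 / (1 - y))" by (simp add: d_eq(1))
    also have "\<dots> \<le> 50494 / 100000 * (586032 / 10000000) * (100845 / 100000)"
      using z z2 y N 1 3 by (intro mult_mono) auto
    finally have 4: "N * d \<le> 2985 / 100000" by simp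
    have "N * (N * d) = z * (N * (N * y)) * (1 / (1 - y))" by (simp add: d_eq(1))
    also have "\<dots> \<le> 50494 / 100000 * (410222 / 1000000) * (100845 / 100000)"
      using z z2 y N 2 3 by (intro mult_mono) auto
    finally have 5: "N * (N * d) \<le> 20895 / 100000" by simp
    show ?thesis using 4 5 by simp
  qed
  then show ND2: "N * D \<le> 3 / 100" "N * (N * D) \<le> 21 / 100"
  proof -
    have "N * (N * D) \<le> 1001 / 1000 * (N * (N * d))" using mult_left_mono[OF ND1, of N] N by (simp add: mult.left_commute)
    then show "N * D \<le> 3 / 100" "N * (N * D) \<le> 21 / 100" using small ND1 by linarith+
  qed
  show "N * T \<le> (N * D) ^ 4 / 10000"
  proof -
    have "y ^ 6 \<le> (2 * d) ^ 6" using y y_le by (intro power_mono) auto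
    then have "N * T \<le> N * (2 * d * N ^ 4 * (2 * d) ^ 6)"
      using T_bound(2) N d_eq(2) by (intro mult_left_mono order_trans[OF T_bound(2)]) auto
    also have "\<dots> = 128 * (N * d) ^ 4 * ((N * d) * (d * d))"
      by (simp add: power_mult_distrib eval_nat_numeral)
    also have "\<dots> \<le> 128 * (1002 / 1000 * (N * D)) ^ 4 * (3 / 100 * (3 / 700 * (3 / 700)))"
    proof -
      have "d \<le> 1002 / 1000 * D" using Dd d_eq(2) by linarith
      from mult_left_mono[OF this, of N] have a: "N * d \<le> 1002 / 1000 * (N * D)" using N by (simp add: mult.left_commute)
      have c: "N * d \<le> 3 / 100" using small by simp
      have "7 * d \<le> N * d" using N d_eq(2) by (intro mult_right_mono) auto
      then have e: "d \<le> 3 / 700" using small by linarith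
      show ?thesis
        by (intro mult_mono power_mono a c e) (use N d_eq(2) D0 in auto)
    qed
    also have "\<dots> \<le> (N * D) ^ 4 / 10000" by (simp add: power_mult_distrib power_divide)
    finally show ?thesis .
  qed
qed

text \<open>The sums up to the third term are evaluated exactly with the help of \<open>y * (z + d) = d\<close>,
  which eliminates the power \<open>y\<close>; afterwards \<open>d\<close> is replaced by \<open>D\<close>,
  from which it differs by less than the tail.\<close>

theorem good_constants_large:
  assumes zero: "real_lin t z = 0"
  shows "good_constants t z"
proof -
  define d' y' where "d' = d" and "y' = y"
  note d_eq' = d_eq[folded d'_def y'_def]
  define D where "D = 2 * z - 1"
  define x where "x = N * D"
  define \<nu> where "\<nu> = 1 / N"
  define e where "e = d' - D"
  define \<delta> :: real where "\<delta> = 1 / 2 ^ (t + 2)"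
  define \<psi> where "\<psi> = \<delta> / D"
  define B where "B = (1 + D) ^ (t + 1)"
  note pb = perturbation_bounds[OF zero, folded D_def, folded d'_def, folded x_def e_def]
  have \<nu>N: "\<nu> * N = 1" using N by (simp add: \<nu>_def)
  have \<nu>x: "\<nu> * x = D" "\<nu> * x ^ 2 = N * D ^ 2" using N by (simp_all add: \<nu>_def x_def power2_eq_square)
  have x: "0 < x" "x \<le> 3 / 100" using pb N by (auto simp: x_def)
  interpret ex: expansion x \<nu>
    by unfold_locales (use x N in \<open>auto simp: \<nu>_def\<close>)
  note x2 = ex.x2
  have D: "0 < D" "D \<le> 3 / 700" using pb ex.\<nu> mult_mono[of \<nu> "1 / 7" x "3 / 100"] x \<nu>x by auto
  have TN: "T \<le> x ^ 4 / 70000"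
    using pb(5) mult_right_mono[OF N(1) T_bound(1)] by linarith
  have T1: "T \<le> N * T" using N T_bound(1) mult_right_mono[of 1 N T] by simp
  have e3: "\<bar>e\<bar> \<le> x ^ 3 / 10000" using pb(1) TN x2 by linarith
  have eD: "\<bar>e / D\<bar> \<le> x ^ 3 / 10000"
  proof -
    have "N * \<bar>e\<bar> \<le> x ^ 4 / 10000" using pb(1,5) N mult_left_mono[OF pb(1), of N] by linarith
    then have "\<bar>e\<bar> * N \<le> x * (x ^ 3 / 10000)" by (simp add: mult.commute eval_nat_numeral)
    then have "\<bar>e\<bar> * N \<le> (D * (x ^ 3 / 10000)) * N" unfolding x_def by (simp only: mult_ac)
    then have "\<bar>e\<bar> \<le> D * (x ^ 3 / 10000)" using N by simp
    then show ?thesis using D by (simp add: field_simps)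
  qed
  have zD: "z = (1 + D) / 2" by (simp add: D_def)
  have yB: "y' = 2 * \<delta> * B"
  proof -
    have "y' = ((1 + D) / 2) ^ (t + 1)" unfolding zD[symmetric] y'_def by (rule y_def)
    then show ?thesis by (simp add: power_divide B_def \<delta>_def)
  qed
  have dD: "d' = D + e" by (simp add: e_def)
  have zz: "2 * z = 1 + D" by (simp add: zD)
  have zd: "2 * (z + d') = 1 + D + 2 * d'" by (simp add: zD)
  interpret ie: inverse_expansion x \<nu> \<psi>
  proof (unfold_locales, rule ex.inverse_weight_expansion[OF _ _ e3 eD])
    have id: "N * (N - 1) / 2 * D ^ 2 = (1 - \<nu>) * x ^ 2 / 2"
      using N by (simp add: \<nu>_def x_def power_mult_distrib) (simp add: field_simps power2_eq_square)
    show "1 + x + (1 - \<nu>) * x ^ 2 / 2 \<le> B"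
      using power_two_terms[of D "t + 1"] D unfolding B_def id[symmetric] unfolding x_def by (simp add: N_def)
    show "B \<le> 1 + x + (1 - \<nu>) * x ^ 2 / 2 + x ^ 3 / 5"
      using power_three_terms[of D "t + 1"] D x unfolding B_def id[symmetric] unfolding x_def by (simp add: N_def)
    have "\<delta> * (B * (1 + 3 * D + 2 * e)) = D + e"
    proof -
      have "\<delta> * (B * (1 + 3 * D + 2 * e)) = y' * (z + d')" by (simp add: yB zD dD field_simps)
      then show ?thesis using d_eq'(3) dD by simp
    qed
    then have "\<psi> * (B * (1 + 3 * D + 2 * e)) = (D + e) / D" by (simp add: \<psi>_def)
    then show "\<psi> * (B * (1 + 3 * \<nu> * x + 2 * e)) = 1 + e / D"
      using D by (simp add: mult.assoc \<nu>x add_divide_distrib)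
  qed
  have u: "ie.u = N * \<delta>" unfolding ie.u_def using D by (simp add: x_def \<psi>_def)
  define J1 where "J1 = alt_sum (\<lambda>j. real j * lin_coeff t j z)"
  define J2 where "J2 = alt_sum (\<lambda>j. real j ^ 2 * lin_coeff t j z)"
  define E1 where "E1 = alt_sum (\<lambda>j. euler_lin t j z)"
  define JE where "JE = alt_sum (\<lambda>j. real j * euler_lin t j z)"
  define E2 where "E2 = alt_sum (\<lambda>j. euler2_lin t j z)"
  define k where "k = log_weight t 2 z"
  define k' where "k' = log_weight' t 2 z"
  have z1: "z < 1" using z by simp
  note ps = partial_sums[OF t2(1) z, of 3 T]
  have e2: "euler_lin t 2 z = d' * k" "euler2_lin t 2 z = d' * (k ^ 2 + k')"
    by (simp_all add: euler_lin_def euler2_lin_def d_def d'_def k_def k'_def)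
  have s: "\<bar>J1 - (- z + 2 * d')\<bar> \<le> T" "\<bar>E1 - (- 2 * z + d' * k)\<bar> \<le> T" "\<bar>J2 - (- z + 4 * d')\<bar> \<le> T"
    "\<bar>JE - (- z + 2 * (d' * k))\<bar> \<le> T" "\<bar>E2 - (- 2 * z + d' * (k ^ 2 + k'))\<bar> \<le> T"
    using ps(2-6) unfolding J1_def[symmetric] J2_def[symmetric] E1_def[symmetric] JE_def[symmetric] E2_def[symmetric]
    by (simp_all add: T_def numeral_3_eq_3 first_terms[OF z1] e2[unfolded numeral_2_eq_2] d'_def d_def numeral_2_eq_2 algebra_simps)
  define \<tau>1 where "\<tau>1 = J1 - (- z + 2 * d')"
  define \<tau>2 where "\<tau>2 = E1 - (- 2 * z + d' * k)"
  define \<tau>3 where "\<tau>3 = J2 - (- z + 4 * d')"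
  define \<tau>4 where "\<tau>4 = JE - (- z + 2 * (d' * k))"
  define \<tau>5 where "\<tau>5 = E2 - (- 2 * z + d' * (k ^ 2 + k'))"
  note \<tau> = s[folded \<tau>1_def \<tau>2_def \<tau>3_def \<tau>4_def \<tau>5_def]
  have q: "ie.q = 1 + D" by (simp add: ie.q_def \<nu>x)
  have k: "(1 + D) * k = 1 + D + N * (1 + D + 2 * d')"
  proof -
    have "k = 1 + N * ((z + d') / z)" unfolding k_def log_weight_2 y'_def[symmetric] d_eq'(4) by simp
    then have "2 * z * k = 2 * z + N * (2 * (z + d'))" using z by (simp add: field_simps)
    then show ?thesis unfolding zd zz .
  qed
  have k': "(1 + D) ^ 2 * k' = 2 * N ^ 2 * d' * (1 + D + 2 * d')"
  proof -
    have "k' = N ^ 2 * y' / (1 - y') ^ 2" unfolding k'_def using explicit_terms(5)[OF z1, of t] by (simp add: br_2 N_def y_def y'_def)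
    also have "\<dots> = N ^ 2 * (y' / (1 - y')) * (1 / (1 - y'))" by (simp add: power2_eq_square)
    also have "y' / (1 - y') = d' / z" using d_eq'(1) z by simp
    finally have "k' = N ^ 2 * (d' / z) * ((z + d') / z)" unfolding d_eq'(4) .
    then have "(2 * z) ^ 2 * k' = 2 * N ^ 2 * d' * (2 * (z + d'))" using z by (simp add: field_simps power2_eq_square)
    then show ?thesis unfolding zd zz .
  qed
  have xT: "N * T \<le> x ^ 4 / 10000" by (rule pb(5))
  have e4: "\<bar>e\<bar> \<le> T" by (rule pb(1))
  have ND: "N * D ^ 2 = D * x" "N * D = x" by (simp_all add: x_def power2_eq_square)
  have D2: "\<bar>1 + D\<bar> \<le> 2" "\<bar>e\<bar> \<le> 1 / 100" using D e3 x2 x by (auto simp: abs_le_iff)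
  have H1: "\<bar>J1 + (1 - 3 * \<nu> * x) / 2\<bar> \<le> x ^ 4"
  proof -
    have "J1 + (1 - 3 * \<nu> * x) / 2 = 2 * e + \<tau>1" by (simp add: mult.assoc \<nu>x \<tau>1_def dD zD field_simps)
    then show ?thesis using e4 \<tau>(1) TN x2(7) by linarith
  qed
  have H3: "\<bar>J2 + (1 - 7 * \<nu> * x) / 2\<bar> \<le> x ^ 4"
  proof -
    have "J2 + (1 - 7 * \<nu> * x) / 2 = 4 * e + \<tau>3" by (simp add: mult.assoc \<nu>x \<tau>3_def dD zD field_simps)
    then show ?thesis using e4 \<tau>(3) TN x2(7) by linarith
  qed
  define g where "g = (1 + D) * e + N * (e * (1 + 5 * D + 2 * e))"
  have g: "\<bar>g\<bar> \<le> 4 * (N * T)"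
  proof -
    have "\<bar>g\<bar> \<le> 2 * T + N * (T * 2)"
      unfolding g_def using D D2 e4 N by (intro order_trans[OF abs_triangle_ineq] add_mono abs_mult_le) (auto simp: abs_le_iff)
    then show ?thesis using T1 by linarith
  qed
  have qdk: "(1 + D) * (d' * k) = (1 + D) * D + x * (1 + 3 * D) + g"
  proof -
    have "(1 + D) * (d' * k) = d' * ((1 + D) * k)" by simp
    also have "\<dots> = (1 + D) * D + (N * D) * (1 + 3 * D) + g" unfolding k dD g_def by (simp add: algebra_simps)
    finally show ?thesis by (simp only: x_def)
  qed
  have H2: "\<bar>ie.q * E1 - ie.E\<^sub>0\<bar> \<le> x ^ 4"
  proof -
    have E0: "ie.E\<^sub>0 = - 1 - D + x + 3 * (D * x)"
      using \<nu>x by (simp add: ie.E\<^sub>0_def ND algebra_simps)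
    have "(1 + D) * E1 = - ((1 + D) * (1 + D)) + (1 + D) * (d' * k) + (1 + D) * \<tau>2"
      by (simp add: \<tau>2_def zD field_simps)
    then have "ie.q * E1 - ie.E\<^sub>0 = g + (1 + D) * \<tau>2" unfolding qdk q E0 by (simp add: algebra_simps)
    moreover have "\<bar>(1 + D) * \<tau>2\<bar> \<le> 2 * T" by (intro abs_mult_le D2 \<tau>)
    ultimately show ?thesis using g T1 xT x2(7) by linarith
  qed
  have H4: "\<bar>ie.q * JE - ie.JE\<^sub>0\<bar> \<le> x ^ 4"
  proof -
    have J0: "ie.JE\<^sub>0 = - ((1 + D) * (1 + D)) / 2 + 2 * ((1 + D) * D) + 2 * (x * (1 + 3 * D))"
      unfolding ie.JE\<^sub>0_def q using \<nu>x by (simp add: power2_eq_square mult.assoc)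
    have "(1 + D) * JE = - ((1 + D) * (1 + D)) / 2 + 2 * ((1 + D) * (d' * k)) + (1 + D) * \<tau>4"
      by (simp add: \<tau>4_def zD field_simps)
    then have "ie.q * JE - ie.JE\<^sub>0 = 2 * g + (1 + D) * \<tau>4" unfolding qdk q J0 by (simp add: algebra_simps)
    moreover have "\<bar>(1 + D) * \<tau>4\<bar> \<le> 2 * T" by (intro abs_mult_le D2 \<tau>)
    ultimately show ?thesis using g T1 xT x2(7) by linarith
  qed
  have H5: "\<bar>\<nu> * ie.q ^ 2 * E2 - ie.E2\<^sub>0\<bar> \<le> x ^ 4"
  proof -
    define c where "c = \<nu> * (1 + D) + 1 + D"
    define G where "G = c * c + (4 * c + 2 + 2 * D) * (2 * D + e) + 8 * (3 * D * D + 3 * D * e + e * e)"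
    have c: "\<bar>c\<bar> \<le> 116 / 100"
      using ex.\<nu> D mult_mono[of \<nu> "1 / 7" "1 + D" "703 / 700"] unfolding c_def by (auto simp: abs_le_iff)
    have "\<bar>G\<bar> \<le> 116 / 100 * (116 / 100) + (4 * (116 / 100) + 2 + 2 * (3 / 700)) * (2 * (3 / 700) + 1 / 100)
        + 8 * (3 * (3 / 700) * (3 / 700) + 3 * (3 / 700) * (1 / 100) + 1 / 100 * (1 / 100))"
      unfolding G_def using D by (intro order_trans[OF abs_triangle_ineq] add_mono abs_mult_le c D2) auto
    then have G: "\<bar>G\<bar> \<le> 2" by simp
    have a: "3 * \<nu> * x = 3 * D" "2 * \<nu> * x = 2 * D" by (simp_all add: mult.assoc \<nu>x)
    have c2: "c + 2 * D = \<nu> * (1 + D) + 1 + 3 * D" by (simp add: c_def)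
    have E0: "ie.E2\<^sub>0 = - \<nu> * (1 + D) ^ 3 + N * (D * ((c + 2 * D) ^ 2 + 2 * D * (1 + 3 * D)))"
      unfolding ie.E2\<^sub>0_def q a c2 by (simp add: x_def mult.assoc)
    have "(1 + D) ^ 2 * (k ^ 2 + k') = ((1 + D) * k) ^ 2 + (1 + D) ^ 2 * k'" by (simp only: distrib_left power_mult_distrib)
    also have "\<dots> = (1 + D + N * (1 + D + 2 * d')) ^ 2 + 2 * N ^ 2 * d' * (1 + D + 2 * d')" unfolding k k' ..
    also have "1 + D + N * (1 + D + 2 * d') = N * (c + 2 * d')"
      using \<nu>N by (simp add: c_def algebra_simps)
    finally have kk: "(1 + D) ^ 2 * (k ^ 2 + k') = N ^ 2 * ((c + 2 * d') ^ 2 + 2 * d' * (1 + D + 2 * d'))"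
      by (simp add: power2_eq_square algebra_simps)
    have E2e: "E2 = - (1 + D) + d' * (k ^ 2 + k') + \<tau>5" using zz by (simp add: \<tau>5_def)
    have "\<nu> * (1 + D) ^ 2 * E2 = - \<nu> * (1 + D) ^ 3 + \<nu> * d' * ((1 + D) ^ 2 * (k ^ 2 + k')) + \<nu> * (1 + D) ^ 2 * \<tau>5"
      unfolding E2e by (simp add: algebra_simps power2_eq_square power3_eq_cube)
    also have "\<nu> * d' * ((1 + D) ^ 2 * (k ^ 2 + k')) = (\<nu> * N) * (N * (d' * ((c + 2 * d') ^ 2 + 2 * d' * (1 + D + 2 * d'))))"
      unfolding kk by (simp add: power2_eq_square)
    also have "\<dots> = N * (D * ((c + 2 * D) ^ 2 + 2 * D * (1 + 3 * D))) + N * (e * G)"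
      unfolding \<nu>N dD G_def by (simp add: algebra_simps power2_eq_square)
    finally have "\<nu> * ie.q ^ 2 * E2 - ie.E2\<^sub>0 = N * (e * G) + \<nu> * ((1 + D) * ((1 + D) * \<tau>5))"
      unfolding q E0 by (simp add: power2_eq_square mult_ac)
    moreover have "\<bar>N * (e * G)\<bar> \<le> N * (T * 2)" using N by (intro abs_mult_le e4 G) auto
    moreover have "\<bar>\<nu> * ((1 + D) * ((1 + D) * \<tau>5))\<bar> \<le> 1 * (2 * (2 * T))"
      using ex.\<nu> by (intro abs_mult_le D2 \<tau>) auto
    ultimately show ?thesis using T1 xT x2(7) by linarith
  qed
  have E1n: "E1 < 0" and mu: "\<bar>J1 / E1 - ie.mean_poly\<bar> \<le> 23 * x ^ 4"
    by (rule ie.mean_expansion[OF H1 H2])+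
  have hm: "height_mu t z = J1 / E1" by (simp add: height_mu_def J1_def E1_def)
  have sg: "\<bar>\<nu> * height_sigma2 t z - ie.variance_poly\<bar> \<le> 7 * x ^ 3"
    unfolding height_sigma2_def J2_def[symmetric] JE_def[symmetric] E2_def[symmetric] E1_def[symmetric] hm
    by (rule ie.variance_expansion[OF H2 mu H3 H4 H5])
  have tN: "real t = N - 1" by (simp add: N_def)
  have pw: "2 ^ (t + 3) = 2 / \<delta>" "2 ^ (2 * t + 5) = 2 / \<delta> ^ 2" "2 ^ (3 * t + 8) = 4 / \<delta> ^ 3" "2 ^ (t + 4) = 4 / \<delta>"
    "2 ^ (2 * t + 6) = 4 / \<delta> ^ 2" "2 ^ (4 * t) = 1 / (256 * \<delta> ^ 4)" "2 ^ (3 * t) = 1 / (64 * \<delta> ^ 3)"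
    by (simp_all add: \<delta>_def power_divide power_add power_mult power_mult_distrib mult.commute flip: power_mult)
  have mp: "ie.mean_poly = mean_approx t"
    unfolding ie.mean_poly_def u mean_approx_def pw tN unfolding \<nu>_def using N
    by (simp add: field_simps power2_eq_square power3_eq_cube)
  have vp: "N * ie.variance_poly = variance_approx t"
    unfolding ie.variance_poly_def u variance_approx_def pw tN unfolding \<nu>_def using N
    by (simp add: field_simps power2_eq_square power3_eq_cube)
  have td: "8 / 10 * x \<le> real t * \<delta>"
  proof -
    have "real t * \<delta> = ((1 - \<nu>) * N) * (D * \<psi>)" using D N by (simp add: \<psi>_def \<nu>_def N_def field_simps)
    also have "\<dots> = (1 - \<nu>) * \<psi> * x" by (simp add: x_def)
    finally have eq: "real t * \<delta> = (1 - \<nu>) * \<psi> * x" .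
    have "6 / 7 * (955 / 1000) \<le> (1 - \<nu>) * \<psi>" using ex.\<nu> ie.u_expansions(1) x by (intro mult_mono) auto
    then show ?thesis unfolding eq using x by (intro mult_right_mono) auto
  qed
  have p4: "(8 / 10 * x) ^ 4 \<le> (real t * \<delta>) ^ 4" "(8 / 10 * x) ^ 3 \<le> (real t * \<delta>) ^ 3" using td x by (auto intro!: power_mono)
  have m_tol: "23 * x ^ 4 \<le> 0.55 * real t ^ 4 / 2 ^ (4 * t)"
  proof -
    have l: "(8 / 10 * x) ^ 4 = 4096 / 10000 * x ^ 4" by (simp add: power_mult_distrib power_divide)
    have r: "0.55 * real t ^ 4 / 2 ^ (4 * t) = 704 / 5 * (real t * \<delta>) ^ 4" unfolding pw by (simp add: power_mult_distrib)
    show ?thesis unfolding r using p4(1)[unfolded l] x2(7) by linarith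
  qed
  have v_tol: "N * (7 * x ^ 3) \<le> 0.26 * real t ^ 4 / 2 ^ (3 * t)"
  proof -
    have "6 / 7 * N \<le> real t" using N by (simp add: tN)
    then have "6 / 7 * N * (8 / 10 * x) ^ 3 \<le> real t * (real t * \<delta>) ^ 3" using p4 N x by (intro mult_mono) auto
    then have "(416 / 25) * (6 / 7 * N * (8 / 10 * x) ^ 3) \<le> (416 / 25) * (real t * (real t * \<delta>) ^ 3)" by simp
    also have "(416 / 25) * (real t * (real t * \<delta>) ^ 3) = 0.26 * real t ^ 4 / 2 ^ (3 * t)"
      unfolding pw by (simp add: power_mult_distrib eval_nat_numeral)
    finally have "(416 / 25) * (6 / 7 * N * (8 / 10 * x) ^ 3) \<le> 0.26 * real t ^ 4 / 2 ^ (3 * t)" .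
    moreover have "N * (7 * x ^ 3) \<le> (416 / 25) * (6 / 7 * N * (8 / 10 * x) ^ 3)"
    proof -
      have l: "(8 / 10 * x) ^ 3 = 512 / 1000 * x ^ 3" by (simp add: power_mult_distrib power_divide)
      have "0 \<le> N * x ^ 3" using N x by simp
      moreover have "7 * w \<le> (416 / 25) * (6 / 7 * (512 / 1000 * w))" if "0 \<le> w" for w :: real using that by linarith
      ultimately have "7 * (N * x ^ 3) \<le> (416 / 25) * (6 / 7 * (512 / 1000 * (N * x ^ 3)))" by blast
      then show ?thesis unfolding l by (simp only: mult_ac)
    qed
    ultimately show ?thesis by linarith
  qed
  have v_err: "\<bar>height_sigma2 t z - variance_approx t\<bar> \<le> N * (7 * x ^ 3)"
  proof -
    have "height_sigma2 t z - variance_approx t = N * (\<nu> * height_sigma2 t z - ie.variance_poly)"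
      unfolding vp[symmetric] using \<nu>N by (simp add: algebra_simps)
    then show ?thesis using N sg by (simp add: abs_mult)
  qed
  have v_pos: "0 < height_sigma2 t z"
  proof -
    have "\<nu> / 4 - (1 / 4 * x + 1 * (3 / 100 * x)) \<le> ie.variance_poly"
    proof -
      have "\<bar>(- 1 + 7 * \<nu> - 8 * \<nu> ^ 2) / 4 * ie.u\<bar> \<le> 1 / 4 * x"
        using ie.u_expansions(8,9) by (intro abs_mult_le ie.coeff_bounds) auto
      moreover have "\<bar>(- 4 + 16 * \<nu> + 7 * \<nu> ^ 2 - 33 * \<nu> ^ 3) / 4 * ie.u ^ 2\<bar> \<le> 1 * (3 / 100 * x)"
        using ie.u_powers by (intro abs_mult_le ie.coeff_bounds) auto
      ultimately show ?thesis unfolding ie.variance_poly_def by linarith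
    qed
    then have "\<nu> / 4 - 3 / 10 * x \<le> \<nu> * height_sigma2 t z" using sg[unfolded abs_le_iff] x2(4) x by linarith
    then have "N * (\<nu> / 4 - 3 / 10 * x) \<le> N * (\<nu> * height_sigma2 t z)" using N by (intro mult_left_mono) auto
    moreover have "N * (\<nu> / 4 - 3 / 10 * x) = 1 / 4 - 3 / 10 * (N * x)" using \<nu>N by (simp add: algebra_simps)
    moreover have "N * (\<nu> * height_sigma2 t z) = height_sigma2 t z" using \<nu>N by (simp add: algebra_simps)
    ultimately show ?thesis using pb(4) by simp
  qed
  show ?thesis
    unfolding good_constants_def E1_def[symmetric] hm
    using E1n v_pos mu[unfolded mp] m_tol v_err v_tol by linarith
qed

end

section \<open>Mean, variance and limit distribution of the height\<close>

lemma good_constants: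
  assumes t: "2 \<le> t" and z: "1 / 2 \<le> z" "z \<le> 0.56" and zero: "real_lin t z = 0"
  shows "good_constants t z"
proof -
  consider "t = 2" | "t = 3" | "t = 4" | "t = 5" | "6 \<le> t" using t by linarith
  then show ?thesis
    using good_constants_2 good_constants_3 good_constants_4 good_constants_5
      large_arity.good_constants_large[OF large_arity.intro] z zero
    by cases auto
qed

theorem theorem3:
  shows "\<exists>(\<mu> :: nat \<Rightarrow> real) (\<sigma>2 :: nat \<Rightarrow> real) (\<epsilon> :: nat \<Rightarrow> real) (\<epsilon>' :: nat \<Rightarrow> real).
    \<forall>t::nat. t \<ge> 2 \<longrightarrow>
      height_asymp_normal t \<and>
      height_local_limit t \<and>
      (\<lambda>n. mean_height t n - \<mu> t * real n) \<in> O(\<lambda>_. 1) \<and>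
      (\<lambda>n. var_height t n - \<sigma>2 t * real n) \<in> O(\<lambda>_. 1) \<and>
      complex_of_real (\<mu> t) =
        deriv (\<lambda>w. b t (q0 t) w) 1 / (q0 t * deriv (\<lambda>q. b t q 1) (q0 t)) \<and>
      \<mu> t = 1 / 2 + (real t - 2) / 2 ^ (t + 3)
            + (2 * real t ^ 2 + 3 * real t - 8) / 2 ^ (2 * t + 5)
            + (9 * real t ^ 3 + 45 * real t ^ 2 + 2 * real t - 88) / 2 ^ (3 * t + 8)
            + 0.55 * real t ^ 4 / 2 ^ (4 * t) * \<epsilon> t \<and>
      \<sigma>2 t = 1 / 4 + (- (real t ^ 2) + 5 * real t - 2) / 2 ^ (t + 4)
            + (- 4 * real t ^ 3 + 4 * real t ^ 2 + 27 * real t - 14) / 2 ^ (2 * t + 6)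
            + 0.26 * real t ^ 4 / 2 ^ (3 * t) * \<epsilon>' t \<and>
      \<bar>\<epsilon> t\<bar> \<le> 1 \<and> \<bar>\<epsilon>' t\<bar> \<le> 1"
proof -
  define \<mu> where "\<mu> t = height_mu t (Re (q0 t))" for t
  define \<sigma>2 where "\<sigma>2 t = height_sigma2 t (Re (q0 t))" for t
  define A where "A t = 0.55 * real t ^ 4 / 2 ^ (4 * t)" for t
  define A' where "A' t = 0.26 * real t ^ 4 / 2 ^ (3 * t)" for t
  define \<epsilon> where "\<epsilon> t = (\<mu> t - mean_approx t) / A t" for t
  define \<epsilon>' where "\<epsilon>' t = (\<sigma>2 t - variance_approx t) / A' t" for t
  show ?thesis
  proof (rule exI[of _ \<mu>], rule exI[of _ \<sigma>2], rule exI[of _ \<epsilon>], rule exI[of _ \<epsilon>'], intro allI impI)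
    fix t :: nat assume t: "2 \<le> t"
    obtain z where z: "1 / 2 \<le> z" "z \<le> 0.56" "real_lin t z = 0" and q: "q0 t = of_real z"
      and uniq: "\<And>q. norm q < 1 - 0.72 / real t \<Longrightarrow> den t q 1 = 0 \<Longrightarrow> q = of_real z"
      using dominant_pole[OF t] by metis
    note g = good_constants[OF t z, unfolded good_constants_def]
    interpret height_constants t z
      by unfold_locales (use t z uniq g in auto)
    have ms: "\<mu> t = height_mu t z" "\<sigma>2 t = height_sigma2 t z" by (simp_all add: \<mu>_def \<sigma>2_def q)
    have A: "0 < A t" "0 < A' t" using t by (simp_all add: A_def A'_def)
    have err: "\<bar>\<mu> t - mean_approx t\<bar> \<le> A t" "\<bar>\<sigma>2 t - variance_approx t\<bar> \<le> A' t"
      using g by (simp_all only: ms A_def A'_def)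
    have "\<bar>\<epsilon> t\<bar> \<le> 1" "\<bar>\<epsilon>' t\<bar> \<le> 1"
      using err A by (simp_all add: \<epsilon>_def \<epsilon>'_def abs_divide)
    moreover have "\<mu> t = mean_approx t + A t * \<epsilon> t" "\<sigma>2 t = variance_approx t + A' t * \<epsilon>' t"
      using A by (simp_all add: \<epsilon>_def \<epsilon>'_def)
    moreover have "complex_of_real (\<mu> t) = deriv (\<lambda>w. b t (q0 t) w) 1 / (q0 t * deriv (\<lambda>q. b t q 1) (q0 t))"
      unfolding ms q by (rule mean_constant_formula)
    moreover note height_limit_laws[folded ms]
    ultimately show "height_asymp_normal t \<and>
      height_local_limit t \<and>
      (\<lambda>n. mean_height t n - \<mu> t * real n) \<in> O(\<lambda>_. 1) \<and>
      (\<lambda>n. var_height t n - \<sigma>2 t * real n) \<in> O(\<lambda>_. 1) \<and>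
      complex_of_real (\<mu> t) =
        deriv (\<lambda>w. b t (q0 t) w) 1 / (q0 t * deriv (\<lambda>q. b t q 1) (q0 t)) \<and>
      \<mu> t = 1 / 2 + (real t - 2) / 2 ^ (t + 3)
            + (2 * real t ^ 2 + 3 * real t - 8) / 2 ^ (2 * t + 5)
            + (9 * real t ^ 3 + 45 * real t ^ 2 + 2 * real t - 88) / 2 ^ (3 * t + 8)
            + 0.55 * real t ^ 4 / 2 ^ (4 * t) * \<epsilon> t \<and>
      \<sigma>2 t = 1 / 4 + (- (real t ^ 2) + 5 * real t - 2) / 2 ^ (t + 4)
            + (- 4 * real t ^ 3 + 4 * real t ^ 2 + 27 * real t - 14) / 2 ^ (2 * t + 6)
            + 0.26 * real t ^ 4 / 2 ^ (3 * t) * \<epsilon>' t \<and>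
      \<bar>\<epsilon> t\<bar> \<le> 1 \<and> \<bar>\<epsilon>' t\<bar> \<le> 1"
      unfolding mean_approx_def variance_approx_def A_def A'_def by blast
  qed
qed

end
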